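(* Let $d\le 3$, let $\Omega\subset\mathbb{R}^d$ be a bounded domain with Lipschitz boundary, and let $K$ and $g$ satisfy the assumptions (K) and (G) given in the context. Let $(X,S(t))$ be the dynamical system generated on $X=\{u\in L^2(\Omega): 0\le u\le 1 \text{ a.e. in }\Omega\}$ (with the $L^2(\Omega)$-topology) by the nonlocal Cahn-Hilliard equation with reaction described in the context. Then there exists an exponential attractor $\mathcal{A}'$ for $(X,S(t))$ with respect to the $L^2(\Omega)$-metric.
   Context: Convolution: for $\rho$ defined on $\Omega$, $(K\ast\rho)(x)=\int_\Omega K(x-y)\rho(y)\,dy$, $x\in\Omega$. Assumption (K): $K:\mathbb{R}^d\to\mathbb{R}$ satisfies $K(x)=K(-x)$ for a.a. $x$; $\sup_{x\in\Omega}\int_\Omega|K(x-y)|\,dy<+\infty$; for every $p\in[1,+\infty]$ there is $r_p>0$ with $\|K\ast\rho\|_{W^{1,p}(\Omega)}\le r_p\|\rho\|_{L^p(\Omega)}$ for all $\rho\in L^p(\Omega)$; there is $C>0$ with $\|K\ast\rho\|_{H^2(\Omega)}\le C\|\rho\|_{H^1(\Omega)}$ for all $\rho\in H^1(\Omega)$. Assumption (G): $g:\Omega\times[0,1]\to\mathbb{R}$, $(x,s)\mapsto g(x,s)$, is measurable in $x$ and $C^{1,1}$ in $s$ uniformly in $x$ (i.e. $g(x,\cdot)$ is bounded in $C^{1,1}([0,1])$ uniformly in $x$), and $g(x,0)\ge 0\ge g(x,1)$ for a.a. $x\in\Omega$. One writes $g(u)$ for the function $g(x,u(x,t))$. The equation: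 with $\mu(u)=u(1-u)$, $\frac{\partial u}{\partial t}-\Delta u-\nabla\cdot(\mu(u)\nabla w)=g(u)$ in $\Omega\times(0,\infty)$, $w=K\ast(1-2u)$, with no-flux boundary condition $n\cdot(\nabla u+\mu(u)\nabla w)=0$ on $\partial\Omega\times(0,\infty)$ and $u(0)=u_0$. (This is $\partial_t u-\nabla\cdot(\mu(u)\nabla v)=g(u)$ with $v=f'(u)+w$, $f(u)=u\log u+(1-u)\log(1-u)$, $\mu=1/f''$.) Weak solution: $u\in L^2_{\rm loc}(0,\infty;H^1(\Omega))\cap H^1_{\rm loc}(0,\infty;(H^1(\Omega))^* )$ with $0\le u\le 1$ a.e. in $\Omega\times(0,\infty)$, $w=K\ast(1-2u)\in C([0,\infty);W^{1,\infty}(\Omega))$, $u(0)=u_0$ a.e. in $\Omega$, and, for a.e. $t>0$ and every $\psi\in H^1(\Omega)$, $$\langle\dot u,\psi\rangle_{H^1(\Omega)}+(\mu(u)\nabla w,\nabla\psi)_{L^2(\Omega)}+(\nabla u,\nabla\psi)_{L^2(\Omega)}=(g(u),\psi)_{L^2(\Omega)}.$$ It is known that there is a unique weak solution; $S(t)u_0:=u(t)$, where $u$ is the weak solution with initial datum $u_0\in X$, defines a strongly continuous semigroup on $X$. Exponential attractor with respect to the $L^2(\Omega)$ metric: a compact set $\mathcal{A}'$ for which there exist constants $c,C>0$ independent of $t$ and $u_0$ such that $\inf_{a\in\mathcal{A}'}\|S(t)u_0-a\|_{L^2(\Omega)}\le C e^{-ct}$ for all $u_0\in X$ and all $t\ge0$.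 *)

theory Defs
  imports "HOL-Analysis.Analysis" "HOL-Probability.Essential_Supremum"
begin

section \<open>Bounded Lipschitz domains\<close>

text \<open>Near each boundary point, the domain is the subgraph of a Lipschitz function over the
  hyperplane orthogonal to some unit vector \<open>e\<close>.  Only the restriction of \<open>\<gamma>\<close> to that hyperplane
  is used; a Lipschitz function on it extends to the whole space.\<close>

definition lipschitz_boundary :: "'a::euclidean_space set \<Rightarrow> bool" where
  "lipschitz_boundary \<Omega> \<longleftrightarrow>
     (\<forall>p\<in>frontier \<Omega>. \<exists>r>0. \<exists>e \<gamma> L. norm e = 1 \<and> L-lipschitz_on UNIV \<gamma> \<and>
        \<Omega> \<inter> ball p r = {x \<in> ball p r. x \<bullet> e < (\<gamma> (x - (x \<bullet> e) *\<^sub>R e) :: real)})"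

definition bounded_lipschitz_domain :: "'a::euclidean_space set \<Rightarrow> bool" where
  "bounded_lipschitz_domain \<Omega> \<longleftrightarrow>
     open \<Omega> \<and> connected \<Omega> \<and> \<Omega> \<noteq> {} \<and> bounded \<Omega> \<and> lipschitz_boundary \<Omega>"

section \<open>Lebesgue spaces\<close>

text \<open>Elements of function spaces are represented by functions rather than by classes modulo
  equality almost everywhere, so the norms below are seminorms on functions.\<close>

definition Lp_norm ::
  "ennreal \<Rightarrow> 'a::euclidean_space set \<Rightarrow> ('a \<Rightarrow> 'b::real_normed_vector) \<Rightarrow> real" where
  "Lp_norm p \<Omega> f =
     (if p = \<infinity> then real_of_ereal (esssup (lebesgue_on \<Omega>) (\<lambda>x. ereal (norm (f x))))
      else (LINT x|lebesgue_on \<Omega>. norm (f x) powr enn2real p) powr (1 / enn2real p))"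

definition Lp ::
  "ennreal \<Rightarrow> 'a::euclidean_space set \<Rightarrow> ('a \<Rightarrow> 'b::real_normed_vector) set" where
  "Lp p \<Omega> = {f \<in> borel_measurable (lebesgue_on \<Omega>).
     if p = \<infinity> then esssup (lebesgue_on \<Omega>) (\<lambda>x. ereal (norm (f x))) < \<infinity>
     else integrable (lebesgue_on \<Omega>) (\<lambda>x. norm (f x) powr enn2real p)}"

definition L2_inner ::
  "'a::euclidean_space set \<Rightarrow> ('a \<Rightarrow> 'b::real_inner) \<Rightarrow> ('a \<Rightarrow> 'b) \<Rightarrow> real" where
  "L2_inner \<Omega> f h = (LINT x|lebesgue_on \<Omega>. f x \<bullet> h x)"

definition L2_dist ::
  "'a::euclidean_space set \<Rightarrow> ('a \<Rightarrow> real) \<Rightarrow> ('a \<Rightarrow> real) \<Rightarrow> real" where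
  "L2_dist \<Omega> u v = Lp_norm 2 \<Omega> (\<lambda>x. u x - v x)"

text \<open>The topology of the pseudometric \<open>L2_dist\<close>.  Its open sets are saturated under equality
  almost everywhere, so a set of functions is compact iff its image in the usual quotient is.\<close>

definition L2_topology :: "'a::euclidean_space set \<Rightarrow> ('a \<Rightarrow> real) topology" where
  "L2_topology \<Omega> = topology (\<lambda>U. U \<subseteq> Lp 2 \<Omega> \<and>
     (\<forall>u\<in>U. \<exists>\<epsilon>>0. \<forall>v\<in>Lp 2 \<Omega>. L2_dist \<Omega> v u < \<epsilon> \<longrightarrow> v \<in> U))"

lemma openin_L2_topology:
  "openin (L2_topology \<Omega>) U \<longleftrightarrow> U \<subseteq> Lp 2 \<Omega> \<and>
     (\<forall>u\<in>U. \<exists>\<epsilon>>0. \<forall>v\<in>Lp 2 \<Omega>. L2_dist \<Omega> v u < \<epsilon> \<longrightarrow> v \<in> U)"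
proof -
  let ?P = "\<lambda>U. U \<subseteq> Lp 2 \<Omega> \<and>
     (\<forall>u\<in>U. \<exists>\<epsilon>>0. \<forall>v\<in>Lp 2 \<Omega>. L2_dist \<Omega> v u < \<epsilon> \<longrightarrow> v \<in> U)"
  have "?P (U \<inter> V)" if U: "?P U" and V: "?P V" for U V
  proof (intro conjI ballI)
    show "U \<inter> V \<subseteq> Lp 2 \<Omega>" using U by blast
    fix u assume u: "u \<in> U \<inter> V"
    obtain a where a: "a > 0" "\<forall>v\<in>Lp 2 \<Omega>. L2_dist \<Omega> v u < a \<longrightarrow> v \<in> U" using U u by blast
    obtain b where b: "b > 0" "\<forall>v\<in>Lp 2 \<Omega>. L2_dist \<Omega> v u < b \<longrightarrow> v \<in> V" using V u by blast
    show "\<exists>\<epsilon>>0. \<forall>v\<in>Lp 2 \<Omega>. L2_dist \<Omega> v u < \<epsilon> \<longrightarrow> v \<in> U \<inter> V"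
      using a b by (intro exI[of _ "min a b"]) auto
  qed
  moreover have "?P (\<Union>\<U>)" if "\<forall>U\<in>\<U>. ?P U" for \<U>
    using that by (meson Union_iff Union_least)
  ultimately have "istopology ?P"
    unfolding istopology_def by blast
  then show ?thesis
    unfolding L2_topology_def by (simp add: topology_inverse')
qed

section \<open>Weak derivatives and Sobolev spaces\<close>

primrec Ck :: "nat \<Rightarrow> ('a::euclidean_space \<Rightarrow> real) \<Rightarrow> bool" where
  "Ck 0 f \<longleftrightarrow> continuous_on UNIV f"
| "Ck (Suc k) f \<longleftrightarrow> f differentiable_on UNIV \<and>
     (\<forall>i\<in>Basis. Ck k (\<lambda>x. frechet_derivative f (at x) i))"

text \<open>\<open>C_c\<^sup>\<infinity>(\<Omega>)\<close>, with test functions extended by zero outside of \<open>\<Omega>\<close>.\<close>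

definition test_function :: "'a::euclidean_space set \<Rightarrow> ('a \<Rightarrow> real) \<Rightarrow> bool" where
  "test_function \<Omega> \<phi> \<longleftrightarrow>
     (\<forall>k. Ck k \<phi>) \<and> compact (closure {x. \<phi> x \<noteq> 0}) \<and> closure {x. \<phi> x \<noteq> 0} \<subseteq> \<Omega>"

definition locally_integrable ::
  "'a::euclidean_space set \<Rightarrow> ('a \<Rightarrow> 'b::{banach, second_countable_topology}) \<Rightarrow> bool" where
  "locally_integrable \<Omega> f \<longleftrightarrow> (\<forall>C. compact C \<and> C \<subseteq> \<Omega> \<longrightarrow> integrable (lebesgue_on C) f)"

definition weak_gradient ::
  "'a::euclidean_space set \<Rightarrow> ('a \<Rightarrow> real) \<Rightarrow> ('a \<Rightarrow> 'a) \<Rightarrow> bool" where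
  "weak_gradient \<Omega> f G \<longleftrightarrow> locally_integrable \<Omega> f \<and> locally_integrable \<Omega> G \<and>
     (\<forall>\<phi>. test_function \<Omega> \<phi> \<longrightarrow> (\<forall>i\<in>Basis.
        (LINT x|lebesgue_on \<Omega>. f x * frechet_derivative \<phi> (at x) i) =
        - (LINT x|lebesgue_on \<Omega>. (G x \<bullet> i) * \<phi> x)))"

text \<open>Weak gradients are unique only almost everywhere; every use of the chosen representative
  below is under an integral or an essential supremum.\<close>

definition wgrad :: "'a::euclidean_space set \<Rightarrow> ('a \<Rightarrow> real) \<Rightarrow> 'a \<Rightarrow> 'a" where
  "wgrad \<Omega> f = (SOME G. weak_gradient \<Omega> f G)"

definition W1 :: "ennreal \<Rightarrow> 'a::euclidean_space set \<Rightarrow> ('a \<Rightarrow> real) set" where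
  "W1 p \<Omega> = {f \<in> Lp p \<Omega>. \<exists>G \<in> Lp p \<Omega>. weak_gradient \<Omega> f G}"

text \<open>Sobolev norms are normalised as sums of Lebesgue norms.  This is equivalent to the other
  usual choices, with constants depending only on \<open>p\<close> and the dimension.\<close>

definition W1_norm :: "ennreal \<Rightarrow> 'a::euclidean_space set \<Rightarrow> ('a \<Rightarrow> real) \<Rightarrow> real" where
  "W1_norm p \<Omega> f = Lp_norm p \<Omega> f + Lp_norm p \<Omega> (wgrad \<Omega> f)"

abbreviation H1 :: "'a::euclidean_space set \<Rightarrow> ('a \<Rightarrow> real) set" where
  "H1 \<equiv> W1 2"

abbreviation H1_norm :: "'a::euclidean_space set \<Rightarrow> ('a \<Rightarrow> real) \<Rightarrow> real" where
  "H1_norm \<equiv> W1_norm 2"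

definition H2 :: "'a::euclidean_space set \<Rightarrow> ('a \<Rightarrow> real) set" where
  "H2 \<Omega> = {f \<in> H1 \<Omega>. \<forall>i\<in>Basis. (\<lambda>x. wgrad \<Omega> f x \<bullet> i) \<in> H1 \<Omega>}"

definition H2_norm :: "'a::euclidean_space set \<Rightarrow> ('a \<Rightarrow> real) \<Rightarrow> real" where
  "H2_norm \<Omega> f = H1_norm \<Omega> f + (\<Sum>i\<in>Basis. Lp_norm 2 \<Omega> (wgrad \<Omega> (\<lambda>x. wgrad \<Omega> f x \<bullet> i)))"

text \<open>The dual of \<open>H1 \<Omega>\<close>.  Only the values of a functional on \<open>H1 \<Omega>\<close> are relevant.\<close>

definition H1_dual :: "'a::euclidean_space set \<Rightarrow> (('a \<Rightarrow> real) \<Rightarrow> real) set" where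
  "H1_dual \<Omega> = {F.
     (\<forall>\<phi>\<in>H1 \<Omega>. \<forall>\<psi>\<in>H1 \<Omega>. F (\<lambda>x. \<phi> x + \<psi> x) = F \<phi> + F \<psi>) \<and>
     (\<forall>c. \<forall>\<psi>\<in>H1 \<Omega>. F (\<lambda>x. c * \<psi> x) = c * F \<psi>) \<and>
     (\<exists>C. \<forall>\<psi>\<in>H1 \<Omega>. \<bar>F \<psi>\<bar> \<le> C * H1_norm \<Omega> \<psi>)}"

definition H1_dual_norm :: "'a::euclidean_space set \<Rightarrow> (('a \<Rightarrow> real) \<Rightarrow> real) \<Rightarrow> real" where
  "H1_dual_norm \<Omega> F = (SUP \<psi>\<in>{\<psi> \<in> H1 \<Omega>. H1_norm \<Omega> \<psi> \<le> 1}. \<bar>F \<psi>\<bar>)"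

section \<open>Functions of time with values in a function space\<close>

text \<open>\<open>V\<close> is a space of real functions with seminorm \<open>N\<close>: either \<open>H1 \<Omega>\<close> or its dual.
  The first definition is strong (Bochner) measurability.\<close>

definition strongly_measurable ::
  "('c \<Rightarrow> real) set \<Rightarrow> (('c \<Rightarrow> real) \<Rightarrow> real) \<Rightarrow> real set \<Rightarrow> (real \<Rightarrow> 'c \<Rightarrow> real) \<Rightarrow> bool" where
  "strongly_measurable V N I f \<longleftrightarrow>
     (\<exists>s :: nat \<Rightarrow> real \<Rightarrow> 'c \<Rightarrow> real.
        (\<forall>n. simple_function (lebesgue_on I) (s n) \<and> s n ` I \<subseteq> V) \<and>
        (AE t in lebesgue_on I. f t \<in> V \<and> (\<lambda>n. N (\<lambda>x. s n t x - f t x)) \<longlonglongrightarrow> 0))"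

definition L2_loc ::
  "('c \<Rightarrow> real) set \<Rightarrow> (('c \<Rightarrow> real) \<Rightarrow> real) \<Rightarrow> (real \<Rightarrow> 'c \<Rightarrow> real) \<Rightarrow> bool" where
  "L2_loc V N f \<longleftrightarrow> (\<forall>a b. 0 < a \<and> a < b \<longrightarrow>
     strongly_measurable V N {a..b} f \<and> integrable (lebesgue_on {a..b}) (\<lambda>t. (N (f t))\<^sup>2))"

definition cont_in ::
  "('c \<Rightarrow> real) set \<Rightarrow> (('c \<Rightarrow> real) \<Rightarrow> real) \<Rightarrow> (real \<Rightarrow> 'c \<Rightarrow> real) \<Rightarrow> bool" where
  "cont_in V N f \<longleftrightarrow> (\<forall>t\<ge>0. f t \<in> V \<and>
     ((\<lambda>s. N (\<lambda>x. f s x - f t x)) \<longlongrightarrow> 0) (at t within {0..}))"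

text \<open>\<open>du\<close> is the distributional time derivative of \<open>u\<close> on \<open>(0, \<infinity>)\<close>, as functions with values in
  the dual of \<open>H1 \<Omega>\<close>, where \<open>u t\<close> is identified with \<open>\<lambda>\<psi>. L2_inner \<Omega> (u t) \<psi>\<close>.  The identity
  of Bochner integrals in the dual is evaluated at each \<open>\<psi>\<close>.\<close>

definition weak_time_derivative ::
  "'a::euclidean_space set \<Rightarrow> (real \<Rightarrow> 'a \<Rightarrow> real) \<Rightarrow> (real \<Rightarrow> ('a \<Rightarrow> real) \<Rightarrow> real) \<Rightarrow> bool" where
  "weak_time_derivative \<Omega> u du \<longleftrightarrow>
     (\<forall>\<eta>. test_function {0<..} \<eta> \<longrightarrow> (\<forall>\<psi>\<in>H1 \<Omega>.
        (LINT t|lebesgue_on {0<..}. L2_inner \<Omega> (u t) \<psi> * deriv \<eta> t) =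
        - (LINT t|lebesgue_on {0<..}. du t \<psi> * \<eta> t)))"

section \<open>The nonlocal Cahn--Hilliard equation with reaction\<close>

definition conv ::
  "'a::euclidean_space set \<Rightarrow> ('a \<Rightarrow> real) \<Rightarrow> ('a \<Rightarrow> real) \<Rightarrow> 'a \<Rightarrow> real" where
  "conv \<Omega> K \<rho> x = (LINT y|lebesgue_on \<Omega>. K (x - y) * \<rho> y)"

definition assumption_K :: "'a::euclidean_space set \<Rightarrow> ('a \<Rightarrow> real) \<Rightarrow> bool" where
  "assumption_K \<Omega> K \<longleftrightarrow>
     K \<in> borel_measurable lebesgue \<and>
     (AE x in lebesgue. K x = K (- x)) \<and>
     (SUP x\<in>\<Omega>. \<integral>\<^sup>+ y. ennreal \<bar>K (x - y)\<bar> \<partial>lebesgue_on \<Omega>) < \<infinity> \<and>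
     (\<forall>p\<ge>1. \<exists>r>0. \<forall>\<rho>\<in>Lp p \<Omega>.
        conv \<Omega> K \<rho> \<in> W1 p \<Omega> \<and> W1_norm p \<Omega> (conv \<Omega> K \<rho>) \<le> r * Lp_norm p \<Omega> \<rho>) \<and>
     (\<exists>C>0. \<forall>\<rho>\<in>H1 \<Omega>.
        conv \<Omega> K \<rho> \<in> H2 \<Omega> \<and> H2_norm \<Omega> (conv \<Omega> K \<rho>) \<le> C * H1_norm \<Omega> \<rho>)"

definition assumption_G :: "'a::euclidean_space set \<Rightarrow> ('a \<Rightarrow> real \<Rightarrow> real) \<Rightarrow> bool" where
  "assumption_G \<Omega> g \<longleftrightarrow>
     (\<forall>s\<in>{0..1}. (\<lambda>x. g x s) \<in> borel_measurable (lebesgue_on \<Omega>)) \<and>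
     (\<exists>M. \<forall>x\<in>\<Omega>. \<exists>g'.
        (\<forall>s\<in>{0..1}. (g x has_real_derivative g' s) (at s within {0..1}) \<and>
           \<bar>g x s\<bar> \<le> M \<and> \<bar>g' s\<bar> \<le> M) \<and>
        M-lipschitz_on {0..1} g') \<and>
     (AE x in lebesgue_on \<Omega>. g x 0 \<ge> 0 \<and> 0 \<ge> g x 1)"

definition mobility :: "real \<Rightarrow> real" where
  "mobility s = s * (1 - s)"

definition potential ::
  "'a::euclidean_space set \<Rightarrow> ('a \<Rightarrow> real) \<Rightarrow> (real \<Rightarrow> 'a \<Rightarrow> real) \<Rightarrow> real \<Rightarrow> 'a \<Rightarrow> real" where
  "potential \<Omega> K u t = conv \<Omega> K (\<lambda>y. 1 - 2 * u t y)"

definition phase_space :: "'a::euclidean_space set \<Rightarrow> ('a \<Rightarrow> real) set" where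
  "phase_space \<Omega> = {u \<in> Lp 2 \<Omega>. AE x in lebesgue_on \<Omega>. 0 \<le> u x \<and> u x \<le> 1}"

text \<open>\<open>u\<close> is the representative that is continuous on \<open>[0, \<infinity>)\<close> with values in \<open>L\<^sup>2(\<Omega>)\<close>; this gives
  meaning to the initial condition and to \<open>u t\<close> for every single \<open>t\<close>.\<close>

definition weak_solution ::
  "'a::euclidean_space set \<Rightarrow> ('a \<Rightarrow> real) \<Rightarrow> ('a \<Rightarrow> real \<Rightarrow> real) \<Rightarrow>
   ('a \<Rightarrow> real) \<Rightarrow> (real \<Rightarrow> 'a \<Rightarrow> real) \<Rightarrow> bool" where
  "weak_solution \<Omega> K g u0 u \<longleftrightarrow>
     cont_in (Lp 2 \<Omega>) (Lp_norm 2 \<Omega>) u \<and>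
     L2_loc (H1 \<Omega>) (H1_norm \<Omega>) u \<and>
     (AE t in lebesgue_on {0<..}. AE x in lebesgue_on \<Omega>. 0 \<le> u t x \<and> u t x \<le> 1) \<and>
     cont_in (W1 \<infinity> \<Omega>) (W1_norm \<infinity> \<Omega>) (potential \<Omega> K u) \<and>
     (AE x in lebesgue_on \<Omega>. u 0 x = u0 x) \<and>
     (\<exists>du. L2_loc (H1_dual \<Omega>) (H1_dual_norm \<Omega>) du \<and> weak_time_derivative \<Omega> u du \<and>
        (AE t in lebesgue_on {0<..}. \<forall>\<psi>\<in>H1 \<Omega>.
           du t \<psi>
           + L2_inner \<Omega> (\<lambda>x. mobility (u t x) *\<^sub>R wgrad \<Omega> (potential \<Omega> K u t) x) (wgrad \<Omega> \<psi>)
           + L2_inner \<Omega> (wgrad \<Omega> (u t)) (wgrad \<Omega> \<psi>)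
           = L2_inner \<Omega> (\<lambda>x. g x (u t x)) \<psi>))"

text \<open>\<open>S\<close> maps an initial datum to (a representative of) its weak solution.  The semigroup law and
  the continuity of \<open>S\<close> follow (up to equality almost everywhere) from uniqueness and continuous
  dependence of weak solutions, and are not required separately.\<close>

definition generated_system ::
  "'a::euclidean_space set \<Rightarrow> ('a \<Rightarrow> real) \<Rightarrow> ('a \<Rightarrow> real \<Rightarrow> real) \<Rightarrow>
   (real \<Rightarrow> ('a \<Rightarrow> real) \<Rightarrow> 'a \<Rightarrow> real) \<Rightarrow> bool" where
  "generated_system \<Omega> K g S \<longleftrightarrow>
     (\<forall>u0\<in>phase_space \<Omega>. (\<forall>t\<ge>0. S t u0 \<in> phase_space \<Omega>) \<and>
        weak_solution \<Omega> K g u0 (\<lambda>t. S t u0))"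

definition exponential_attractor ::
  "'a::euclidean_space set \<Rightarrow> (real \<Rightarrow> ('a \<Rightarrow> real) \<Rightarrow> 'a \<Rightarrow> real) \<Rightarrow> ('a \<Rightarrow> real) set \<Rightarrow> bool" where
  "exponential_attractor \<Omega> S A \<longleftrightarrow>
     A \<subseteq> phase_space \<Omega> \<and> A \<noteq> {} \<and> compactin (L2_topology \<Omega>) A \<and>
     (\<exists>c>0. \<exists>C>0. \<forall>u0\<in>phase_space \<Omega>. \<forall>t\<ge>0.
        (INF a\<in>A. L2_dist \<Omega> (S t u0) a) \<le> C * exp (- c * t))"

end

theory Submission
  imports Defs
begin

text \<open>The attractor is the \<open>L\<^sup>2\<close>-closure of \<open>{S t u\<^sub>0 | t \<ge> 2}\<close>.  It trivially attracts, so everything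
  rests on its compactness, that is, on total boundedness of this set, since \<open>phase_space \<Omega>\<close> is
  complete.  Testing the equation with \<open>u\<close> bounds \<open>\<integral>\<^sub>t\<^sup>t\<^sup>+\<^sup>1 \<parallel>u\<parallel>\<^sup>2\<close> in \<open>H\<^sup>1\<close> uniformly, hence every trajectory
  visits a fixed ball of \<open>H\<^sup>1\<close> during each time interval of length one.  That ball is totally bounded
  in \<open>L\<^sup>2\<close> by a Poincare inequality on small boxes; no regularity of the boundary is needed because
  \<open>0 \<le> u \<le> 1\<close> makes a thin boundary layer negligible.  Testing the difference of two solutions
  with itself gives Lipschitz dependence on the data over unit times, so the states reached after
  the visit are covered by finitely many compact arcs of trajectories up to a small error.\<close>

text \<open>An exponential attractor has to be compact and to attract at an exponential rate. A
  compact set that contains every trajectory from time 2 on therefore qualifies, and the factor exp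
  2 in the constant pays for the earlier times. Two obstacles shape the proof. A solution is
  controlled only on compact subintervals of the open half line, and its time derivative lies only
  in the dual of H1. Every estimate therefore restarts a trajectory at some s > 0, and the chain
  rule for the squared norm becomes an inequality obtained from Riemann sums. Moreover, the visits
  to the H1 ball occur at uncontrolled times, so the time \<tau> left after a visit depends on the
  trajectory. Centres of a net must be continued along their own trajectories, and compactness of
  [0,1] takes care of \<tau>. In the energy estimates (K) with p = infinity bounds the drift grad w,
  (K) with p = 2 makes it Lipschitz in u, and Young's inequality hides the remaining gradient factor
  in the diffusion term.\<close>

section \<open>Test functions of product form\<close>

text \<open>Infinite differentiability in coinductive form: the class \<open>C\<close> is closed
  under taking derivatives. A proof of smoothness only has to exhibit such a class, and no iterated
  derivatives are formed.\<close>

definition smooth :: "(real \<Rightarrow> real) \<Rightarrow> bool" where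
  "smooth f \<longleftrightarrow> (\<exists>C. f \<in> C \<and> (\<forall>g\<in>C. \<exists>g'\<in>C. \<forall>x. (g has_real_derivative g' x) (at x)))"

lemma smooth_derivE:
  assumes "smooth f"
  obtains f' where "smooth f'" "\<And>x. (f has_real_derivative f' x) (at x)"
  using assms unfolding smooth_def by metis

lemma smooth_antideriv:
  assumes f: "smooth f" and F: "\<And>x. (F has_real_derivative f x) (at x)"
  shows "smooth F"
proof -
  obtain C where C: "f \<in> C" "\<forall>g\<in>C. \<exists>g'\<in>C. \<forall>x. (g has_real_derivative g' x) (at x)"
    using f unfolding smooth_def by auto
  have "\<forall>g\<in>insert F C. \<exists>g'\<in>insert F C. \<forall>x. (g has_real_derivative g' x) (at x)"
    using C F by auto
  then show ?thesis unfolding smooth_def by blast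
qed

inductive_set additive_closure :: "(real \<Rightarrow> real) set \<Rightarrow> (real \<Rightarrow> real) set" for C where
  base: "f \<in> C \<Longrightarrow> f \<in> additive_closure C"
| add: "f \<in> additive_closure C \<Longrightarrow> g \<in> additive_closure C \<Longrightarrow> (\<lambda>x. f x + g x) \<in> additive_closure C"

text \<open>Differentiation leaves the natural classes (products, multiples of flat functions), but
  only by sums. As derivatives distribute over sums, it is enough that each member has a derivative
  that is a sum of members.\<close>

lemma smooth_additive_closureI:
  assumes f: "f \<in> C"
    and C: "\<And>g. g \<in> C \<Longrightarrow> \<exists>g'\<in>additive_closure C. \<forall>x. (g has_real_derivative g' x) (at x)"
  shows "smooth f"
proof -
  have "\<exists>g'\<in>additive_closure C. \<forall>x. (g has_real_derivative g' x) (at x)"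
    if "g \<in> additive_closure C" for g
    using that
  proof induction
    case (add g1 g2)
    then obtain g1' g2' where "g1' \<in> additive_closure C" "g2' \<in> additive_closure C"
      "\<forall>x. (g1 has_real_derivative g1' x) (at x)" "\<forall>x. (g2 has_real_derivative g2' x) (at x)"
      by auto
    then show ?case
      by (intro bexI[of _ "\<lambda>x. g1' x + g2' x"] additive_closure.add allI DERIV_add) auto
  qed (use C in auto)
  then show ?thesis unfolding smooth_def using f additive_closure.base by blast
qed

lemma smooth_mult:
  assumes "smooth f" "smooth g"
  shows "smooth (\<lambda>x. f x * g x)"
proof -
  obtain C where C: "f \<in> C" "\<And>g. g \<in> C \<Longrightarrow> \<exists>g'\<in>C. \<forall>x. (g has_real_derivative g' x) (at x)"
    using assms(1) unfolding smooth_def by auto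
  obtain D where D: "g \<in> D" "\<And>g. g \<in> D \<Longrightarrow> \<exists>g'\<in>D. \<forall>x. (g has_real_derivative g' x) (at x)"
    using assms(2) unfolding smooth_def by auto
  define E where "E = {(\<lambda>x. a x * b x) | a b. a \<in> C \<and> b \<in> D}"
  show ?thesis
  proof (rule smooth_additive_closureI[of _ E])
    show "(\<lambda>x. f x * g x) \<in> E" using C D by (auto simp: E_def)
    fix p assume "p \<in> E"
    then obtain a b where p: "p = (\<lambda>x. a x * b x)" "a \<in> C" "b \<in> D" unfolding E_def by blast
    obtain a' b' where a': "a' \<in> C" "\<forall>x. (a has_real_derivative a' x) (at x)"
      and b': "b' \<in> D" "\<forall>x. (b has_real_derivative b' x) (at x)"
      using C(2)[OF p(2)] D(2)[OF p(3)] by auto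
    have "(\<lambda>x. a' x * b x + b' x * a x) \<in> additive_closure E"
    proof (rule additive_closure.add; rule additive_closure.base)
      show "(\<lambda>x. a' x * b x) \<in> E" using a' p by (auto simp: E_def)
      show "(\<lambda>x. b' x * a x) \<in> E"
        unfolding E_def mult.commute[of "b' _"] using b' p by blast
    qed
    moreover have "\<forall>x. (p has_real_derivative (a' x * b x + b' x * a x)) (at x)"
      unfolding p using a' b' by (intro allI DERIV_mult) auto
    ultimately show "\<exists>g'\<in>additive_closure E. \<forall>x. (p has_real_derivative g' x) (at x)"
      by (intro bexI) auto
  qed
qed

lemma smooth_affine:
  assumes "smooth f"
  shows "smooth (\<lambda>x. k * f (m * x + c))"
proof -
  obtain C where C: "f \<in> C" "\<And>g. g \<in> C \<Longrightarrow> \<exists>g'\<in>C. \<forall>x. (g has_real_derivative g' x) (at x)"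
    using assms(1) unfolding smooth_def by auto
  \<comment> \<open>The prefactor ranges over all reals, since each derivative contributes another
    factor \<open>m\<close>.\<close>
  define E where "E = {(\<lambda>x. k * g (m * x + c)) | g k. g \<in> C}"
  have "\<exists>g'\<in>E. \<forall>x. (p has_real_derivative g' x) (at x)" if pE: "p \<in> E" for p
  proof -
    obtain g k where p: "p = (\<lambda>x. k * g (m * x + c))" "g \<in> C" using pE by (auto simp: E_def)
    obtain g' where g': "g' \<in> C" "\<And>x. (g has_real_derivative g' x) (at x)" using C p by meson
    have "(p has_real_derivative (k * m) * g' (m * x + c)) (at x)" for x
    proof -
      have "((\<lambda>x. g (m * x + c)) has_real_derivative g' (m * x + c) * m) (at x)"
        by (rule DERIV_chain2[OF g'(2)]) (auto intro!: derivative_eq_intros)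
      then show ?thesis unfolding p by (auto dest: DERIV_cmult[of _ _ _ _ k] simp: algebra_simps)
    qed
    moreover have "(\<lambda>x. (k * m) * g' (m * x + c)) \<in> E" unfolding E_def using g' by blast
    ultimately show ?thesis by (intro bexI) auto
  qed
  moreover have "(\<lambda>x. k * f (m * x + c)) \<in> E" using C by (auto simp: E_def)
  ultimately show ?thesis unfolding smooth_def by blast
qed

lemma smooth_diff:
  assumes "smooth f" "smooth g"
  shows "smooth (\<lambda>x. f x - g x)"
proof -
  obtain C where C: "f \<in> C" "\<And>g. g \<in> C \<Longrightarrow> \<exists>g'\<in>C. \<forall>x. (g has_real_derivative g' x) (at x)"
    using assms(1) unfolding smooth_def by auto
  obtain D where D: "g \<in> D" "\<And>g. g \<in> D \<Longrightarrow> \<exists>g'\<in>D. \<forall>x. (g has_real_derivative g' x) (at x)"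
    using assms(2) unfolding smooth_def by auto
  define E where "E = {(\<lambda>x. a x - b x) | a b. a \<in> C \<and> b \<in> D}"
  have "\<exists>g'\<in>E. \<forall>x. (p has_real_derivative g' x) (at x)" if pE: "p \<in> E" for p
  proof -
    obtain a b where p: "p = (\<lambda>x. a x - b x)" "a \<in> C" "b \<in> D"
      using pE unfolding E_def by blast
    obtain a' b' where a': "a' \<in> C" "\<forall>x. (a has_real_derivative a' x) (at x)"
      and b': "b' \<in> D" "\<forall>x. (b has_real_derivative b' x) (at x)"
      using C(2)[OF p(2)] D(2)[OF p(3)] by auto
    show ?thesis
      by (rule bexI[of _ "\<lambda>x. a' x - b' x"]) (use a' b' p in \<open>auto simp: E_def intro!: DERIV_diff\<close>)
  qed
  moreover have "(\<lambda>x. f x - g x) \<in> E" using C D by (auto simp: E_def)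
  ultimately show ?thesis unfolding smooth_def by blast
qed

section \<open>Flat functions and smooth approximations of intervals\<close>

definition flat_power :: "nat \<Rightarrow> real \<Rightarrow> real" where
  "flat_power k x = (if x > 0 then inverse x ^ k * exp (- inverse x) else 0)"

text \<open>The functions exp(-1/x) / x^k form a family closed under differentiation up to linear
  combinations. At 0 no expansion is involved: the difference quotient of one member is exactly the
  next member, and this tends to 0 from both sides.\<close>

lemma flat_power_deriv:
  "(flat_power k has_real_derivative (- real k * flat_power (Suc k) x + flat_power (k + 2) x)) (at x)"
proof -
  consider "x > 0" | "x < 0" | "x = 0" by linarith
  then show ?thesis
  proof cases
    case 1
    have "((\<lambda>x. inverse x ^ k * exp (- inverse x)) has_real_derivative
       (- real k * flat_power (Suc k) x + flat_power (k + 2) x)) (at x)"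
    proof (cases k)
      case 0
      then show ?thesis using 1
        by (auto intro!: derivative_eq_intros simp: flat_power_def field_simps power2_eq_square)
    next
      case (Suc m)
      have "m = 0 \<or> x ^ m = x * x ^ (m - Suc 0)"
        by (metis Suc_pred' One_nat_def power_Suc neq0_conv)
      then show ?thesis using 1 Suc
        by (auto intro!: derivative_eq_intros simp: flat_power_def field_simps power2_eq_square)
    qed
    moreover have "eventually (\<lambda>y. y \<in> {0<..}) (nhds x)"
      using 1 by (intro eventually_nhds_in_open) auto
    then have "eventually (\<lambda>y. flat_power k y = inverse y ^ k * exp (- inverse y)) (nhds x)"
      by eventually_elim (auto simp: flat_power_def)
    ultimately show ?thesis by (subst DERIV_cong_ev[OF refl _ refl]) auto
  next
    case 2
    have "eventually (\<lambda>y. y \<in> {..<0}) (nhds x)"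
      using 2 by (intro eventually_nhds_in_open) auto
    then have "eventually (\<lambda>y. flat_power k y = 0) (nhds x)"
      by eventually_elim (auto simp: flat_power_def)
    then show ?thesis using 2 by (subst DERIV_cong_ev[OF refl _ refl]) (auto simp: flat_power_def)
  next
    case 3
    have r: "((\<lambda>h. flat_power (Suc k) h) \<longlongrightarrow> 0) (at_right 0)"
    proof -
      have "((\<lambda>h::real. inverse h ^ (Suc k) / exp (inverse h)) \<longlongrightarrow> 0) (at_right 0)"
        by (rule filterlim_compose[OF tendsto_power_div_exp_0 filterlim_inverse_at_top_right])
      then show ?thesis
        by (rule Lim_transform_eventually)
           (auto simp: eventually_at_right_less flat_power_def exp_minus divide_inverse
             intro!: eventually_at_rightI[of 0 1])
    qed
    have l: "((\<lambda>h. flat_power (Suc k) h) \<longlongrightarrow> 0) (at_left 0)"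
      by (rule Lim_transform_eventually[of "\<lambda>_. 0"])
         (auto simp: flat_power_def intro!: eventually_at_leftI[of "-1"])
    have "((\<lambda>h. flat_power (Suc k) h) \<longlongrightarrow> 0) (at 0)"
      using l r by (simp add: filterlim_at_split)
    moreover have "flat_power (Suc k) h = (flat_power k (0 + h) - flat_power k 0) / h" for h
      by (simp add: flat_power_def divide_inverse)
    ultimately show ?thesis using 3 unfolding DERIV_def by (simp add: flat_power_def)
  qed
qed

lemma smooth_flat_power: "smooth (flat_power k)"
proof (rule smooth_additive_closureI[of _ "{(\<lambda>x. c * flat_power k x) | c k. True}"])
  let ?C = "{(\<lambda>x. c * flat_power k x) | c k. True}"
  show "flat_power k \<in> ?C" by (auto intro!: exI[of _ 1] exI[of _ k])
  fix g assume "g \<in> ?C"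
  then obtain c k where g: "g = (\<lambda>x. c * flat_power k x)" by auto
  have "(\<lambda>x. (c * (- real k)) * flat_power (Suc k) x + c * flat_power (k + 2) x) \<in> additive_closure ?C"
    by (rule additive_closure.add; rule additive_closure.base) blast+
  moreover have "(g has_real_derivative (c * (- real k)) * flat_power (Suc k) x + c * flat_power (k + 2) x) (at x)" for x
    using DERIV_cmult[OF flat_power_deriv[of k x], of c] unfolding g by (simp add: algebra_simps)
  ultimately show "\<exists>g'\<in>additive_closure ?C. \<forall>x. (g has_real_derivative g' x) (at x)"
    by (intro bexI) auto
qed

text \<open>exp(-1/y) tends to 1 as y tends to infinity, so stretching both factors by n + 1 drives
  the product to the indicator of the open interval, while its values stay between 0 and 1 and it
  vanishes outside.\<close>

definition bump :: "nat \<Rightarrow> real \<Rightarrow> real \<Rightarrow> real \<Rightarrow> real" where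
  "bump n a b x = flat_power 0 (real (Suc n) * (x - a)) * flat_power 0 (real (Suc n) * (b - x))"

lemma smooth_bump: "smooth (bump n a b)"
proof -
  have "smooth (\<lambda>x. 1 * flat_power 0 (real (Suc n) * x + - real (Suc n) * a))"
       "smooth (\<lambda>x. 1 * flat_power 0 (- real (Suc n) * x + real (Suc n) * b))"
    by (rule smooth_affine[OF smooth_flat_power])+
  from smooth_mult[OF this] show ?thesis unfolding bump_def by (simp add: algebra_simps)
qed

lemma bump_bounds: "0 \<le> bump n a b x" "bump n a b x \<le> 1"
proof -
  have *: "0 \<le> flat_power 0 y \<and> flat_power 0 y \<le> 1" for y by (auto simp: flat_power_def)
  show "0 \<le> bump n a b x" "bump n a b x \<le> 1"
    unfolding bump_def using * by (auto intro!: mult_le_one)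
qed

lemma bump_eq_0: "x \<notin> {a<..<b} \<Longrightarrow> bump n a b x = 0"
  by (auto simp: bump_def flat_power_def not_less mult_le_0_iff zero_less_mult_iff)

lemma bump_tendsto: "(\<lambda>n. bump n a b x) \<longlonglongrightarrow> indicator {a<..<b} x"
proof (cases "x \<in> {a<..<b}")
  case True
  have *: "(\<lambda>n. flat_power 0 (real (Suc n) * y)) \<longlonglongrightarrow> 1" if "y > 0" for y
  proof -
    have "(\<lambda>n. exp (- (inverse (real (Suc n)) * inverse y))) \<longlonglongrightarrow> exp (- (0 * inverse y))"
      by (intro tendsto_intros LIMSEQ_inverse_real_of_nat)
    then show ?thesis using that by (simp add: flat_power_def)
  qed
  have "(\<lambda>n. bump n a b x) \<longlonglongrightarrow> 1 * 1"
    unfolding bump_def by (intro tendsto_mult *) (use True in auto)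
  then show ?thesis using True by simp
qed (simp add: bump_eq_0)

lemma continuous_on_smooth: "smooth f \<Longrightarrow> continuous_on A f"
  by (erule smooth_derivE) (meson DERIV_continuous continuous_at_imp_continuous_on)

section \<open>Products of functions of one coordinate\<close>

lemma has_derivative_coordinate_prod:
  fixes q :: "'a::euclidean_space \<Rightarrow> real \<Rightarrow> real"
  assumes q: "\<And>j. j \<in> Basis \<Longrightarrow> (q j has_real_derivative q' j) (at (x \<bullet> j))"
  shows "((\<lambda>x. \<Prod>j\<in>Basis. q j (x \<bullet> j)) has_derivative
           (\<lambda>y. \<Sum>j\<in>Basis. q' j * (y \<bullet> j) * (\<Prod>k\<in>Basis - {j}. q k (x \<bullet> k)))) (at x)"
proof (rule has_derivative_prod)
  fix j :: 'a assume j: "j \<in> Basis"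
  have "((\<lambda>x. x \<bullet> j) has_derivative (\<lambda>y. y \<bullet> j)) (at x)"
    by (auto intro!: derivative_eq_intros)
  from has_derivative_compose[OF this, where g = "q j" and g' = "(*) (q' j)"] q[OF j]
  show "((\<lambda>x. q j (x \<bullet> j)) has_derivative (\<lambda>y. q' j * (y \<bullet> j))) (at x)"
    by (simp add: has_field_derivative_def)
qed

lemma frechet_derivative_coordinate_prod:
  fixes q :: "'a::euclidean_space \<Rightarrow> real \<Rightarrow> real"
  assumes q: "\<And>j. j \<in> Basis \<Longrightarrow> (q j has_real_derivative q' j) (at (x \<bullet> j))" and i: "i \<in> Basis"
  shows "frechet_derivative (\<lambda>x. \<Prod>j\<in>Basis. q j (x \<bullet> j)) (at x) i =
    q' i * (\<Prod>k\<in>Basis - {i}. q k (x \<bullet> k))"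
proof -
  have "frechet_derivative (\<lambda>x. \<Prod>j\<in>Basis. q j (x \<bullet> j)) (at x) i =
     (\<Sum>j\<in>Basis. q' j * (i \<bullet> j) * (\<Prod>k\<in>Basis - {j}. q k (x \<bullet> k)))"
    by (subst frechet_derivative_at[OF has_derivative_coordinate_prod[OF q], symmetric]) auto
  also have "\<dots> = (\<Sum>j\<in>Basis. if j = i then q' i * (\<Prod>k\<in>Basis - {i}. q k (x \<bullet> k)) else 0)"
    by (intro sum.cong) (auto simp: inner_Basis i)
  finally show ?thesis using i by simp
qed

text \<open>A partial derivative replaces one factor by its derivative, so the result is again of
  product form. This is why the induction runs over arbitrary families \<open>q\<close>.\<close>

lemma Ck_coordinate_prod:
  fixes q :: "'a::euclidean_space \<Rightarrow> real \<Rightarrow> real"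
  assumes "\<And>j. j \<in> Basis \<Longrightarrow> smooth (q j)"
  shows "Ck k (\<lambda>x. \<Prod>j\<in>Basis. q j (x \<bullet> j))"
  using assms
proof (induction k arbitrary: q)
  case 0
  have "continuous_on UNIV (\<lambda>x. q j (x \<bullet> j))" if "j \<in> Basis" for j
    by (rule continuous_on_compose2[OF continuous_on_smooth[OF 0[OF that], of UNIV]])
       (auto intro!: continuous_intros)
  then show ?case by (simp add: continuous_on_prod)
next
  case (Suc k)
  have "\<forall>j\<in>Basis. \<exists>q'. smooth q' \<and> (\<forall>x. (q j has_real_derivative q' x) (at x))"
    using Suc.prems by (meson smooth_derivE)
  then have "\<exists>q'. \<forall>j\<in>Basis. smooth (q' j) \<and> (\<forall>x. (q j has_real_derivative q' j x) (at x))"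
    by (rule bchoice)
  then obtain q' where q': "\<And>j. j \<in> Basis \<Longrightarrow> smooth (q' j)"
    "\<And>j x. j \<in> Basis \<Longrightarrow> (q j has_real_derivative q' j x) (at x)" by blast
  show ?case
  proof (simp, intro conjI ballI)
    show "(\<lambda>x. \<Prod>j\<in>Basis. q j (x \<bullet> j)) differentiable_on UNIV"
      unfolding differentiable_on_def
    proof
      fix x :: 'a
      show "(\<lambda>x. \<Prod>j\<in>Basis. q j (x \<bullet> j)) differentiable at x"
        using has_derivative_coordinate_prod[of q "\<lambda>j. q' j (x \<bullet> j)" x] q'(2)
        by (auto simp: differentiable_def)
    qed
    fix i :: 'a assume i: "i \<in> Basis"
    have "frechet_derivative (\<lambda>x. \<Prod>j\<in>Basis. q j (x \<bullet> j)) (at x) i =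
        (\<Prod>j\<in>Basis. (q(i := q' i)) j (x \<bullet> j))" for x
      using i q' frechet_derivative_coordinate_prod[of q "\<lambda>j. q' j (x \<bullet> j)" x i]
      by (simp add: prod.remove[of Basis i])
    then show "Ck k (\<lambda>x. frechet_derivative (\<lambda>x. \<Prod>j\<in>Basis. q j (x \<bullet> j)) (at x) i)"
      using Suc.IH[of "q(i := q' i)"] Suc.prems q' i by auto
  qed
qed

definition box_bump :: "nat \<Rightarrow> 'a::euclidean_space \<Rightarrow> 'a \<Rightarrow> 'a \<Rightarrow> real" where
  "box_bump n a b x = (\<Prod>j\<in>Basis. bump n (a \<bullet> j) (b \<bullet> j) (x \<bullet> j))"

lemma box_bump_bounds: "0 \<le> box_bump n a b x" "box_bump n a b x \<le> 1"
  unfolding box_bump_def by (auto intro!: prod_nonneg prod_le_1 simp: bump_bounds)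

lemma box_bump_eq_0: "x \<notin> box a b \<Longrightarrow> box_bump n a b x = 0"
proof -
  assume "x \<notin> box a b"
  then obtain j where "j \<in> Basis" "x \<bullet> j \<notin> {a \<bullet> j<..<b \<bullet> j}" by (auto simp: box_def)
  then show ?thesis unfolding box_bump_def by (intro prod_zero bexI[of _ j] bump_eq_0) auto
qed

lemma box_bump_tendsto: "(\<lambda>n. box_bump n a b x) \<longlonglongrightarrow> indicator (box a b) x"
proof -
  have "(\<lambda>n. box_bump n a b x) \<longlonglongrightarrow> (\<Prod>j\<in>Basis. indicator {a \<bullet> j<..<b \<bullet> j} (x \<bullet> j))"
    unfolding box_bump_def by (intro tendsto_prod bump_tendsto)
  also have "(\<Prod>j\<in>Basis. indicator {a \<bullet> j<..<b \<bullet> j} (x \<bullet> j)) = (indicator (box a b) x :: real)"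
  proof (cases "x \<in> box a b")
    case False
    then obtain j where "j \<in> Basis" "x \<bullet> j \<notin> {a \<bullet> j<..<b \<bullet> j}" by (auto simp: box_def)
    then have "(\<Prod>j\<in>Basis. indicator {a \<bullet> j<..<b \<bullet> j} (x \<bullet> j)) = (0 :: real)"
      by (intro prod_zero bexI[of _ j]) auto
    then show ?thesis using False by simp
  qed (auto simp: box_def)
  finally show ?thesis .
qed

lemma Ck_box_bump: "Ck k (box_bump n a b)"
  unfolding box_bump_def by (intro Ck_coordinate_prod smooth_bump)

lemma test_functionI:
  assumes "\<And>k. Ck k \<phi>" and "\<And>x. x \<notin> C \<Longrightarrow> \<phi> x = 0" and "compact C" "C \<subseteq> \<Omega>"
  shows "test_function \<Omega> \<phi>"
proof -
  have "closure {x. \<phi> x \<noteq> 0} \<subseteq> C"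
    by (rule closure_minimal) (use assms compact_imp_closed in auto)
  then show ?thesis unfolding test_function_def using assms
    by (metis closed_closure compact_closure bounded_subset compact_imp_bounded bounded_closure
        compact_eq_bounded_closed order_trans)
qed

lemma test_function_box_bump: "cbox a b \<subseteq> \<Omega> \<Longrightarrow> test_function \<Omega> (box_bump n a b)"
  by (rule test_functionI[OF Ck_box_bump, of "cbox a b"])
     (use box_subset_cbox in \<open>auto intro!: box_bump_eq_0\<close>)

section \<open>Weak gradients and integrals over boxes\<close>

lemma integral_lebesgue_on_vanish:
  fixes h :: "'a::euclidean_space \<Rightarrow> 'b::{banach, second_countable_topology}"
  assumes "C \<subseteq> \<Omega>" "C \<in> sets lebesgue" "\<Omega> \<in> sets lebesgue" "\<And>x. x \<in> \<Omega> - C \<Longrightarrow> h x = 0"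
  shows "(LINT x|lebesgue_on \<Omega>. h x) = (LINT x|lebesgue_on C. h x)"
proof -
  have "indicator \<Omega> x *\<^sub>R h x = indicator C x *\<^sub>R h x" for x
    using assms by (cases "x \<in> C"; cases "x \<in> \<Omega>") auto
  then have "(\<lambda>x. indicator \<Omega> x *\<^sub>R h x) = (\<lambda>x. indicator C x *\<^sub>R h x)" by blast
  then show ?thesis using assms by (simp add: integral_restrict_space del: real_scaleR_def)
qed

text \<open>Dominated convergence on a common compact support \<open>C\<close>. As \<open>f\<close>
  is only locally integrable, its multiple by \<open>M\<close> is an integrable majorant on
  \<open>C\<close> but perhaps not on \<Omega>.\<close>

lemma tendsto_integral_times_bounded:
  fixes f :: "'a::euclidean_space \<Rightarrow> real"
  assumes f: "locally_integrable \<Omega> f" and \<Omega>: "\<Omega> \<in> sets lebesgue"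
    and C: "compact C" "C \<subseteq> \<Omega>"
    and h0: "\<And>n x. x \<notin> C \<Longrightarrow> h n x = 0" and hc: "\<And>n. continuous_on UNIV (h n)"
    and hb: "\<And>n x. \<bar>h n x\<bar> \<le> M" and hl: "\<And>x. (\<lambda>n. h n x) \<longlonglongrightarrow> h' x"
  shows "(\<lambda>n. LINT x|lebesgue_on \<Omega>. f x * h n x) \<longlonglongrightarrow> (LINT x|lebesgue_on \<Omega>. f x * h' x)"
proof -
  have Cs: "C \<in> sets lebesgue" using C by (simp add: borel_compact sets_completionI_sets)
  have h'0: "h' x = 0" if "x \<notin> C" for x
    using hl[of x] h0[OF that] by (simp add: LIMSEQ_const_iff)
  have int: "integrable (lebesgue_on C) f" using f C unfolding locally_integrable_def by auto
  have m: "h n \<in> borel_measurable (lebesgue_on C)" for n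
    by (rule continuous_imp_measurable_on_sets_lebesgue[OF continuous_on_subset[OF hc] Cs]) auto
  have m': "h' \<in> borel_measurable (lebesgue_on C)"
    by (rule borel_measurable_LIMSEQ_real[OF _ m]) (use hl in auto)
  have "(\<lambda>n. LINT x|lebesgue_on C. f x * h n x) \<longlonglongrightarrow> (LINT x|lebesgue_on C. f x * h' x)"
  proof (rule integral_dominated_convergence[where w = "\<lambda>x. M * \<bar>f x\<bar>"])
    show "(\<lambda>x. f x * h' x) \<in> borel_measurable (lebesgue_on C)"
      "\<And>n. (\<lambda>x. f x * h n x) \<in> borel_measurable (lebesgue_on C)"
      using borel_measurable_integrable[OF int] m m' by measurable
    show "AE x in lebesgue_on C. (\<lambda>n. f x * h n x) \<longlonglongrightarrow> f x * h' x"
      by (intro AE_I2 tendsto_mult_left hl)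
    show "AE x in lebesgue_on C. norm (f x * h n x) \<le> M * \<bar>f x\<bar>" for n
      by (intro AE_I2) (auto simp: abs_mult mult.commute[of M] intro!: mult_left_mono hb)
  qed (use int in auto)
  moreover have "(LINT x|lebesgue_on \<Omega>. f x * k x) = (LINT x|lebesgue_on C. f x * k x)"
    if "\<And>x. x \<notin> C \<Longrightarrow> k x = 0" for k :: "'a \<Rightarrow> real"
    using that by (intro integral_lebesgue_on_vanish C Cs \<Omega>) auto
  ultimately show ?thesis using h0 h'0 by simp
qed

lemma locally_integrable_inner:
  "locally_integrable \<Omega> G \<Longrightarrow> locally_integrable \<Omega> (\<lambda>x. G x \<bullet> (i::'a::euclidean_space))"
  unfolding locally_integrable_def by (auto intro: integrable_inner_left)

text \<open>Testing with smooth approximations of \<open>\<integral>\<^sub>0\<^sup>l \<one>\<^bsub>box a b\<^esub>(x - r i) dr\<close>.\<close>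

lemma weak_gradient_box_difference:
  fixes f :: "'a::euclidean_space \<Rightarrow> real"
  assumes wg: "weak_gradient \<Omega> f G" and \<Omega>: "\<Omega> \<in> sets lebesgue" and i: "i \<in> Basis" and l: "0 \<le> l"
    and sub: "cbox a (b + l *\<^sub>R i) \<subseteq> \<Omega>"
  shows "(LINT x|lebesgue_on \<Omega>. f x * (indicator (box a b) (x - l *\<^sub>R i) - indicator (box a b) x)) =
    (LINT x|lebesgue_on \<Omega>. (G x \<bullet> i) * integral {0..l} (\<lambda>r. indicator (box a b) (x - r *\<^sub>R i)))"
proof -
  let ?C = "cbox a (b + l *\<^sub>R i)"
  define p where "p n = bump n (a \<bullet> i) (b \<bullet> i)" for n
  have "\<exists>F. \<forall>x. -\<infinity> < ereal x \<longrightarrow> ereal x < \<infinity> \<longrightarrow> (F has_vector_derivative p n x) (at x)" for n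
    by (rule einterval_antiderivative)
       (use continuous_on_smooth[OF smooth_bump, of UNIV] in \<open>auto simp: p_def continuous_on_eq_continuous_at\<close>)
  then have "\<exists>F. \<forall>x. (F has_real_derivative p n x) (at x)" for n
    by (simp add: has_real_derivative_iff_has_vector_derivative)
  then obtain P where P: "\<And>n x. (P n has_real_derivative p n x) (at x)" by metis
  have sP: "smooth (P n)" for n
    by (rule smooth_antideriv[OF smooth_bump P[unfolded p_def]])
  \<comment> \<open>\<open>Q n\<close> has two readings: it is the integral of
    \<open>p n (s - r)\<close> over r in [0,l], and its derivative is
    \<open>p n s - p n (s - l)\<close>. Used as the i-th factor of a product of bumps, it gives a
    test function whose i-th derivative is a difference of two shifted box bumps.\<close>
  define Q where "Q n s = P n s - P n (s - l)" for n s
  have sQ: "smooth (Q n)" for n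
    using smooth_diff[OF sP[of n] smooth_affine[OF sP[of n], of 1 1 "-l"]] unfolding Q_def[abs_def] by simp
  have Q': "(Q n has_real_derivative (p n s - p n (s - l))) (at s)" for n s
  proof -
    have "((\<lambda>s. P n (s - l)) has_real_derivative p n (s - l) * 1) (at s)"
      by (rule DERIV_chain2[OF P]) (auto intro!: derivative_eq_intros)
    then show ?thesis unfolding Q_def[abs_def] using DERIV_diff[OF P[of n s]] by fastforce
  qed
  have Qint: "((\<lambda>r. p n (s - r)) has_integral Q n s) {0..l}" for n s
  proof -
    have "((\<lambda>r. - P n (s - r)) has_vector_derivative p n (s - r)) (at r within {0..l})" for r
    proof -
      have "((\<lambda>r. P n (s - r)) has_real_derivative p n (s - r) * (-1)) (at r within {0..l})"
        by (rule DERIV_chain2[OF P]) (auto intro!: derivative_eq_intros)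
      from DERIV_minus[OF this] show ?thesis
        by (simp add: has_real_derivative_iff_has_vector_derivative)
    qed
    from fundamental_theorem_of_calculus[OF l this] show ?thesis by (simp add: Q_def)
  qed
  define q where "q n = (\<lambda>j. bump n (a \<bullet> j) (b \<bullet> j))(i := Q n)" for n
  define \<phi> where "\<phi> n x = (\<Prod>j\<in>Basis. q n j (x \<bullet> j))" for n x
  have Ck: "Ck k (\<phi> n)" for n k
    unfolding \<phi>_def by (rule Ck_coordinate_prod) (auto simp: q_def sQ smooth_bump)
  have shift: "box_bump n a b (x - r *\<^sub>R i) =
      p n (x \<bullet> i - r) * (\<Prod>j\<in>Basis - {i}. bump n (a \<bullet> j) (b \<bullet> j) (x \<bullet> j))" for n x r
  proof -
    have "(x - r *\<^sub>R i) \<bullet> j = x \<bullet> j" if "j \<in> Basis - {i}" for j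
      using that i by (auto simp: inner_diff_left inner_Basis)
    note * = this
    show ?thesis unfolding box_bump_def
      by (subst prod.remove[of Basis i]) (auto simp: i p_def * inner_diff_left[of x _ i] intro!: prod.cong)
  qed
  have \<phi>_eq: "\<phi> n x = Q n (x \<bullet> i) * (\<Prod>j\<in>Basis - {i}. bump n (a \<bullet> j) (b \<bullet> j) (x \<bullet> j))" for n x
    unfolding \<phi>_def by (subst prod.remove[of Basis i]) (auto simp: i q_def intro!: prod.cong)
  have \<phi>_int: "((\<lambda>r. box_bump n a b (x - r *\<^sub>R i)) has_integral \<phi> n x) {0..l}" for n x
    unfolding shift \<phi>_eq by (intro has_integral_mult_left Qint)
  have out: "x - r *\<^sub>R i \<notin> box a b" if "x \<notin> ?C" "r \<in> {0..l}" for x r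
  proof
    assume *: "x - r *\<^sub>R i \<in> box a b"
    have "a \<bullet> j \<le> x \<bullet> j \<and> x \<bullet> j \<le> (b + l *\<^sub>R i) \<bullet> j" if j: "j \<in> Basis" for j
      using * that \<open>r \<in> _\<close> i by (auto simp: mem_box inner_diff_left inner_add_left inner_Basis
        split: if_splits dest!: bspec[of _ _ j])
    then show False using \<open>x \<notin> ?C\<close> by (auto simp: mem_box)
  qed
  have \<phi>0: "\<phi> n x = 0" if "x \<notin> ?C" for n x
    using has_integral_unique[OF \<phi>_int[of n x] has_integral_is_0]
    by (auto simp: box_bump_eq_0 out that)
  have \<phi>b: "\<bar>\<phi> n x\<bar> \<le> l" for n x
  proof -
    have "0 \<le> \<phi> n x" by (rule has_integral_nonneg[OF \<phi>_int]) (auto simp: box_bump_bounds)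
    moreover have "\<phi> n x \<le> l * 1"
      using has_integral_le[OF \<phi>_int has_integral_const_real[of 1 0 l], of n x] l
      by (simp add: box_bump_bounds)
    ultimately show ?thesis by simp
  qed
  have \<phi>l: "(\<lambda>n. \<phi> n x) \<longlonglongrightarrow> integral {0..l} (\<lambda>r. indicator (box a b) (x - r *\<^sub>R i))" for x
  proof -
    have "(\<lambda>n. integral {0..l} (\<lambda>r. box_bump n a b (x - r *\<^sub>R i)))
        \<longlonglongrightarrow> integral {0..l} (\<lambda>r. indicator (box a b) (x - r *\<^sub>R i))"
      by (rule dominated_convergence[where h = "\<lambda>_. 1"])
         (use \<phi>_int box_bump_tendsto in \<open>auto simp: has_integral_iff box_bump_bounds\<close>)
    then show ?thesis using \<phi>_int by (simp add: has_integral_iff)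
  qed
  have D: "frechet_derivative (\<phi> n) (at x) i = box_bump n a b x - box_bump n a b (x - l *\<^sub>R i)" for n x
  proof -
    define q' where "q' j = (if j = i then p n (x \<bullet> i) - p n (x \<bullet> i - l) else deriv (q n j) (x \<bullet> j))" for j
    have "(q n j has_real_derivative q' j) (at (x \<bullet> j))" if "j \<in> Basis" for j
    proof (cases "j = i")
      case False
      obtain d where "\<And>y. (bump n (a \<bullet> j) (b \<bullet> j) has_real_derivative d y) (at y)"
        using smooth_derivE[OF smooth_bump] by blast
      then have "(bump n (a \<bullet> j) (b \<bullet> j) has_real_derivative deriv (bump n (a \<bullet> j) (b \<bullet> j)) (x \<bullet> j)) (at (x \<bullet> j))"
        by (metis DERIV_imp_deriv)
      then show ?thesis using False by (simp add: q'_def q_def)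
    qed (use Q' in \<open>auto simp: q'_def q_def\<close>)
    then have "frechet_derivative (\<phi> n) (at x) i = q' i * (\<Prod>k\<in>Basis - {i}. q n k (x \<bullet> k))"
      unfolding \<phi>_def using i by (intro frechet_derivative_coordinate_prod) auto
    also have "(\<Prod>k\<in>Basis - {i}. q n k (x \<bullet> k)) =
       (\<Prod>j\<in>Basis - {i}. bump n (a \<bullet> j) (b \<bullet> j) (x \<bullet> j))"
      by (auto simp: q_def intro!: prod.cong)
    finally show ?thesis using shift[of n x 0] shift[of n x l] by (simp add: q'_def left_diff_distrib)
  qed
  have eq: "(LINT x|lebesgue_on \<Omega>. f x * (box_bump n a b x - box_bump n a b (x - l *\<^sub>R i))) =
      - (LINT x|lebesgue_on \<Omega>. (G x \<bullet> i) * \<phi> n x)" for n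
  proof -
    have "test_function \<Omega> (\<phi> n)"
      by (rule test_functionI[OF Ck \<phi>0 _ sub]) auto
    then show ?thesis using wg i unfolding weak_gradient_def D[symmetric] by blast
  qed
  have cont: "continuous_on UNIV (box_bump n a b)" for n :: nat using Ck_box_bump[of 0 n a b] by simp
  have 1: "(\<lambda>n. LINT x|lebesgue_on \<Omega>. f x * (box_bump n a b x - box_bump n a b (x - l *\<^sub>R i))) \<longlonglongrightarrow>
      (LINT x|lebesgue_on \<Omega>. f x * (indicator (box a b) x - indicator (box a b) (x - l *\<^sub>R i)))"
  proof (rule tendsto_integral_times_bounded[where C = ?C and M = 1])
    show "continuous_on UNIV (\<lambda>x. box_bump n a b x - box_bump n a b (x - l *\<^sub>R i))" for n
      by (intro continuous_on_diff cont continuous_on_compose2[OF cont]) (auto intro!: continuous_intros)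
    show "\<bar>box_bump n a b x - box_bump n a b (x - l *\<^sub>R i)\<bar> \<le> 1" for n x
      using box_bump_bounds[of n a b x] box_bump_bounds[of n a b "x - l *\<^sub>R i"] by linarith
    show "box_bump n a b x - box_bump n a b (x - l *\<^sub>R i) = 0" if "x \<notin> ?C" for n x
      using out[OF that, of 0] out[OF that, of l] l by (simp add: box_bump_eq_0)
  qed (use wg \<Omega> sub in \<open>auto simp: weak_gradient_def intro!: tendsto_diff box_bump_tendsto\<close>)
  have 2: "(\<lambda>n. LINT x|lebesgue_on \<Omega>. (G x \<bullet> i) * \<phi> n x) \<longlonglongrightarrow>
     (LINT x|lebesgue_on \<Omega>. (G x \<bullet> i) * integral {0..l} (\<lambda>r. indicator (box a b) (x - r *\<^sub>R i)))"
    by (rule tendsto_integral_times_bounded[where C = ?C and M = l])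
       (use wg \<Omega> sub \<phi>0 \<phi>b \<phi>l Ck[of 0] in
         \<open>auto simp: weak_gradient_def intro: locally_integrable_inner\<close>)
  have "(LINT x|lebesgue_on \<Omega>. f x * (indicator (box a b) x - indicator (box a b) (x - l *\<^sub>R i))) =
    - (LINT x|lebesgue_on \<Omega>. (G x \<bullet> i) * integral {0..l} (\<lambda>r. indicator (box a b) (x - r *\<^sub>R i)))"
    using LIMSEQ_unique[OF 1[unfolded eq] tendsto_minus[OF 2]] .
  moreover have "f x * (indicator (box a b) (x - l *\<^sub>R i) - indicator (box a b) x) =
      - (f x * (indicator (box a b) x - indicator (box a b) (x - l *\<^sub>R i)))" for x
    by (simp add: algebra_simps)
  ultimately show ?thesis by simp
qed

text \<open>Lebesgue differentiation along boxes with lower corner x: almost every value of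
  \<open>f\<close> is a limit of averages over such boxes, and the averages are 0 as soon as the box
  fits into \<open>U\<close>.\<close>

lemma negligible_if_box_integrals_0:
  fixes f :: "'a::euclidean_space \<Rightarrow> real"
  assumes f: "\<And>a b. f integrable_on cbox a b" and "open U"
    and 0: "\<And>a b. cbox a b \<subseteq> U \<Longrightarrow> integral (cbox a b) f = 0"
  shows "negligible {x \<in> U. f x \<noteq> 0}"
proof -
  obtain N where N: "negligible N"
    "\<And>x e. x \<notin> N \<Longrightarrow> 0 < e \<Longrightarrow> \<exists>d>0. \<forall>h. 0 < h \<and> h < d \<longrightarrow>
       norm (integral (cbox x (x + h *\<^sub>R One)) f /\<^sub>R h ^ DIM('a) - f x) < e"
    using integrable_ccontinuous_explicit[of f] f by metis
  have "f x = 0" if x: "x \<in> U" "x \<notin> N" for x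
  proof (rule ccontr)
    assume "f x \<noteq> 0"
    then obtain d where d: "d > 0" "\<And>h. 0 < h \<Longrightarrow> h < d \<Longrightarrow>
       norm (integral (cbox x (x + h *\<^sub>R One)) f /\<^sub>R h ^ DIM('a) - f x) < \<bar>f x\<bar>"
      using N(2)[OF x(2), of "\<bar>f x\<bar>"] by auto
    obtain r where r: "r > 0" "cball x r \<subseteq> U" using x \<open>open U\<close> open_contains_cball by blast
    \<comment> \<open>Halving keeps \<open>h\<close> strictly below \<open>d\<close>. Division by
      the dimension puts the box into the ball, because the Euclidean norm is at most the sum of the
      moduli of the coordinates.\<close>
    define h where "h = min (d / 2) (r / DIM('a))"
    have h: "0 < h" "h < d" "h * DIM('a) \<le> r" using d r by (auto simp: h_def min_def field_simps)
    have "cbox x (x + h *\<^sub>R One) \<subseteq> cball x r"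
    proof
      fix y assume y: "y \<in> cbox x (x + h *\<^sub>R One)"
      have "norm (y - x) \<le> (\<Sum>j\<in>Basis. \<bar>(y - x) \<bullet> j\<bar>)" by (rule norm_le_l1)
      also have "\<dots> \<le> (\<Sum>j\<in>(Basis::'a set). h)"
        using y by (intro sum_mono) (auto simp: mem_box inner_diff_left inner_add_left abs_if algebra_simps)
      finally show "y \<in> cball x r" using h by (simp add: dist_norm norm_minus_commute mult.commute)
    qed
    then have "integral (cbox x (x + h *\<^sub>R One)) f = 0" using 0 r by auto
    then show False using d(2)[OF h(1,2)] by simp
  qed
  then have "{x \<in> U. f x \<noteq> 0} \<subseteq> N" by auto
  then show ?thesis using N(1) negligible_subset by blast
qed

lemma AE_lebesgue_on_iff_negligible:
  "S \<in> sets lebesgue \<Longrightarrow> (AE x in lebesgue_on S. P x) \<longleftrightarrow> negligible {x \<in> S. \<not> P x}"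
  by (simp add: AE_restrict_space_iff completion.AE_iff_null_sets negligible_iff_null_sets)

lemma integrable_lebesgue_on_subset:
  fixes f :: "'a::euclidean_space \<Rightarrow> 'b::{banach, second_countable_topology}"
  assumes "integrable (lebesgue_on S) f" "T \<subseteq> S" "S \<in> sets lebesgue" "T \<in> sets lebesgue"
  shows "integrable (lebesgue_on T) f"
proof -
  have "integrable lebesgue (\<lambda>x. indicator T x *\<^sub>R (indicator S x *\<^sub>R f x))"
    by (rule integrable_mult_indicator) (use assms in \<open>simp_all add: integrable_restrict_space\<close>)
  also have "(\<lambda>x. indicator T x *\<^sub>R (indicator S x *\<^sub>R f x)) = (\<lambda>x. indicator T x *\<^sub>R f x)"
    using assms(2) by (auto simp: indicator_def fun_eq_iff)
  finally show ?thesis using assms by (simp add: integrable_restrict_space)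
qed

text \<open>The differentiation argument wants a function integrable over every box. It is therefore
  applied to \<open>f\<close> cut off outside one closed box in \<Omega> at a time; countably many
  such boxes fill \<Omega>, and their faces are null sets.\<close>

lemma AE_0_if_box_integrals_0:
  fixes f :: "'a::euclidean_space \<Rightarrow> real"
  assumes f: "locally_integrable \<Omega> f" and "open \<Omega>"
    and 0: "\<And>a b. cbox a b \<subseteq> \<Omega> \<Longrightarrow> (LINT x|lebesgue_on \<Omega>. f x * indicator (box a b) x) = 0"
  shows "AE x in lebesgue_on \<Omega>. f x = 0"
proof -
  have neg: "negligible {x \<in> box c d. f x \<noteq> 0}" if cd: "cbox c d \<subseteq> \<Omega>" for c d
  proof -
    let ?g = "\<lambda>x. if x \<in> cbox c d then f x else 0"
    have fcd: "f integrable_on cbox c d"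
      using f cd by (auto simp: locally_integrable_def intro: integrable_on_lebesgue_on)
    have gint: "?g integrable_on cbox a b" for a b
      using integrable_restrict_Int[of "cbox c d" f "cbox a b"] 
      by (metis (no_types, lifting) Int_interval inf_commute integrable_on_subcbox inf_le1 fcd)
    have "integral (cbox a b) ?g = 0" if "cbox a b \<subseteq> box c d" for a b
    proof -
      have sub: "cbox a b \<subseteq> cbox c d" using that box_subset_cbox by blast
      have "integral (cbox a b) ?g = integral (cbox a b) f"
        by (rule integral_cong) (use sub in auto)
      also have "\<dots> = integral (box a b) f" by (rule integral_open_interval[symmetric])
      also have "\<dots> = (LINT x|lebesgue_on (box a b). f x)"
      proof (rule lebesgue_integral_eq_integral[symmetric])
        have "integrable (lebesgue_on (cbox c d)) f" using f cd by (auto simp: locally_integrable_def)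
        then show "integrable (lebesgue_on (box a b)) f"
          using sub box_subset_cbox by (intro integrable_lebesgue_on_subset[of "cbox c d" f "box a b"]) auto
      qed auto
      also have "\<dots> = (LINT x|lebesgue_on (box a b). f x * indicator (box a b) x)"
        by (intro Bochner_Integration.integral_cong) auto
      also have "\<dots> = (LINT x|lebesgue_on \<Omega>. f x * indicator (box a b) x)"
        by (rule integral_lebesgue_on_vanish[symmetric])
           (use sub cd box_subset_cbox[of a b] \<open>open \<Omega>\<close> in \<open>auto simp: borel_open sets_completionI_sets\<close>)
      also have "\<dots> = 0" using 0 sub cd by auto
      finally show ?thesis .
    qed
    then have "negligible {x \<in> box c d. ?g x \<noteq> 0}"
      using gint by (intro negligible_if_box_integrals_0) auto
    then show ?thesis by (rule negligible_subset) (use box_subset_cbox in auto)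
  qed
  obtain D where D: "countable D" "D \<subseteq> Pow \<Omega>" "\<And>X. X \<in> D \<Longrightarrow> \<exists>a b. X = cbox a b" "\<Union>D = \<Omega>"
    using open_countable_Union_open_cbox[OF \<open>open \<Omega>\<close>] by metis
  have "negligible (\<Union>X\<in>D. {x \<in> X. f x \<noteq> 0})"
  proof (rule negligible_countable_Union)
    show "countable ((\<lambda>X. {x \<in> X. f x \<noteq> 0}) ` D)" using D by auto
    fix Y assume "Y \<in> (\<lambda>X. {x \<in> X. f x \<noteq> 0}) ` D"
    then obtain X where X: "X \<in> D" "Y = {x \<in> X. f x \<noteq> 0}" by auto
    obtain a b where ab: "X = cbox a b" using D(3)[OF X(1)] by auto
    have "negligible ({x \<in> box a b. f x \<noteq> 0} \<union> (cbox a b - box a b))"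
      using neg[of a b] X ab D(2) by (auto simp: negligible_Un_eq negligible_frontier_interval)
    then show "negligible Y" by (rule negligible_subset) (auto simp: X ab)
  qed
  also have "(\<Union>X\<in>D. {x \<in> X. f x \<noteq> 0}) = {x \<in> \<Omega>. f x \<noteq> 0}" using D(4) by auto
  finally show ?thesis using \<open>open \<Omega>\<close>
    by (subst AE_lebesgue_on_iff_negligible) (auto simp: borel_open sets_completionI_sets)
qed

text \<open>Testing with box bumps and letting n tend to infinity makes the two gradients agree on
  all boxes. As \<open>wgrad\<close> is an arbitrary choice, this is what allows a concrete gradient
  to be substituted for it under integrals. Agreement of \<open>f\<close> and \<open>f'\<close> is
  asked on \<Omega> only, because convolutions will be compared there.\<close>

lemma weak_gradient_unique:
  assumes "weak_gradient \<Omega> f G" "weak_gradient \<Omega> f' G'" and ff': "\<And>x. x \<in> \<Omega> \<Longrightarrow> f x = f' x"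
    and "open \<Omega>"
  shows "AE x in lebesgue_on \<Omega>. G x = G' x"
proof -
  have \<Omega>: "\<Omega> \<in> sets lebesgue" using \<open>open \<Omega>\<close> by (auto simp: borel_open sets_completionI_sets)
  have "AE x in lebesgue_on \<Omega>. G x \<bullet> i - G' x \<bullet> i = 0" if i: "i \<in> Basis" for i
  proof (rule AE_0_if_box_integrals_0[OF _ \<open>open \<Omega>\<close>])
    have l: "locally_integrable \<Omega> (\<lambda>x. G x \<bullet> i)" "locally_integrable \<Omega> (\<lambda>x. G' x \<bullet> i)"
      using assms by (auto simp: weak_gradient_def intro: locally_integrable_inner)
    then show li: "locally_integrable \<Omega> (\<lambda>x. G x \<bullet> i - G' x \<bullet> i)"
      unfolding locally_integrable_def by auto
    fix a b :: 'a assume ab: "cbox a b \<subseteq> \<Omega>"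
    have lim: "(\<lambda>n. LINT x|lebesgue_on \<Omega>. h x * box_bump n a b x) \<longlonglongrightarrow>
        (LINT x|lebesgue_on \<Omega>. h x * indicator (box a b) x)" if "locally_integrable \<Omega> h" for h
      by (rule tendsto_integral_times_bounded[where C = "cbox a b" and M = 1])
         (use that \<Omega> ab box_subset_cbox[of a b] box_bump_tendsto Ck_box_bump[of 0] in
           \<open>auto intro!: box_bump_eq_0 simp: box_bump_bounds\<close>)
    have "(LINT x|lebesgue_on \<Omega>. (G x \<bullet> i) * box_bump n a b x) =
          (LINT x|lebesgue_on \<Omega>. (G' x \<bullet> i) * box_bump n a b x)" for n
    proof -
      note t = test_function_box_bump[OF ab, of n]
      have "(LINT x|lebesgue_on \<Omega>. f x * frechet_derivative (box_bump n a b) (at x) i) =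
          (LINT x|lebesgue_on \<Omega>. f' x * frechet_derivative (box_bump n a b) (at x) i)"
        by (intro Bochner_Integration.integral_cong) (auto simp: ff')
      moreover have "(LINT x|lebesgue_on \<Omega>. f x * frechet_derivative (box_bump n a b) (at x) i) =
          - (LINT x|lebesgue_on \<Omega>. (G x \<bullet> i) * box_bump n a b x)"
        using assms(1) t i unfolding weak_gradient_def by blast
      moreover have "(LINT x|lebesgue_on \<Omega>. f' x * frechet_derivative (box_bump n a b) (at x) i) =
          - (LINT x|lebesgue_on \<Omega>. (G' x \<bullet> i) * box_bump n a b x)"
        using assms(2) t i unfolding weak_gradient_def by blast
      ultimately show ?thesis by simp
    qed
    then have eq: "(LINT x|lebesgue_on \<Omega>. (G x \<bullet> i) * indicator (box a b) x) =
          (LINT x|lebesgue_on \<Omega>. (G' x \<bullet> i) * indicator (box a b) x)"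
      using LIMSEQ_unique lim[OF l(1)] lim[OF l(2)] by auto
    have int: "integrable (lebesgue_on \<Omega>) (\<lambda>x. h x * indicator (box a b) x)"
      if "locally_integrable \<Omega> h" for h :: "'a \<Rightarrow> real"
    proof -
      have "integrable (lebesgue_on (cbox a b)) h" using that ab by (auto simp: locally_integrable_def)
      then have "integrable (lebesgue_on (box a b)) h"
        using box_subset_cbox by (intro integrable_lebesgue_on_subset[of "cbox a b" h "box a b"]) auto
      then have "integrable lebesgue (\<lambda>x. indicator (box a b) x *\<^sub>R h x)"
        by (simp add: integrable_restrict_space)
      also have "(\<lambda>x. indicator (box a b) x *\<^sub>R h x) = (\<lambda>x. indicator \<Omega> x *\<^sub>R (h x * indicator (box a b) x))"
        using ab box_subset_cbox[of a b] by (auto simp: indicator_def fun_eq_iff)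
      finally show ?thesis using \<Omega> by (simp add: integrable_restrict_space)
    qed
    show "(LINT x|lebesgue_on \<Omega>. (G x \<bullet> i - G' x \<bullet> i) * indicator (box a b) x) = 0"
      using int[OF l(1)] int[OF l(2)] eq by (simp add: left_diff_distrib)
  qed
  then have "AE x in lebesgue_on \<Omega>. \<forall>i\<in>Basis. G x \<bullet> i = G' x \<bullet> i"
    by (simp add: AE_finite_all)
  then show ?thesis by eventually_elim (simp add: euclidean_eq_iff[of "G _"])
qed

section \<open>The spaces \<open>L\<^sup>2\<close> and \<open>H\<^sup>1\<close>\<close>

lemma sets_lebesgue_open: "open (\<Omega> :: 'a::euclidean_space set) \<Longrightarrow> \<Omega> \<in> sets lebesgue"
  by (auto simp: borel_open sets_completionI_sets)

lemma Lp2_iff: "f \<in> Lp 2 \<Omega> \<longleftrightarrow>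
    f \<in> borel_measurable (lebesgue_on \<Omega>) \<and> integrable (lebesgue_on \<Omega>) (\<lambda>x. (norm (f x))\<^sup>2)"
proof -
  have "norm (f x) powr 2 = (norm (f x))\<^sup>2" for x
    by (cases "f x = 0") (auto simp: powr_numeral)
  then show ?thesis by (simp add: Lp_def)
qed

lemma Lp2_measurable: "f \<in> Lp 2 \<Omega> \<Longrightarrow> f \<in> borel_measurable (lebesgue_on \<Omega>)"
  by (simp add: Lp2_iff)

lemma Lp2_norm_eq: "Lp_norm 2 \<Omega> f = sqrt (LINT x|lebesgue_on \<Omega>. (norm (f x))\<^sup>2)"
proof -
  have "norm (f x) powr 2 = (norm (f x))\<^sup>2" for x
    by (cases "f x = 0") (auto simp: powr_numeral)
  then show ?thesis by (simp add: Lp_norm_def powr_half_sqrt)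
qed

lemma Lp2_norm_nonneg [simp]: "0 \<le> Lp_norm 2 \<Omega> f"
  by (simp add: Lp2_norm_eq)

lemma Lp2_norm_sq: "(Lp_norm 2 \<Omega> f)\<^sup>2 = (LINT x|lebesgue_on \<Omega>. (norm (f x))\<^sup>2)"
  by (simp add: Lp2_norm_eq)

lemma L2_inner_self: "L2_inner \<Omega> f f = (Lp_norm 2 \<Omega> f)\<^sup>2"
  by (simp add: Lp2_norm_sq L2_inner_def power2_norm_eq_inner)

text \<open>Lebesgue measure is complete, so changing values on a null set preserves measurability.
  In this way \<open>wgrad\<close> inherits measurability from any concrete weak gradient.\<close>

lemma borel_measurable_lebesgue_on_cong_AE:
  fixes f h :: "'a::euclidean_space \<Rightarrow> 'b::euclidean_space"
  assumes \<Omega>: "\<Omega> \<in> sets lebesgue" and f: "f \<in> borel_measurable (lebesgue_on \<Omega>)"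
    and eq: "AE x in lebesgue_on \<Omega>. f x = h x"
  shows "h \<in> borel_measurable (lebesgue_on \<Omega>)"
proof -
  have "(\<lambda>x. if x \<in> \<Omega> then f x else 0) \<in> borel_measurable lebesgue"
    using f \<Omega> by (rule borel_measurable_if_I)
  moreover have "AE x in lebesgue. (if x \<in> \<Omega> then f x else 0) = (if x \<in> \<Omega> then h x else 0)"
    using eq \<Omega> by (auto simp: AE_restrict_space_iff elim!: eventually_mono)
  ultimately have "(\<lambda>x. if x \<in> \<Omega> then h x else 0) \<in> borel_measurable lebesgue"
    by (rule borel_measurable_AE)
  then show ?thesis by (rule borel_measurable_if_D)
qed

lemma Lp2_norm_cong_AE:
  fixes f h :: "'a::euclidean_space \<Rightarrow> 'b::euclidean_space"
  assumes \<Omega>: "\<Omega> \<in> sets lebesgue" and f: "f \<in> borel_measurable (lebesgue_on \<Omega>)"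
    and eq: "AE x in lebesgue_on \<Omega>. f x = h x"
  shows "Lp_norm 2 \<Omega> f = Lp_norm 2 \<Omega> h"
proof -
  note [measurable] = f borel_measurable_lebesgue_on_cong_AE[OF assms]
  show ?thesis unfolding Lp2_norm_eq
    by (intro arg_cong[where f = sqrt] integral_cong_AE) (use eq in \<open>auto\<close>)
qed

lemma integrable_L2_inner:
  fixes f h :: "'a::euclidean_space \<Rightarrow> 'b::euclidean_space"
  assumes "f \<in> Lp 2 \<Omega>" "h \<in> Lp 2 \<Omega>"
  shows "integrable (lebesgue_on \<Omega>) (\<lambda>x. f x \<bullet> h x)"
proof (rule Bochner_Integration.integrable_bound)
  show "integrable (lebesgue_on \<Omega>) (\<lambda>x. (norm (f x))\<^sup>2 + (norm (h x))\<^sup>2)"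
    using assms by (auto simp: Lp2_iff)
  show "(\<lambda>x. f x \<bullet> h x) \<in> borel_measurable (lebesgue_on \<Omega>)"
    using assms[THEN Lp2_measurable] by measurable
  have "\<bar>a \<bullet> b\<bar> \<le> (norm a)\<^sup>2 + (norm b)\<^sup>2" for a b :: 'b
  proof -
    have "\<bar>a \<bullet> b\<bar> \<le> norm a * norm b" by (rule Cauchy_Schwarz_ineq2)
    also have "\<dots> \<le> (norm a)\<^sup>2 + (norm b)\<^sup>2"
      using sum_squares_bound[of "norm a" "norm b"] mult_nonneg_nonneg[of "norm a" "norm b"]
        norm_ge_zero[of a] norm_ge_zero[of b] by linarith
    finally show ?thesis .
  qed
  then show "AE x in lebesgue_on \<Omega>. norm (f x \<bullet> h x) \<le> norm ((norm (f x))\<^sup>2 + (norm (h x))\<^sup>2)"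
    by auto
qed

lemma Lp2_add:
  fixes f h :: "'a::euclidean_space \<Rightarrow> 'b::euclidean_space"
  assumes "f \<in> Lp 2 \<Omega>" "h \<in> Lp 2 \<Omega>"
  shows "(\<lambda>x. f x + h x) \<in> Lp 2 \<Omega>"
proof -
  have "(norm (f x + h x))\<^sup>2 = (norm (f x))\<^sup>2 + (norm (h x))\<^sup>2 + 2 * (f x \<bullet> h x)" for x
    by (simp add: power2_norm_eq_inner inner_simps inner_commute)
  then show ?thesis using assms integrable_L2_inner[OF assms] by (auto simp: Lp2_iff)
qed

lemma Lp2_scaleR:
  fixes f :: "'a::euclidean_space \<Rightarrow> 'b::euclidean_space"
  assumes "f \<in> Lp 2 \<Omega>"
  shows "(\<lambda>x. c *\<^sub>R f x) \<in> Lp 2 \<Omega>"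
  using assms by (auto simp: Lp2_iff power_mult_distrib)

lemma Lp2_diff:
  fixes f h :: "'a::euclidean_space \<Rightarrow> 'b::euclidean_space"
  assumes "f \<in> Lp 2 \<Omega>" "h \<in> Lp 2 \<Omega>"
  shows "(\<lambda>x. f x - h x) \<in> Lp 2 \<Omega>"
  using Lp2_add[OF assms(1) Lp2_scaleR[OF assms(2), of "-1"]] by simp

lemma Lp2_cmult: "f \<in> Lp 2 \<Omega> \<Longrightarrow> (\<lambda>x. c * f x :: real) \<in> Lp 2 \<Omega>"
  using Lp2_scaleR[of f \<Omega> c] by simp

lemma Lp2_norm_scaleR: "Lp_norm 2 \<Omega> (\<lambda>x. c *\<^sub>R f x) = \<bar>c\<bar> * Lp_norm 2 \<Omega> f"
  by (simp add: Lp2_norm_eq power_mult_distrib real_sqrt_mult)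

text \<open>The weighted inequality 2ab <= s a^2 + b^2/s is integrated with \<open>s\<close> close
  to the optimal ratio of the two norms. The shift by \<delta> covers vanishing norms and costs only
  \<delta> times the sum of the norms.\<close>

lemma L2_Cauchy_Schwarz:
  fixes f h :: "'a::euclidean_space \<Rightarrow> 'b::euclidean_space"
  assumes "f \<in> Lp 2 \<Omega>" "h \<in> Lp 2 \<Omega>"
  shows "\<bar>L2_inner \<Omega> f h\<bar> \<le> Lp_norm 2 \<Omega> f * Lp_norm 2 \<Omega> h"
proof (rule field_le_epsilon)
  fix e :: real assume "e > 0"
  let ?a = "Lp_norm 2 \<Omega> f" and ?b = "Lp_norm 2 \<Omega> h"
  define \<delta> where "\<delta> = e / (?a + ?b + 1)"
  have ab: "?a \<ge> 0" "?b \<ge> 0" by auto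
  have "\<delta> > 0" unfolding \<delta>_def using \<open>e > 0\<close> ab by (intro divide_pos_pos add_nonneg_pos add_nonneg_nonneg) auto
  have p: "?a + \<delta> > 0" "?b + \<delta> > 0" "?a + ?b + 1 > 0"
    using ab \<open>\<delta> > 0\<close> by (auto intro!: add_nonneg_pos)
  define s where "s = (?b + \<delta>) / (?a + \<delta>)"
  have "s > 0" unfolding s_def using ab \<open>\<delta> > 0\<close> by (intro divide_pos_pos add_nonneg_pos) auto
  have i: "integrable (lebesgue_on \<Omega>) (\<lambda>x. s * (norm (f x))\<^sup>2 + (norm (h x))\<^sup>2 / s)"
    using assms by (auto simp: Lp2_iff)
  have pw: "\<bar>2 * (u \<bullet> v)\<bar> \<le> s * (norm u)\<^sup>2 + (norm v)\<^sup>2 / s" for u v :: 'b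
  proof -
    have "0 \<le> (sqrt s * norm u - norm v / sqrt s)\<^sup>2" by simp
    also have "\<dots> = s * (norm u)\<^sup>2 + (norm v)\<^sup>2 / s - 2 * (norm u * norm v)"
      using \<open>s > 0\<close> by (simp add: power2_diff power_mult_distrib power_divide)
    finally show ?thesis using Cauchy_Schwarz_ineq2[of u v] by (auto simp: abs_mult)
  qed
  have "\<bar>2 * L2_inner \<Omega> f h\<bar> = \<bar>LINT x|lebesgue_on \<Omega>. 2 * (f x \<bullet> h x)\<bar>"
    by (simp add: L2_inner_def)
  also have "\<dots> \<le> (LINT x|lebesgue_on \<Omega>. s * (norm (f x))\<^sup>2 + (norm (h x))\<^sup>2 / s)"
    using integrable_L2_inner[OF assms] pw
    by (intro order_trans[OF integral_abs_bound] integral_mono_AE[OF _ i]) auto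
  also have "\<dots> = s * ?a\<^sup>2 + ?b\<^sup>2 / s"
    using assms by (simp add: Lp2_norm_sq Lp2_iff)
  also have "s * ?a\<^sup>2 \<le> (?b + \<delta>) * ?a"
  proof -
    have "s * ?a\<^sup>2 = (?b + \<delta>) * ?a * (?a / (?a + \<delta>))" by (simp add: s_def power2_eq_square)
    also have "\<dots> \<le> (?b + \<delta>) * ?a * 1"
      using ab p \<open>\<delta> > 0\<close> by (intro mult_left_mono mult_nonneg_nonneg) (auto simp: divide_le_eq)
    finally show ?thesis by simp
  qed
  also have "?b\<^sup>2 / s \<le> (?a + \<delta>) * ?b"
  proof -
    have "?b\<^sup>2 / s = (?a + \<delta>) * ?b * (?b / (?b + \<delta>))" by (simp add: s_def power2_eq_square)
    also have "\<dots> \<le> (?a + \<delta>) * ?b * 1"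
      using ab p \<open>\<delta> > 0\<close> by (intro mult_left_mono mult_nonneg_nonneg) (auto simp: divide_le_eq)
    finally show ?thesis by simp
  qed
  finally have "2 * \<bar>L2_inner \<Omega> f h\<bar> \<le> 2 * (?a * ?b) + \<delta> * (?a + ?b)"
    by (simp add: abs_mult algebra_simps)
  also have "\<delta> * (?a + ?b) \<le> e"
    using \<open>e > 0\<close> p(3) by (simp add: \<delta>_def divide_le_eq mult_left_mono)
  finally show "\<bar>L2_inner \<Omega> f h\<bar> \<le> ?a * ?b + e" using \<open>e > 0\<close> by linarith
qed

lemma Lp2_norm_sq_add:
  fixes f h :: "'a::euclidean_space \<Rightarrow> 'b::euclidean_space"
  assumes "f \<in> Lp 2 \<Omega>" "h \<in> Lp 2 \<Omega>"
  shows "(Lp_norm 2 \<Omega> (\<lambda>x. f x + h x))\<^sup>2 =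
    (Lp_norm 2 \<Omega> f)\<^sup>2 + 2 * L2_inner \<Omega> f h + (Lp_norm 2 \<Omega> h)\<^sup>2"
proof -
  have "(norm (f x + h x))\<^sup>2 = (norm (f x))\<^sup>2 + 2 * (f x \<bullet> h x) + (norm (h x))\<^sup>2" for x
    by (simp add: power2_norm_eq_inner inner_simps inner_commute)
  then show ?thesis using assms integrable_L2_inner[OF assms]
    by (simp add: Lp2_norm_sq L2_inner_def Lp2_iff)
qed

lemma Lp2_norm_triangle:
  fixes f h :: "'a::euclidean_space \<Rightarrow> 'b::euclidean_space"
  assumes "f \<in> Lp 2 \<Omega>" "h \<in> Lp 2 \<Omega>"
  shows "Lp_norm 2 \<Omega> (\<lambda>x. f x + h x) \<le> Lp_norm 2 \<Omega> f + Lp_norm 2 \<Omega> h"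
proof (rule power2_le_imp_le)
  show "(Lp_norm 2 \<Omega> (\<lambda>x. f x + h x))\<^sup>2 \<le> (Lp_norm 2 \<Omega> f + Lp_norm 2 \<Omega> h)\<^sup>2"
    using L2_Cauchy_Schwarz[OF assms] by (simp add: Lp2_norm_sq_add[OF assms] power2_sum)
qed auto

lemma L2_dist_triangle:
  assumes "f \<in> Lp 2 \<Omega>" "g \<in> Lp 2 \<Omega>" "h \<in> Lp 2 \<Omega>"
  shows "L2_dist \<Omega> f h \<le> L2_dist \<Omega> f g + L2_dist \<Omega> g h"
  using Lp2_norm_triangle[OF Lp2_diff[OF assms(1,2)] Lp2_diff[OF assms(2,3)]]
  by (simp add: L2_dist_def)

lemma L2_dist_commute: "L2_dist \<Omega> f g = L2_dist \<Omega> g f"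
  by (simp add: L2_dist_def Lp2_norm_eq power2_commute)

lemma L2_dist_nonneg [simp]: "0 \<le> L2_dist \<Omega> f g"
  by (simp add: L2_dist_def)

lemma L2_dist_self [simp]: "L2_dist \<Omega> f f = 0"
  by (simp add: L2_dist_def Lp2_norm_eq)

lemma L2_inner_diff_left:
  fixes f g h :: "'a::euclidean_space \<Rightarrow> 'b::euclidean_space"
  assumes "f \<in> Lp 2 \<Omega>" "g \<in> Lp 2 \<Omega>" "h \<in> Lp 2 \<Omega>"
  shows "L2_inner \<Omega> (\<lambda>x. f x - g x) h = L2_inner \<Omega> f h - L2_inner \<Omega> g h"
  using integrable_L2_inner[OF assms(1,3)] integrable_L2_inner[OF assms(2,3)]
  by (simp add: L2_inner_def inner_diff_left)

lemma L2_inner_cong_AE: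
  fixes f h :: "'a::euclidean_space \<Rightarrow> 'b::euclidean_space"
  assumes \<Omega>: "\<Omega> \<in> sets lebesgue" and m: "f \<in> borel_measurable (lebesgue_on \<Omega>)" "h \<in> borel_measurable (lebesgue_on \<Omega>)"
    and eq: "AE x in lebesgue_on \<Omega>. f x = f' x" "AE x in lebesgue_on \<Omega>. h x = h' x"
  shows "L2_inner \<Omega> f h = L2_inner \<Omega> f' h'"
proof -
  note [measurable] = m borel_measurable_lebesgue_on_cong_AE[OF \<Omega> m(1) eq(1)] borel_measurable_lebesgue_on_cong_AE[OF \<Omega> m(2) eq(2)]
  show ?thesis unfolding L2_inner_def
    by (intro integral_cong_AE) (use eq in \<open>auto\<close>)
qed

lemma Lp2_norm_le_of_AE:
  fixes f :: "'a::euclidean_space \<Rightarrow> 'b::euclidean_space"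
  assumes f: "f \<in> borel_measurable (lebesgue_on \<Omega>)" and h: "h \<in> Lp 2 \<Omega>"
    and le: "AE x in lebesgue_on \<Omega>. norm (f x) \<le> c * norm (h x)" and c: "c \<ge> 0"
  shows "f \<in> Lp 2 \<Omega>" "Lp_norm 2 \<Omega> f \<le> c * Lp_norm 2 \<Omega> h"
proof -
  have le2: "AE x in lebesgue_on \<Omega>. (norm (f x))\<^sup>2 \<le> c\<^sup>2 * (norm (h x))\<^sup>2"
    using le by eventually_elim (metis norm_ge_zero power_mono power_mult_distrib)
  have ih: "integrable (lebesgue_on \<Omega>) (\<lambda>x. c\<^sup>2 * (norm (h x))\<^sup>2)" using h by (auto simp: Lp2_iff)
  have i: "integrable (lebesgue_on \<Omega>) (\<lambda>x. (norm (f x))\<^sup>2)"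
    by (rule Bochner_Integration.integrable_bound[OF ih]) (use f le2 in auto)
  then show "f \<in> Lp 2 \<Omega>" using f by (simp add: Lp2_iff)
  have "(LINT x|lebesgue_on \<Omega>. (norm (f x))\<^sup>2) \<le> (LINT x|lebesgue_on \<Omega>. c\<^sup>2 * (norm (h x))\<^sup>2)"
    by (rule integral_mono_AE[OF i ih le2])
  then have "Lp_norm 2 \<Omega> f \<le> sqrt (c\<^sup>2 * (LINT x|lebesgue_on \<Omega>. (norm (h x))\<^sup>2))"
    by (simp add: Lp2_norm_eq)
  then show "Lp_norm 2 \<Omega> f \<le> c * Lp_norm 2 \<Omega> h"
    using c by (simp add: real_sqrt_mult Lp2_norm_eq)
qed

lemma Lp2_const: "\<Omega> \<in> lmeasurable \<Longrightarrow> (\<lambda>x. c) \<in> Lp 2 \<Omega>"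
  using finite_measure.integrable_const[OF finite_measure_lebesgue_on] by (auto simp: Lp2_iff)

section \<open>Linearity of weak gradients and the seminorm of H1\<close>

lemma weak_gradient_scale_add:
  assumes "weak_gradient \<Omega> f F" "weak_gradient \<Omega> h H" and \<Omega>: "\<Omega> \<in> sets lebesgue"
  shows "weak_gradient \<Omega> (\<lambda>x. a * f x + b * h x) (\<lambda>x. a *\<^sub>R F x + b *\<^sub>R H x)"
  unfolding weak_gradient_def
proof (intro conjI allI impI ballI)
  have l: "locally_integrable \<Omega> f" "locally_integrable \<Omega> h" "locally_integrable \<Omega> F" "locally_integrable \<Omega> H"
    using assms by (auto simp: weak_gradient_def)
  show "locally_integrable \<Omega> (\<lambda>x. a * f x + b * h x)" "locally_integrable \<Omega> (\<lambda>x. a *\<^sub>R F x + b *\<^sub>R H x)"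
    using l by (auto simp: locally_integrable_def)
  fix \<phi> :: "'a \<Rightarrow> real" and i :: 'a assume \<phi>: "test_function \<Omega> \<phi>" and i: "i \<in> Basis"
  define C where "C = closure {x. \<phi> x \<noteq> 0}"
  have C: "compact C" "C \<subseteq> \<Omega>" using \<phi> by (auto simp: test_function_def C_def)
  have Cs: "C \<in> sets lebesgue" using C by (simp add: borel_compact sets_completionI_sets)
  have \<phi>0: "\<phi> x = 0" if "x \<notin> C" for x
    using that closure_subset[of "{x. \<phi> x \<noteq> 0}"] by (auto simp: C_def)
  \<comment> \<open>Off the closed support \<phi> vanishes in a neighbourhood, hence so does its
    derivative. Both integrands thus live on the compact set \<open>C\<close>, where locally
    integrable functions are integrable, and the integrals may be split.\<close>
  have D0: "frechet_derivative \<phi> (at x) i = 0" if "x \<notin> C" for x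
  proof -
    have "eventually (\<lambda>y. y \<in> - C) (nhds x)"
      using that C by (intro eventually_nhds_in_open) (auto simp: compact_imp_closed open_Compl)
    then have "eventually (\<lambda>y. 0 = \<phi> y) (nhds x)" by eventually_elim (auto simp: \<phi>0)
    then have "(\<phi> has_derivative (\<lambda>_. 0)) (at x)"
      using has_derivative_transform_eventually[of "\<lambda>_. 0" "\<lambda>_. 0" x UNIV \<phi>]
      by (simp add: eventually_at_filter eventually_nhds_x_imp_x[of _ x] \<phi>0[OF that] eventually_mono)
    from frechet_derivative_at[OF this] show ?thesis by (metis)
  qed
  have Ck: "Ck 0 \<phi>" "Ck 1 \<phi>" using \<phi> by (auto simp: test_function_def simp del: Ck.simps)
  have c1: "continuous_on UNIV \<phi>" using Ck by simp
  have c2: "continuous_on UNIV (\<lambda>x. frechet_derivative \<phi> (at x) i)" using Ck i by simp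
  have int: "integrable (lebesgue_on \<Omega>) (\<lambda>x. k x * v x)"
    if k: "locally_integrable \<Omega> k" and v: "continuous_on UNIV v" "\<And>x. x \<notin> C \<Longrightarrow> v x = 0"
    for k v :: "'a \<Rightarrow> real"
  proof -
    have kC: "integrable (lebesgue_on C) k" using k C by (auto simp: locally_integrable_def)
    have "bounded (v ` C)"
      using C v by (meson compact_continuous_image compact_imp_bounded continuous_on_subset top_greatest)
    then obtain B where B: "\<And>x. x \<in> C \<Longrightarrow> \<bar>v x\<bar> \<le> B" by (auto simp: bounded_iff)
    have "integrable (lebesgue_on C) (\<lambda>x. k x * v x)"
    proof (rule Bochner_Integration.integrable_bound)
      show "integrable (lebesgue_on C) (\<lambda>x. B * \<bar>k x\<bar>)" using kC by auto
      have "v \<in> borel_measurable (lebesgue_on C)"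
        by (rule continuous_imp_measurable_on_sets_lebesgue[OF continuous_on_subset[OF v(1)] Cs]) auto
      then show "(\<lambda>x. k x * v x) \<in> borel_measurable (lebesgue_on C)" using kC by measurable
      show "AE x in lebesgue_on C. norm (k x * v x) \<le> norm (B * \<bar>k x\<bar>)"
        using B by (intro AE_I2) (auto simp: abs_mult mult.commute[of B] intro!: mult_left_mono order_trans[OF B abs_ge_self])
    qed
    then have "integrable lebesgue (\<lambda>x. indicator C x *\<^sub>R (k x * v x))"
      using Cs by (simp add: integrable_restrict_space del: real_scaleR_def)
    also have "(\<lambda>x. indicator C x *\<^sub>R (k x * v x)) = (\<lambda>x. indicator \<Omega> x *\<^sub>R (k x * v x))"
      using v(2) C(2) by (auto simp: indicator_def fun_eq_iff)
    finally show ?thesis using \<Omega> by (simp add: integrable_restrict_space)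
  qed
  have *: "(LINT x|lebesgue_on \<Omega>. f x * frechet_derivative \<phi> (at x) i) = - (LINT x|lebesgue_on \<Omega>. (F x \<bullet> i) * \<phi> x)"
    "(LINT x|lebesgue_on \<Omega>. h x * frechet_derivative \<phi> (at x) i) = - (LINT x|lebesgue_on \<Omega>. (H x \<bullet> i) * \<phi> x)"
    using assms \<phi> i by (auto simp: weak_gradient_def)
  have "(LINT x|lebesgue_on \<Omega>. (a * f x + b * h x) * frechet_derivative \<phi> (at x) i) =
     a * (LINT x|lebesgue_on \<Omega>. f x * frechet_derivative \<phi> (at x) i) +
     b * (LINT x|lebesgue_on \<Omega>. h x * frechet_derivative \<phi> (at x) i)"
    using int[OF l(1) c2 D0] int[OF l(2) c2 D0] by (simp add: distrib_right mult.assoc)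
  also have "\<dots> = - (LINT x|lebesgue_on \<Omega>. ((a *\<^sub>R F x + b *\<^sub>R H x) \<bullet> i) * \<phi> x)"
    using int[OF locally_integrable_inner[OF l(3)] c1 \<phi>0, of i] int[OF locally_integrable_inner[OF l(4)] c1 \<phi>0, of i]
    unfolding * by (simp add: inner_add_left distrib_right mult.assoc)
  finally show "(LINT x|lebesgue_on \<Omega>. (a * f x + b * h x) * frechet_derivative \<phi> (at x) i) =
     - (LINT x|lebesgue_on \<Omega>. ((a *\<^sub>R F x + b *\<^sub>R H x) \<bullet> i) * \<phi> x)" .
qed

lemma W1_weak_gradient: "f \<in> W1 p \<Omega> \<Longrightarrow> weak_gradient \<Omega> f (wgrad \<Omega> f)"
  unfolding W1_def wgrad_def using someI_ex[of "weak_gradient \<Omega> f"] by auto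

lemma wgrad_eq_AE:
  assumes "open \<Omega>" "weak_gradient \<Omega> f G"
  shows "AE x in lebesgue_on \<Omega>. wgrad \<Omega> f x = G x"
proof -
  have "weak_gradient \<Omega> f (wgrad \<Omega> f)"
    unfolding wgrad_def using someI_ex[of "weak_gradient \<Omega> f"] assms by auto
  from weak_gradient_unique[OF this assms(2) refl assms(1)] show ?thesis .
qed

lemma H1_Lp2: "f \<in> H1 \<Omega> \<Longrightarrow> f \<in> Lp 2 \<Omega>"
  by (simp add: W1_def)

lemma Lp2_AE_eq:
  fixes f h :: "'a::euclidean_space \<Rightarrow> 'b::euclidean_space"
  assumes \<Omega>: "\<Omega> \<in> sets lebesgue" and f: "f \<in> Lp 2 \<Omega>" and eq: "AE x in lebesgue_on \<Omega>. h x = f x"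
  shows "h \<in> Lp 2 \<Omega>"
proof (rule Lp2_norm_le_of_AE(1)[OF _ f, of _ 1])
  show "h \<in> borel_measurable (lebesgue_on \<Omega>)"
    by (rule borel_measurable_lebesgue_on_cong_AE[OF \<Omega> Lp2_measurable[OF f]]) (use eq in auto)
qed (use eq in auto)

lemma wgrad_Lp2:
  assumes "open \<Omega>" "f \<in> H1 \<Omega>"
  shows "wgrad \<Omega> f \<in> Lp 2 \<Omega>"
proof -
  obtain G where G: "G \<in> Lp 2 \<Omega>" "weak_gradient \<Omega> f G" using assms by (auto simp: W1_def)
  then show ?thesis using Lp2_AE_eq[OF sets_lebesgue_open[OF assms(1)] G(1) wgrad_eq_AE[OF assms(1) G(2)]] by simp
qed

lemma H1_scale_add:
  assumes \<Omega>: "open \<Omega>" and f: "f \<in> H1 \<Omega>" "h \<in> H1 \<Omega>"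
  shows "(\<lambda>x. a * f x + b * h x) \<in> H1 \<Omega>"
    and "AE x in lebesgue_on \<Omega>. wgrad \<Omega> (\<lambda>x. a * f x + b * h x) x = a *\<^sub>R wgrad \<Omega> f x + b *\<^sub>R wgrad \<Omega> h x"
proof -
  note w = weak_gradient_scale_add[OF f[THEN W1_weak_gradient] sets_lebesgue_open[OF \<Omega>], of a b]
  show "(\<lambda>x. a * f x + b * h x) \<in> H1 \<Omega>"
    unfolding W1_def using w Lp2_add[OF Lp2_scaleR[OF wgrad_Lp2[OF \<Omega> f(1)]] Lp2_scaleR[OF wgrad_Lp2[OF \<Omega> f(2)]], of a b]
      Lp2_add[OF Lp2_cmult[OF H1_Lp2[OF f(1)], of a] Lp2_cmult[OF H1_Lp2[OF f(2)], of b]] by auto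
  show "AE x in lebesgue_on \<Omega>. wgrad \<Omega> (\<lambda>x. a * f x + b * h x) x = a *\<^sub>R wgrad \<Omega> f x + b *\<^sub>R wgrad \<Omega> h x"
    by (rule wgrad_eq_AE[OF \<Omega> w])
qed

lemma H1_diff:
  assumes \<Omega>: "open \<Omega>" and f: "f \<in> H1 \<Omega>" "h \<in> H1 \<Omega>"
  shows "(\<lambda>x. f x - h x) \<in> H1 \<Omega>"
    and "AE x in lebesgue_on \<Omega>. wgrad \<Omega> (\<lambda>x. f x - h x) x = wgrad \<Omega> f x - wgrad \<Omega> h x"
  using H1_scale_add[OF assms, of 1 "-1"] by simp_all

lemma H1_cmult:
  assumes \<Omega>: "open \<Omega>" and f: "f \<in> H1 \<Omega>"
  shows "(\<lambda>x. c * f x) \<in> H1 \<Omega>"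
  using H1_scale_add(1)[OF \<Omega> f f, of c 0] by simp

lemma H1_0:
  assumes \<Omega>: "open \<Omega>"
  shows "(\<lambda>x. 0) \<in> H1 \<Omega>"
proof -
  have "(\<lambda>x. 0::real) \<in> Lp 2 \<Omega>" "(\<lambda>x. 0::'a) \<in> Lp 2 \<Omega>" by (auto simp: Lp2_iff)
  moreover have "weak_gradient \<Omega> (\<lambda>x. 0) (\<lambda>x. 0)" by (auto simp: weak_gradient_def locally_integrable_def)
  ultimately show ?thesis unfolding W1_def by blast
qed

lemma H1_norm_nonneg [simp]: "0 \<le> H1_norm \<Omega> f"
  by (simp add: W1_norm_def)

lemma H1_norm_scale_add:
  assumes \<Omega>: "open \<Omega>" and f: "f \<in> H1 \<Omega>" "h \<in> H1 \<Omega>"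
  shows "H1_norm \<Omega> (\<lambda>x. a * f x + b * h x) \<le> \<bar>a\<bar> * H1_norm \<Omega> f + \<bar>b\<bar> * H1_norm \<Omega> h"
proof -
  note w = wgrad_Lp2[OF \<Omega> f(1)] wgrad_Lp2[OF \<Omega> f(2)]
  have "Lp_norm 2 \<Omega> (\<lambda>x. a * f x + b * h x) \<le> \<bar>a\<bar> * Lp_norm 2 \<Omega> f + \<bar>b\<bar> * Lp_norm 2 \<Omega> h"
    using Lp2_norm_triangle[OF Lp2_scaleR[OF H1_Lp2[OF f(1)], of a] Lp2_scaleR[OF H1_Lp2[OF f(2)], of b]]
      Lp2_norm_scaleR[of \<Omega> a f] Lp2_norm_scaleR[of \<Omega> b h] by simp
  moreover have "Lp_norm 2 \<Omega> (wgrad \<Omega> (\<lambda>x. a * f x + b * h x)) \<le>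
      \<bar>a\<bar> * Lp_norm 2 \<Omega> (wgrad \<Omega> f) + \<bar>b\<bar> * Lp_norm 2 \<Omega> (wgrad \<Omega> h)"
    using Lp2_norm_triangle[OF Lp2_scaleR[OF w(1), of a] Lp2_scaleR[OF w(2), of b]]
      Lp2_norm_cong_AE[OF sets_lebesgue_open[OF \<Omega>] Lp2_measurable[OF wgrad_Lp2[OF \<Omega> H1_scale_add(1)[OF assms]]]
        H1_scale_add(2)[OF assms], of a b]
      Lp2_norm_scaleR[of \<Omega> a "wgrad \<Omega> f"] Lp2_norm_scaleR[of \<Omega> b "wgrad \<Omega> h"] by simp
  ultimately show ?thesis by (simp add: W1_norm_def algebra_simps)
qed

lemma Lp_norm_le_H1_norm: "Lp_norm 2 \<Omega> f \<le> H1_norm \<Omega> f" "Lp_norm 2 \<Omega> (wgrad \<Omega> f) \<le> H1_norm \<Omega> f"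
  by (auto simp: W1_norm_def)

lemma phase_space_Lp2: "u \<in> phase_space \<Omega> \<Longrightarrow> u \<in> Lp 2 \<Omega>"
  by (simp add: phase_space_def)

section \<open>A Poincare inequality on boxes\<close>

lemma nn_integral_lborel_translate:
  fixes f :: "'a::euclidean_space \<Rightarrow> ennreal"
  assumes [measurable]: "f \<in> borel_measurable borel"
  shows "(\<integral>\<^sup>+x. f (x + c) \<partial>lborel) = (\<integral>\<^sup>+x. f x \<partial>lborel)"
proof -
  have "(\<integral>\<^sup>+x. f x \<partial>lborel) = (\<integral>\<^sup>+x. f x \<partial>distr lborel borel ((+) c))"
    by (simp add: lborel_distr_plus)
  also have "\<dots> = (\<integral>\<^sup>+x. f (c + x) \<partial>lborel)" by (rule nn_integral_distr) auto
  finally show ?thesis by (simp add: add.commute)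
qed

lemma integral_lborel_translate:
  fixes f :: "'a::euclidean_space \<Rightarrow> real"
  assumes [measurable]: "f \<in> borel_measurable borel"
  shows "(LINT x|lborel. f (x + c)) = (LINT x|lborel. f x)"
proof -
  have "(LINT x|lborel. f x) = (LINT x|distr lborel borel ((+) c). f x)"
    by (simp add: lborel_distr_plus)
  also have "\<dots> = (LINT x|lborel. f (c + x))" by (rule integral_distr) auto
  finally show ?thesis by (simp add: add.commute)
qed

lemma integrable_lborel_translate:
  fixes f :: "'a::euclidean_space \<Rightarrow> real"
  assumes "integrable lborel f"
  shows "integrable lborel (\<lambda>x. f (x + c))"
proof -
  have "integrable (distr lborel borel ((+) c)) f" using assms by (simp add: lborel_distr_plus)
  then have "integrable lborel (\<lambda>x. f (c + x))"
    by (subst (asm) integrable_distr_eq) (use assms in auto)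
  then show ?thesis by (simp add: add.commute)
qed

text \<open>Translations and Fubini will be applied in \<open>lborel\<close>, which asks for Borel
  functions, while weak gradients are only Lebesgue measurable. Passing to this representative once
  settles the matter for a whole box.\<close>

lemma borel_representative:
  fixes f :: "'a::euclidean_space \<Rightarrow> real"
  assumes f: "integrable (lebesgue_on S) f" and S: "S \<in> sets borel"
  obtains f0 where "integrable lborel f0" "f0 \<in> borel_measurable borel"
    "AE x in lebesgue. indicator S x * f x = f0 x" "\<And>x. x \<notin> S \<Longrightarrow> f0 x = 0"
proof -
  have i: "integrable lebesgue (\<lambda>x. indicator S x * f x)"
    using f S by (simp add: integrable_restrict_space sets_completionI_sets)
  then have "(\<lambda>x. indicator S x * f x) \<in> borel_measurable (completion lborel)" by auto
  from completion_ex_borel_measurable_real[OF this] obtain g where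
    g: "g \<in> borel_measurable lborel" "AE x in lborel. indicator S x * f x = g x" by auto
  define f0 where "f0 x = indicator S x * g x" for x
  have m: "f0 \<in> borel_measurable borel" unfolding f0_def using g(1) S by measurable
  have ae: "AE x in lebesgue. indicator S x * f x = f0 x"
    using AE_completion[OF g(2)] by eventually_elim (auto simp: f0_def indicator_def)
  have "integrable lebesgue f0"
    by (rule Bochner_Integration.integrable_cong_AE_imp[OF i])
       (use m ae in \<open>auto intro: measurable_completion\<close>)
  then have "integrable lborel f0" using m by (simp add: integrable_completion)
  then show ?thesis using that m ae by (auto simp: f0_def)
qed

text \<open>The integral of \<open>f (x + l i) - f x\<close> over a box equals that of \<open>\<integral>\<^sub>0\<^sup>l G (x + r i) \<bullet> i dr\<close>; boxes
  determine a function almost everywhere.\<close>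

lemma L1_translation_bound:
  fixes f :: "'a::euclidean_space \<Rightarrow> real"
  assumes wg: "weak_gradient \<Omega> f G" and \<Omega>: "open \<Omega>" and sub: "cbox c d \<subseteq> \<Omega>" and i: "i \<in> Basis"
    and l: "0 \<le> l"
    and f0: "integrable lborel f0" "f0 \<in> borel_measurable borel"
      "AE x in lebesgue. indicator (cbox c d) x * f x = f0 x"
    and g0: "integrable lborel g0" "g0 \<in> borel_measurable borel"
      "AE x in lebesgue. indicator (cbox c d) x * (G x \<bullet> i) = g0 x"
  shows "(\<integral>\<^sup>+x. indicator (cbox c d) x * indicator (cbox c d) (x + l *\<^sub>R i) * ennreal \<bar>f0 (x + l *\<^sub>R i) - f0 x\<bar> \<partial>lborel)
    \<le> ennreal l * (\<integral>\<^sup>+x. ennreal \<bar>g0 x\<bar> \<partial>lborel)"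
proof -
  note [measurable] = f0(2) g0(2)
  have \<Omega>s: "\<Omega> \<in> sets lebesgue" using \<Omega> by (rule sets_lebesgue_open)
  define h where "h = (\<lambda>(x, r). indicator {0..l} r * g0 (x + r *\<^sub>R i))"
  have hm: "h \<in> borel_measurable (lborel \<Otimes>\<^sub>M lborel)"
    unfolding h_def case_prod_beta by measurable
  note [measurable] = hm
  have tonelli: "(\<integral>\<^sup>+r. \<integral>\<^sup>+x. ennreal \<bar>h (x, r)\<bar> \<partial>lborel \<partial>lborel) = ennreal l * (\<integral>\<^sup>+x. ennreal \<bar>g0 x\<bar> \<partial>lborel)"
  proof -
    have "(\<integral>\<^sup>+x. ennreal \<bar>h (x, r)\<bar> \<partial>lborel) = indicator {0..l} r * (\<integral>\<^sup>+x. ennreal \<bar>g0 x\<bar> \<partial>lborel)" for r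
    proof -
      have "(\<integral>\<^sup>+x. ennreal \<bar>h (x, r)\<bar> \<partial>lborel) = (\<integral>\<^sup>+x. indicator {0..l} r * ennreal \<bar>g0 (x + r *\<^sub>R i)\<bar> \<partial>lborel)"
        by (intro nn_integral_cong) (auto simp: h_def indicator_def)
      also have "\<dots> = indicator {0..l} r * (\<integral>\<^sup>+x. ennreal \<bar>g0 (x + r *\<^sub>R i)\<bar> \<partial>lborel)"
        by (intro nn_integral_cmult) measurable
      also have "(\<integral>\<^sup>+x. ennreal \<bar>g0 (x + r *\<^sub>R i)\<bar> \<partial>lborel) = (\<integral>\<^sup>+x. ennreal \<bar>g0 x\<bar> \<partial>lborel)"
        by (rule nn_integral_lborel_translate[where f = "\<lambda>x. ennreal \<bar>g0 x\<bar>"]) measurable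
      finally show ?thesis .
    qed
    then show ?thesis using l by (simp add: nn_integral_multc)
  qed
  have fin: "(\<integral>\<^sup>+x. ennreal \<bar>g0 x\<bar> \<partial>lborel) < \<infinity>" using g0(1) by (auto simp: integrable_iff_bounded)
  have hint: "integrable (lborel \<Otimes>\<^sub>M lborel) h"
  proof (rule integrableI_bounded)
    have "(\<integral>\<^sup>+z. ennreal (norm (h z)) \<partial>(lborel \<Otimes>\<^sub>M lborel)) = (\<integral>\<^sup>+r. \<integral>\<^sup>+x. ennreal \<bar>h (x, r)\<bar> \<partial>lborel \<partial>lborel)"
      by (subst lborel_pair.nn_integral_snd[symmetric]) auto
    also have "\<dots> < \<infinity>" unfolding tonelli using fin by (simp add: ennreal_mult_less_top)
    finally show "(\<integral>\<^sup>+z. ennreal (norm (h z)) \<partial>(lborel \<Otimes>\<^sub>M lborel)) < \<infinity>" .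
  qed fact
  \<comment> \<open>\<open>k\<close> is the defect in the fundamental theorem of calculus along the
    segment from x to x + l i. It vanishes almost everywhere on \<open>?U\<close> once its integral
    over every box inside \<open>?U\<close> is 0.\<close>
  define k where "k x = f0 (x + l *\<^sub>R i) - f0 x - (LINT r|lborel. h (x, r))" for x
  have ki: "integrable lborel k"
    unfolding k_def
    by (intro Bochner_Integration.integrable_diff integrable_lborel_translate f0 lborel_pair.integrable_fst' hint)
  have k_on: "k integrable_on S" if "S \<in> sets borel" for S
    by (rule set_borel_integral_eq_integral(1))
       (use integrable_mult_indicator[OF _ ki, of S] that in \<open>simp add: set_integrable_def\<close>)
  \<comment> \<open>The upper face is pulled back by \<open>l\<close> in direction \<open>i\<close>,
    so that the whole segment starting at a point of \<open>?U\<close> stays in the original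
    box.\<close>
  let ?U = "box c (d - l *\<^sub>R i)"
  \<comment> \<open>The weak formulation speaks of integrals over \<Omega> with respect to Lebesgue
    measure. Against a Borel weight supported in the box, the functions may be replaced by their
    Borel representatives.\<close>
  have conv: "(LINT x|lebesgue_on \<Omega>. v x * w x) = (LINT x|lborel. v0 x * w x)"
    if w: "w \<in> borel_measurable borel" "\<And>x. x \<notin> cbox c d \<Longrightarrow> w x = 0"
      and v0: "v0 \<in> borel_measurable borel" "AE x in lebesgue. indicator (cbox c d) x * v x = v0 x"
    for v v0 w :: "'a \<Rightarrow> real"
  proof -
    have eq: "(\<lambda>x. indicator \<Omega> x *\<^sub>R (v x * w x)) = (\<lambda>x. (indicator (cbox c d) x * v x) * w x)"
      using w(2) sub by (auto simp: indicator_def fun_eq_iff)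
    have ae: "AE x in lebesgue. v0 x * w x = (indicator (cbox c d) x * v x) * w x"
      using v0(2) by eventually_elim auto
    have m: "(\<lambda>x. v0 x * w x) \<in> borel_measurable lebesgue"
      using w(1) v0(1) by (intro measurable_completion) auto
    have "(LINT x|lebesgue_on \<Omega>. v x * w x) = (LINT x|lebesgue. (indicator (cbox c d) x * v x) * w x)"
      using \<Omega>s by (subst integral_restrict_space) (simp_all add: eq del: real_scaleR_def)
    also have "\<dots> = (LINT x|lebesgue. v0 x * w x)"
      by (rule integral_cong_AE[OF borel_measurable_AE[OF m ae] m]) (use ae in \<open>auto elim: eventually_mono\<close>)
    also have "\<dots> = (LINT x|lborel. v0 x * w x)"
      using w(1) v0(1) by (intro integral_completion) auto
    finally show ?thesis .
  qed
  have zero: "integral (cbox a b) k = 0" if ab: "cbox a b \<subseteq> ?U" for a b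
  proof (cases "box a b = {}")
    case True
    then have "negligible (cbox a b)" using negligible_interval(1) by blast
    then show ?thesis by (rule integral_negligible)
  next
    case False
    have sub2: "cbox a (b + l *\<^sub>R i) \<subseteq> cbox c d"
    proof -
      have "cbox a b \<noteq> {}" using False box_subset_cbox by fastforce
      then have "a \<in> ?U" "b \<in> ?U" using ab by (auto simp: subset_iff mem_box box_ne_empty)
      then have "\<forall>j\<in>Basis. c \<bullet> j \<le> a \<bullet> j \<and> (b + l *\<^sub>R i) \<bullet> j \<le> d \<bullet> j"
        by (auto simp: mem_box inner_simps inner_Basis dest!: bspec intro: less_imp_le)
      then show ?thesis by (simp add: subset_box)
    qed
    define w where "w r x = indicat_real (box a b) (x - r *\<^sub>R i)" for r x
    have w0: "w r x = 0" if "x \<notin> cbox c d" "r \<in> {0..l}" for r x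
    proof (rule ccontr)
      assume "w r x \<noteq> 0"
      then have "x - r *\<^sub>R i \<in> box a b" by (auto simp: w_def indicator_def split: if_splits)
      then have "x \<in> cbox a (b + l *\<^sub>R i)"
        using \<open>r \<in> {0..l}\<close> i by (auto simp: mem_box inner_simps inner_Basis split: if_splits dest!: bspec)
      then show False using sub2 that by auto
    qed
    have [measurable]: "(\<lambda>x. w r x) \<in> borel_measurable borel" for r unfolding w_def by measurable
    have [measurable]: "(\<lambda>z. w (snd z) (fst z)) \<in> borel_measurable (lborel \<Otimes>\<^sub>M lborel)"
      unfolding w_def by measurable
    define W where "W x = (LINT r|lborel. indicator {0..l} r * w r x)" for x
    have [measurable]: "W \<in> borel_measurable borel"
    proof -
      have "(\<lambda>(x, r). indicator {0..l} r * w r x) \<in> borel_measurable (lborel \<Otimes>\<^sub>M lborel)"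
        unfolding case_prod_beta by measurable
      from lborel.borel_measurable_lebesgue_integral[OF this] show ?thesis by (simp add: W_def[abs_def])
    qed
    have W_eq: "integral {0..l} (\<lambda>r. indicator (box a b) (x - r *\<^sub>R i)) = W x" for x
    proof -
      have "set_integrable lborel {0..l} (\<lambda>r. w r x)"
        unfolding set_integrable_def
      proof (rule Bochner_Integration.integrable_bound)
        show "integrable lborel (indicat_real {0..l})" using l by (simp add: integrable_indicator_iff)
        show "(\<lambda>r. indicat_real {0..l} r *\<^sub>R w r x) \<in> borel_measurable lborel"
          unfolding w_def by measurable
      qed (auto simp: w_def indicator_def)
      from set_borel_integral_eq_integral(2)[OF this] show ?thesis
        by (simp add: W_def w_def set_lebesgue_integral_def)
    qed
    have "(LINT x|lebesgue_on \<Omega>. f x * (w l x - w 0 x)) = (LINT x|lebesgue_on \<Omega>. (G x \<bullet> i) * W x)"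
      using weak_gradient_box_difference[OF wg \<Omega>s i l, of a b] sub sub2
      by (simp add: W_eq[symmetric] w_def)
    moreover have W0: "W x = 0" if "x \<notin> cbox c d" for x
    proof -
      have "(\<lambda>r. indicator {0..l} r * w r x) = (\<lambda>r. 0)"
        using w0[OF that] by (auto simp: indicator_def fun_eq_iff)
      then show ?thesis by (simp add: W_def)
    qed
    ultimately have main: "(LINT x|lborel. f0 x * (w l x - w 0 x)) = (LINT x|lborel. g0 x * W x)"
      using conv[of "\<lambda>x. w l x - w 0 x" f0 f] conv[of W g0 "\<lambda>x. G x \<bullet> i"] f0 g0 w0 l
      by auto
    have wb: "\<bar>w r x\<bar> \<le> 1" for r x by (auto simp: w_def indicator_def)
    have iw: "integrable lborel (\<lambda>x. u x * v x)" if "integrable lborel u" "v \<in> borel_measurable borel" "\<And>x. \<bar>v x\<bar> \<le> 1"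
      for u v :: "'a \<Rightarrow> real"
      by (rule Bochner_Integration.integrable_bound[OF integrable_norm[OF that(1)]])
         (use that in \<open>auto simp: abs_mult mult_left_le\<close>)
    have 1: "(LINT x|lborel. f0 (x + l *\<^sub>R i) * w 0 x) = (LINT x|lborel. f0 x * w l x)"
      using integral_lborel_translate[of "\<lambda>x. f0 x * w l x" "l *\<^sub>R i"] by (simp add: w_def)
    \<comment> \<open>For fixed \<open>r\<close>, a translation by r i moves the shift from
      \<open>g0\<close> to the indicator of the box. Two applications of Fubini surround this
      substitution and turn the indicator into the weight \<open>W\<close>.\<close>
    have 2: "(LINT x|lborel. (LINT r|lborel. h (x, r)) * w 0 x) = (LINT x|lborel. g0 x * W x)"
    proof -
      have wm: "(\<lambda>z. w 0 (fst z)) \<in> borel_measurable (lborel \<Otimes>\<^sub>M lborel)"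
        unfolding w_def by measurable
      have hw: "integrable (lborel \<Otimes>\<^sub>M lborel) (\<lambda>(x, r). h (x, r) * w 0 x)"
        unfolding case_prod_beta prod.collapse
        by (rule Bochner_Integration.integrable_bound[OF integrable_norm[OF hint]])
           (use wm wb in \<open>auto simp: abs_mult mult_left_le\<close>)
      have gw: "integrable (lborel \<Otimes>\<^sub>M lborel) (\<lambda>(x, r). g0 x * (indicator {0..l} r * w r x))"
      proof (rule integrableI_bounded)
        have "(\<integral>\<^sup>+z. ennreal (norm (case z of (x, r) \<Rightarrow> g0 x * (indicator {0..l} r * w r x))) \<partial>(lborel \<Otimes>\<^sub>M lborel))
          \<le> (\<integral>\<^sup>+z. ennreal \<bar>g0 (fst z)\<bar> * indicator {0..l} (snd z) \<partial>(lborel \<Otimes>\<^sub>M lborel))"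
          by (intro nn_integral_mono) (auto simp: w_def indicator_def split: prod.splits)
        also have "\<dots> = (\<integral>\<^sup>+x. \<integral>\<^sup>+r. ennreal \<bar>g0 x\<bar> * indicator {0..l} r \<partial>lborel \<partial>lborel)"
          by (subst lborel.nn_integral_fst[symmetric]) auto
        also have "\<dots> = (\<integral>\<^sup>+x. ennreal \<bar>g0 x\<bar> \<partial>lborel) * ennreal l"
          using l by (simp add: nn_integral_cmult nn_integral_multc)
        also have "\<dots> < \<infinity>" using fin by (simp add: ennreal_mult_less_top)
        finally show "(\<integral>\<^sup>+z. ennreal (norm (case z of (x, r) \<Rightarrow> g0 x * (indicator {0..l} r * w r x))) \<partial>(lborel \<Otimes>\<^sub>M lborel)) < \<infinity>" .
      qed (unfold case_prod_beta, measurable)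
      have "(LINT x|lborel. (LINT r|lborel. h (x, r)) * w 0 x) = (LINT x|lborel. LINT r|lborel. h (x, r) * w 0 x)"
        by simp
      also have "\<dots> = (LINT r|lborel. LINT x|lborel. h (x, r) * w 0 x)"
        by (rule lborel_pair.Fubini_integral[OF hw, symmetric])
      also have "\<dots> = (LINT r|lborel. LINT x|lborel. g0 x * (indicator {0..l} r * w r x))"
      proof (rule Bochner_Integration.integral_cong[OF refl])
        fix r :: real
        have "(LINT x|lborel. g0 (x + r *\<^sub>R i) * (indicator {0..l} r * w r (x + r *\<^sub>R i))) =
            (LINT x|lborel. g0 x * (indicator {0..l} r * w r x))"
          by (rule integral_lborel_translate[where f = "\<lambda>x. g0 x * (indicator {0..l} r * w r x)"]) measurable
        then show "(LINT x|lborel. h (x, r) * w 0 x) = (LINT x|lborel. g0 x * (indicator {0..l} r * w r x))"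
          by (simp add: h_def w_def mult_ac)
      qed
      also have "\<dots> = (LINT x|lborel. LINT r|lborel. g0 x * (indicator {0..l} r * w r x))"
        by (rule lborel_pair.Fubini_integral[OF gw])
      finally show ?thesis by (simp add: W_def)
    qed
    have "integral (cbox a b) k = integral (box a b) k" by (rule integral_open_interval[symmetric])
    also have "\<dots> = (LINT x:box a b|lborel. k x)"
      by (rule set_borel_integral_eq_integral(2)[symmetric])
         (use integrable_mult_indicator[OF _ ki, of "box a b"] in \<open>simp add: set_integrable_def\<close>)
    also have "\<dots> = (LINT x|lborel. f0 (x + l *\<^sub>R i) * w 0 x - f0 x * w 0 x - (LINT r|lborel. h (x, r)) * w 0 x)"
      unfolding set_lebesgue_integral_def k_def by (intro Bochner_Integration.integral_cong) (auto simp: w_def algebra_simps)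
    also have "\<dots> = (LINT x|lborel. f0 (x + l *\<^sub>R i) * w 0 x) - (LINT x|lborel. f0 x * w 0 x)
        - (LINT x|lborel. (LINT r|lborel. h (x, r)) * w 0 x)"
      using iw[OF integrable_lborel_translate[OF f0(1)], of "w 0"] iw[OF f0(1), of "w 0"]
        iw[OF lborel_pair.integrable_fst'[OF hint], of "w 0"] wb by simp
    also have "\<dots> = 0"
      using main iw[OF f0(1), of "w l"] iw[OF f0(1), of "w 0"] wb
      unfolding 1 2 by (simp add: right_diff_distrib)
    finally show ?thesis .
  qed
  have "negligible {x \<in> ?U. k x \<noteq> 0}"
    by (rule negligible_if_box_integrals_0[OF k_on _ zero]) auto
  moreover have "negligible (cbox c (d - l *\<^sub>R i) - ?U)" by (rule negligible_frontier_interval)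
  ultimately have "negligible ({x \<in> ?U. k x \<noteq> 0} \<union> (cbox c (d - l *\<^sub>R i) - ?U))"
    by (simp add: negligible_Un)
  then have "AE x in lebesgue. x \<notin> {x \<in> ?U. k x \<noteq> 0} \<union> (cbox c (d - l *\<^sub>R i) - ?U)"
    unfolding negligible_iff_null_sets by (rule AE_not_in)
  then have ae: "AE x in lborel. x \<in> cbox c (d - l *\<^sub>R i) \<longrightarrow> k x = 0"
    unfolding AE_completion_iff by eventually_elim auto
  have mem: "x \<in> cbox c (d - l *\<^sub>R i)" if "x \<in> cbox c d" "x + l *\<^sub>R i \<in> cbox c d" for x
    using that l i by (auto simp: mem_box inner_simps)
  have "(\<integral>\<^sup>+x. indicator (cbox c d) x * indicator (cbox c d) (x + l *\<^sub>R i) * ennreal \<bar>f0 (x + l *\<^sub>R i) - f0 x\<bar> \<partial>lborel)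
      \<le> (\<integral>\<^sup>+x. \<integral>\<^sup>+r. ennreal \<bar>h (x, r)\<bar> \<partial>lborel \<partial>lborel)"
  proof (rule nn_integral_mono_AE)
    show "AE x in lborel. indicator (cbox c d) x * indicator (cbox c d) (x + l *\<^sub>R i) * ennreal \<bar>f0 (x + l *\<^sub>R i) - f0 x\<bar>
       \<le> (\<integral>\<^sup>+r. ennreal \<bar>h (x, r)\<bar> \<partial>lborel)"
      using ae lborel_pair.AE_integrable_fst'[OF hint]
    proof eventually_elim
      case (elim x)
      show ?case
      proof (cases "x \<in> cbox c d \<and> x + l *\<^sub>R i \<in> cbox c d")
        case True
        then have "f0 (x + l *\<^sub>R i) - f0 x = (LINT r|lborel. h (x, r))"
          using elim(1) mem by (simp add: k_def)
        then have "ennreal \<bar>f0 (x + l *\<^sub>R i) - f0 x\<bar> \<le> (\<integral>\<^sup>+r. ennreal \<bar>h (x, r)\<bar> \<partial>lborel)"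
          using integral_norm_bound_ennreal[OF elim(2)] by simp
        then show ?thesis using True by simp
      qed (auto simp: indicator_def)
    qed
  qed
  also have "\<dots> = (\<integral>\<^sup>+r. \<integral>\<^sup>+x. ennreal \<bar>h (x, r)\<bar> \<partial>lborel \<partial>lborel)"
    by (rule lborel_pair.Fubini'[symmetric]) measurable
  also have "\<dots> = ennreal l * (\<integral>\<^sup>+x. ennreal \<bar>g0 x\<bar> \<partial>lborel)" by (rule tonelli)
  finally show ?thesis .
qed

text \<open>For negative \<open>l\<close>, substituting x - l i for x exchanges the end points of
  the segment and leaves a shift by the positive amount -l.\<close>

lemma L1_translation_bound_signed:
  fixes f :: "'a::euclidean_space \<Rightarrow> real"
  assumes wg: "weak_gradient \<Omega> f G" and \<Omega>: "open \<Omega>" and sub: "cbox c d \<subseteq> \<Omega>" and i: "i \<in> Basis"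
    and f0: "integrable lborel f0" "f0 \<in> borel_measurable borel"
      "AE x in lebesgue. indicator (cbox c d) x * f x = f0 x"
    and g0: "integrable lborel g0" "g0 \<in> borel_measurable borel"
      "AE x in lebesgue. indicator (cbox c d) x * (G x \<bullet> i) = g0 x"
  shows "(\<integral>\<^sup>+x. indicator (cbox c d) x * indicator (cbox c d) (x + l *\<^sub>R i) * ennreal \<bar>f0 (x + l *\<^sub>R i) - f0 x\<bar> \<partial>lborel)
    \<le> ennreal \<bar>l\<bar> * (\<integral>\<^sup>+x. ennreal \<bar>g0 x\<bar> \<partial>lborel)"
proof (cases "l \<ge> 0")
  case True
  then show ?thesis using L1_translation_bound[OF wg \<Omega> sub i True f0 g0] by simp
next
  case False
  note [measurable] = f0(2)
  let ?F = "\<lambda>x. indicator (cbox c d) x * indicator (cbox c d) (x + l *\<^sub>R i) * ennreal \<bar>f0 (x + l *\<^sub>R i) - f0 x\<bar>"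
  have "(\<integral>\<^sup>+x. ?F x \<partial>lborel) = (\<integral>\<^sup>+x. ?F (x + (- l) *\<^sub>R i) \<partial>lborel)"
    by (rule nn_integral_lborel_translate[symmetric]) measurable
  also have "\<dots> = (\<integral>\<^sup>+x. indicator (cbox c d) x * indicator (cbox c d) (x + (- l) *\<^sub>R i) *
      ennreal \<bar>f0 (x + (- l) *\<^sub>R i) - f0 x\<bar> \<partial>lborel)"
    by (intro nn_integral_cong) (simp add: abs_minus_commute mult_ac)
  also have "\<dots> \<le> ennreal (- l) * (\<integral>\<^sup>+x. ennreal \<bar>g0 x\<bar> \<partial>lborel)"
    by (rule L1_translation_bound[OF wg \<Omega> sub i _ f0 g0]) (use False in simp)
  finally show ?thesis using False by simp
qed

text \<open>Integrate \<open>f x - f y\<close> over all pairs of points of the box and move from \<open>x\<close> to \<open>y\<close> along one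
  coordinate after the other, which does not leave the box.\<close>

lemma Poincare_box:
  fixes f :: "'a::euclidean_space \<Rightarrow> real"
  assumes wg: "weak_gradient \<Omega> f G" and \<Omega>: "open \<Omega>" and sub: "cbox c d \<subseteq> \<Omega>"
  shows "(LINT x|lebesgue_on (cbox c d). \<bar>f x\<bar>) \<le> \<bar>LINT x|lebesgue_on (cbox c d). f x\<bar> +
    2 ^ DIM('a) * DIM('a) * norm (d - c) * (LINT x|lebesgue_on (cbox c d). norm (G x))"
proof (cases "box c d = {}")
  case True
  then have "cbox c d \<in> null_sets lebesgue"
    using negligible_interval(1) negligible_iff_null_sets by blast
  then have "(LINT x|lebesgue_on (cbox c d). h x) = 0" for h :: "'a \<Rightarrow> real"
    using has_bochner_integral_null has_bochner_integral_integral_eq by blast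
  then show ?thesis by simp
next
  case False
  define Q where "Q = cbox c d"
  have Qb: "Q \<in> sets borel" "Q \<in> sets lebesgue" unfolding Q_def by auto
  have cd: "c \<bullet> j < d \<bullet> j" if "j \<in> Basis" for j using False that by (auto simp: box_ne_empty)
  have fi: "integrable (lebesgue_on Q) f" and Gi: "integrable (lebesgue_on Q) G"
    using wg sub by (auto simp: weak_gradient_def locally_integrable_def Q_def)
  obtain f0 where f0: "integrable lborel f0" "f0 \<in> borel_measurable borel"
    "AE x in lebesgue. indicator Q x * f x = f0 x" "\<And>x. x \<notin> Q \<Longrightarrow> f0 x = 0"
    using borel_representative[OF fi Qb(1)] by metis
  have "\<forall>i. \<exists>g. integrable lborel g \<and> g \<in> borel_measurable borel \<and>
      (AE x in lebesgue. indicator Q x * (G x \<bullet> i) = g x)"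
    using borel_representative[OF integrable_inner_left[OF Gi] Qb(1)] by metis
  then obtain g where g: "\<And>i. integrable lborel (g i)" "\<And>i. g i \<in> borel_measurable borel"
    "\<And>i. AE x in lebesgue. indicator Q x * (G x \<bullet> i) = g i x" by metis
  note [measurable] = f0(2) g(2) Qb(1)
  define I where "I i = (\<integral>\<^sup>+x. ennreal \<bar>g i x\<bar> \<partial>lborel)" for i
  define T where "T h = (\<integral>\<^sup>+x. indicator Q x * indicator Q (x + h) * ennreal \<bar>f0 (x + h) - f0 x\<bar> \<partial>lborel)" for h
  define part where "part S h = (\<Sum>i\<in>S. (h \<bullet> i) *\<^sub>R i)" for S and h :: 'a
  have T_part: "T (part S h) \<le> (\<Sum>i\<in>S. ennreal \<bar>h \<bullet> i\<bar> * I i)" if "finite S" "S \<subseteq> Basis" for S h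
    using that
  proof (induction S)
    case empty
    then show ?case by (simp add: T_def part_def)
  next
    case (insert j S)
    have j: "j \<in> Basis" using insert by auto
    define e where "e = part S h"
    have e': "part (insert j S) h = (h \<bullet> j) *\<^sub>R j + e" using insert by (simp add: part_def e_def)
    have ej: "e \<bullet> k = (if k \<in> S then h \<bullet> k else 0)" if "k \<in> Basis" for k
    proof -
      have "e \<bullet> k = (\<Sum>i\<in>S. if i = k then h \<bullet> k else 0)"
        unfolding e_def part_def inner_sum_left
        by (intro sum.cong refl) (use insert that in \<open>auto simp: inner_Basis\<close>)
      then show ?thesis using insert(1) by simp
    qed
    \<comment> \<open>Each coordinate of the intermediate point is a coordinate of x or of the end
      point, so the path does not leave the box.\<close>
    have mid: "x + e \<in> Q" if "x \<in> Q" "x + ((h \<bullet> j) *\<^sub>R j + e) \<in> Q" for x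
      unfolding Q_def mem_box
    proof
      fix k :: 'a assume k: "k \<in> Basis"
      show "c \<bullet> k \<le> (x + e) \<bullet> k \<and> (x + e) \<bullet> k \<le> d \<bullet> k"
      proof (cases "k = j")
        case True
        then have "e \<bullet> k = 0" using ej[OF k] insert(2) by simp
        then show ?thesis using that(1) k by (auto simp: Q_def mem_box inner_add_left)
      next
        case False
        then have "j \<bullet> k = 0" using j k by (simp add: inner_Basis)
        then show ?thesis using that(2) k by (auto simp: Q_def mem_box inner_add_left dest!: bspec)
      qed
    qed
    let ?u = "\<lambda>x. indicator Q x * indicator Q (x + e) * ennreal \<bar>f0 (x + e) - f0 x\<bar>"
    let ?v = "\<lambda>x. indicator Q x * indicator Q (x + (h \<bullet> j) *\<^sub>R j) * ennreal \<bar>f0 (x + (h \<bullet> j) *\<^sub>R j) - f0 x\<bar>"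
    have "T (part (insert j S) h) \<le> (\<integral>\<^sup>+x. ?u x + ?v (x + e) \<partial>lborel)"
      unfolding T_def e'
    proof (intro nn_integral_mono)
      fix x
      show "indicator Q x * indicator Q (x + ((h \<bullet> j) *\<^sub>R j + e)) * ennreal \<bar>f0 (x + ((h \<bullet> j) *\<^sub>R j + e)) - f0 x\<bar>
         \<le> ?u x + ?v (x + e)"
      proof (cases "x \<in> Q \<and> x + ((h \<bullet> j) *\<^sub>R j + e) \<in> Q")
        case True
        have eq: "x + ((h \<bullet> j) *\<^sub>R j + e) = x + e + (h \<bullet> j) *\<^sub>R j" by simp
        have "\<bar>f0 (x + e + (h \<bullet> j) *\<^sub>R j) - f0 x\<bar> \<le> \<bar>f0 (x + e) - f0 x\<bar> + \<bar>f0 (x + e + (h \<bullet> j) *\<^sub>R j) - f0 (x + e)\<bar>"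
          by linarith
        then have "ennreal \<bar>f0 (x + e + (h \<bullet> j) *\<^sub>R j) - f0 x\<bar> \<le>
            ennreal \<bar>f0 (x + e) - f0 x\<bar> + ennreal \<bar>f0 (x + e + (h \<bullet> j) *\<^sub>R j) - f0 (x + e)\<bar>"
          by (simp add: ennreal_plus[symmetric] ennreal_leI del: ennreal_plus)
        then show ?thesis using True mid[of x] unfolding eq by simp
      qed (auto simp: indicator_def)
    qed
    also have "\<dots> = (\<integral>\<^sup>+x. ?u x \<partial>lborel) + (\<integral>\<^sup>+x. ?v (x + e) \<partial>lborel)"
      by (intro nn_integral_add) measurable
    also have "(\<integral>\<^sup>+x. ?v (x + e) \<partial>lborel) = (\<integral>\<^sup>+x. ?v x \<partial>lborel)"
      by (rule nn_integral_lborel_translate) measurable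
    also have "(\<integral>\<^sup>+x. ?u x \<partial>lborel) = T (part S h)" by (simp add: T_def e_def)
    also have "\<dots> \<le> (\<Sum>i\<in>S. ennreal \<bar>h \<bullet> i\<bar> * I i)" using insert by auto
    also have "(\<integral>\<^sup>+x. ?v x \<partial>lborel) \<le> ennreal \<bar>h \<bullet> j\<bar> * I j"
      unfolding I_def Q_def
      by (rule L1_translation_bound_signed[OF wg \<Omega> sub j]) (use f0 g in \<open>auto simp: Q_def\<close>)
    finally show ?case using insert by (simp add: add.commute add_mono)
  qed
  \<comment> \<open>Differences of points of \<open>Q\<close> fill a box of volume 2^d V with V the
    volume of \<open>Q\<close> and d the dimension: hence the factor 2^d of the inequality, and
    after division by V no dependence on the shape of the box. The further factor d arises when each
    component of the gradient is bounded by its norm.\<close>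
  have T_le: "T h \<le> indicator (cbox (c - d) (d - c)) h * (ennreal (norm (d - c)) * (\<Sum>i\<in>Basis. I i))" for h
  proof (cases "h \<in> cbox (c - d) (d - c)")
    case True
    have "T h \<le> (\<Sum>i\<in>Basis. ennreal \<bar>h \<bullet> i\<bar> * I i)"
      using T_part[of Basis h] by (simp add: part_def euclidean_representation)
    also have "\<dots> \<le> (\<Sum>i\<in>Basis. ennreal (norm (d - c)) * I i)"
    proof (intro sum_mono mult_right_mono ennreal_leI)
      fix i :: 'a assume i: "i \<in> Basis"
      have "\<bar>h \<bullet> i\<bar> \<le> \<bar>(d - c) \<bullet> i\<bar>"
        using True i cd[OF i] by (auto simp: mem_box inner_diff_left dest!: bspec[of _ _ i])
      also have "\<dots> \<le> norm (d - c)" using i by (rule Basis_le_norm)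
      finally show "\<bar>h \<bullet> i\<bar> \<le> norm (d - c)" .
    qed auto
    finally show ?thesis using True by (simp add: sum_distrib_left)
  next
    case False
    have "indicator Q x * indicator Q (x + h) = (0::ennreal)" for x
    proof (rule ccontr)
      assume "indicator Q x * indicator Q (x + h) \<noteq> (0::ennreal)"
      then have "x \<in> Q" "x + h \<in> Q" by (auto simp: indicator_def split: if_splits)
      then have "h \<in> cbox (c - d) (d - c)"
        unfolding Q_def mem_box
        by (auto simp: inner_simps) (smt (verit, best))+
      then show False using False by simp
    qed
    then have "T h = 0" unfolding T_def by (simp only: mult_zero_left nn_integral_const)
    then show ?thesis by simp
  qed
  define V where "V = measure lborel Q"
  have em: "emeasure lborel Q = ennreal V" unfolding V_def Q_def by (rule emeasure_eq_ennreal_measure) (simp add: emeasure_lborel_cbox_eq)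
  have V: "V = (\<Prod>j\<in>Basis. (d - c) \<bullet> j)"
    unfolding V_def Q_def using cd by (subst measure_lborel_cbox_eq) (auto intro: less_imp_le)
  have Vpos: "V > 0" unfolding V using cd by (intro prod_pos) (auto simp: inner_diff_left)
  have em2: "emeasure lborel (cbox (c - d) (d - c)) = ennreal (2 ^ DIM('a) * V)"
  proof -
    have "emeasure lborel (cbox (c - d) (d - c)) = ennreal (\<Prod>j\<in>Basis. (d - c - (c - d)) \<bullet> j)"
      by (rule emeasure_lborel_cbox) (use cd in \<open>auto simp: inner_diff_left intro: less_imp_le\<close>)
    also have "(\<Prod>j\<in>Basis. (d - c - (c - d)) \<bullet> j) = (\<Prod>j\<in>(Basis :: 'a set). 2 * ((d - c) \<bullet> j))"
      by (intro prod.cong) (auto simp: inner_simps)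
    finally show ?thesis by (simp add: V prod.distrib)
  qed
  define D where "D x y = indicator Q x * indicator Q y * ennreal \<bar>f0 y - f0 x\<bar>" for x y
  have [measurable]: "(\<lambda>z. D (fst z) (snd z)) \<in> borel_measurable (lborel \<Otimes>\<^sub>M lborel)"
    unfolding D_def by measurable
  \<comment> \<open>The substitution y = h + x and Fubini sort the pairs of points by their
    difference h.\<close>
  have "(\<integral>\<^sup>+x. \<integral>\<^sup>+y. D x y \<partial>lborel \<partial>lborel) = (\<integral>\<^sup>+x. \<integral>\<^sup>+h. D x (h + x) \<partial>lborel \<partial>lborel)"
    by (intro nn_integral_cong nn_integral_lborel_translate[symmetric]) (auto simp: D_def)
  also have "\<dots> = (\<integral>\<^sup>+h. \<integral>\<^sup>+x. D x (h + x) \<partial>lborel \<partial>lborel)"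
  proof (rule lborel_pair.Fubini')
    show "(\<lambda>(x, y). D y (x + y)) \<in> borel_measurable (lborel \<Otimes>\<^sub>M lborel)"
      unfolding D_def case_prod_beta by measurable
  qed
  also have "\<dots> = (\<integral>\<^sup>+h. T h \<partial>lborel)" by (simp add: T_def D_def add.commute)
  also have "\<dots> \<le> (\<integral>\<^sup>+h. indicator (cbox (c - d) (d - c)) h * (ennreal (norm (d - c)) * (\<Sum>i\<in>Basis. I i)) \<partial>lborel)"
    by (intro nn_integral_mono T_le)
  also have "\<dots> = ennreal (2 ^ DIM('a) * V) * (ennreal (norm (d - c)) * (\<Sum>i\<in>Basis. I i))"
    by (simp add: nn_integral_multc em2)
  finally have double: "(\<integral>\<^sup>+x. \<integral>\<^sup>+y. D x y \<partial>lborel \<partial>lborel) \<le>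
      ennreal (2 ^ DIM('a) * V) * (ennreal (norm (d - c)) * (\<Sum>i\<in>Basis. I i))" .
  have LQ: "(LINT x|lebesgue_on Q. v x) = (LINT x|lborel. v0 x)"
    if "v0 \<in> borel_measurable borel" "AE x in lebesgue. indicator Q x * v x = v0 x" for v v0 :: "'a \<Rightarrow> real"
  proof -
    have m: "v0 \<in> borel_measurable lebesgue" using that(1) by (intro measurable_completion) simp
    have ae: "AE x in lebesgue. v0 x = indicator Q x * v x" using that(2) by eventually_elim simp
    have "(LINT x|lebesgue_on Q. v x) = (LINT x|lebesgue. indicator Q x * v x)"
      by (simp add: integral_restrict_space)
    also have "\<dots> = (LINT x|lebesgue. v0 x)"
      by (rule integral_cong_AE[OF borel_measurable_AE[OF m ae] m]) (use that in auto)
    also have "\<dots> = (LINT x|lborel. v0 x)" using that by (simp add: integral_completion)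
    finally show ?thesis .
  qed
  define F where "F = (LINT x|lborel. f0 x)"
  \<comment> \<open>For x in \<open>Q\<close>, V f(x) is the integral of \<open>f\<close> over the
    box plus the integral of f(x) - f(y) over y in the box.\<close>
  have pw: "ennreal V * ennreal \<bar>f0 x\<bar> \<le> indicator Q x * ennreal \<bar>F\<bar> + (\<integral>\<^sup>+y. D x y \<partial>lborel)" for x
  proof (cases "x \<in> Q")
    case True
    have i1: "integrable lborel (\<lambda>y. indicator Q y * (f0 x - f0 y))"
    proof -
      have a: "integrable lborel (\<lambda>y. indicator Q y * f0 x)"
        by (intro integrable_mult_left) (simp add: integrable_indicator_iff em)
      have b: "(\<lambda>y. indicator Q y * (f0 x - f0 y)) = (\<lambda>y. indicator Q y * f0 x - f0 y)"
        using f0(4) by (auto simp: indicator_def fun_eq_iff)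
      show ?thesis unfolding b using a f0(1) by auto
    qed
    have "(LINT y|lborel. indicator Q y * (f0 x - f0 y)) = (LINT y|lborel. indicator Q y * f0 x - f0 y)"
      using f0(4) by (intro Bochner_Integration.integral_cong) (auto simp: indicator_def)
    also have "\<dots> = V * f0 x - F"
      using f0(1) by (simp add: integrable_indicator_iff em F_def V_def)
    finally have eq: "V * f0 x = F + (LINT y|lborel. indicator Q y * (f0 x - f0 y))" by simp
    have "ennreal \<bar>LINT y|lborel. indicator Q y * (f0 x - f0 y)\<bar> \<le> (\<integral>\<^sup>+y. ennreal \<bar>indicator Q y * (f0 x - f0 y)\<bar> \<partial>lborel)"
      using integral_norm_bound_ennreal[OF i1] by simp
    also have "\<dots> = (\<integral>\<^sup>+y. D x y \<partial>lborel)"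
      using True by (intro nn_integral_cong) (auto simp: D_def indicator_def abs_minus_commute)
    finally have le: "ennreal \<bar>LINT y|lborel. indicator Q y * (f0 x - f0 y)\<bar> \<le> (\<integral>\<^sup>+y. D x y \<partial>lborel)" .
    have "ennreal V * ennreal \<bar>f0 x\<bar> = ennreal \<bar>V * f0 x\<bar>"
      using Vpos by (simp add: ennreal_mult[symmetric] abs_mult)
    also have "\<dots> \<le> ennreal (\<bar>F\<bar> + \<bar>LINT y|lborel. indicator Q y * (f0 x - f0 y)\<bar>)"
      unfolding eq by (intro ennreal_leI) linarith
    also have "\<dots> = ennreal \<bar>F\<bar> + ennreal \<bar>LINT y|lborel. indicator Q y * (f0 x - f0 y)\<bar>"
      by (simp add: ennreal_plus)
    also have "\<dots> \<le> ennreal \<bar>F\<bar> + (\<integral>\<^sup>+y. D x y \<partial>lborel)" by (intro add_left_mono le)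
    finally show ?thesis using True by simp
  qed (simp add: f0(4))
  have "ennreal V * (\<integral>\<^sup>+x. ennreal \<bar>f0 x\<bar> \<partial>lborel) = (\<integral>\<^sup>+x. ennreal V * ennreal \<bar>f0 x\<bar> \<partial>lborel)"
    by (simp add: nn_integral_cmult)
  also have "\<dots> \<le> (\<integral>\<^sup>+x. indicator Q x * ennreal \<bar>F\<bar> + (\<integral>\<^sup>+y. D x y \<partial>lborel) \<partial>lborel)"
    by (intro nn_integral_mono pw)
  also have "\<dots> = (\<integral>\<^sup>+x. indicator Q x * ennreal \<bar>F\<bar> \<partial>lborel) + (\<integral>\<^sup>+x. \<integral>\<^sup>+y. D x y \<partial>lborel \<partial>lborel)"
  proof (rule nn_integral_add)
    show "(\<lambda>x. \<integral>\<^sup>+y. D x y \<partial>lborel) \<in> borel_measurable lborel"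
      using lborel.borel_measurable_nn_integral[of "\<lambda>x y. D x y" lborel] by (simp add: case_prod_beta)
  qed measurable
  also have "\<dots> \<le> ennreal V * ennreal \<bar>F\<bar> + ennreal (2 ^ DIM('a) * V) * (ennreal (norm (d - c)) * (\<Sum>i\<in>Basis. I i))"
    using double by (simp add: nn_integral_multc em add_left_mono)
  finally have fin: "ennreal V * (\<integral>\<^sup>+x. ennreal \<bar>f0 x\<bar> \<partial>lborel) \<le>
      ennreal V * ennreal \<bar>F\<bar> + ennreal (2 ^ DIM('a) * V) * (ennreal (norm (d - c)) * (\<Sum>i\<in>Basis. I i))" .
  define J where "J = (LINT x|lebesgue_on Q. norm (G x))"
  have I_eq: "I i = ennreal (LINT x|lborel. \<bar>g i x\<bar>)" for i
    unfolding I_def using g(1) by (intro nn_integral_eq_integral) auto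
  have IJ: "(LINT x|lborel. \<bar>g i x\<bar>) \<le> J" if i: "i \<in> Basis" for i
  proof -
    have "(LINT x|lborel. \<bar>g i x\<bar>) = (LINT x|lebesgue_on Q. \<bar>G x \<bullet> i\<bar>)"
      by (rule LQ[symmetric]) (use g(3)[of i] in \<open>auto elim!: eventually_mono simp: abs_mult[symmetric] indicator_def\<close>)
    also have "\<dots> \<le> J" unfolding J_def
      using Gi Basis_le_norm[OF i] by (intro integral_mono) (auto intro!: integrable_abs integrable_inner_left)
    finally show ?thesis .
  qed
  have f_eq: "(LINT x|lebesgue_on Q. \<bar>f x\<bar>) = (LINT x|lborel. \<bar>f0 x\<bar>)"
    by (rule LQ) (use f0(3) in \<open>auto elim!: eventually_mono simp: indicator_def\<close>)
  have F_eq: "(LINT x|lebesgue_on Q. f x) = F"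
    unfolding F_def by (rule LQ) (use f0 in auto)
  have f0n: "(\<integral>\<^sup>+x. ennreal \<bar>f0 x\<bar> \<partial>lborel) = ennreal (LINT x|lborel. \<bar>f0 x\<bar>)"
    using f0(1) by (intro nn_integral_eq_integral) auto
  have sumI: "(\<Sum>i\<in>Basis. I i) = ennreal (\<Sum>i\<in>Basis. LINT x|lborel. \<bar>g i x\<bar>)"
    unfolding I_eq by (rule sum_ennreal) simp
  have nn: "0 \<le> (LINT x|lborel. \<bar>f0 x\<bar>)" "0 \<le> (\<Sum>i\<in>Basis. LINT x|lborel. \<bar>g i x\<bar>)" by (auto intro: sum_nonneg)
  have "V * (LINT x|lborel. \<bar>f0 x\<bar>) \<le>
      V * \<bar>F\<bar> + (2 ^ DIM('a) * V) * (norm (d - c) * (\<Sum>i\<in>Basis. LINT x|lborel. \<bar>g i x\<bar>))"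
    using fin nn Vpos unfolding f0n sumI
    by (simp add: ennreal_mult[symmetric] ennreal_plus[symmetric] del: ennreal_plus)
  also have "\<dots> = V * (\<bar>F\<bar> + 2 ^ DIM('a) * norm (d - c) * (\<Sum>i\<in>Basis. LINT x|lborel. \<bar>g i x\<bar>))"
    by (simp add: algebra_simps)
  finally have "(LINT x|lborel. \<bar>f0 x\<bar>) \<le> \<bar>F\<bar> + 2 ^ DIM('a) * norm (d - c) * (\<Sum>i\<in>Basis. LINT x|lborel. \<bar>g i x\<bar>)"
    using Vpos by simp
  also have "(\<Sum>i\<in>Basis. LINT x|lborel. \<bar>g i x\<bar>) \<le> DIM('a) * J"
    using sum_bounded_above[of Basis "\<lambda>i. LINT x|lborel. \<bar>g i x\<bar>" J] IJ by simp
  then have "2 ^ DIM('a) * norm (d - c) * (\<Sum>i\<in>Basis. LINT x|lborel. \<bar>g i x\<bar>) \<le> 2 ^ DIM('a) * norm (d - c) * (DIM('a) * J)"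
    by (intro mult_left_mono) auto
  finally show ?thesis using f_eq F_eq by (simp add: J_def Q_def mult_ac)
qed

section \<open>Total boundedness and compactness in \<open>L\<^sup>2\<close>\<close>

lemma phase_space_bounds: "u \<in> phase_space \<Omega> \<Longrightarrow> AE x in lebesgue_on \<Omega>. 0 \<le> u x \<and> u x \<le> 1"
  by (simp add: phase_space_def)

lemma integrable_lebesgue_on_bounded:
  fixes w :: "'a::euclidean_space \<Rightarrow> real"
  assumes "\<Omega> \<in> lmeasurable" "w \<in> borel_measurable (lebesgue_on \<Omega>)" "AE x in lebesgue_on \<Omega>. \<bar>w x\<bar> \<le> B"
  shows "integrable (lebesgue_on \<Omega>) w"
  by (rule finite_measure.integrable_const_bound[OF finite_measure_lebesgue_on[OF assms(1)], of _ B])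
     (use assms in auto)

text \<open>Differences of elements of the phase space are bounded by 1, so L1 smallness, which is
  what the Poincare inequality on boxes yields, implies L2 smallness.\<close>

lemma Lp2_norm_sq_le_L1:
  fixes w :: "'a::euclidean_space \<Rightarrow> real"
  assumes "\<Omega> \<in> lmeasurable" "w \<in> borel_measurable (lebesgue_on \<Omega>)" "AE x in lebesgue_on \<Omega>. \<bar>w x\<bar> \<le> 1"
  shows "(Lp_norm 2 \<Omega> w)\<^sup>2 \<le> (LINT x|lebesgue_on \<Omega>. \<bar>w x\<bar>)"
proof -
  have le: "AE x in lebesgue_on \<Omega>. (norm (w x))\<^sup>2 \<le> \<bar>w x\<bar>"
    using assms(3)
  proof eventually_elim
    case (elim x)
    have "\<bar>w x\<bar> * \<bar>w x\<bar> \<le> \<bar>w x\<bar> * 1" by (intro mult_left_mono elim) auto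
    then show ?case by (simp add: power2_eq_square)
  qed
  have i: "integrable (lebesgue_on \<Omega>) (\<lambda>x. \<bar>w x\<bar>)"
    by (rule integrable_lebesgue_on_bounded[of _ _ 1]) (use assms in auto)
  have "integrable (lebesgue_on \<Omega>) (\<lambda>x. (norm (w x))\<^sup>2)"
    by (rule Bochner_Integration.integrable_bound[OF i]) (use assms(2) le in auto)
  from integral_mono_AE[OF this i le] show ?thesis by (simp add: Lp2_norm_sq)
qed

lemma L1_norm_le_Lp2_norm:
  fixes w :: "'a::euclidean_space \<Rightarrow> 'b::euclidean_space"
  assumes \<Omega>: "\<Omega> \<in> lmeasurable" and w: "w \<in> Lp 2 \<Omega>"
  shows "(LINT x|lebesgue_on \<Omega>. norm (w x)) \<le> Lp_norm 2 \<Omega> w * sqrt (measure lebesgue \<Omega>)"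
proof -
  have n: "(\<lambda>x. norm (w x)) \<in> Lp 2 \<Omega>" using w by (auto simp: Lp2_iff)
  have "(LINT x|lebesgue_on \<Omega>. norm (w x)) = L2_inner \<Omega> (\<lambda>x. norm (w x)) (\<lambda>x. 1)"
    by (simp add: L2_inner_def)
  also have "\<dots> \<le> Lp_norm 2 \<Omega> (\<lambda>x. norm (w x)) * Lp_norm 2 \<Omega> (\<lambda>x. 1::real)"
    using L2_Cauchy_Schwarz[OF n Lp2_const[OF \<Omega>, of 1]] by linarith
  also have "Lp_norm 2 \<Omega> (\<lambda>x. 1::real) = sqrt (measure lebesgue \<Omega>)"
    using \<Omega> by (simp add: Lp2_norm_eq measure_restrict_space)
  finally show ?thesis by (simp add: Lp2_norm_eq)
qed

text \<open>The boxes with tags in a large compact subset \<open>T\<close> of \<open>\<Omega>\<close> of a fine division lie in \<open>\<Omega>\<close> and cover \<open>T\<close>;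
  the rest of \<open>\<Omega>\<close> has small measure and \<open>w\<close> is bounded by \<open>1\<close> there.\<close>

lemma H1_determined_by_box_averages:
  fixes \<Omega> :: "'a::euclidean_space set"
  assumes \<Omega>: "open \<Omega>" "bounded \<Omega>" and R: "0 \<le> R" and e: "0 < e"
  obtains P \<delta> where "finite P" "0 < \<delta>" "\<And>K. K \<in> P \<Longrightarrow> K \<subseteq> \<Omega> \<and> (\<exists>a b. K = cbox a b)"
    "\<And>w. w \<in> H1 \<Omega> \<Longrightarrow> AE x in lebesgue_on \<Omega>. \<bar>w x\<bar> \<le> 1 \<Longrightarrow> Lp_norm 2 \<Omega> (wgrad \<Omega> w) \<le> R \<Longrightarrow>
       (\<And>K. K \<in> P \<Longrightarrow> \<bar>LINT x|lebesgue_on K. w x\<bar> \<le> \<delta>) \<Longrightarrow> Lp_norm 2 \<Omega> w \<le> e"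
proof -
  have \<Omega>s: "\<Omega> \<in> sets lebesgue" using \<Omega>(1) by (rule sets_lebesgue_open)
  have \<Omega>l: "\<Omega> \<in> lmeasurable" using bounded_set_imp_lmeasurable[OF \<Omega>(2) \<Omega>s] .
  define M where "M = sqrt (measure lebesgue \<Omega>)"
  have M0: "M \<ge> 0" by (simp add: M_def)
  define c where "c = 2 ^ DIM('a) * real DIM('a)"
  have c0: "c \<ge> 0" by (simp add: c_def)
  \<comment> \<open>Three errors of size \<open>e'\<close> will occur: integrals over the boxes,
    oscillation on the boxes, and the boundary layer. Together they bound the squared L2 norm by 3/4
    of \<open>e\<close> squared.\<close>
  define e' where "e' = e\<^sup>2 / 4"
  have e': "e' > 0" using e by (simp add: e'_def)
  obtain T where T: "closed T" "T \<subseteq> \<Omega>" "\<Omega> - T \<in> lmeasurable" "emeasure lebesgue (\<Omega> - T) < ennreal e'"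
    using sets_lebesgue_inner_closed[OF \<Omega>s e'] by metis
  \<comment> \<open>\<open>R * M\<close> bounds the L1 norm of the gradient and \<open>c\<close> is
    the Poincare constant, so boxes of diameter \<rho> have total oscillation at most
    \<open>e'\<close>. Adding 1 keeps the denominator positive.\<close>
  define \<rho> where "\<rho> = e' / (c * (R * M) + 1)"
  have den: "c * (R * M) + 1 > 0" using c0 R M0 by (intro add_nonneg_pos mult_nonneg_nonneg) auto
  have \<rho>: "\<rho> > 0" "c * (R * M) * \<rho> \<le> e'"
    using e' den by (auto simp: \<rho>_def field_simps)
  obtain a b where ab: "\<Omega> \<subseteq> cbox a b" using bounded_subset_cbox_symmetric[OF \<Omega>(2)] by metis
  \<comment> \<open>The radius \<rho>/2 keeps the corners of a box tagged in \<open>T\<close> at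
    distance at most \<rho>. The value -T elsewhere forbids boxes with other tags to meet
    \<open>T\<close>, which forces the remaining ones to cover it.\<close>
  define \<gamma> where "\<gamma> x = (if x \<in> T then ball x (\<rho> / 2) \<inter> \<Omega> else - T)" for x
  have "gauge \<gamma>" using T \<Omega> \<rho> by (auto simp: gauge_def \<gamma>_def open_Compl)
  then obtain p where p: "p tagged_division_of cbox a b" "\<gamma> fine p"
    using fine_division_exists by metis
  define P where "P = snd ` {z \<in> p. fst z \<in> T}"
  have pD: "(snd ` p) division_of cbox a b" by (rule division_of_tagged_division[OF p(1)])
  have PD: "P division_of \<Union>P"
    by (rule division_of_subset[of "snd ` p"]) (use pD division_ofD(6)[OF pD] in \<open>auto simp: P_def\<close>)
  have finP: "finite P" using PD by (rule division_of_finite)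
  have KP: "K \<subseteq> \<Omega> \<and> (\<exists>x. K \<subseteq> ball x (\<rho> / 2))" if "K \<in> P" for K
    using that p(2) unfolding P_def fine_def \<gamma>_def by fastforce
  have box: "\<exists>u v. K = cbox u v" if "K \<in> P" for K
    using division_ofD(4)[OF PD that] .
  have TP: "T \<subseteq> \<Union>P"
  proof
    fix y assume y: "y \<in> T"
    then have "y \<in> cbox a b" using T ab by auto
    then obtain x K where xK: "(x, K) \<in> p" "y \<in> K" using tagged_division_ofD(6)[OF p(1)] by blast
    then have "K \<subseteq> \<gamma> x" using p(2) by (auto simp: fine_def)
    then have "x \<in> T" using xK y by (auto simp: \<gamma>_def split: if_splits)
    then show "y \<in> \<Union>P" using xK by (force simp: P_def)
  qed
  define \<delta> where "\<delta> = e' / (card P + 1)"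
  have \<delta>: "\<delta> > 0" "card P * \<delta> \<le> e'" using e' by (auto simp: \<delta>_def field_simps)
  have US: "\<Union>P \<in> sets lebesgue" and PS: "\<And>K. K \<in> P \<Longrightarrow> K \<in> sets lebesgue"
    using finP box by (auto intro!: sets.finite_Union) fastforce+
  have UO: "\<Union>P \<subseteq> \<Omega>" using KP by auto
  have sum_int: "(\<Sum>K\<in>P. LINT x|lebesgue_on K. h x) = (LINT x|lebesgue_on (\<Union>P). h x)"
    if h: "integrable (lebesgue_on \<Omega>) h" for h :: "'a \<Rightarrow> real"
  proof -
    have i: "integrable (lebesgue_on K) h" if "K \<subseteq> \<Omega>" "K \<in> sets lebesgue" for K
      by (rule integrable_lebesgue_on_subset[OF h that(1) \<Omega>s that(2)])
    have "(\<Sum>K\<in>P. LINT x|lebesgue_on K. h x) = (\<Sum>K\<in>P. integral K h)"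
      using i KP PS by (intro sum.cong refl lebesgue_integral_eq_integral) auto
    also have "\<dots> = integral (\<Union>P) h"
      by (rule integral_combine_division_bottomup[OF PD, symmetric])
         (use i KP PS in \<open>auto intro!: integrable_on_lebesgue_on\<close>)
    also have "\<dots> = (LINT x|lebesgue_on (\<Union>P). h x)"
      using i UO US by (intro lebesgue_integral_eq_integral[symmetric]) auto
    finally show ?thesis .
  qed
  have main: "Lp_norm 2 \<Omega> w \<le> e"
    if w: "w \<in> H1 \<Omega>" and b: "AE x in lebesgue_on \<Omega>. \<bar>w x\<bar> \<le> 1" and g: "Lp_norm 2 \<Omega> (wgrad \<Omega> w) \<le> R"
      and K: "\<And>K. K \<in> P \<Longrightarrow> \<bar>LINT x|lebesgue_on K. w x\<bar> \<le> \<delta>" for w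
  proof -
    have wm: "w \<in> borel_measurable (lebesgue_on \<Omega>)" using Lp2_measurable[OF H1_Lp2[OF w]] .
    have wi: "integrable (lebesgue_on \<Omega>) (\<lambda>x. \<bar>w x\<bar>)"
      by (rule integrable_lebesgue_on_bounded[OF \<Omega>l, of _ 1]) (use wm b in auto)
    have Gl: "wgrad \<Omega> w \<in> Lp 2 \<Omega>" by (rule wgrad_Lp2[OF \<Omega>(1) w])
    have Gi: "integrable (lebesgue_on \<Omega>) (\<lambda>x. norm (wgrad \<Omega> w x))"
    proof -
      have "integrable (lebesgue_on \<Omega>) (\<lambda>x. norm (wgrad \<Omega> w x) \<bullet> (1::real))"
        by (rule integrable_L2_inner[OF _ Lp2_const[OF \<Omega>l]]) (use Gl in \<open>auto simp: Lp2_iff\<close>)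
      then show ?thesis by simp
    qed
    have Kb: "(LINT x|lebesgue_on K. \<bar>w x\<bar>) \<le> \<delta> + c * \<rho> * (LINT x|lebesgue_on K. norm (wgrad \<Omega> w x))"
      if KP': "K \<in> P" for K
    proof -
      obtain u v where uv: "K = cbox u v" using box[OF KP'] by auto
      obtain x where x: "K \<subseteq> ball x (\<rho> / 2)" using KP[OF KP'] by auto
      have "K \<noteq> {}" using division_ofD(3)[OF PD KP'] .
      then have "u \<in> K" "v \<in> K" using uv by (auto simp: mem_box box_ne_empty)
      then have "dist x u < \<rho> / 2" "dist x v < \<rho> / 2" using x by (auto simp: subset_iff)
      then have "dist v u \<le> \<rho>" using dist_triangle[of v u x] by (simp add: dist_commute)
      then have d: "norm (v - u) \<le> \<rho>" by (simp add: dist_norm)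
      have "(LINT x|lebesgue_on K. \<bar>w x\<bar>) \<le> \<bar>LINT x|lebesgue_on K. w x\<bar> +
          c * norm (v - u) * (LINT x|lebesgue_on K. norm (wgrad \<Omega> w x))"
        using Poincare_box[OF W1_weak_gradient[OF w] \<Omega>(1), of u v] KP[OF KP'] by (simp add: uv c_def)
      also have "c * norm (v - u) * (LINT x|lebesgue_on K. norm (wgrad \<Omega> w x)) \<le>
          c * \<rho> * (LINT x|lebesgue_on K. norm (wgrad \<Omega> w x))"
        by (intro mult_right_mono mult_left_mono d c0) auto
      finally show ?thesis using K[OF KP'] by linarith
    qed
    have "(LINT x|lebesgue_on (\<Union>P). \<bar>w x\<bar>) = (\<Sum>K\<in>P. LINT x|lebesgue_on K. \<bar>w x\<bar>)"
      by (rule sum_int[OF wi, symmetric])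
    also have "\<dots> \<le> (\<Sum>K\<in>P. \<delta> + c * \<rho> * (LINT x|lebesgue_on K. norm (wgrad \<Omega> w x)))"
      by (intro sum_mono Kb)
    also have "\<dots> = card P * \<delta> + c * \<rho> * (LINT x|lebesgue_on (\<Union>P). norm (wgrad \<Omega> w x))"
      by (simp add: sum.distrib sum_distrib_left[symmetric] sum_int[OF Gi])
    finally have UP1: "(LINT x|lebesgue_on (\<Union>P). \<bar>w x\<bar>) \<le>
        card P * \<delta> + c * \<rho> * (LINT x|lebesgue_on (\<Union>P). norm (wgrad \<Omega> w x))" .
    have "(LINT x|lebesgue_on (\<Union>P). norm (wgrad \<Omega> w x)) \<le> (LINT x|lebesgue_on \<Omega>. norm (wgrad \<Omega> w x))"
    proof -
      have "(LINT x|lebesgue_on (\<Union>P). norm (wgrad \<Omega> w x)) = integral (\<Union>P) (\<lambda>x. norm (wgrad \<Omega> w x))"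
        using integrable_lebesgue_on_subset[OF Gi UO \<Omega>s US] US by (intro lebesgue_integral_eq_integral)
      also have "\<dots> \<le> integral \<Omega> (\<lambda>x. norm (wgrad \<Omega> w x))"
        using integrable_lebesgue_on_subset[OF Gi UO \<Omega>s US] US UO Gi \<Omega>s
        by (intro integral_subset_le integrable_on_lebesgue_on) auto
      also have "\<dots> = (LINT x|lebesgue_on \<Omega>. norm (wgrad \<Omega> w x))"
        using Gi \<Omega>s by (intro lebesgue_integral_eq_integral[symmetric])
      finally show ?thesis .
    qed
    also have "\<dots> \<le> Lp_norm 2 \<Omega> (wgrad \<Omega> w) * M"
      unfolding M_def by (rule L1_norm_le_Lp2_norm[OF \<Omega>l Gl])
    also have "\<dots> \<le> R * M" by (intro mult_right_mono g M0)
    finally have "c * \<rho> * (LINT x|lebesgue_on (\<Union>P). norm (wgrad \<Omega> w x)) \<le> c * \<rho> * (R * M)"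
      using c0 \<rho>(1) by (intro mult_left_mono mult_nonneg_nonneg) auto
    also have "\<dots> \<le> e'" using \<rho>(2) by (simp add: mult_ac)
    finally have UP: "(LINT x|lebesgue_on (\<Union>P). \<bar>w x\<bar>) \<le> e' + e'"
      using UP1 \<delta>(2) by linarith
    have iU: "integrable (lebesgue_on \<Omega>) (\<lambda>x. indicator (\<Union>P) x * \<bar>w x\<bar>)"
      and iD: "integrable (lebesgue_on \<Omega>) (\<lambda>x. indicat_real (\<Omega> - \<Union>P) x)"
    proof -
      have "\<Union>P \<in> sets (lebesgue_on \<Omega>)" "\<Omega> - \<Union>P \<in> sets (lebesgue_on \<Omega>)"
        using US \<Omega>s UO by (auto simp: sets_restrict_space_iff)
      note [measurable] = this wm
      show "integrable (lebesgue_on \<Omega>) (\<lambda>x. indicator (\<Union>P) x * \<bar>w x\<bar>)"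
      proof (rule integrable_lebesgue_on_bounded[OF \<Omega>l, of _ 1])
        show "AE x in lebesgue_on \<Omega>. \<bar>indicator (\<Union>P) x * \<bar>w x\<bar>\<bar> \<le> 1"
          using b by eventually_elim (simp add: indicator_def)
      qed measurable
      show "integrable (lebesgue_on \<Omega>) (\<lambda>x. indicat_real (\<Omega> - \<Union>P) x)"
      proof (rule integrable_lebesgue_on_bounded[OF \<Omega>l, of _ 1])
        show "AE x in lebesgue_on \<Omega>. \<bar>indicat_real (\<Omega> - \<Union>P) x\<bar> \<le> 1" by (simp add: indicator_def)
      qed measurable
    qed
    have "(LINT x|lebesgue_on \<Omega>. \<bar>w x\<bar>) \<le> (LINT x|lebesgue_on \<Omega>. indicator (\<Union>P) x * \<bar>w x\<bar> + indicat_real (\<Omega> - \<Union>P) x)"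
    proof (rule integral_mono_AE[OF wi])
      show "AE x in lebesgue_on \<Omega>. \<bar>w x\<bar> \<le> indicator (\<Union>P) x * \<bar>w x\<bar> + indicat_real (\<Omega> - \<Union>P) x"
        using b AE_space by eventually_elim (auto simp: indicator_def)
    qed (use iU iD in auto)
    also have "\<dots> = (LINT x|lebesgue_on \<Omega>. indicator (\<Union>P) x * \<bar>w x\<bar>) + (LINT x|lebesgue_on \<Omega>. indicat_real (\<Omega> - \<Union>P) x)"
      using iU iD by simp
    also have "(LINT x|lebesgue_on \<Omega>. indicator (\<Union>P) x * \<bar>w x\<bar>) = (LINT x|lebesgue_on (\<Union>P). indicator (\<Union>P) x * \<bar>w x\<bar>)"
      by (rule integral_lebesgue_on_vanish[OF UO US \<Omega>s]) auto
    also have "\<dots> = (LINT x|lebesgue_on (\<Union>P). \<bar>w x\<bar>)"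
      by (intro Bochner_Integration.integral_cong) auto
    also have "(LINT x|lebesgue_on \<Omega>. indicat_real (\<Omega> - \<Union>P) x) \<le> e'"
    proof -
      have "(LINT x|lebesgue_on \<Omega>. indicat_real (\<Omega> - \<Union>P) x) = measure lebesgue (\<Omega> - \<Union>P)"
        using \<Omega>s US by (simp add: measure_restrict_space sets_restrict_space_iff Int_absorb2)
      also have "\<dots> \<le> measure lebesgue (\<Omega> - T)"
        using TP T(3) \<Omega>s US by (intro measure_mono_fmeasurable) auto
      also have "\<dots> \<le> e'"
        using T(4) unfolding emeasure_eq_measure2[OF T(3)] by (simp add: ennreal_less_iff)
      finally show ?thesis .
    qed
    finally have "(LINT x|lebesgue_on \<Omega>. \<bar>w x\<bar>) \<le> 3 * e'" using UP by linarith
    then have "(Lp_norm 2 \<Omega> w)\<^sup>2 \<le> e\<^sup>2"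
      using Lp2_norm_sq_le_L1[OF \<Omega>l wm b] e' unfolding e'_def by linarith
    then show ?thesis using e by (simp add: power2_le_iff_abs_le)
  qed
  show ?thesis
  proof (rule that[of P \<delta>])
    show "K \<subseteq> \<Omega> \<and> (\<exists>a b. K = cbox a b)" if "K \<in> P" for K using KP[OF that] box[OF that] by simp
  qed (fact finP \<delta>(1) main)+
qed

text \<open>The integrals over the finitely many boxes are rounded to multiples of \<delta>. Only
  finitely many patterns arise, and functions with the same pattern are close; the bound on the
  gradient of their difference is 2R. One representative of each pattern is kept, so the net lies in
  \<open>B\<close> itself, which later allows its elements to be continued along
  trajectories.\<close>

lemma H1_totally_bounded:
  fixes \<Omega> :: "'a::euclidean_space set"
  assumes \<Omega>: "open \<Omega>" "bounded \<Omega>" and B: "B \<subseteq> H1 \<Omega> \<inter> phase_space \<Omega>"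
    and R: "\<And>u. u \<in> B \<Longrightarrow> Lp_norm 2 \<Omega> (wgrad \<Omega> u) \<le> R" and e: "0 < e"
  shows "\<exists>N. finite N \<and> N \<subseteq> B \<and> (\<forall>u\<in>B. \<exists>v\<in>N. L2_dist \<Omega> u v \<le> e)"
proof (cases "B = {}")
  case False
  then have R0: "R \<ge> 0" using R Lp2_norm_nonneg order_trans by blast
  have \<Omega>s: "\<Omega> \<in> sets lebesgue" using \<Omega>(1) by (rule sets_lebesgue_open)
  have \<Omega>l: "\<Omega> \<in> lmeasurable" using bounded_set_imp_lmeasurable[OF \<Omega>(2) \<Omega>s] .
  obtain P \<delta> where P: "finite P" "0 < \<delta>" "\<And>K. K \<in> P \<Longrightarrow> K \<subseteq> \<Omega> \<and> (\<exists>a b. K = cbox a b)"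
    "\<And>w. w \<in> H1 \<Omega> \<Longrightarrow> AE x in lebesgue_on \<Omega>. \<bar>w x\<bar> \<le> 1 \<Longrightarrow> Lp_norm 2 \<Omega> (wgrad \<Omega> w) \<le> 2 * R \<Longrightarrow>
       (\<And>K. K \<in> P \<Longrightarrow> \<bar>LINT x|lebesgue_on K. w x\<bar> \<le> \<delta>) \<Longrightarrow> Lp_norm 2 \<Omega> w \<le> e"
    using H1_determined_by_box_averages[OF \<Omega>, of "2 * R" e] R0 e by (metis mult_nonneg_nonneg zero_le_numeral)
  define m where "m u = restrict (\<lambda>K. \<lfloor>(LINT x|lebesgue_on K. u x) / \<delta>\<rfloor>) P" for u :: "'a \<Rightarrow> real"
  have Ks: "K \<in> sets lebesgue" if "K \<in> P" for K using P(3)[OF that] by auto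
  have ui: "integrable (lebesgue_on K) u" if "u \<in> B" "K \<in> P" for u K
  proof (rule integrable_lebesgue_on_subset[OF _ _ \<Omega>s Ks[OF that(2)]])
    have "u \<in> phase_space \<Omega>" using that B by auto
    then show "integrable (lebesgue_on \<Omega>) u"
      by (intro integrable_lebesgue_on_bounded[OF \<Omega>l, of _ 1])
         (auto simp: phase_space_def Lp2_measurable elim: eventually_mono)
  qed (use P(3) that in auto)
  have bound: "(LINT x|lebesgue_on K. u x) \<in> {0..measure lebesgue \<Omega>}" if u: "u \<in> B" and K: "K \<in> P" for u K
  proof -
    have KO: "K \<subseteq> \<Omega>" using P(3)[OF K] by auto
    have Kl: "K \<in> lmeasurable" using P(3)[OF K] by auto
    have "AE x in lebesgue. x \<in> \<Omega> \<longrightarrow> 0 \<le> u x \<and> u x \<le> 1"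
    proof (rule iffD1[OF AE_restrict_space_iff])
      show "AE x in lebesgue_on \<Omega>. 0 \<le> u x \<and> u x \<le> 1" using u B phase_space_bounds by blast
    qed (use \<Omega>s in auto)
    then have ae: "AE x in lebesgue_on K. 0 \<le> u x \<and> u x \<le> 1"
      using Ks[OF K] KO by (auto simp: AE_restrict_space_iff elim: eventually_mono)
    have "(LINT x|lebesgue_on K. u x) \<ge> 0" by (rule integral_nonneg_AE) (use ae in auto)
    moreover have "(LINT x|lebesgue_on K. u x) \<le> (LINT x|lebesgue_on K. 1)"
      by (rule integral_mono_AE[OF ui[OF u K]])
         (use ae finite_measure.integrable_const[OF finite_measure_lebesgue_on[OF Kl]] in auto)
    moreover have "(LINT x|lebesgue_on K. 1) = measure lebesgue K"
      using Ks[OF K] by (simp add: measure_restrict_space)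
    moreover have "measure lebesgue K \<le> measure lebesgue \<Omega>"
      by (rule measure_mono_fmeasurable[OF KO Ks[OF K] \<Omega>l])
    ultimately show ?thesis by auto
  qed
  have "m ` B \<subseteq> (\<Pi>\<^sub>E K\<in>P. {0..\<lfloor>measure lebesgue \<Omega> / \<delta>\<rfloor>})"
    using bound P(2) by (auto simp: m_def PiE_def Pi_def intro!: floor_mono divide_right_mono)
  moreover have "finite (\<Pi>\<^sub>E K\<in>P. {0..\<lfloor>measure lebesgue \<Omega> / \<delta>\<rfloor>})"
    using P(1) by (intro finite_PiE) auto
  ultimately have fin: "finite (m ` B)" using finite_subset by blast
  define N where "N = inv_into B m ` (m ` B)"
  have "L2_dist \<Omega> u (inv_into B m (m u)) \<le> e" if u: "u \<in> B" for u
  proof -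
    define v where "v = inv_into B m (m u)"
    have v: "v \<in> B" "m v = m u" using u by (auto simp: v_def inv_into_into f_inv_into_f)
    have uv: "u \<in> H1 \<Omega>" "v \<in> H1 \<Omega>" "u \<in> phase_space \<Omega>" "v \<in> phase_space \<Omega>" using u v B by auto
    have "Lp_norm 2 \<Omega> (\<lambda>x. u x - v x) \<le> e"
    proof (rule P(4))
      show "(\<lambda>x. u x - v x) \<in> H1 \<Omega>" by (rule H1_diff(1)[OF \<Omega>(1) uv(1,2)])
      show "AE x in lebesgue_on \<Omega>. \<bar>u x - v x\<bar> \<le> 1"
        using phase_space_bounds[OF uv(3)] phase_space_bounds[OF uv(4)] by eventually_elim auto
      note wl = wgrad_Lp2[OF \<Omega>(1) uv(1)] wgrad_Lp2[OF \<Omega>(1) uv(2)]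
      have "Lp_norm 2 \<Omega> (wgrad \<Omega> (\<lambda>x. u x - v x)) = Lp_norm 2 \<Omega> (\<lambda>x. wgrad \<Omega> u x + (-1) *\<^sub>R wgrad \<Omega> v x)"
        by (rule Lp2_norm_cong_AE[OF \<Omega>s Lp2_measurable[OF wgrad_Lp2[OF \<Omega>(1) H1_diff(1)[OF \<Omega>(1) uv(1,2)]]]])
           (use H1_diff(2)[OF \<Omega>(1) uv(1,2)] in simp)
      also have "\<dots> \<le> Lp_norm 2 \<Omega> (wgrad \<Omega> u) + Lp_norm 2 \<Omega> (\<lambda>x. (-1) *\<^sub>R wgrad \<Omega> v x)"
        by (rule Lp2_norm_triangle[OF wl(1) Lp2_scaleR[OF wl(2)]])
      also have "\<dots> \<le> 2 * R" using R[OF u] R[OF v(1)] unfolding Lp2_norm_scaleR by simp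
      finally show "Lp_norm 2 \<Omega> (wgrad \<Omega> (\<lambda>x. u x - v x)) \<le> 2 * R" .
      fix K assume K: "K \<in> P"
      have "m u K = m v K" using v by simp
      then have "\<lfloor>(LINT x|lebesgue_on K. u x) / \<delta>\<rfloor> = \<lfloor>(LINT x|lebesgue_on K. v x) / \<delta>\<rfloor>" using K by (simp add: m_def)
      then have "\<bar>(LINT x|lebesgue_on K. u x) / \<delta> - (LINT x|lebesgue_on K. v x) / \<delta>\<bar> \<le> 1" by linarith
      then have "\<bar>(LINT x|lebesgue_on K. u x) - (LINT x|lebesgue_on K. v x)\<bar> \<le> \<delta>"
        using P(2) by (simp add: diff_divide_distrib[symmetric] abs_divide divide_le_eq)
      then show "\<bar>LINT x|lebesgue_on K. u x - v x\<bar> \<le> \<delta>"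
        using ui[OF u K] ui[OF v(1) K] by simp
    qed
    then show ?thesis by (simp add: L2_dist_def v_def)
  qed
  moreover have "finite N" "N \<subseteq> B" using fin by (auto simp: N_def inv_into_into)
  ultimately show ?thesis by (intro exI[of _ N]) (auto simp: N_def)
qed auto

section \<open>Completeness and compactness in the phase space\<close>

lemma phase_space_complete:
  fixes \<Omega> :: "'a::euclidean_space set"
  assumes \<Omega>: "\<Omega> \<in> lmeasurable" and v: "\<And>n. v n \<in> phase_space \<Omega>"
    and d: "\<And>n. L2_dist \<Omega> (v n) (v (Suc n)) \<le> (1/2) ^ n"
  shows "\<exists>u\<in>phase_space \<Omega>. (\<lambda>n. L2_dist \<Omega> (v n) u) \<longlonglongrightarrow> 0"
proof -
  have \<Omega>s: "\<Omega> \<in> sets lebesgue" using \<Omega> by auto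
  let ?M = "lebesgue_on \<Omega>"
  define S where "S = sqrt (measure lebesgue \<Omega>)"
  have vL: "v n \<in> Lp 2 \<Omega>" for n using v phase_space_Lp2 by auto
  have [measurable]: "v n \<in> borel_measurable ?M" for n using Lp2_measurable[OF vL] .
  \<comment> \<open>The increments are summable in L1, hence their series converges almost
    everywhere and the sequence has a pointwise limit. The bounds 0 and 1 pass to the limit and
    supply the majorant for convergence in L2.\<close>
  have L1: "(\<integral>\<^sup>+x. ennreal \<bar>v n x - v (Suc n) x\<bar> \<partial>?M) \<le> ennreal (S * (1/2) ^ n)" for n
  proof -
    have "(\<lambda>x. v n x - v (Suc n) x) \<in> Lp 2 \<Omega>" by (rule Lp2_diff[OF vL vL])
    from L1_norm_le_Lp2_norm[OF \<Omega> this]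
    have "(LINT x|?M. \<bar>v n x - v (Suc n) x\<bar>) \<le> L2_dist \<Omega> (v n) (v (Suc n)) * S"
      by (simp add: L2_dist_def S_def)
    also have "\<dots> \<le> (1/2) ^ n * S" using d by (intro mult_right_mono) (auto simp: S_def)
    finally have le: "(LINT x|?M. \<bar>v n x - v (Suc n) x\<bar>) \<le> S * (1/2) ^ n" by (simp add: mult.commute)
    have "integrable ?M (\<lambda>x. v n x - v (Suc n) x)"
    proof (rule integrable_lebesgue_on_bounded[OF \<Omega>, of _ 1])
      show "AE x in ?M. \<bar>v n x - v (Suc n) x\<bar> \<le> 1"
        using phase_space_bounds[OF v[of n]] phase_space_bounds[OF v[of "Suc n"]] by eventually_elim auto
    qed measurable
    then have "(\<integral>\<^sup>+x. ennreal \<bar>v n x - v (Suc n) x\<bar> \<partial>?M) = ennreal (LINT x|?M. \<bar>v n x - v (Suc n) x\<bar>)"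
      by (intro nn_integral_eq_integral) auto
    then show ?thesis using le by (simp add: ennreal_leI)
  qed
  have "(\<integral>\<^sup>+x. (\<Sum>n. ennreal \<bar>v n x - v (Suc n) x\<bar>) \<partial>?M) = (\<Sum>n. \<integral>\<^sup>+x. ennreal \<bar>v n x - v (Suc n) x\<bar> \<partial>?M)"
    by (rule nn_integral_suminf) measurable
  also have "\<dots> \<le> (\<Sum>n. ennreal (S * (1/2) ^ n))" by (intro suminf_le L1) auto
  also have "\<dots> = ennreal (\<Sum>n. S * (1/2) ^ n)"
    by (intro suminf_ennreal2) (auto simp: S_def intro!: summable_mult summable_geometric)
  also have "\<dots> < \<infinity>" by simp
  finally have "AE x in ?M. (\<Sum>n. ennreal \<bar>v n x - v (Suc n) x\<bar>) \<noteq> \<infinity>"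
    by (intro nn_integral_PInf_AE) auto
  then have conv: "AE x in ?M. convergent (\<lambda>n. v n x)"
  proof eventually_elim
    case (elim x)
    then have "summable (\<lambda>n. \<bar>v n x - v (Suc n) x\<bar>)" by (intro summable_suminf_not_top) auto
    then have "summable (\<lambda>n. \<bar>v (Suc n) x - v n x\<bar>)" by (subst abs_minus_commute)
    then have "summable (\<lambda>n. v (Suc n) x - v n x)" by (rule summable_rabs_cancel)
    then have "convergent (\<lambda>n. \<Sum>i<n. v (Suc i) x - v i x)" by (simp add: summable_iff_convergent)
    then have "convergent (\<lambda>n. v n x - v 0 x)" using sum_lessThan_telescope[of "\<lambda>n. v n x"] by simp
    then show ?case using convergent_add[OF _ convergent_const[of "v 0 x"], of "\<lambda>n. v n x - v 0 x"] by simp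
  qed
  define u where "u x = lim (\<lambda>n. v n x)" for x
  have um[measurable]: "u \<in> borel_measurable ?M" unfolding u_def by measurable
  have lim: "AE x in ?M. (\<lambda>n. v n x) \<longlonglongrightarrow> u x"
    using conv by eventually_elim (simp add: u_def convergent_LIMSEQ_iff)
  have bd: "AE x in ?M. \<forall>n. 0 \<le> v n x \<and> v n x \<le> 1"
    using phase_space_bounds[OF v] by (simp add: AE_all_countable)
  have ub: "AE x in ?M. 0 \<le> u x \<and> u x \<le> 1"
    using lim bd
    by eventually_elim (auto intro: LIMSEQ_le_const LIMSEQ_le_const2)
  have "integrable ?M (\<lambda>x. (norm (u x))\<^sup>2)"
  proof (rule integrable_lebesgue_on_bounded[OF \<Omega>, of _ 1])
    show "AE x in ?M. \<bar>(norm (u x))\<^sup>2\<bar> \<le> 1"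
      using ub by eventually_elim (simp add: power_le_one)
  qed measurable
  then have up: "u \<in> phase_space \<Omega>" using um ub by (simp add: phase_space_def Lp2_iff)
  have "(\<lambda>n. LINT x|?M. (norm (v n x - u x))\<^sup>2) \<longlonglongrightarrow> (LINT x|?M. 0)"
  proof (rule integral_dominated_convergence[where w = "\<lambda>_. 1"])
    show "integrable ?M (\<lambda>_. 1::real)"
      using finite_measure.integrable_const[OF finite_measure_lebesgue_on[OF \<Omega>]] .
    show "AE x in ?M. (\<lambda>n. (norm (v n x - u x))\<^sup>2) \<longlonglongrightarrow> 0"
      using lim by eventually_elim (auto intro!: tendsto_eq_intros)
    show "AE x in ?M. norm ((norm (v n x - u x))\<^sup>2) \<le> 1" for n
      using bd ub
    proof eventually_elim
      case (elim x)
      then have "0 \<le> v n x" "v n x \<le> 1" "0 \<le> u x" "u x \<le> 1" by auto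
      then have "\<bar>v n x - u x\<bar> \<le> 1" by auto
      then show ?case by (simp add: abs_square_le_1)
    qed
  qed auto
  then have "(\<lambda>n. sqrt (LINT x|?M. (norm (v n x - u x))\<^sup>2)) \<longlonglongrightarrow> sqrt 0"
    by (intro tendsto_real_sqrt) simp
  then show ?thesis using up by (intro bexI[of _ u]) (simp_all add: L2_dist_def Lp2_norm_eq)
qed

text \<open>Total boundedness and completeness give compactness, here for a pseudometric on
  representatives. A set without finite subcover contains another one of arbitrarily small diameter;
  points picked from a nested sequence of such sets converge to a limit whose neighbourhood in the
  cover already swallows one of them.\<close>

lemma compactin_L2_closure:
  fixes \<Omega> :: "'a::euclidean_space set"
  assumes \<Omega>: "\<Omega> \<in> lmeasurable" and A0: "A0 \<subseteq> phase_space \<Omega>"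
    and tb: "\<And>e. e > 0 \<Longrightarrow> \<exists>N. finite N \<and> N \<subseteq> phase_space \<Omega> \<and> (\<forall>u\<in>A0. \<exists>v\<in>N. L2_dist \<Omega> u v \<le> e)"
  shows "compactin (L2_topology \<Omega>) {u \<in> phase_space \<Omega>. \<forall>e>0. \<exists>v\<in>A0. L2_dist \<Omega> u v < e}"
    (is "compactin _ ?A")
proof -
  have ps: "phase_space \<Omega> \<subseteq> Lp 2 \<Omega>" using phase_space_Lp2 by auto
  have "openin (L2_topology \<Omega>) (Lp 2 \<Omega>)" unfolding openin_L2_topology by (auto intro: exI[of _ 1])
  then have top: "Lp 2 \<Omega> \<subseteq> topspace (L2_topology \<Omega>)" by (rule openin_subset)
  have "\<exists>F. finite F \<and> F \<subseteq> U \<and> ?A \<subseteq> \<Union>F"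
    if U: "\<forall>X\<in>U. openin (L2_topology \<Omega>) X" "?A \<subseteq> \<Union>U" for U
  proof (rule ccontr)
    assume no: "\<not> ?thesis"
    define bad where "bad B \<longleftrightarrow> B \<subseteq> ?A \<and> (\<nexists>F. finite F \<and> F \<subseteq> U \<and> B \<subseteq> \<Union>F)" for B
    have step: "\<exists>B'. bad B' \<and> B' \<subseteq> B \<and> (\<forall>x\<in>B'. \<forall>y\<in>B'. L2_dist \<Omega> x y \<le> e)"
      if B: "bad B" and e: "e > 0" for B e
    proof -
      \<comment> \<open>One e/4 is spent on passing from the closure to \<open>A0\<close> and
        another on the net; the pieces then have radius e/2 and diameter at most e.\<close>
      obtain N where N: "finite N" "N \<subseteq> phase_space \<Omega>" "\<forall>u\<in>A0. \<exists>v\<in>N. L2_dist \<Omega> u v \<le> e / 4"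
        using tb[of "e / 4"] e by auto
      define C where "C v = {u \<in> B. L2_dist \<Omega> u v \<le> e / 2}" for v
      have cover: "B \<subseteq> (\<Union>v\<in>N. C v)"
      proof
        fix u assume u: "u \<in> B"
        then have uA: "u \<in> ?A" using B by (auto simp: bad_def)
        then obtain a where a: "a \<in> A0" "L2_dist \<Omega> u a < e / 4" using e by (auto dest!: spec[of _ "e / 4"])
        obtain v where v: "v \<in> N" "L2_dist \<Omega> a v \<le> e / 4" using N a by auto
        have "L2_dist \<Omega> u v \<le> L2_dist \<Omega> u a + L2_dist \<Omega> a v"
          using uA a v A0 N(2) ps by (intro L2_dist_triangle) auto
        then show "u \<in> (\<Union>v\<in>N. C v)" using a v u by (auto simp: C_def intro!: bexI[of _ v])
      qed
      have "\<exists>v\<in>N. bad (C v)"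
      proof (rule ccontr)
        assume "\<not> ?thesis"
        moreover have "C v \<subseteq> B" for v by (auto simp: C_def)
        ultimately have "\<forall>v\<in>N. \<exists>F. finite F \<and> F \<subseteq> U \<and> C v \<subseteq> \<Union>F"
          using B unfolding bad_def by (meson order_trans)
        then obtain F where F: "\<forall>v\<in>N. finite (F v) \<and> F v \<subseteq> U \<and> C v \<subseteq> \<Union>(F v)" by metis
        have "B \<subseteq> \<Union>(\<Union>v\<in>N. F v)"
        proof
          fix x assume "x \<in> B"
          then obtain v where "v \<in> N" "x \<in> C v" using cover by blast
          then obtain X where "X \<in> F v" "x \<in> X" using F by (meson UnionE subsetD)
          then show "x \<in> \<Union>(\<Union>v\<in>N. F v)" using \<open>v \<in> N\<close> by auto
        qed
        moreover have "finite (\<Union>v\<in>N. F v)" "(\<Union>v\<in>N. F v) \<subseteq> U" using F N(1) by auto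
        ultimately show False using B unfolding bad_def by blast
      qed
      then obtain v where v: "v \<in> N" "bad (C v)" by auto
      have "L2_dist \<Omega> x y \<le> e" if "x \<in> C v" "y \<in> C v" for x y
      proof -
        have "L2_dist \<Omega> x y \<le> L2_dist \<Omega> x v + L2_dist \<Omega> v y"
          using that v N(2) B ps by (intro L2_dist_triangle) (auto simp: C_def bad_def)
        then show ?thesis using that L2_dist_commute[of \<Omega> v y] by (auto simp: C_def)
      qed
      then show ?thesis using v by (intro exI[of _ "C v"]) (auto simp: C_def)
    qed
    have "bad ?A" using no by (auto simp: bad_def)
    have "\<exists>B. \<forall>n. (bad (B n) \<and> (\<forall>x\<in>B n. \<forall>y\<in>B n. L2_dist \<Omega> x y \<le> (1/2) ^ n)) \<and> B (Suc n) \<subseteq> B n"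
    proof (rule dependent_nat_choice)
      show "\<exists>B. bad B \<and> (\<forall>x\<in>B. \<forall>y\<in>B. L2_dist \<Omega> x y \<le> (1/2) ^ 0)"
        using step[OF \<open>bad ?A\<close>, of 1] by auto
      fix B n assume "bad B \<and> (\<forall>x\<in>B. \<forall>y\<in>B. L2_dist \<Omega> x y \<le> (1/2) ^ n)"
      then show "\<exists>B'. (bad B' \<and> (\<forall>x\<in>B'. \<forall>y\<in>B'. L2_dist \<Omega> x y \<le> (1/2) ^ Suc n)) \<and> B' \<subseteq> B"
        using step[of B "(1/2) ^ Suc n"] by auto
    qed
    then obtain B where B: "\<And>n. bad (B n)" "\<And>n x y. x \<in> B n \<Longrightarrow> y \<in> B n \<Longrightarrow> L2_dist \<Omega> x y \<le> (1/2) ^ n"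
      "\<And>n. B (Suc n) \<subseteq> B n" by metis
    have "B n \<noteq> {}" for n using B(1)[of n] unfolding bad_def by (metis empty_subsetI finite.emptyI)
    then have "\<forall>n. \<exists>x. x \<in> B n" by blast
    then obtain v where v: "\<And>n. v n \<in> B n" by metis
    have vA: "v n \<in> ?A" for n using v[of n] B(1)[of n] unfolding bad_def by blast
    then have vp: "v n \<in> phase_space \<Omega>" for n by auto
    have "L2_dist \<Omega> (v n) (v (Suc n)) \<le> (1/2) ^ n" for n
      using B(2)[of "v n" n "v (Suc n)"] v[of n] v[of "Suc n"] B(3)[of n] by auto
    then obtain u where u: "u \<in> phase_space \<Omega>" "(\<lambda>n. L2_dist \<Omega> (v n) u) \<longlonglongrightarrow> 0"
      using phase_space_complete[of \<Omega> v, OF \<Omega> vp] by auto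
    have "u \<in> ?A"
    proof (intro CollectI conjI allI impI u)
      fix e :: real assume e: "e > 0"
      obtain n where n: "L2_dist \<Omega> (v n) u < e / 2"
        using order_tendstoD(2)[OF u(2), of "e / 2"] e by (auto simp: eventually_sequentially)
      obtain a where a: "a \<in> A0" "L2_dist \<Omega> (v n) a < e / 2" using vA[of n] e by (auto dest!: spec[of _ "e / 2"])
      have "L2_dist \<Omega> u a \<le> L2_dist \<Omega> u (v n) + L2_dist \<Omega> (v n) a"
        using u vp a A0 ps by (intro L2_dist_triangle) auto
      then show "\<exists>a\<in>A0. L2_dist \<Omega> u a < e"
        using n a L2_dist_commute[of \<Omega> u "v n"] by (intro bexI[of _ a]) auto
    qed
    then obtain X where X: "X \<in> U" "u \<in> X" using U by auto
    then obtain e where e: "e > 0" "\<forall>w\<in>Lp 2 \<Omega>. L2_dist \<Omega> w u < e \<longrightarrow> w \<in> X"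
      using U(1) unfolding openin_L2_topology by meson
    have ev: "eventually (\<lambda>n. L2_dist \<Omega> (v n) u < e / 2 \<and> (1/2::real) ^ n < e / 2) sequentially"
      using order_tendstoD(2)[OF u(2), of "e / 2"] order_tendstoD(2)[OF LIMSEQ_power_zero[of "1/2::real"], of "e / 2"] e(1)
      by (auto intro: eventually_conj)
    then obtain n where n: "L2_dist \<Omega> (v n) u < e / 2" "(1/2::real) ^ n < e / 2"
      by (auto simp: eventually_sequentially)
    have "B n \<subseteq> X"
    proof
      fix w assume w: "w \<in> B n"
      then have wp: "w \<in> phase_space \<Omega>" using B(1)[of n] by (auto simp: bad_def)
      have "L2_dist \<Omega> w u \<le> L2_dist \<Omega> w (v n) + L2_dist \<Omega> (v n) u"
        using wp vp u ps by (intro L2_dist_triangle) auto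
      then have "L2_dist \<Omega> w u < e" using B(2)[OF w v] n by linarith
      then show "w \<in> X" using e wp ps by auto
    qed
    then have "\<exists>F. finite F \<and> F \<subseteq> U \<and> B n \<subseteq> \<Union>F" using X by (intro exI[of _ "{X}"]) auto
    then show False using B(1)[of n] by (simp add: bad_def)
  qed
  then show ?thesis using top ps unfolding compactin_def by auto
qed

section \<open>Functions of time\<close>

lemma integral_indicator_greaterThanLessThan:
  assumes "0 \<le> (l::real)" "p \<le> q"
  shows "integral {0..l} (indicator {p<..<q}) = max 0 (min l q) - max 0 (min l p)"
proof -
  have "integral {0..l} (indicat_real {p<..<q}) = measure lebesgue ({p<..<q} \<inter> {0..l})"
    by (intro integral_indicator) auto
  also have "\<dots> = measure lebesgue ({max 0 p..min l q})"
  proof (rule antisym)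
    show "measure lebesgue ({p<..<q} \<inter> {0..l}) \<le> measure lebesgue ({max 0 p..min l q})"
      by (rule measure_mono_fmeasurable) auto
    have "measure lebesgue ({max 0 p..min l q}) = measure lebesgue ({max 0 p<..<min l q})"
      by (cases "max 0 p \<le> min l q") auto
    also have "\<dots> \<le> measure lebesgue ({p<..<q} \<inter> {0..l})"
      by (rule measure_mono_fmeasurable) auto
    finally show "measure lebesgue ({max 0 p..min l q}) \<le> measure lebesgue ({p<..<q} \<inter> {0..l})" .
  qed
  also have "\<dots> = max 0 (min l q) - max 0 (min l p)"
    using assms by (cases "max 0 p \<le> min l q") (auto simp: max_def min_def)
  finally show ?thesis .
qed

lemma integral_average_tendsto:
  fixes y :: "real \<Rightarrow> real"
  assumes y: "continuous_on {a..b} y" and "a < b"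
  shows "(\<lambda>n. integral {a..a + (b - a) / real (Suc n)} y * (real (Suc n) / (b - a))) \<longlonglongrightarrow> y a"
proof -
  have "((\<lambda>x. integral {a..x} y) has_real_derivative y a) (at a within {a..b})"
    by (rule integral_has_real_derivative[OF y]) (use \<open>a < b\<close> in auto)
  then have lim: "((\<lambda>z. (integral {a..z} y - integral {a..a} y) / (z - a)) \<longlongrightarrow> y a) (at a within {a..b})"
    by (simp add: has_field_derivative_iff)
  have "filterlim (\<lambda>n. a + (b - a) / real (Suc n)) (at a within {a..b}) sequentially"
    unfolding filterlim_at
  proof
    have "(\<lambda>n. a + (b - a) * inverse (real (Suc n))) \<longlonglongrightarrow> a + (b - a) * 0"
      by (intro tendsto_intros LIMSEQ_inverse_real_of_nat)
    then show "(\<lambda>n. a + (b - a) / real (Suc n)) \<longlonglongrightarrow> a" by (simp add: divide_inverse)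
    show "\<forall>\<^sub>F n in sequentially. a + (b - a) / real (Suc n) \<in> {a..b} \<and> a + (b - a) / real (Suc n) \<noteq> a"
    proof (intro always_eventually allI)
      fix n
      have "(b - a) / real (Suc n) \<le> (b - a) / 1" using \<open>a < b\<close> by (intro divide_left_mono) auto
      moreover have "(b - a) / real (Suc n) > 0" using \<open>a < b\<close> by simp
      ultimately show "a + (b - a) / real (Suc n) \<in> {a..b} \<and> a + (b - a) / real (Suc n) \<noteq> a" by simp
    qed
  qed
  from filterlim_compose[OF lim this] show ?thesis by (simp add: field_simps)
qed

text \<open>A distributional time derivative is a weak gradient on the half line, so
  \<open>weak_gradient_box_difference\<close> applies in dimension one. With the shift t - s and
  intervals of length 1/(n+1) it compares averages of \<open>y\<close> just after t and just after
  s, and continuity turns these averages into values.\<close>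

lemma weak_derivative_integral:
  fixes y f :: "real \<Rightarrow> real"
  assumes y: "continuous_on {0<..} y"
    and f: "\<And>a b. 0 < a \<Longrightarrow> a < b \<Longrightarrow> integrable (lebesgue_on {a..b}) f"
    and w: "\<And>\<eta>. test_function {0<..} \<eta> \<Longrightarrow>
      (LINT t|lebesgue_on {0<..}. y t * deriv \<eta> t) = - (LINT t|lebesgue_on {0<..}. f t * \<eta> t)"
    and s: "0 < s" "s < t"
  shows "f integrable_on {s..t}" "y t - y s = integral {s..t} f"
proof -
  have cpt: "\<exists>a b. 0 < a \<and> a < b \<and> C \<subseteq> {a..b}" if C: "compact C" "C \<subseteq> {0<..}" for C :: "real set"
  proof (cases "C = {}")
    case True
    then show ?thesis by (intro exI[of _ 1] exI[of _ 2]) auto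
  next
    case False
    obtain m where m: "m \<in> C" "\<And>x. x \<in> C \<Longrightarrow> m \<le> x" using compact_attains_inf[OF C(1) False] by auto
    obtain M where M: "M \<in> C" "\<And>x. x \<in> C \<Longrightarrow> x \<le> M" using compact_attains_sup[OF C(1) False] by auto
    have "0 < m" "m \<le> M" using m M C(2) by auto
    moreover have "C \<subseteq> {m..M + 1}" using m(2) M(2) by fastforce
    ultimately show ?thesis by (intro exI[of _ m] exI[of _ "M + 1"]) auto
  qed
  have Cs: "C \<in> sets lebesgue" if "compact C" for C :: "real set"
    using that by (simp add: borel_compact sets_completionI_sets)
  have lf: "locally_integrable {0<..} f"
    unfolding locally_integrable_def
  proof (intro allI impI, elim conjE)
    fix C :: "real set" assume C: "compact C" "C \<subseteq> {0<..}"
    obtain a b where ab: "0 < a" "a < b" "C \<subseteq> {a..b}" using cpt[OF C] by auto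
    show "integrable (lebesgue_on C) f"
      by (rule integrable_lebesgue_on_subset[OF f[OF ab(1,2)] ab(3)]) (use Cs[OF C(1)] in auto)
  qed
  have ly: "locally_integrable {0<..} y"
    unfolding locally_integrable_def
  proof (intro allI impI, elim conjE)
    fix C :: "real set" assume C: "compact C" "C \<subseteq> {0<..}"
    obtain a b where ab: "0 < a" "a < b" "C \<subseteq> {a..b}" using cpt[OF C] by auto
    have "integrable (lebesgue_on {a..b}) y"
      by (rule continuous_imp_integrable_real[OF continuous_on_subset[OF y]]) (use ab in auto)
    then show "integrable (lebesgue_on C) y"
      by (rule integrable_lebesgue_on_subset[OF _ ab(3)]) (use Cs[OF C(1)] in auto)
  qed
  have wg: "weak_gradient {0<..} y f"
    unfolding weak_gradient_def
  proof (intro conjI lf ly allI impI ballI)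
    fix \<phi> :: "real \<Rightarrow> real" and i :: real assume \<phi>: "test_function {0<..} \<phi>" and i: "i \<in> Basis"
    have "Ck 1 \<phi>" using \<phi> by (auto simp: test_function_def simp del: Ck.simps)
    then have "\<phi> differentiable at x" for x by (auto simp: differentiable_on_def)
    then have "frechet_derivative \<phi> (at x) i = deriv \<phi> x" for x
      using i by (metis Basis_real_def DERIV_deriv_iff_real_differentiable frechet_derivative_at
          has_field_derivative_imp_has_derivative mult.right_neutral singletonD)
    then show "(LINT x|lebesgue_on {0<..}. y x * frechet_derivative \<phi> (at x) i) =
        - (LINT x|lebesgue_on {0<..}. f x \<bullet> i * \<phi> x)"
      using w[OF \<phi>] i by simp
  qed
  define l where "l = t - s"
  have l: "l > 0" using s by (simp add: l_def)
  define \<delta> where "\<delta> n = 1 / real (Suc n)" for n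
  have \<delta>: "0 < \<delta> n" "\<delta> n \<le> 1" for n by (auto simp: \<delta>_def)
  define cl where "cl z = max 0 (min l z)" for z
  \<comment> \<open>For small \<delta> this weight is a trapezoid: it rises from 0 to 1 on
    [s, s + \<delta>] and falls on [t, t + \<delta>]. Writing it through the clamp \<open>cl\<close>
    makes continuity and the bound by 1 immediate; its limit is the indicator of
    \<open>{s<..t}\<close>.\<close>
  define h where "h n x = (cl (x - s) - cl (x - s - \<delta> n)) * real (Suc n)" for n x
  have inth: "integral {0..l} (\<lambda>r. indicator {s<..<s + \<delta> n} (x - r)) = cl (x - s) - cl (x - s - \<delta> n)" for n x
  proof -
    have "(\<lambda>r. indicat_real {s<..<s + \<delta> n} (x - r)) = indicator {x - s - \<delta> n<..<x - s}"
      by (auto simp: indicator_def fun_eq_iff)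
    then show ?thesis
      using integral_indicator_greaterThanLessThan[of l "x - s - \<delta> n" "x - s"] l \<delta>[of n] by (simp add: cl_def)
  qed
  have key: "(LINT x|lebesgue_on {0<..}. y x * (indicator {s<..<s + \<delta> n} (x - l) - indicator {s<..<s + \<delta> n} x)) * real (Suc n)
      = (LINT x|lebesgue_on {0<..}. f x * h n x)" for n
  proof -
    have "cbox s (s + \<delta> n + l *\<^sub>R 1) \<subseteq> {0<..}" using s by auto
    then have "(LINT x|lebesgue_on {0<..}. y x * (indicator {s<..<s + \<delta> n} (x - l) - indicator {s<..<s + \<delta> n} x))
      = (LINT x|lebesgue_on {0<..}. f x * (cl (x - s) - cl (x - s - \<delta> n)))"
      using weak_gradient_box_difference[OF wg, of 1 l s "s + \<delta> n"] l
      by (simp add: inth)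
    then show ?thesis by (simp add: h_def mult.assoc[symmetric])
  qed
  have clb: "0 \<le> cl p - cl (p - d) \<and> cl p - cl (p - d) \<le> d" if "0 \<le> d" for p d
    using that by (auto simp: cl_def max_def min_def)
  have R: "(\<lambda>n. LINT x|lebesgue_on {0<..}. f x * h n x) \<longlonglongrightarrow> (LINT x|lebesgue_on {0<..}. f x * indicator {s<..t} x)"
  proof (rule tendsto_integral_times_bounded[OF lf, where C = "{s..t + 1}" and M = 1])
    show "h n x = 0" if "x \<notin> {s..t + 1}" for n x
      using that \<delta>[of n] l by (auto simp: h_def cl_def l_def max_def min_def)
    show "continuous_on UNIV (h n)" for n unfolding h_def cl_def by (intro continuous_intros)
    show "\<bar>h n x\<bar> \<le> 1" for n x
    proof -
      have "0 \<le> h n x" unfolding h_def using clb[of "\<delta> n" "x - s"] \<delta>[of n] by (intro mult_nonneg_nonneg) auto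
      moreover have "h n x \<le> \<delta> n * real (Suc n)"
        unfolding h_def using clb[of "\<delta> n" "x - s"] \<delta>[of n] by (intro mult_right_mono) auto
      moreover have "\<delta> n * real (Suc n) = 1" by (simp add: \<delta>_def)
      ultimately show ?thesis by simp
    qed
    show "(\<lambda>n. h n x) \<longlonglongrightarrow> indicator {s<..t} x" for x
    proof (rule tendsto_eventually)
      have d0: "\<delta> \<longlonglongrightarrow> 0" unfolding \<delta>_def using LIMSEQ_inverse_real_of_nat by (simp add: divide_inverse)
      consider "x \<le> s" | "s < x" "x \<le> t" | "t < x" by linarith
      then show "\<forall>\<^sub>F n in sequentially. h n x = indicator {s<..t} x"
      proof cases
        case 1
        then show ?thesis using \<delta>(1) by (auto simp: h_def cl_def max_def min_def intro!: always_eventually)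
           (smt (verit, best))+
      next
        case 2
        have "\<forall>\<^sub>F n in sequentially. \<delta> n < x - s" using order_tendstoD(2)[OF d0] 2 by auto
        then show ?thesis
        proof eventually_elim
          case (elim n)
          then have "h n x = \<delta> n * real (Suc n)" using 2 \<delta>[of n] by (auto simp: h_def cl_def l_def max_def min_def)
          then show ?case using 2 by (simp add: \<delta>_def)
        qed
      next
        case 3
        have "\<forall>\<^sub>F n in sequentially. \<delta> n < x - t" using order_tendstoD(2)[OF d0] 3 by auto
        then show ?thesis
          by eventually_elim (use 3 l in \<open>auto simp: h_def cl_def l_def max_def min_def\<close>)
      qed
    qed
  qed (use s in auto)
  have fR: "(LINT x|lebesgue_on {0<..}. f x * indicator {s<..t} x) = integral {s..t} f"
  proof -
    have "(LINT x|lebesgue_on {0<..}. f x * indicator {s<..t} x) = (LINT x|lebesgue_on {s<..t}. f x * indicator {s<..t} x)"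
      by (rule integral_lebesgue_on_vanish) (use s in auto)
    also have "\<dots> = (LINT x|lebesgue_on {s<..t}. f x)" by (intro Bochner_Integration.integral_cong) auto
    also have "\<dots> = integral {s<..t} f"
      by (rule lebesgue_integral_eq_integral[OF integrable_lebesgue_on_subset[OF f[OF s]]]) auto
    also have "\<dots> = integral {s..t} f"
      by (rule integral_spike_set) (auto intro: negligible_subset[of "{s}"])
    finally show ?thesis .
  qed
  have yint: "(LINT x|lebesgue_on {0<..}. y x * indicator {a<..<a + \<delta> n} x) = integral {a..a + \<delta> n} y"
    "integrable (lebesgue_on {0<..}) (\<lambda>x. y x * indicator {a<..<a + \<delta> n} x)"
    if "a > 0" for a n
  proof -
    have i: "integrable (lebesgue_on {a..a + \<delta> n}) y"
      by (rule continuous_imp_integrable_real[OF continuous_on_subset[OF y]]) (use that in auto)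
    have i2: "integrable (lebesgue_on {a<..<a + \<delta> n}) y"
      by (rule integrable_lebesgue_on_subset[OF i]) auto
    have "(LINT x|lebesgue_on {0<..}. y x * indicator {a<..<a + \<delta> n} x) = (LINT x|lebesgue_on {a<..<a + \<delta> n}. y x * indicator {a<..<a + \<delta> n} x)"
      by (rule integral_lebesgue_on_vanish) (use that in auto)
    also have "\<dots> = (LINT x|lebesgue_on {a<..<a + \<delta> n}. y x)" by (intro Bochner_Integration.integral_cong) auto
    also have "\<dots> = integral {a<..<a + \<delta> n} y"
      by (rule lebesgue_integral_eq_integral[OF i2]) auto
    also have "\<dots> = integral {a..a + \<delta> n} y"
      using integral_open_interval[of a "a + \<delta> n" y] by simp
    finally show "(LINT x|lebesgue_on {0<..}. y x * indicator {a<..<a + \<delta> n} x) = integral {a..a + \<delta> n} y" .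
    have "integrable lebesgue (\<lambda>x. indicator {a<..<a + \<delta> n} x *\<^sub>R y x)"
      using i2 by (simp add: integrable_restrict_space)
    also have "(\<lambda>x. indicator {a<..<a + \<delta> n} x *\<^sub>R y x) = (\<lambda>x. indicator {0<..} x *\<^sub>R (y x * indicator {a<..<a + \<delta> n} x))"
      using that by (auto simp: indicator_def fun_eq_iff)
    finally show "integrable (lebesgue_on {0<..}) (\<lambda>x. y x * indicator {a<..<a + \<delta> n} x)"
      by (simp add: integrable_restrict_space)
  qed
  have Leq: "(LINT x|lebesgue_on {0<..}. y x * (indicator {s<..<s + \<delta> n} (x - l) - indicator {s<..<s + \<delta> n} x))
      = integral {t..t + \<delta> n} y - integral {s..s + \<delta> n} y" for n
  proof -
    have "(indicat_real {s<..<s + \<delta> n} (x - l)) = indicator {t<..<t + \<delta> n} x" for x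
      by (auto simp: indicator_def l_def)
    then show ?thesis using yint[of t n] yint[of s n] s by (simp add: right_diff_distrib)
  qed
  have av: "(\<lambda>n. integral {a..a + \<delta> n} y * real (Suc n)) \<longlonglongrightarrow> y a" if "a > 0" for a
    using integral_average_tendsto[of a "a + 1" y] continuous_on_subset[OF y, of "{a..a + 1}"] that
    by (simp add: \<delta>_def subset_iff)
  have "(\<lambda>n. (integral {t..t + \<delta> n} y - integral {s..s + \<delta> n} y) * real (Suc n)) \<longlonglongrightarrow> y t - y s"
    unfolding left_diff_distrib using s by (intro tendsto_diff av) auto
  then show "y t - y s = integral {s..t} f"
    using LIMSEQ_unique R unfolding key[symmetric] Leq fR by blast
  show "f integrable_on {s..t}" using f[OF s] by (intro integrable_on_lebesgue_on) auto
qed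

section \<open>Testing an evolution with itself\<close>

lemma integral_le_off_negligible:
  fixes f g :: "real \<Rightarrow> real"
  assumes f: "f integrable_on S" and g: "g integrable_on S" and Z: "negligible Z"
    and le: "\<And>x. x \<in> S - Z \<Longrightarrow> f x \<le> g x"
  shows "integral S f \<le> integral S g"
proof -
  define f' where "f' x = (if x \<in> Z then g x else f x)" for x
  have "f' integrable_on S" by (rule integrable_spike[OF f Z]) (auto simp: f'_def)
  moreover have "integral S f' = integral S f" by (rule integral_spike[OF Z]) (auto simp: f'_def)
  ultimately show ?thesis using integral_le[of f' S g] g le by (auto simp: f'_def)
qed

text \<open>Folding [0, nh] onto one cell: integrating grid sums over all offsets of the grid
  recovers the full integral. A function with small integral therefore has a small sum on some
  grid.\<close>

lemma has_integral_periodic_sum: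
  fixes e :: "real \<Rightarrow> real"
  assumes "0 \<le> h" "e integrable_on {0..real n * h}"
  shows "((\<lambda>r. \<Sum>k<n. e (r + real k * h)) has_integral integral {0..real n * h} e) {0..h}"
  using assms(2)
proof (induction n)
  case (Suc n)
  have le: "real n * h \<le> real (Suc n) * h" using assms(1) by (intro mult_right_mono) auto
  have i1: "e integrable_on {0..real n * h}" and i2: "e integrable_on {real n * h..real (Suc n) * h}"
    using integrable_on_subinterval[OF Suc.prems] le assms(1) by auto
  have "(e has_integral integral {real n * h..real (Suc n) * h} e) {real n * h..real (Suc n) * h}"
    using i2 by (rule integrable_integral)
  then have A: "((\<lambda>r. e (r + real n * h)) has_integral integral {real n * h..real (Suc n) * h} e) {0..h}"
    using has_integral_shift_real_ivl[of e _ "real n * h" "real (Suc n) * h" "real n * h"]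
    by (simp add: algebra_simps)
  have B: "integral {0..real n * h} e + integral {real n * h..real (Suc n) * h} e = integral {0..real (Suc n) * h} e"
    by (rule Henstock_Kurzweil_Integration.integral_combine[OF _ le Suc.prems]) (use assms(1) in auto)
  show ?case using has_integral_add[OF Suc.IH[OF i1] A] unfolding B sum.lessThan_Suc .
qed (simp add: has_integral_0)

text \<open>Testing with \<open>z\<close> itself, without smoothing in time: \<open>[0, T]\<close> is divided into intervals of length
  \<open>h\<close>, and the increment over each of them is tested with the value of \<open>z\<close> at its right end.  For
  almost every offset of the division these values lie in \<open>V\<close>, and since \<open>z\<close> is approximated in
  \<open>L\<^sup>2(0, T; V)\<close> by continuous functions, some offset makes the resulting Riemann sums accurate.\<close>

lemma energy_inequality:
  fixes N :: "('c \<Rightarrow> real) \<Rightarrow> real" and z :: "real \<Rightarrow> 'c \<Rightarrow> real" and F :: "real \<Rightarrow> ('c \<Rightarrow> real) \<Rightarrow> real"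
  assumes T: "0 < T" and q: "continuous_on {0..T} q" and Z: "negligible Z"
    and Ntri: "\<And>\<phi> \<psi> \<omega>. \<phi> \<in> V \<Longrightarrow> \<psi> \<in> V \<Longrightarrow> \<omega> \<in> V \<Longrightarrow>
        N (\<lambda>x. \<phi> x - \<psi> x) \<le> N (\<lambda>x. \<phi> x - \<omega> x) + N (\<lambda>x. \<omega> x - \<psi> x)"
    and Nsym: "\<And>\<phi> \<psi>. \<phi> \<in> V \<Longrightarrow> \<psi> \<in> V \<Longrightarrow> N (\<lambda>x. \<phi> x - \<psi> x) \<le> N (\<lambda>x. \<psi> x - \<phi> x)"
    and zV: "\<And>t. t \<in> {0..T} - Z \<Longrightarrow> z t \<in> V"
    and incr: "\<And>s t. t \<in> {0..T} - Z \<Longrightarrow> 0 \<le> s \<Longrightarrow> s < t \<Longrightarrow>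
        (\<lambda>r. F r (z t)) integrable_on {s..t} \<and> q t - q s \<le> 2 * integral {s..t} (\<lambda>r. F r (z t))"
    and Flip: "\<And>r \<phi>. r \<in> {0..T} - Z \<Longrightarrow> \<phi> \<in> V \<Longrightarrow> F r \<phi> - F r (z r) \<le> G r * N (\<lambda>x. \<phi> x - z r x)"
    and FP: "\<And>r. r \<in> {0..T} - Z \<Longrightarrow> F r (z r) \<le> P r"
    and G0: "\<And>r. 0 \<le> G r" and P: "P integrable_on {0..T}" and G: "(\<lambda>r. (G r)\<^sup>2) integrable_on {0..T}"
    and approx: "\<And>\<epsilon>. \<epsilon> > 0 \<Longrightarrow> \<exists>s e d Z'. (\<forall>t\<in>{0..T}. s t \<in> V) \<and> 0 < d \<and>
        (\<forall>t\<in>{0..T}. \<forall>r\<in>{0..T}. \<bar>t - r\<bar> \<le> d \<longrightarrow> N (\<lambda>x. s t x - s r x) \<le> \<epsilon>) \<and>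
        (\<lambda>t. (e t)\<^sup>2) integrable_on {0..T} \<and> integral {0..T} (\<lambda>t. (e t)\<^sup>2) \<le> \<epsilon>\<^sup>2 \<and> negligible Z' \<and>
        (\<forall>t\<in>{0..T} - Z'. N (\<lambda>x. z t x - s t x) \<le> e t)"
  shows "q T - q 0 \<le> 2 * integral {0..T} P"
proof -
  define \<Gamma> where "\<Gamma> = integral {0..T} (\<lambda>r. (G r)\<^sup>2)"
  \<comment> \<open>Twice the error terms in the majorant below contribute \<epsilon> (T + 3
    \<Gamma> + 1), and the errors at the grid points contribute another 2 \<epsilon>.\<close>
  define C where "C = T + 3 * \<Gamma> + 3"
  \<comment> \<open>The offset of the grid is free, so the grid spans only an interval [a,b] close
    to [0,T]. The missing ends disappear in the limit by continuity of \<open>q\<close> and of the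
    indefinite integral of \<open>P\<close>.\<close>
  have one: "\<exists>a b. 0 \<le> a \<and> a \<le> \<epsilon> \<and> T - \<epsilon> \<le> b \<and> b \<le> T \<and> a \<le> b \<and> q b - q a \<le> 2 * integral {a..b} P + \<epsilon> * C"
    if \<epsilon>: "\<epsilon> > 0" for \<epsilon>
  proof -
    obtain s e d Z' where s: "\<And>t. t \<in> {0..T} \<Longrightarrow> s t \<in> V" and d: "0 < d"
      and sd: "\<And>t r. t \<in> {0..T} \<Longrightarrow> r \<in> {0..T} \<Longrightarrow> \<bar>t - r\<bar> \<le> d \<Longrightarrow> N (\<lambda>x. s t x - s r x) \<le> \<epsilon>"
      and ei: "(\<lambda>t. (e t)\<^sup>2) integrable_on {0..T}" and e2: "integral {0..T} (\<lambda>t. (e t)\<^sup>2) \<le> \<epsilon>\<^sup>2"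
      and Z': "negligible Z'" and ze: "\<And>t. t \<in> {0..T} - Z' \<Longrightarrow> N (\<lambda>x. z t x - s t x) \<le> e t"
      using approx[OF \<epsilon>] by blast
    obtain n where n: "T / min d \<epsilon> < real n" using reals_Archimedean2 by blast
    have "0 < T / min d \<epsilon>" using T d \<epsilon> by simp
    then have n0: "n > 0" using n by (metis less_trans of_nat_0_less_iff)
    define h where "h = T / real n"
    have h: "0 < h" "h \<le> d" "h \<le> \<epsilon>" "real n * h = T"
    proof -
      show "0 < h" "real n * h = T" using T n0 by (auto simp: h_def)
      have "T < real n * min d \<epsilon>" using n d \<epsilon> by (simp add: divide_less_eq)
      then have "h < min d \<epsilon>" unfolding h_def using n0
        by (subst pos_divide_less_eq) (simp_all add: mult.commute del: min_less_iff_conj)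
      then show "h \<le> d" "h \<le> \<epsilon>" by auto
    qed
    define Y where "Y = Z \<union> Z'"
    have Y: "negligible Y" using Z Z' by (simp add: Y_def negligible_Un)
    define sh where "sh k = (+) (- (real k * h)) ` Y" for k
    have sh: "negligible (sh k)" for k unfolding sh_def by (rule negligible_translation[OF Y])
    \<comment> \<open>Offsets for which some grid point meets the exceptional set. The points 0 and
      h are excluded as well, so that the grid points lie strictly between 0 and T.\<close>
    define W where "W = (\<Union>k<n. sh k) \<union> {0, h}"
    have W: "negligible W" unfolding W_def
      by (intro negligible_Un negligible_Union) (auto intro: sh)
    define E where "E r = (\<Sum>k<n. (e (r + real k * h))\<^sup>2)" for r
    have E: "(E has_integral integral {0..T} (\<lambda>t. (e t)\<^sup>2)) {0..h}"
      unfolding E_def using has_integral_periodic_sum[of h "\<lambda>t. (e t)\<^sup>2" n] h ei by simp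
    \<comment> \<open>The mean of \<open>E\<close> over the offsets is at most \<epsilon>^2 / h. The
      factor 2 makes the contradiction strict, and the null set \<open>W\<close> does not affect the
      integral.\<close>
    have "\<exists>r. r \<in> {0..h} - W \<and> E r \<le> 2 * \<epsilon>\<^sup>2 / h"
    proof (rule ccontr)
      assume "\<not> ?thesis"
      then have "integral {0..h} (\<lambda>r. 2 * \<epsilon>\<^sup>2 / h) \<le> integral {0..h} E"
        by (intro integral_le_off_negligible[OF _ _ W]) (use E in \<open>auto simp: has_integral_iff\<close>)
      also have "\<dots> \<le> \<epsilon>\<^sup>2" using E e2 by (simp add: has_integral_iff)
      finally show False using h \<epsilon> by simp
    qed
    then obtain r where r: "r \<in> {0..h}" "r \<notin> W" "E r \<le> 2 * \<epsilon>\<^sup>2 / h" by auto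
    have r0: "0 < r" "r < h" using r by (auto simp: W_def less_le)
    define t where "t k = r + real k * h" for k
    have tY: "t k \<notin> Y" if "k < n" for k
    proof
      assume "t k \<in> Y"
      then have "r \<in> sh k" by (auto simp: sh_def t_def image_iff intro!: bexI[of _ "r + real k * h"])
      then show False using r(2) that by (auto simp: W_def)
    qed
    have tT: "0 < t k" "t k < T" if "k < n" for k
    proof -
      have "real k + 1 \<le> real n" using that by linarith
      then have "(real k + 1) * h \<le> real n * h" using h(1) by (intro mult_right_mono) auto
      then show "t k < T" using r0 h(4) by (simp add: t_def algebra_simps)
      show "0 < t k" using r0 h(1) by (simp add: t_def add_pos_nonneg)
    qed
    \<comment> \<open>To \<open>P\<close> are added the terms produced by G y <= \<epsilon>/2 G^2 +
      y^2/(2 \<epsilon>) for y = \<epsilon>, y = e \<sigma> and y = e u, where u is the right end of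
      a cell. The term with e u is constant on the cell and is summed separately over the
      grid.\<close>
    define B where "B \<sigma> = P \<sigma> + (\<epsilon> / 2 * (1 + 3 * (G \<sigma>)\<^sup>2) + (e \<sigma>)\<^sup>2 / (2 * \<epsilon>))" for \<sigma>
    have Ri: "(\<lambda>\<sigma>. \<epsilon> / 2 * (1 + 3 * (G \<sigma>)\<^sup>2) + (e \<sigma>)\<^sup>2 / (2 * \<epsilon>)) integrable_on {0..T}"
      by (intro integrable_add integrable_on_mult_right integrable_on_divide G ei integrable_const_ivl)
    have Bi: "B integrable_on {0..T}" unfolding B_def by (intro integrable_add P Ri)
    have sub: "f integrable_on {a..b}" if "f integrable_on {0..T}" "0 \<le> a" "b \<le> T" for f :: "real \<Rightarrow> real" and a b
      using integrable_on_subinterval[OF that(1), of a b] that by auto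
    have step: "q (t (Suc k)) - q (t k) \<le> 2 * integral {t k..t (Suc k)} B + h * (e (t (Suc k)))\<^sup>2 / \<epsilon>"
      if k: "Suc k < n" for k
    proof -
      define u where "u = t (Suc k)"
      have u: "u \<in> {0..T} - Z" "u \<in> {0..T} - Z'" using tY[OF k] tT[OF k] by (auto simp: u_def Y_def)
      have tu: "u - t k = h" by (simp add: u_def t_def algebra_simps)
      have tk: "0 < t k" using tT k by auto
      have "t k < u" using tu h(1) by linarith
      note I = incr[OF u(1) less_imp_le[OF tk] this]
      have iB0: "B integrable_on {t k..u}" by (rule sub[OF Bi]) (use tk u in auto)
      have iB: "(\<lambda>\<sigma>. B \<sigma> + (e u)\<^sup>2 / (2 * \<epsilon>)) integrable_on {t k..u}"
        by (rule integrable_add[OF iB0 integrable_const_ivl])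
      have "integral {t k..u} (\<lambda>r. F r (z u)) \<le> integral {t k..u} (\<lambda>\<sigma>. B \<sigma> + (e u)\<^sup>2 / (2 * \<epsilon>))"
      proof (rule integral_le_off_negligible[OF conjunct1[OF I] iB Y])
        fix \<sigma> assume \<sigma>: "\<sigma> \<in> {t k..u} - Y"
        then have \<sigma>T: "\<sigma> \<in> {0..T}" "\<sigma> \<in> {0..T} - Z" "\<sigma> \<in> {0..T} - Z'" using tk u by (auto simp: Y_def)
        have uT: "u \<in> {0..T}" using u by auto
        have "N (\<lambda>x. z u x - z \<sigma> x) \<le> N (\<lambda>x. z u x - s u x) + N (\<lambda>x. s u x - z \<sigma> x)"
          by (intro Ntri zV s u \<sigma>T uT)
        also have "N (\<lambda>x. s u x - z \<sigma> x) \<le> N (\<lambda>x. s u x - s \<sigma> x) + N (\<lambda>x. s \<sigma> x - z \<sigma> x)"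
          by (intro Ntri zV s u \<sigma>T uT)
        also have "N (\<lambda>x. s u x - s \<sigma> x) \<le> \<epsilon>"
          by (rule sd[OF uT \<sigma>T(1)]) (use \<sigma> tu h in auto)
        also have "N (\<lambda>x. s \<sigma> x - z \<sigma> x) \<le> N (\<lambda>x. z \<sigma> x - s \<sigma> x)" by (intro Nsym s zV \<sigma>T)
        also have "\<dots> \<le> e \<sigma>" by (rule ze[OF \<sigma>T(3)])
        also have "N (\<lambda>x. z u x - s u x) \<le> e u" by (rule ze[OF u(2)])
        finally have Nle: "N (\<lambda>x. z u x - z \<sigma> x) \<le> e u + (\<epsilon> + e \<sigma>)" by simp
        have am: "G \<sigma> * y \<le> \<epsilon> / 2 * (G \<sigma>)\<^sup>2 + y\<^sup>2 / (2 * \<epsilon>)" for y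
        proof -
          have "0 \<le> (\<epsilon> * G \<sigma> - y)\<^sup>2 / (2 * \<epsilon>)" using \<epsilon> by simp
          also have "\<dots> = \<epsilon> / 2 * (G \<sigma>)\<^sup>2 + y\<^sup>2 / (2 * \<epsilon>) - G \<sigma> * y"
            using \<epsilon> by (simp add: power2_eq_square field_simps)
          finally show ?thesis by simp
        qed
        have "F \<sigma> (z u) \<le> F \<sigma> (z \<sigma>) + G \<sigma> * N (\<lambda>x. z u x - z \<sigma> x)"
          using Flip[OF \<sigma>T(2) zV[OF u(1)]] by linarith
        also have "F \<sigma> (z \<sigma>) \<le> P \<sigma>" by (rule FP[OF \<sigma>T(2)])
        also have "G \<sigma> * N (\<lambda>x. z u x - z \<sigma> x) \<le> G \<sigma> * (e u + (\<epsilon> + e \<sigma>))"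
          by (intro mult_left_mono Nle G0)
        also have "\<dots> = G \<sigma> * e u + G \<sigma> * \<epsilon> + G \<sigma> * e \<sigma>" by (simp add: algebra_simps)
        also have "\<dots> \<le> (\<epsilon> / 2 * (G \<sigma>)\<^sup>2 + (e u)\<^sup>2 / (2 * \<epsilon>)) + (\<epsilon> / 2 * (G \<sigma>)\<^sup>2 + \<epsilon>\<^sup>2 / (2 * \<epsilon>))
            + (\<epsilon> / 2 * (G \<sigma>)\<^sup>2 + (e \<sigma>)\<^sup>2 / (2 * \<epsilon>))"
          by (intro add_mono am)
        also have "\<epsilon>\<^sup>2 / (2 * \<epsilon>) = \<epsilon> / 2" using \<epsilon> by (simp add: power2_eq_square)
        finally show "F \<sigma> (z u) \<le> B \<sigma> + (e u)\<^sup>2 / (2 * \<epsilon>)" by (simp add: B_def algebra_simps)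
      qed
      also have "\<dots> = integral {t k..u} B + h * (e u)\<^sup>2 / (2 * \<epsilon>)"
        using tu h(1) by (simp add: integral_add[OF iB0 integrable_const_ivl])
      finally have i: "integral {t k..u} (\<lambda>r. F r (z u)) \<le> integral {t k..u} B + h * (e u)\<^sup>2 / (2 * \<epsilon>)" .
      define X where "X = h * (e u)\<^sup>2 / (2 * \<epsilon>)"
      have X: "h * (e u)\<^sup>2 / \<epsilon> = 2 * X" by (simp add: X_def)
      have "2 * integral {t k..u} (\<lambda>r. F r (z u)) \<le> 2 * integral {t k..u} B + h * (e u)\<^sup>2 / \<epsilon>"
        using i unfolding X X_def[symmetric] by linarith
      then show ?thesis using conjunct2[OF I] by (simp add: u_def)
    qed
    have tel: "q (t m) - q (t 0) \<le> 2 * integral {t 0..t m} B + h / \<epsilon> * (\<Sum>k=1..m. (e (t k))\<^sup>2)" if "m < n" for m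
      using that
    proof (induction m)
      case (Suc m)
      have le: "t 0 \<le> t m" "t m \<le> t (Suc m)" using h(1) by (auto simp: t_def algebra_simps)
      have "integral {t 0..t m} B + integral {t m..t (Suc m)} B = integral {t 0..t (Suc m)} B"
        by (rule Henstock_Kurzweil_Integration.integral_combine[OF le])
           (rule sub[OF Bi], use tT[OF Suc.prems] tT[OF n0] in auto)
      then show ?case using Suc step[OF Suc.prems] by (simp add: distrib_left)
    qed simp
    define b where "b = t (n - 1)"
    have n1: "n - 1 < n" using n0 by simp
    have tb: "t 0 \<le> b" "b \<le> T" using tT[OF n1] h(1) by (auto simp: b_def t_def)
    have bT: "T - \<epsilon> \<le> b"
    proof -
      have "b = r + (T - h)" using n0 h(4) by (simp add: b_def t_def of_nat_diff algebra_simps)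
      then show ?thesis using r0 h(3) by simp
    qed
    have t0: "0 \<le> t 0" "t 0 \<le> \<epsilon>" using r0 h(3) by (auto simp: t_def)
    have sumE: "(\<Sum>k=1..n-1. (e (t k))\<^sup>2) \<le> E r"
      unfolding E_def t_def by (intro sum_mono2) (use n0 in auto)
    have "h / \<epsilon> * (\<Sum>k=1..n-1. (e (t k))\<^sup>2) \<le> h / \<epsilon> * (2 * \<epsilon>\<^sup>2 / h)"
      using sumE r(3) h(1) \<epsilon> by (intro mult_left_mono) auto
    also have "\<dots> = 2 * \<epsilon>" using h(1) \<epsilon> by (simp add: power2_eq_square)
    finally have S: "h / \<epsilon> * (\<Sum>k=1..n-1. (e (t k))\<^sup>2) \<le> 2 * \<epsilon>" .
    let ?R = "\<lambda>\<sigma>. \<epsilon> / 2 * (1 + 3 * (G \<sigma>)\<^sup>2) + (e \<sigma>)\<^sup>2 / (2 * \<epsilon>)"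
    have "integral {t 0..b} B = integral {t 0..b} P + integral {t 0..b} ?R"
      unfolding B_def by (rule integral_add) (use sub[OF P] sub[OF Ri] t0 tb in auto)
    moreover have "integral {t 0..b} ?R \<le> integral {0..T} ?R"
      by (rule integral_subset_le) (use sub[OF Ri] Ri t0 tb \<epsilon> in auto)
    moreover have "integral {0..T} ?R = \<epsilon> / 2 * (T + 3 * \<Gamma>) + integral {0..T} (\<lambda>t. (e t)\<^sup>2) / (2 * \<epsilon>)"
    proof (rule integral_unique)
      have c: "((\<lambda>\<sigma>. 1::real) has_integral T) {0..T}"
        using has_integral_const_real[of "1::real" 0 T] T by simp
      have g: "((\<lambda>\<sigma>. 3 * (G \<sigma>)\<^sup>2) has_integral 3 * \<Gamma>) {0..T}"
        unfolding \<Gamma>_def by (rule has_integral_mult_right[OF integrable_integral[OF G]])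
      show "(?R has_integral \<epsilon> / 2 * (T + 3 * \<Gamma>) + integral {0..T} (\<lambda>t. (e t)\<^sup>2) / (2 * \<epsilon>)) {0..T}"
        by (rule has_integral_add[OF has_integral_mult_right[OF has_integral_add[OF c g]]
              has_integral_divide[OF integrable_integral[OF ei]]])
    qed
    moreover have "integral {0..T} (\<lambda>t. (e t)\<^sup>2) / (2 * \<epsilon>) \<le> \<epsilon>\<^sup>2 / (2 * \<epsilon>)"
      using e2 \<epsilon> by (intro divide_right_mono) auto
    moreover have "\<epsilon>\<^sup>2 / (2 * \<epsilon>) = \<epsilon> / 2" using \<epsilon> by (simp add: power2_eq_square)
    ultimately have "integral {t 0..b} B \<le> integral {t 0..b} P + (\<epsilon> / 2 * (T + 3 * \<Gamma>) + \<epsilon> / 2)" by linarith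
    then have "q b - q (t 0) \<le> 2 * integral {t 0..b} P + \<epsilon> * C"
      using tel[OF n1] S unfolding b_def[symmetric] C_def by (simp add: algebra_simps)
    then show ?thesis using t0 tb bT by (intro exI[of _ "t 0"] exI[of _ b]) auto
  qed
  have "\<forall>n. \<exists>a b. 0 \<le> a \<and> a \<le> 1 / real (Suc n) \<and> T - 1 / real (Suc n) \<le> b \<and> b \<le> T \<and> a \<le> b \<and>
      q b - q a \<le> 2 * integral {a..b} P + 1 / real (Suc n) * C"
    by (intro allI one) simp
  then obtain a b where ab: "\<And>n. 0 \<le> a n" "\<And>n. a n \<le> 1 / real (Suc n)" "\<And>n. T - 1 / real (Suc n) \<le> b n"
      "\<And>n. b n \<le> T" "\<And>n. a n \<le> b n" "\<And>n. q (b n) - q (a n) \<le> 2 * integral {a n..b n} P + 1 / real (Suc n) * C"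
    by metis
  have inv: "(\<lambda>n. 1 / real (Suc n)) \<longlonglongrightarrow> 0" using LIMSEQ_inverse_real_of_nat by (simp add: divide_inverse)
  have a: "a \<longlonglongrightarrow> 0" by (rule tendsto_sandwich[OF _ _ tendsto_const inv]) (use ab in auto)
  have b: "b \<longlonglongrightarrow> T"
  proof (rule tendsto_sandwich[OF _ _ _ tendsto_const])
    show "(\<lambda>n. T - 1 / real (Suc n)) \<longlonglongrightarrow> T" using tendsto_diff[OF tendsto_const inv, of T] by simp
  qed (use ab in auto)
  have aT: "a n \<in> {0..T}" "b n \<in> {0..T}" for n
    using ab(1,4,5)[of n] order_trans[OF ab(1)[of n] ab(5)[of n]] by auto
  have lim: "(\<lambda>n. f (a n)) \<longlonglongrightarrow> f 0" "(\<lambda>n. f (b n)) \<longlonglongrightarrow> f T" if f: "continuous_on {0..T} f" for f :: "real \<Rightarrow> real"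
    using continuous_on_tendsto_compose[OF f a] continuous_on_tendsto_compose[OF f b] aT T by auto
  have IP: "integral {a n..b n} P = integral {0..b n} P - integral {0..a n} P" for n
    using Henstock_Kurzweil_Integration.integral_combine[OF ab(1)[of n] ab(5)[of n], of P] integrable_on_subinterval[OF P, of 0 "b n"] aT[of n]
    by auto
  note cP = indefinite_integral_continuous_1[OF P]
  have L1: "(\<lambda>n. 2 * (integral {0..b n} P - integral {0..a n} P) + 1 / real (Suc n) * C)
      \<longlonglongrightarrow> 2 * (integral {0..T} P - integral {0..0} P) + 0 * C"
    by (intro tendsto_intros lim[OF cP] inv)
  have L2: "(\<lambda>n. q (b n) - q (a n)) \<longlonglongrightarrow> q T - q 0" by (intro tendsto_diff lim[OF q])
  have "q T - q 0 \<le> 2 * (integral {0..T} P - integral {0..0} P) + 0 * C"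
    by (rule LIMSEQ_le[OF L2 L1]) (use ab(6) IP in auto)
  then show ?thesis by simp
qed

section \<open>Approximation by continuous functions of time\<close>

lemma indicator_L1_approx:
  fixes E :: "real set" and \<kappa> :: real
  assumes E: "E \<in> sets lebesgue" and \<kappa>: "\<kappa> > 0"
  obtains c :: "real \<Rightarrow> real" where "continuous_on UNIV c" "\<And>t. 0 \<le> c t" "\<And>t. c t \<le> 1"
    "\<And>I. I \<in> lmeasurable \<Longrightarrow> (LINT t|lebesgue_on I. \<bar>indicator E t - c t\<bar>) \<le> \<kappa>"
proof -
  obtain U where U: "open U" "E \<subseteq> U" "U - E \<in> lmeasurable" "emeasure lebesgue (U - E) < ennreal (\<kappa> / 2)"
    using sets_lebesgue_outer_open[OF E, of "\<kappa> / 2"] \<kappa> by auto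
  obtain T where T: "closed T" "T \<subseteq> E" "E - T \<in> lmeasurable" "emeasure lebesgue (E - T) < ennreal (\<kappa> / 2)"
    using sets_lebesgue_inner_closed[OF E, of "\<kappa> / 2"] \<kappa> by auto
  \<comment> \<open>Off U - T, a set of measure at most \<kappa>, this Urysohn function agrees with
    the indicator of \<open>E\<close>, so one \<open>c\<close> serves all sets
    \<open>I\<close>.\<close>
  obtain c where c: "continuous_on UNIV c" "\<And>t. c t \<in> closed_segment 1 (0::real)"
    "\<And>t. t \<in> T \<Longrightarrow> c t = 1" "\<And>t. t \<in> - U \<Longrightarrow> c t = 0"
    using Urysohn[of T "- U" 1 "0::real"] T U by auto
  have c01: "0 \<le> c t" "c t \<le> 1" for t using c(2)[of t] by (auto simp: closed_segment_eq_real_ivl)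
  have UT: "U - T = (U - E) \<union> (E - T)" using U(2) T(2) by auto
  have mUT: "U - T \<in> lmeasurable" unfolding UT using U(3) T(3) by auto
  have m1: "measure lebesgue (U - E) < \<kappa> / 2" using U(4) unfolding emeasure_eq_measure2[OF U(3)] by (simp add: ennreal_less_iff)
  have m2: "measure lebesgue (E - T) < \<kappa> / 2" using T(4) unfolding emeasure_eq_measure2[OF T(3)] by (simp add: ennreal_less_iff)
  have m: "measure lebesgue (U - T) \<le> \<kappa>"
    unfolding UT using measure_Un_le[of "U - E" lebesgue "E - T"] U(3) T(3) m1 m2 by auto
  have "(LINT t|lebesgue_on I. \<bar>indicator E t - c t\<bar>) \<le> \<kappa>" if I: "I \<in> lmeasurable" for I
  proof -
    have Is: "I \<in> sets lebesgue" using I by auto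
    have cm: "c \<in> borel_measurable (lebesgue_on I)"
      by (rule continuous_imp_measurable_on_sets_lebesgue[OF continuous_on_subset[OF c(1)] Is]) auto
    have Em: "indicat_real E \<in> borel_measurable (lebesgue_on I)"
      using E by (intro measurable_restrict_space1 borel_measurable_indicator) auto
    have Um: "indicat_real (U - T) \<in> borel_measurable (lebesgue_on I)"
      using mUT by (intro measurable_restrict_space1 borel_measurable_indicator) auto
    have i: "integrable (lebesgue_on I) (indicat_real (U - T))"
      by (rule integrable_lebesgue_on_bounded[OF I Um, of 1]) (simp add: indicator_def)
    have "(LINT t|lebesgue_on I. \<bar>indicator E t - c t\<bar>) \<le> (LINT t|lebesgue_on I. indicator (U - T) t)"
    proof (rule integral_mono_AE[OF _ i])
      have "\<bar>indicator E t - c t\<bar> \<le> indicator (U - T) t" for t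
        using c01[of t] c(3)[of t] c(4)[of t] U(2) T(2) by (auto simp: indicator_def)
      then show "AE t in lebesgue_on I. \<bar>indicator E t - c t\<bar> \<le> indicator (U - T) t" by simp
      show "integrable (lebesgue_on I) (\<lambda>t. \<bar>indicator E t - c t\<bar>)"
      proof (rule integrable_lebesgue_on_bounded[OF I, of _ 1])
        show "AE t in lebesgue_on I. \<bar>\<bar>indicator E t - c t\<bar>\<bar> \<le> 1" using c01 by (auto simp: indicator_def)
      qed (use cm Em in measurable)
    qed
    also have "\<dots> = measure lebesgue ((U - T) \<inter> I)"
      using mUT Is by (subst integral_restrict_space) (auto simp: indicator_inter_arith[symmetric] Int_commute)
    also have "\<dots> \<le> measure lebesgue (U - T)"
      using mUT Is by (intro measure_mono_fmeasurable) auto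
    finally show ?thesis using m by simp
  qed
  then show ?thesis using that[OF c(1) c01] by auto
qed

text \<open>Functions stand for classes modulo equality almost everywhere, so \<open>N\<close> is a
  seminorm and V a set of functions instead of a normed vector space type. The axiom
  \<open>N_scale_add\<close> packs homogeneity and the triangle inequality into one; with both
  scalars 0 it forces the norm of 0 to be 0.\<close>

locale seminormed_space =
  fixes V :: "('c \<Rightarrow> real) set" and N :: "('c \<Rightarrow> real) \<Rightarrow> real"
  assumes zero: "(\<lambda>x. 0) \<in> V"
    and scale_add: "\<And>a b f h. f \<in> V \<Longrightarrow> h \<in> V \<Longrightarrow> (\<lambda>x. a * f x + b * h x) \<in> V"
    and N_nonneg: "\<And>f. f \<in> V \<Longrightarrow> 0 \<le> N f"
    and N_scale_add: "\<And>a b f h. f \<in> V \<Longrightarrow> h \<in> V \<Longrightarrow> N (\<lambda>x. a * f x + b * h x) \<le> \<bar>a\<bar> * N f + \<bar>b\<bar> * N h"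
begin

lemma diff_in: "f \<in> V \<Longrightarrow> h \<in> V \<Longrightarrow> (\<lambda>x. f x - h x) \<in> V"
  using scale_add[of f h 1 "-1"] by simp

lemma N_triangle:
  assumes "f \<in> V" "h \<in> V" "k \<in> V"
  shows "N (\<lambda>x. f x - h x) \<le> N (\<lambda>x. f x - k x) + N (\<lambda>x. k x - h x)"
  using N_scale_add[OF diff_in[OF assms(1,3)] diff_in[OF assms(3,2)], of 1 1] by simp

lemma N_sym: "f \<in> V \<Longrightarrow> h \<in> V \<Longrightarrow> N (\<lambda>x. f x - h x) \<le> N (\<lambda>x. h x - f x)"
  using N_scale_add[OF diff_in[of h f] zero, of "-1" 0] by simp

lemma N_diff_eq: "f \<in> V \<Longrightarrow> h \<in> V \<Longrightarrow> N (\<lambda>x. f x - h x) = N (\<lambda>x. h x - f x)"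
  using N_sym by (simp add: antisym)

lemma sum_in:
  "finite R \<Longrightarrow> R \<subseteq> V \<Longrightarrow> (\<lambda>x. \<Sum>v\<in>R. a v * v x) \<in> V"
proof (induction R rule: finite_induct)
  case (insert v R)
  then show ?case using scale_add[of v "\<lambda>x. \<Sum>v\<in>R. a v * v x" "a v" 1] by simp
qed (use zero in simp)

lemma N_sum_le:
  "finite R \<Longrightarrow> R \<subseteq> V \<Longrightarrow> N (\<lambda>x. \<Sum>v\<in>R. a v * v x) \<le> (\<Sum>v\<in>R. \<bar>a v\<bar> * N v)"
proof (induction R rule: finite_induct)
  case empty
  then show ?case using N_scale_add[OF zero zero, of 0 0] by simp
next
  case (insert v R)
  then show ?case using N_scale_add[of v "\<lambda>x. \<Sum>v\<in>R. a v * v x" "a v" 1] sum_in[of R a] by simp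
qed

text \<open>The error \<open>N (\<lambda>x. s n t x - f t x)\<close> involves \<open>f\<close>,
  whose measurability is only known through approximation. It is almost everywhere the limit in m of
  the same expression with \<open>s m\<close> in place of \<open>f\<close>, and those expressions
  are simple functions of t. The limit \<open>d n\<close> is thus a measurable version of the
  error.\<close>

lemma strongly_measurable_N:
  assumes "strongly_measurable V N {a..b} f"
  shows "\<exists>s d. (\<forall>n. simple_function (lebesgue_on {a..b}) (s n) \<and> s n ` {a..b} \<subseteq> V \<and>
      d n \<in> borel_measurable (lebesgue_on {a..b})) \<and>
    (AE t in lebesgue_on {a..b}. f t \<in> V \<and> (\<forall>n. d n t = N (\<lambda>x. s n t x - f t x)) \<and> (\<lambda>n. d n t) \<longlonglongrightarrow> 0)"
proof -
  let ?M = "lebesgue_on {a..b}"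
  obtain s where s: "\<And>n. simple_function ?M (s n)" "\<And>n. s n ` {a..b} \<subseteq> V"
    "AE t in ?M. f t \<in> V \<and> (\<lambda>n. N (\<lambda>x. s n t x - f t x)) \<longlonglongrightarrow> 0"
    using assms unfolding strongly_measurable_def by blast
  define d where "d n t = lim (\<lambda>m. N (\<lambda>x. s n t x - s m t x))" for n t
  have "(\<lambda>t. N (\<lambda>x. s n t x - s m t x)) \<in> borel_measurable ?M" for n m
    by (rule borel_measurable_simple_function)
       (rule simple_function_compose2[OF s(1)[of n] s(1)[of m], of "\<lambda>u v. N (\<lambda>x. u x - v x)"])
  then have dm: "d n \<in> borel_measurable ?M" for n
    unfolding d_def[abs_def] by (rule borel_measurable_lim_metric)
  have "AE t in ?M. f t \<in> V \<and> (\<forall>n. d n t = N (\<lambda>x. s n t x - f t x)) \<and> (\<lambda>n. d n t) \<longlonglongrightarrow> 0"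
    using s(3) AE_space
  proof eventually_elim
    case (elim t)
    then have t: "t \<in> {a..b}" and f: "f t \<in> V" and l: "(\<lambda>n. N (\<lambda>x. s n t x - f t x)) \<longlonglongrightarrow> 0" by auto
    have sV: "s n t \<in> V" for n using s(2)[of n] t by auto
    have "d n t = N (\<lambda>x. s n t x - f t x)" for n
      unfolding d_def
    proof (rule limI, rule LIMSEQ_I)
      fix e :: real assume "e > 0"
      then obtain m0 where m0: "\<And>m. m \<ge> m0 \<Longrightarrow> N (\<lambda>x. s m t x - f t x) < e"
        using LIMSEQ_D[OF l] N_nonneg[OF diff_in[OF sV f]] by (metis abs_of_nonneg diff_zero real_norm_def)
      show "\<exists>m0. \<forall>m\<ge>m0. norm (N (\<lambda>x. s n t x - s m t x) - N (\<lambda>x. s n t x - f t x)) < e"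
      proof (intro exI allI impI)
        fix m assume "m \<ge> m0"
        then show "norm (N (\<lambda>x. s n t x - s m t x) - N (\<lambda>x. s n t x - f t x)) < e"
          using m0[of m] N_triangle[OF sV f sV, of n m] N_triangle[OF sV sV f, of n m] N_diff_eq[OF sV f, of m] by auto
      qed
    qed
    then show ?case using f l by simp
  qed
  then show ?thesis using s dm by blast
qed

text \<open>Pointwise convergence of simple functions does not control the L2 error. Where its error
  exceeds 1, the simple function is replaced by 0; the new error is bounded by 1 or by the norm of
  \<open>f\<close>, so dominated convergence applies. Finally the indicators of the finitely many
  level sets are replaced by continuous functions.\<close>

lemma strongly_measurable_approx:
  assumes f: "strongly_measurable V N {a..b} f" and i: "integrable (lebesgue_on {a..b}) (\<lambda>t. (N (f t))\<^sup>2)"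
    and \<epsilon>: "\<epsilon> > 0"
  shows "\<exists>s e d Z. (\<forall>t. s t \<in> V) \<and> 0 < d \<and>
      (\<forall>t\<in>{a..b}. \<forall>r\<in>{a..b}. \<bar>t - r\<bar> \<le> d \<longrightarrow> N (\<lambda>x. s t x - s r x) \<le> \<epsilon>) \<and>
      (\<lambda>t. (e t)\<^sup>2) integrable_on {a..b} \<and> integral {a..b} (\<lambda>t. (e t)\<^sup>2) \<le> \<epsilon>\<^sup>2 \<and> negligible Z \<and>
      (\<forall>t\<in>{a..b} - Z. f t \<in> V \<and> 0 \<le> e t \<and> N (\<lambda>x. f t x - s t x) \<le> e t)"
proof -
  let ?M = "lebesgue_on {a..b}"
  obtain s d where sd: "\<forall>n. simple_function ?M (s n) \<and> s n ` {a..b} \<subseteq> V \<and> d n \<in> borel_measurable ?M"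
    and ae: "AE t in ?M. f t \<in> V \<and> (\<forall>n. d n t = N (\<lambda>x. s n t x - f t x)) \<and> (\<lambda>n. d n t) \<longlonglongrightarrow> 0"
    using strongly_measurable_N[OF f] by blast
  have s: "\<And>n. simple_function ?M (s n)" "\<And>n. s n ` {a..b} \<subseteq> V"
    and dm[measurable]: "\<And>n. d n \<in> borel_measurable ?M" using sd by blast+
  \<comment> \<open>Only the square of the norm is given as integrable; its root is a measurable
    version of the absolute value of \<open>N (f t)\<close>.\<close>
  define F where "F t = sqrt ((N (f t))\<^sup>2)" for t
  have Fm[measurable]: "F \<in> borel_measurable ?M"
    unfolding F_def using borel_measurable_integrable[OF i] by measurable
  have F0: "F t \<ge> 0" for t by (simp add: F_def)
  have F2: "(F t)\<^sup>2 = (N (f t))\<^sup>2" for t by (simp add: F_def)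
  \<comment> \<open>Majorant of the error after truncation: the error of \<open>s n\<close> where
    that is kept, the norm of \<open>f\<close> where 0 takes its place.\<close>
  define w where "w n t = (if d n t \<le> 1 then \<bar>d n t\<bar> else F t)" for n t
  have [measurable]: "w n \<in> borel_measurable ?M" for n unfolding w_def by measurable
  have d0: "AE t in ?M. f t \<in> V \<and> (\<forall>n. d n t = N (\<lambda>x. s n t x - f t x) \<and> d n t \<ge> 0) \<and> (\<lambda>n. d n t) \<longlonglongrightarrow> 0"
    using ae AE_space
  proof eventually_elim
    case (elim t)
    then have "N (\<lambda>x. s n t x - f t x) \<ge> 0" for n
      using s(2)[of n] by (intro N_nonneg diff_in) auto
    then show ?case using elim by auto
  qed
  have bound_int: "integrable ?M (\<lambda>t. 2 + 2 * (F t)\<^sup>2)"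
    using i finite_measure.integrable_const[OF finite_measure_lebesgue_on, of "{a..b}" 2] by (auto simp: F2)
  have w_le: "AE t in ?M. (w n t)\<^sup>2 \<le> 2 + 2 * (F t)\<^sup>2" for n
    using d0
  proof eventually_elim
    case (elim t)
    have "0 \<le> d n t" using elim by blast
    then have "(w n t)\<^sup>2 \<le> 1 \<or> (w n t)\<^sup>2 = (F t)\<^sup>2" by (auto simp: w_def power_le_one)
    then show ?case using zero_le_power2[of "F t"] by linarith
  qed
  have "(\<lambda>n. LINT t|?M. (w n t)\<^sup>2) \<longlonglongrightarrow> (LINT t|?M. 0)"
  proof (rule integral_dominated_convergence[OF _ _ bound_int])
    show "AE t in ?M. (\<lambda>n. (w n t)\<^sup>2) \<longlonglongrightarrow> 0"
      using d0
    proof eventually_elim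
      case (elim t)
      then have l: "(\<lambda>n. d n t) \<longlonglongrightarrow> 0" by auto
      then have "eventually (\<lambda>n. d n t < 1) sequentially" by (rule order_tendstoD) simp
      then have "eventually (\<lambda>n. \<bar>d n t\<bar> = w n t) sequentially" by eventually_elim (simp add: w_def)
      then have "(\<lambda>n. w n t) \<longlonglongrightarrow> 0"
        using tendsto_rabs_zero[OF l] by (rule Lim_transform_eventually[rotated])
      then show ?case using tendsto_power[of "\<lambda>n. w n t" 0 sequentially 2] by simp
    qed
    show "AE t in ?M. norm ((w n t)\<^sup>2) \<le> 2 + 2 * (F t)\<^sup>2" for n using w_le[of n] by simp
  qed measurable
  then have "(\<lambda>n. LINT t|?M. (w n t)\<^sup>2) \<longlonglongrightarrow> 0" by simp
  from order_tendstoD(2)[OF this, of "\<epsilon>\<^sup>2 / 4"]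
  obtain n where n: "(LINT t|?M. (w n t)\<^sup>2) < \<epsilon>\<^sup>2 / 4" using \<epsilon> by (auto simp: eventually_sequentially)
  define R where "R = s n ` {a..b}"
  have R: "finite R" "R \<subseteq> V" using simple_functionD(1)[OF s(1)[of n]] s(2) by (auto simp: R_def)
  define E where "E v = {t \<in> {a..b}. s n t = v \<and> d n t \<le> 1}" for v
  have E: "E v \<in> sets lebesgue" for v
  proof -
    have "s n -` {v} \<inter> space ?M \<in> sets ?M" by (rule simple_functionD(2)[OF s(1)])
    moreover have "{t \<in> space ?M. d n t \<le> 1} \<in> sets ?M" by measurable
    ultimately have "(s n -` {v} \<inter> space ?M) \<inter> {t \<in> space ?M. d n t \<le> 1} \<in> sets ?M" by (rule sets.Int)
    also have "(s n -` {v} \<inter> space ?M) \<inter> {t \<in> space ?M. d n t \<le> 1} = E v" by (auto simp: E_def)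
    finally show ?thesis by (simp add: sets_restrict_space_iff)
  qed
  define \<Sigma> where "\<Sigma> = (\<Sum>v\<in>R. N v)"
  have NR: "N v \<ge> 0" if "v \<in> R" for v using N_nonneg R that by auto
  have \<Sigma>0: "\<Sigma> \<ge> 0" unfolding \<Sigma>_def by (intro sum_nonneg NR)
  \<comment> \<open>The smoothing error \<zeta> is at most \<Sigma> and has integral at most
    \<Sigma> \<kappa>, so its square integrates to at most \<epsilon>^2/4. With the same share for
    \<open>w n\<close>, the bound (w + \<zeta>)^2 <= 2 w^2 + 2 \<zeta>^2 gives \<epsilon>^2 in
    total.\<close>
  define \<kappa> where "\<kappa> = \<epsilon>\<^sup>2 / (4 * (\<Sigma>\<^sup>2 + 1))"
  have p: "\<Sigma>\<^sup>2 + 1 > 0" by (simp add: add_nonneg_pos)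
  have \<kappa>: "\<kappa> > 0" "\<Sigma> * (\<Sigma> * \<kappa>) \<le> \<epsilon>\<^sup>2 / 4"
  proof -
    show "\<kappa> > 0" using \<epsilon> p by (simp add: \<kappa>_def)
    have "\<Sigma> * (\<Sigma> * \<kappa>) = \<epsilon>\<^sup>2 / 4 * (\<Sigma>\<^sup>2 / (\<Sigma>\<^sup>2 + 1))" by (simp add: \<kappa>_def power2_eq_square)
    also have "\<dots> \<le> \<epsilon>\<^sup>2 / 4 * 1" using p by (intro mult_left_mono) auto
    finally show "\<Sigma> * (\<Sigma> * \<kappa>) \<le> \<epsilon>\<^sup>2 / 4" by simp
  qed
  have "\<forall>v. \<exists>c. continuous_on UNIV c \<and> (\<forall>t. 0 \<le> c t \<and> c t \<le> 1) \<and>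
      (LINT t|?M. \<bar>indicator (E v) t - c t\<bar>) \<le> \<kappa>"
  proof
    fix v
    show "\<exists>c. continuous_on UNIV c \<and> (\<forall>t. 0 \<le> c t \<and> c t \<le> 1) \<and>
      (LINT t|?M. \<bar>indicator (E v) t - c t\<bar>) \<le> \<kappa>"
      by (rule indicator_L1_approx[OF E[of v] \<kappa>(1)]) (auto intro!: exI)
  qed
  then obtain c where c: "\<And>v. continuous_on UNIV (c v)" "\<And>v t. 0 \<le> c v t" "\<And>v t. c v t \<le> 1"
      "\<And>v. (LINT t|?M. \<bar>indicator (E v) t - c v t\<bar>) \<le> \<kappa>" by metis
  define S where "S t = (\<lambda>x. \<Sum>v\<in>R. c v t * v x)" for t
  have SV: "S t \<in> V" for t unfolding S_def by (rule sum_in[OF R])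
  define \<zeta> where "\<zeta> t = (\<Sum>v\<in>R. \<bar>indicator (E v) t - c v t\<bar> * N v)" for t
  have cm: "c v \<in> borel_measurable ?M" for v
    by (rule continuous_imp_measurable_on_sets_lebesgue[OF continuous_on_subset[OF c(1)]]) auto
  have Em: "indicat_real (E v) \<in> borel_measurable ?M" for v
    using E by (intro measurable_restrict_space1 borel_measurable_indicator) auto
  note [measurable] = cm Em
  have ce: "\<bar>indicator (E v) t - c v t\<bar> \<le> 1" for v t
    using c(2)[of v t] c(3)[of v t] by (auto simp: indicator_def)
  have [measurable]: "\<zeta> \<in> borel_measurable ?M" unfolding \<zeta>_def by measurable
  have \<zeta>b: "0 \<le> \<zeta> t" "\<zeta> t \<le> \<Sigma>" for t
  proof -
    show "0 \<le> \<zeta> t" unfolding \<zeta>_def by (intro sum_nonneg mult_nonneg_nonneg NR) auto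
    have "\<bar>indicator (E v) t - c v t\<bar> * N v \<le> 1 * N v" if "v \<in> R" for v
      by (intro mult_right_mono ce NR that)
    then show "\<zeta> t \<le> \<Sigma>" unfolding \<zeta>_def \<Sigma>_def by (intro sum_mono) simp
  qed
  have ii: "integrable ?M (\<lambda>t. \<bar>indicator (E v) t - c v t\<bar>)" for v
  proof (rule integrable_lebesgue_on_bounded[of _ _ 1])
    show "AE t in ?M. \<bar>\<bar>indicator (E v) t - c v t\<bar>\<bar> \<le> 1" using ce by simp
  qed (auto, measurable)
  have \<zeta>i: "integrable ?M \<zeta>" unfolding \<zeta>_def using ii by auto
  have "(LINT t|?M. \<zeta> t) = (\<Sum>v\<in>R. (LINT t|?M. \<bar>indicator (E v) t - c v t\<bar>) * N v)"
    unfolding \<zeta>_def using ii by (subst Bochner_Integration.integral_sum) auto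
  also have "\<dots> \<le> (\<Sum>v\<in>R. \<kappa> * N v)" by (intro sum_mono mult_right_mono c(4) NR)
  also have "\<dots> = \<Sigma> * \<kappa>" by (simp add: \<Sigma>_def sum_distrib_left mult.commute sum_distrib_right)
  finally have \<zeta>int: "(LINT t|?M. \<zeta> t) \<le> \<Sigma> * \<kappa>" .
  define e where "e t = w n t + \<zeta> t" for t
  have e2_le: "(e t)\<^sup>2 \<le> 2 * (w n t)\<^sup>2 + 2 * (\<Sigma> * \<zeta> t)" for t
  proof -
    have "(e t)\<^sup>2 \<le> 2 * (w n t)\<^sup>2 + 2 * (\<zeta> t)\<^sup>2"
      using sum_squares_bound[of "w n t" "\<zeta> t"] by (simp add: e_def power2_sum)
    also have "(\<zeta> t)\<^sup>2 \<le> \<Sigma> * \<zeta> t" unfolding power2_eq_square by (intro mult_right_mono \<zeta>b)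
    finally show ?thesis by simp
  qed
  have wi: "integrable ?M (\<lambda>t. (w n t)\<^sup>2)"
    by (rule Bochner_Integration.integrable_bound[OF bound_int]) (measurable, use w_le[of n] in \<open>auto elim: eventually_mono\<close>)
  have ri: "integrable ?M (\<lambda>t. 2 * (w n t)\<^sup>2 + 2 * (\<Sigma> * \<zeta> t))" using wi \<zeta>i by auto
  have ei: "integrable ?M (\<lambda>t. (e t)\<^sup>2)"
  proof (rule Bochner_Integration.integrable_bound[OF ri])
    show "(\<lambda>t. (e t)\<^sup>2) \<in> borel_measurable ?M" unfolding e_def by measurable
    show "AE t in ?M. norm ((e t)\<^sup>2) \<le> norm (2 * (w n t)\<^sup>2 + 2 * (\<Sigma> * \<zeta> t))"
      using e2_le order_trans[OF e2_le abs_ge_self] by simp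
  qed
  have "(LINT t|?M. (e t)\<^sup>2) \<le> (LINT t|?M. 2 * (w n t)\<^sup>2 + 2 * (\<Sigma> * \<zeta> t))"
    by (rule integral_mono[OF ei ri]) (rule e2_le)
  also have "\<dots> = 2 * (LINT t|?M. (w n t)\<^sup>2) + 2 * (\<Sigma> * (LINT t|?M. \<zeta> t))" using wi \<zeta>i by simp
  also have "\<Sigma> * (LINT t|?M. \<zeta> t) \<le> \<Sigma> * (\<Sigma> * \<kappa>)" by (intro mult_left_mono \<zeta>int \<Sigma>0)
  finally have e2: "(LINT t|?M. (e t)\<^sup>2) \<le> \<epsilon>\<^sup>2" using n \<kappa>(2) by simp
  have eH: "(\<lambda>t. (e t)\<^sup>2) integrable_on {a..b}" using ei by (intro integrable_on_lebesgue_on) auto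
  have eH2: "integral {a..b} (\<lambda>t. (e t)\<^sup>2) \<le> \<epsilon>\<^sup>2"
    using e2 lebesgue_integral_eq_integral[OF ei] by simp
  have "AE t in ?M. f t \<in> V \<and> 0 \<le> e t \<and> N (\<lambda>x. f t x - S t x) \<le> e t"
    using d0 AE_space
  proof eventually_elim
    case (elim t)
    then have t: "t \<in> {a..b}" and fV: "f t \<in> V" and dn: "d n t = N (\<lambda>x. s n t x - f t x)" "d n t \<ge> 0"
      by (simp, blast+)
    have w0: "w n t \<ge> 0" using F0 by (simp add: w_def)
    have snR: "s n t \<in> R" using t by (auto simp: R_def)
    define g where "g = (\<lambda>x. \<Sum>v\<in>R. indicator (E v) t * v x)"
    have gV: "g \<in> V" unfolding g_def by (rule sum_in[OF R])
    have gs: "g = (if d n t \<le> 1 then s n t else (\<lambda>x. 0))"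
    proof
      fix x
      have "(\<Sum>v\<in>R. indicator (E v) t * v x) = (\<Sum>v\<in>R. if v = s n t then (if d n t \<le> 1 then v x else 0) else 0)"
        using t by (intro sum.cong) (auto simp: E_def indicator_def)
      then show "g x = (if d n t \<le> 1 then s n t else (\<lambda>x. 0)) x" using R(1) snR by (simp add: g_def)
    qed
    have "N (\<lambda>x. f t x - g x) \<le> w n t"
    proof (cases "d n t \<le> 1")
      case True
      then show ?thesis using dn gs N_sym[OF fV, of "s n t"] snR R by (auto simp: w_def)
    next
      case False
      then show ?thesis using gs N_nonneg[OF fV] by (simp add: w_def F_def)
    qed
    moreover have "N (\<lambda>x. g x - S t x) \<le> \<zeta> t"
    proof -
      have "(\<lambda>x. g x - S t x) = (\<lambda>x. \<Sum>v\<in>R. (indicator (E v) t - c v t) * v x)"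
        by (simp add: g_def S_def sum_subtractf left_diff_distrib)
      then show ?thesis unfolding \<zeta>_def using N_sum_le[OF R, of "\<lambda>v. indicator (E v) t - c v t"] by simp
    qed
    ultimately have "N (\<lambda>x. f t x - S t x) \<le> e t"
      using N_triangle[OF fV SV gV, of t] by (simp add: e_def)
    then show ?case using fV w0 \<zeta>b(1)[of t] by (simp add: e_def)
  qed
  then have Z: "negligible {t \<in> {a..b}. \<not> (f t \<in> V \<and> 0 \<le> e t \<and> N (\<lambda>x. f t x - S t x) \<le> e t)}"
    by (subst (asm) AE_lebesgue_on_iff_negligible) auto
  have "\<forall>v. \<exists>\<delta>>0. \<forall>t\<in>{a..b}. \<forall>r\<in>{a..b}. dist r t < \<delta> \<longrightarrow> dist (c v r) (c v t) < \<epsilon> / (\<Sigma> + 1)"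
  proof
    fix v
    have "uniformly_continuous_on {a..b} (c v)"
      by (rule compact_uniformly_continuous[OF continuous_on_subset[OF c(1)]]) auto
    moreover have "\<epsilon> / (\<Sigma> + 1) > 0" using \<epsilon> \<Sigma>0 by simp
    ultimately show "\<exists>\<delta>>0. \<forall>t\<in>{a..b}. \<forall>r\<in>{a..b}. dist r t < \<delta> \<longrightarrow> dist (c v r) (c v t) < \<epsilon> / (\<Sigma> + 1)"
      unfolding uniformly_continuous_on_def by blast
  qed
  then obtain \<delta> where \<delta>: "\<And>v. \<delta> v > 0" "\<And>v t r. t \<in> {a..b} \<Longrightarrow> r \<in> {a..b} \<Longrightarrow> dist r t < \<delta> v \<Longrightarrow> dist (c v r) (c v t) < \<epsilon> / (\<Sigma> + 1)"
    by metis
  \<comment> \<open>The element 1 keeps the minimum defined for every finite \<open>R\<close>, and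
    halving makes \<open>D\<close> strictly smaller than each modulus of continuity.\<close>
  define D where "D = Min (insert 1 (\<delta> ` R)) / 2"
  have Dpos: "Min (insert 1 (\<delta> ` R)) > 0" using R(1) \<delta>(1) by (subst Min_gr_iff) auto
  have D: "D > 0" "\<And>v. v \<in> R \<Longrightarrow> D < \<delta> v"
  proof -
    show "D > 0" using Dpos by (simp add: D_def)
    fix v assume "v \<in> R"
    then have "Min (insert 1 (\<delta> ` R)) \<le> \<delta> v" using R(1) by (intro Min_le) auto
    then show "D < \<delta> v" using Dpos by (simp add: D_def)
  qed
  have "N (\<lambda>x. S t x - S r x) \<le> \<epsilon>" if "t \<in> {a..b}" "r \<in> {a..b}" "\<bar>t - r\<bar> \<le> D" for t r
  proof -
    have "(\<lambda>x. S t x - S r x) = (\<lambda>x. \<Sum>v\<in>R. (c v t - c v r) * v x)"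
      by (simp add: S_def sum_subtractf left_diff_distrib)
    then have "N (\<lambda>x. S t x - S r x) \<le> (\<Sum>v\<in>R. \<bar>c v t - c v r\<bar> * N v)"
      using N_sum_le[OF R, of "\<lambda>v. c v t - c v r"] by simp
    also have "\<dots> \<le> (\<Sum>v\<in>R. \<epsilon> / (\<Sigma> + 1) * N v)"
    proof (intro sum_mono mult_right_mono NR)
      fix v assume v: "v \<in> R"
      have "dist t r < \<delta> v" using D(2)[OF v] that(3) by (simp add: dist_real_def)
      then show "\<bar>c v t - c v r\<bar> \<le> \<epsilon> / (\<Sigma> + 1)" using \<delta>(2)[OF that(2,1)] by (simp add: dist_real_def less_imp_le)
    qed
    also have "\<dots> = \<epsilon> / (\<Sigma> + 1) * \<Sigma>" by (simp add: \<Sigma>_def sum_distrib_left)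
    also have "\<dots> \<le> \<epsilon>" using \<epsilon> \<Sigma>0 by (simp add: field_simps)
    finally show ?thesis .
  qed
  then show ?thesis using SV D(1) eH eH2 Z
    by (intro exI[of _ S] exI[of _ e] exI[of _ D]
          exI[of _ "{t \<in> {a..b}. \<not> (f t \<in> V \<and> 0 \<le> e t \<and> N (\<lambda>x. f t x - S t x) \<le> e t)}"]) auto
qed

end

section \<open>Energy estimates for evolutions with values in \<open>H\<^sup>1\<close>\<close>

lemma seminormed_space_H1: "open \<Omega> \<Longrightarrow> seminormed_space (H1 \<Omega>) (H1_norm \<Omega>)"
  by unfold_locales (auto intro: H1_0 H1_scale_add(1) H1_norm_scale_add)

text \<open>The dual norm is a real supremum, meaningful because the continuity constant bounds the
  values on the unit ball. Since \<open>H1_norm\<close> is only a seminorm, elements of norm 0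
  cannot be rescaled; for them the same constant forces the value 0.\<close>

lemma H1_dual_bound:
  assumes \<Omega>: "open \<Omega>" and F: "F \<in> H1_dual \<Omega>" and \<psi>: "\<psi> \<in> H1 \<Omega>"
  shows "\<bar>F \<psi>\<bar> \<le> H1_dual_norm \<Omega> F * H1_norm \<Omega> \<psi>"
proof -
  obtain C where "\<forall>\<phi>\<in>H1 \<Omega>. \<bar>F \<phi>\<bar> \<le> C * H1_norm \<Omega> \<phi>"
    using F unfolding H1_dual_def by blast
  then have C: "\<And>\<phi>. \<phi> \<in> H1 \<Omega> \<Longrightarrow> \<bar>F \<phi>\<bar> \<le> C * H1_norm \<Omega> \<phi>" by blast
  have scale: "F (\<lambda>x. c * \<phi> x) = c * F \<phi>" if "\<phi> \<in> H1 \<Omega>" for c \<phi>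
    using F that by (auto simp: H1_dual_def)
  let ?S = "{\<phi> \<in> H1 \<Omega>. H1_norm \<Omega> \<phi> \<le> 1}"
  have bdd: "bdd_above ((\<lambda>\<phi>. \<bar>F \<phi>\<bar>) ` ?S)"
  proof (rule bdd_aboveI2)
    fix \<phi> assume "\<phi> \<in> ?S"
    then have "\<bar>F \<phi>\<bar> \<le> C * H1_norm \<Omega> \<phi>" "H1_norm \<Omega> \<phi> \<le> 1" using C by auto
    moreover have "C * H1_norm \<Omega> \<phi> \<le> \<bar>C\<bar> * H1_norm \<Omega> \<phi>" by (intro mult_right_mono) auto
    moreover have "\<bar>C\<bar> * H1_norm \<Omega> \<phi> \<le> \<bar>C\<bar> * 1" using \<open>\<phi> \<in> ?S\<close> by (intro mult_left_mono) auto
    ultimately show "\<bar>F \<phi>\<bar> \<le> \<bar>C\<bar>" by linarith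
  qed
  show ?thesis
  proof (cases "H1_norm \<Omega> \<psi> = 0")
    case True
    then show ?thesis using C[OF \<psi>] by simp
  next
    case False
    define n where "n = H1_norm \<Omega> \<psi>"
    have n: "n > 0" using False H1_norm_nonneg[of \<Omega> \<psi>] unfolding n_def by linarith
    let ?\<phi> = "\<lambda>x. (1 / n) * \<psi> x"
    have "H1_norm \<Omega> ?\<phi> \<le> 1"
      using H1_norm_scale_add[OF \<Omega> \<psi> \<psi>, of "1 / n" 0] n by (simp add: n_def)
    then have "?\<phi> \<in> ?S" using H1_cmult[OF \<Omega> \<psi>, of "1 / n"] by simp
    then have "\<bar>F ?\<phi>\<bar> \<le> H1_dual_norm \<Omega> F" unfolding H1_dual_norm_def by (rule cSUP_upper[OF _ bdd])
    then have "\<bar>F \<psi>\<bar> / n \<le> H1_dual_norm \<Omega> F" unfolding scale[OF \<psi>] using n by (simp add: abs_mult)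
    then show ?thesis using n by (simp add: n_def divide_le_eq)
  qed
qed

lemma H1_dual_add: "F \<in> H1_dual \<Omega> \<Longrightarrow> \<phi> \<in> H1 \<Omega> \<Longrightarrow> \<psi> \<in> H1 \<Omega> \<Longrightarrow> F (\<lambda>x. \<phi> x + \<psi> x) = F \<phi> + F \<psi>"
  and H1_dual_cmult: "F \<in> H1_dual \<Omega> \<Longrightarrow> \<psi> \<in> H1 \<Omega> \<Longrightarrow> F (\<lambda>x. c * \<psi> x) = c * F \<psi>"
  by (simp_all add: H1_dual_def)

lemma H1_dual_apply_diff:
  assumes \<Omega>: "open \<Omega>" and F: "F \<in> H1_dual \<Omega>" and "\<phi> \<in> H1 \<Omega>" "\<psi> \<in> H1 \<Omega>"
  shows "F (\<lambda>x. \<phi> x - \<psi> x) = F \<phi> - F \<psi>"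
  using H1_dual_add[OF F assms(3) H1_cmult[OF \<Omega> assms(4)], of "-1"] H1_dual_cmult[OF F assms(4), of "-1"]
  by simp

lemma H1_dual_diff:
  assumes \<Omega>: "open \<Omega>" and F: "F \<in> H1_dual \<Omega>" and G: "G \<in> H1_dual \<Omega>"
  shows "(\<lambda>\<psi>. F \<psi> - G \<psi>) \<in> H1_dual \<Omega>"
proof -
  have "\<bar>F \<psi> - G \<psi>\<bar> \<le> (H1_dual_norm \<Omega> F + H1_dual_norm \<Omega> G) * H1_norm \<Omega> \<psi>" if "\<psi> \<in> H1 \<Omega>" for \<psi>
    using H1_dual_bound[OF \<Omega> F that] H1_dual_bound[OF \<Omega> G that] by (simp add: distrib_right)
  then show ?thesis using F G unfolding H1_dual_def
    by (auto simp: algebra_simps intro!: exI[of _ "H1_dual_norm \<Omega> F + H1_dual_norm \<Omega> G"])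
qed

text \<open>Evaluation at \<psi> is continuous on the dual, so it turns the approximating simple
  functions into real ones and their limit into a measurable function. On a bounded interval square
  integrability of the dual norm suffices, because y <= y^2 + 1.\<close>

lemma integrable_dual_pairing:
  assumes \<Omega>: "open \<Omega>" and D: "strongly_measurable (H1_dual \<Omega>) (H1_dual_norm \<Omega>) {a..b} D"
    and i: "integrable (lebesgue_on {a..b}) (\<lambda>t. (H1_dual_norm \<Omega> (D t))\<^sup>2)" and \<psi>: "\<psi> \<in> H1 \<Omega>"
  shows "integrable (lebesgue_on {a..b}) (\<lambda>t. D t \<psi>)"
proof -
  let ?M = "lebesgue_on {a..b}"
  obtain s where s: "\<And>n. simple_function ?M (s n)" "\<And>n. s n ` {a..b} \<subseteq> H1_dual \<Omega>"
    "AE t in ?M. D t \<in> H1_dual \<Omega> \<and> (\<lambda>n. H1_dual_norm \<Omega> (\<lambda>x. s n t x - D t x)) \<longlonglongrightarrow> 0"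
    using D unfolding strongly_measurable_def by blast
  have "(\<lambda>t. s n t \<psi>) \<in> borel_measurable ?M" for n
    by (rule borel_measurable_simple_function) (rule simple_function_compose1[OF s(1)[of n], of "\<lambda>F. F \<psi>"])
  then have lm: "(\<lambda>t. lim (\<lambda>n. s n t \<psi>)) \<in> borel_measurable ?M" by (rule borel_measurable_lim_metric)
  have eq: "AE t in ?M. lim (\<lambda>n. s n t \<psi>) = D t \<psi>"
    using s(3) AE_space
  proof eventually_elim
    case (elim t)
    have "(\<lambda>n. s n t \<psi> - D t \<psi>) \<longlonglongrightarrow> 0"
    proof (rule Lim_null_comparison)
      show "\<forall>\<^sub>F n in sequentially. norm (s n t \<psi> - D t \<psi>) \<le> H1_dual_norm \<Omega> (\<lambda>x. s n t x - D t x) * H1_norm \<Omega> \<psi>"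
      proof (intro always_eventually allI)
        fix n
        have "s n t \<in> H1_dual \<Omega>" using s(2)[of n] elim by auto
        from H1_dual_bound[OF \<Omega> H1_dual_diff[OF \<Omega> this] \<psi>] elim
        show "norm (s n t \<psi> - D t \<psi>) \<le> H1_dual_norm \<Omega> (\<lambda>x. s n t x - D t x) * H1_norm \<Omega> \<psi>" by simp
      qed
      show "(\<lambda>n. H1_dual_norm \<Omega> (\<lambda>x. s n t x - D t x) * H1_norm \<Omega> \<psi>) \<longlonglongrightarrow> 0"
        using elim by (intro tendsto_mult_left_zero) auto
    qed
    then show ?case by (intro limI) (simp add: LIM_zero_iff)
  qed
  have m: "(\<lambda>t. D t \<psi>) \<in> borel_measurable ?M" by (rule borel_measurable_lebesgue_on_cong_AE[OF _ lm eq]) auto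
  show ?thesis
  proof (rule Bochner_Integration.integrable_bound[OF _ m])
    show "integrable ?M (\<lambda>t. ((H1_dual_norm \<Omega> (D t))\<^sup>2 + 1) * H1_norm \<Omega> \<psi>)"
      using i finite_measure.integrable_const[OF finite_measure_lebesgue_on, of "{a..b}" "1::real"] by auto
    show "AE t in ?M. norm (D t \<psi>) \<le> norm (((H1_dual_norm \<Omega> (D t))\<^sup>2 + 1) * H1_norm \<Omega> \<psi>)"
      using s(3)
    proof eventually_elim
      case (elim t)
      have "\<bar>D t \<psi>\<bar> \<le> H1_dual_norm \<Omega> (D t) * H1_norm \<Omega> \<psi>" using H1_dual_bound[OF \<Omega> _ \<psi>] elim by blast
      also have "\<dots> \<le> ((H1_dual_norm \<Omega> (D t))\<^sup>2 + 1) * H1_norm \<Omega> \<psi>"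
      proof (rule mult_right_mono)
        show "H1_dual_norm \<Omega> (D t) \<le> (H1_dual_norm \<Omega> (D t))\<^sup>2 + 1"
          using zero_le_power2[of "H1_dual_norm \<Omega> (D t) - 1 / 2"] by (simp add: power2_diff power_divide)
      qed simp
      finally show ?case by simp
    qed
  qed
qed

text \<open>The last clause replaces Bochner measurability: \<open>z\<close> is approximated in \<open>L\<^sup>2(0, T; H\<^sup>1)\<close> by
  continuous functions \<open>s\<close>, and \<open>e\<close> is a measurable majorant of the error.\<close>

definition evolution ::
  "'a::euclidean_space set \<Rightarrow> real \<Rightarrow> (real \<Rightarrow> 'a \<Rightarrow> real) \<Rightarrow> (real \<Rightarrow> ('a \<Rightarrow> real) \<Rightarrow> real) \<Rightarrow> bool" where
  "evolution \<Omega> T z D \<longleftrightarrow>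
     (\<forall>t\<in>{0..T}. z t \<in> Lp 2 \<Omega> \<and> ((\<lambda>r. L2_dist \<Omega> (z r) (z t)) \<longlongrightarrow> 0) (at t within {0..T})) \<and>
     (\<exists>G Z. negligible Z \<and> (\<forall>t. 0 \<le> G t) \<and> (\<lambda>t. (G t)\<^sup>2) integrable_on {0..T} \<and>
        (\<forall>t\<in>{0..T} - Z. z t \<in> H1 \<Omega> \<and> D t \<in> H1_dual \<Omega> \<and> (\<forall>\<psi>\<in>H1 \<Omega>. \<bar>D t \<psi>\<bar> \<le> G t * H1_norm \<Omega> \<psi>))) \<and>
     (\<forall>\<psi>\<in>H1 \<Omega>. \<forall>a b. 0 \<le> a \<and> a < b \<and> b \<le> T \<longrightarrow> (\<lambda>r. D r \<psi>) integrable_on {a..b} \<and>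
        L2_inner \<Omega> (z b) \<psi> - L2_inner \<Omega> (z a) \<psi> = integral {a..b} (\<lambda>r. D r \<psi>)) \<and>
     (\<forall>\<epsilon>>0. \<exists>s e d Z. (\<forall>t. s t \<in> H1 \<Omega>) \<and> 0 < d \<and>
        (\<forall>t\<in>{0..T}. \<forall>r\<in>{0..T}. \<bar>t - r\<bar> \<le> d \<longrightarrow> H1_norm \<Omega> (\<lambda>x. s t x - s r x) \<le> \<epsilon>) \<and>
        (\<lambda>t. (e t)\<^sup>2) integrable_on {0..T} \<and> integral {0..T} (\<lambda>t. (e t)\<^sup>2) \<le> \<epsilon>\<^sup>2 \<and> negligible Z \<and>
        (\<forall>t\<in>{0..T} - Z. z t \<in> H1 \<Omega> \<and> 0 \<le> e t \<and> H1_norm \<Omega> (\<lambda>x. z t x - s t x) \<le> e t))"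

text \<open>The right side has a square that is visibly integrable when those of \<open>a\<close>
  and \<open>b\<close> are, without a product term. It serves as the majorant for differences of two
  evolutions.\<close>

lemma add_le_sqrt_squares: "a + b \<le> sqrt (2 * a\<^sup>2 + 2 * b\<^sup>2)" for a b :: real
proof (rule real_le_rsqrt)
  show "(a + b)\<^sup>2 \<le> 2 * a\<^sup>2 + 2 * b\<^sup>2" using sum_squares_bound[of a b] by (simp add: power2_sum)
qed

text \<open>The notion of evolution is linear although the equation is not: the nonlinearity enters
  only through the identification of \<open>D\<close>. This is what makes the energy inequality
  available for the difference of two solutions.\<close>

lemma evolution_diff:
  assumes \<Omega>: "open \<Omega>" and e1: "evolution \<Omega> T z1 D1" and e2: "evolution \<Omega> T z2 D2"
  shows "evolution \<Omega> T (\<lambda>t x. z1 t x - z2 t x) (\<lambda>t \<psi>. D1 t \<psi> - D2 t \<psi>)"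
  unfolding evolution_def
proof (intro conjI ballI allI impI)
  interpret H: seminormed_space "H1 \<Omega>" "H1_norm \<Omega>" by (rule seminormed_space_H1[OF \<Omega>])
  have L1: "z1 t \<in> Lp 2 \<Omega>" and L2: "z2 t \<in> Lp 2 \<Omega>" if "t \<in> {0..T}" for t
    using e1 e2 that by (auto simp: evolution_def)
  show "(\<lambda>x. z1 t x - z2 t x) \<in> Lp 2 \<Omega>" if t: "t \<in> {0..T}" for t by (rule Lp2_diff[OF L1[OF t] L2[OF t]])
  show "((\<lambda>r. L2_dist \<Omega> (\<lambda>x. z1 r x - z2 r x) (\<lambda>x. z1 t x - z2 t x)) \<longlongrightarrow> 0) (at t within {0..T})"
    if t: "t \<in> {0..T}" for t
  proof (rule Lim_null_comparison)
    show "((\<lambda>r. L2_dist \<Omega> (z1 r) (z1 t) + L2_dist \<Omega> (z2 r) (z2 t)) \<longlongrightarrow> 0) (at t within {0..T})"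
      using e1 e2 t by (intro tendsto_add_zero) (auto simp: evolution_def)
    have "L2_dist \<Omega> (\<lambda>x. z1 r x - z2 r x) (\<lambda>x. z1 t x - z2 t x) \<le> L2_dist \<Omega> (z1 r) (z1 t) + L2_dist \<Omega> (z2 r) (z2 t)"
      if r: "r \<in> {0..T}" for r
    proof -
      have "L2_dist \<Omega> (\<lambda>x. z1 r x - z2 r x) (\<lambda>x. z1 t x - z2 t x) =
          Lp_norm 2 \<Omega> (\<lambda>x. (z1 r x - z1 t x) + (z2 t x - z2 r x))"
        by (simp add: L2_dist_def algebra_simps)
      also have "\<dots> \<le> L2_dist \<Omega> (z1 r) (z1 t) + L2_dist \<Omega> (z2 t) (z2 r)"
        unfolding L2_dist_def by (rule Lp2_norm_triangle[OF Lp2_diff[OF L1[OF r] L1[OF t]] Lp2_diff[OF L2[OF t] L2[OF r]]])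
      finally show ?thesis by (simp add: L2_dist_commute[of \<Omega> "z2 t"])
    qed
    then show "\<forall>\<^sub>F r in at t within {0..T}. norm (L2_dist \<Omega> (\<lambda>x. z1 r x - z2 r x) (\<lambda>x. z1 t x - z2 t x))
        \<le> L2_dist \<Omega> (z1 r) (z1 t) + L2_dist \<Omega> (z2 r) (z2 t)"
      by (auto simp: eventually_at_filter intro!: always_eventually)
  qed
  show "\<exists>G Z. negligible Z \<and> (\<forall>t. 0 \<le> G t) \<and> (\<lambda>t. (G t)\<^sup>2) integrable_on {0..T} \<and>
      (\<forall>t\<in>{0..T} - Z. (\<lambda>x. z1 t x - z2 t x) \<in> H1 \<Omega> \<and> (\<lambda>\<psi>. D1 t \<psi> - D2 t \<psi>) \<in> H1_dual \<Omega> \<and>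
        (\<forall>\<psi>\<in>H1 \<Omega>. \<bar>D1 t \<psi> - D2 t \<psi>\<bar> \<le> G t * H1_norm \<Omega> \<psi>))"
  proof -
    obtain G1 Z1 where 1: "negligible Z1" "\<forall>t. 0 \<le> G1 t" "(\<lambda>t. (G1 t)\<^sup>2) integrable_on {0..T}"
      "\<forall>t\<in>{0..T} - Z1. z1 t \<in> H1 \<Omega> \<and> D1 t \<in> H1_dual \<Omega> \<and> (\<forall>\<psi>\<in>H1 \<Omega>. \<bar>D1 t \<psi>\<bar> \<le> G1 t * H1_norm \<Omega> \<psi>)"
      using e1 unfolding evolution_def by blast
    obtain G2 Z2 where 2: "negligible Z2" "\<forall>t. 0 \<le> G2 t" "(\<lambda>t. (G2 t)\<^sup>2) integrable_on {0..T}"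
      "\<forall>t\<in>{0..T} - Z2. z2 t \<in> H1 \<Omega> \<and> D2 t \<in> H1_dual \<Omega> \<and> (\<forall>\<psi>\<in>H1 \<Omega>. \<bar>D2 t \<psi>\<bar> \<le> G2 t * H1_norm \<Omega> \<psi>)"
      using e2 unfolding evolution_def by blast
    define G where "G t = sqrt (2 * (G1 t)\<^sup>2 + 2 * (G2 t)\<^sup>2)" for t
    have "(\<lambda>t. (G t)\<^sup>2) integrable_on {0..T}"
      unfolding G_def by (simp, intro integrable_add integrable_on_mult_right 1(3) 2(3))
    moreover have "\<bar>D1 t \<psi> - D2 t \<psi>\<bar> \<le> G t * H1_norm \<Omega> \<psi>" if "t \<in> {0..T} - (Z1 \<union> Z2)" "\<psi> \<in> H1 \<Omega>" for t \<psi>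
    proof -
      have "\<bar>D1 t \<psi> - D2 t \<psi>\<bar> \<le> (G1 t + G2 t) * H1_norm \<Omega> \<psi>"
        using bspec[OF 1(4), of t] bspec[OF 2(4), of t] that by (fastforce simp: distrib_right)
      also have "\<dots> \<le> G t * H1_norm \<Omega> \<psi>" unfolding G_def by (intro mult_right_mono add_le_sqrt_squares) simp
      finally show ?thesis .
    qed
    ultimately show ?thesis
      using 1 2 by (intro exI[of _ G] exI[of _ "Z1 \<union> Z2"]) (auto simp: negligible_Un G_def H.diff_in intro: H1_dual_diff[OF \<Omega>])
  qed
  fix \<psi> and a b :: real assume \<psi>: "\<psi> \<in> H1 \<Omega>" and ab: "0 \<le> a \<and> a < b \<and> b \<le> T"
  have 1: "(\<lambda>r. D1 r \<psi>) integrable_on {a..b}" "L2_inner \<Omega> (z1 b) \<psi> - L2_inner \<Omega> (z1 a) \<psi> = integral {a..b} (\<lambda>r. D1 r \<psi>)"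
    and 2: "(\<lambda>r. D2 r \<psi>) integrable_on {a..b}" "L2_inner \<Omega> (z2 b) \<psi> - L2_inner \<Omega> (z2 a) \<psi> = integral {a..b} (\<lambda>r. D2 r \<psi>)"
    using e1 e2 \<psi> ab unfolding evolution_def by blast+
  show "(\<lambda>r. D1 r \<psi> - D2 r \<psi>) integrable_on {a..b}" by (intro integrable_diff 1 2)
  have "a \<in> {0..T}" "b \<in> {0..T}" using ab by auto
  then show "L2_inner \<Omega> (\<lambda>x. z1 b x - z2 b x) \<psi> - L2_inner \<Omega> (\<lambda>x. z1 a x - z2 a x) \<psi> = integral {a..b} (\<lambda>r. D1 r \<psi> - D2 r \<psi>)"
    using 1 2 by (simp add: L2_inner_diff_left[OF L1 L2 H1_Lp2[OF \<psi>]] integral_diff)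
next
  interpret H: seminormed_space "H1 \<Omega>" "H1_norm \<Omega>" by (rule seminormed_space_H1[OF \<Omega>])
  fix \<epsilon> :: real assume \<epsilon>: "0 < \<epsilon>"
  then have \<epsilon>2: "0 < \<epsilon> / 2" by simp
  obtain s1 f1 d1 Z1 where 1: "\<forall>t. s1 t \<in> H1 \<Omega>" "0 < d1"
      "\<forall>t\<in>{0..T}. \<forall>r\<in>{0..T}. \<bar>t - r\<bar> \<le> d1 \<longrightarrow> H1_norm \<Omega> (\<lambda>x. s1 t x - s1 r x) \<le> \<epsilon> / 2"
      "(\<lambda>t. (f1 t)\<^sup>2) integrable_on {0..T}" "integral {0..T} (\<lambda>t. (f1 t)\<^sup>2) \<le> (\<epsilon> / 2)\<^sup>2" "negligible Z1"
      "\<forall>t\<in>{0..T} - Z1. z1 t \<in> H1 \<Omega> \<and> 0 \<le> f1 t \<and> H1_norm \<Omega> (\<lambda>x. z1 t x - s1 t x) \<le> f1 t"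
    using e1 \<epsilon>2 unfolding evolution_def by blast
  obtain s2 f2 d2 Z2 where 2: "\<forall>t. s2 t \<in> H1 \<Omega>" "0 < d2"
      "\<forall>t\<in>{0..T}. \<forall>r\<in>{0..T}. \<bar>t - r\<bar> \<le> d2 \<longrightarrow> H1_norm \<Omega> (\<lambda>x. s2 t x - s2 r x) \<le> \<epsilon> / 2"
      "(\<lambda>t. (f2 t)\<^sup>2) integrable_on {0..T}" "integral {0..T} (\<lambda>t. (f2 t)\<^sup>2) \<le> (\<epsilon> / 2)\<^sup>2" "negligible Z2"
      "\<forall>t\<in>{0..T} - Z2. z2 t \<in> H1 \<Omega> \<and> 0 \<le> f2 t \<and> H1_norm \<Omega> (\<lambda>x. z2 t x - s2 t x) \<le> f2 t"
    using e2 \<epsilon>2 unfolding evolution_def by blast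
  define s where "s t = (\<lambda>x. s1 t x - s2 t x)" for t
  define e where "e t = sqrt (2 * (f1 t)\<^sup>2 + 2 * (f2 t)\<^sup>2)" for t
  have tri: "H1_norm \<Omega> (\<lambda>x. (a x - b x) - (c x - d x)) \<le> H1_norm \<Omega> (\<lambda>x. a x - c x) + H1_norm \<Omega> (\<lambda>x. b x - d x)"
    if "a \<in> H1 \<Omega>" "b \<in> H1 \<Omega>" "c \<in> H1 \<Omega>" "d \<in> H1 \<Omega>" for a b c d
    using H.N_scale_add[OF H.diff_in[OF that(1,3)] H.diff_in[OF that(2,4)], of 1 "-1"] by (simp add: algebra_simps)
  have "H1_norm \<Omega> (\<lambda>x. s t x - s r x) \<le> \<epsilon>" if "t \<in> {0..T}" "r \<in> {0..T}" "\<bar>t - r\<bar> \<le> min d1 d2" for t r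
  proof -
    have "H1_norm \<Omega> (\<lambda>x. s1 t x - s1 r x) \<le> \<epsilon> / 2" "H1_norm \<Omega> (\<lambda>x. s2 t x - s2 r x) \<le> \<epsilon> / 2"
      using 1(3) 2(3) that by auto
    then show ?thesis using tri[of "s1 t" "s2 t" "s1 r" "s2 r"] 1(1) 2(1) by (simp add: s_def)
  qed
  moreover have ei: "((\<lambda>t. (e t)\<^sup>2) has_integral (2 * integral {0..T} (\<lambda>t. (f1 t)\<^sup>2) + 2 * integral {0..T} (\<lambda>t. (f2 t)\<^sup>2))) {0..T}"
    unfolding e_def by (simp, intro has_integral_add has_integral_mult_right integrable_integral 1(4) 2(4))
  moreover have "integral {0..T} (\<lambda>t. (e t)\<^sup>2) \<le> \<epsilon>\<^sup>2"
  proof -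
    have "2 * (\<epsilon> / 2)\<^sup>2 + 2 * (\<epsilon> / 2)\<^sup>2 = \<epsilon>\<^sup>2" by (simp add: power_divide)
    then show ?thesis using integral_unique[OF ei] 1(5) 2(5) by linarith
  qed
  moreover have "H1_norm \<Omega> (\<lambda>x. (z1 t x - z2 t x) - s t x) \<le> e t" if "t \<in> {0..T} - (Z1 \<union> Z2)" for t
  proof -
    have "H1_norm \<Omega> (\<lambda>x. (z1 t x - z2 t x) - s t x) \<le> f1 t + f2 t"
      using tri[of "z1 t" "z2 t" "s1 t" "s2 t"] bspec[OF 1(7), of t] bspec[OF 2(7), of t] 1(1) 2(1) that by (fastforce simp: s_def)
    then show ?thesis using add_le_sqrt_squares[of "f1 t" "f2 t"] by (simp add: e_def)
  qed
  ultimately show "\<exists>s e d Z. (\<forall>t. s t \<in> H1 \<Omega>) \<and> 0 < d \<and>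
        (\<forall>t\<in>{0..T}. \<forall>r\<in>{0..T}. \<bar>t - r\<bar> \<le> d \<longrightarrow> H1_norm \<Omega> (\<lambda>x. s t x - s r x) \<le> \<epsilon>) \<and>
        (\<lambda>t. (e t)\<^sup>2) integrable_on {0..T} \<and> integral {0..T} (\<lambda>t. (e t)\<^sup>2) \<le> \<epsilon>\<^sup>2 \<and> negligible Z \<and>
        (\<forall>t\<in>{0..T} - Z. (\<lambda>x. z1 t x - z2 t x) \<in> H1 \<Omega> \<and> 0 \<le> e t \<and> H1_norm \<Omega> (\<lambda>x. (z1 t x - z2 t x) - s t x) \<le> e t)"
    using 1 2
    by (intro exI[of _ s] exI[of _ e] exI[of _ "min d1 d2"] exI[of _ "Z1 \<union> Z2"])
       (auto simp: s_def e_def negligible_Un has_integral_iff intro: H.diff_in)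
qed

lemma evolution_norm_continuous:
  assumes e: "evolution \<Omega> T z D"
  shows "continuous_on {0..T} (\<lambda>t. (Lp_norm 2 \<Omega> (z t))\<^sup>2)"
proof -
  have "continuous_on {0..T} (\<lambda>t. Lp_norm 2 \<Omega> (z t))"
    unfolding continuous_on_def
  proof
    fix t assume t: "t \<in> {0..T}"
    have L: "z r \<in> Lp 2 \<Omega>" if "r \<in> {0..T}" for r using e that by (auto simp: evolution_def)
    have "((\<lambda>r. Lp_norm 2 \<Omega> (z r) - Lp_norm 2 \<Omega> (z t)) \<longlongrightarrow> 0) (at t within {0..T})"
    proof (rule Lim_null_comparison)
      show "((\<lambda>r. L2_dist \<Omega> (z r) (z t)) \<longlongrightarrow> 0) (at t within {0..T})" using e t by (auto simp: evolution_def)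
      have "\<bar>Lp_norm 2 \<Omega> (z r) - Lp_norm 2 \<Omega> (z t)\<bar> \<le> L2_dist \<Omega> (z r) (z t)" if r: "r \<in> {0..T}" for r
        using Lp2_norm_triangle[OF Lp2_diff[OF L[OF r] L[OF t]] L[OF t]]
          Lp2_norm_triangle[OF Lp2_diff[OF L[OF t] L[OF r]] L[OF r]] L2_dist_commute[of \<Omega> "z r" "z t"]
        by (simp add: L2_dist_def abs_le_iff)
      then show "\<forall>\<^sub>F r in at t within {0..T}. norm (Lp_norm 2 \<Omega> (z r) - Lp_norm 2 \<Omega> (z t)) \<le> L2_dist \<Omega> (z r) (z t)"
        by (auto simp: eventually_at_filter intro!: always_eventually)
    qed
    then show "((\<lambda>r. Lp_norm 2 \<Omega> (z r)) \<longlongrightarrow> Lp_norm 2 \<Omega> (z t)) (at t within {0..T})" by (simp add: LIM_zero_iff)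
  qed
  then show ?thesis by (intro continuous_intros)
qed

text \<open>The increment condition of \<open>energy_inequality\<close> is convexity of the squared
  norm: 0 <= |z s - z t|^2 shows that the squared norm grows from s to t by at most 2 (z t - z s, z
  t), and this pairing is the integral of \<open>D r (z t)\<close> over [s,t]. Only the right end
  has to lie in H1.\<close>

lemma evolution_energy:
  assumes \<Omega>: "open \<Omega>" and T: "0 < T" and e: "evolution \<Omega> T z D" and P: "P integrable_on {0..T}" and Z: "negligible Z"
    and le: "\<And>t. t \<in> {0..T} - Z \<Longrightarrow> z t \<in> H1 \<Omega> \<Longrightarrow> D t (z t) \<le> P t"
  shows "(Lp_norm 2 \<Omega> (z T))\<^sup>2 - (Lp_norm 2 \<Omega> (z 0))\<^sup>2 \<le> 2 * integral {0..T} P"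
proof -
  interpret H: seminormed_space "H1 \<Omega>" "H1_norm \<Omega>" by (rule seminormed_space_H1[OF \<Omega>])
  obtain G Y where GY: "negligible Y" "\<forall>t. 0 \<le> G t" "(\<lambda>t. (G t)\<^sup>2) integrable_on {0..T}"
    "\<forall>t\<in>{0..T} - Y. z t \<in> H1 \<Omega> \<and> D t \<in> H1_dual \<Omega> \<and> (\<forall>\<psi>\<in>H1 \<Omega>. \<bar>D t \<psi>\<bar> \<le> G t * H1_norm \<Omega> \<psi>)"
    using e unfolding evolution_def by blast
  have G: "negligible Y" "\<And>t. 0 \<le> G t" "(\<lambda>t. (G t)\<^sup>2) integrable_on {0..T}"
    "\<And>t. t \<in> {0..T} - Y \<Longrightarrow> z t \<in> H1 \<Omega> \<and> D t \<in> H1_dual \<Omega> \<and> (\<forall>\<psi>\<in>H1 \<Omega>. \<bar>D t \<psi>\<bar> \<le> G t * H1_norm \<Omega> \<psi>)"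
    using GY by blast+
  have L: "z r \<in> Lp 2 \<Omega>" if "r \<in> {0..T}" for r using e that by (auto simp: evolution_def)
  show ?thesis
  proof (rule energy_inequality[where q = "\<lambda>t. (Lp_norm 2 \<Omega> (z t))\<^sup>2" and Z = "Z \<union> Y" and V = "H1 \<Omega>" and N = "H1_norm \<Omega>"
        and z = z and F = D and G = G, OF T evolution_norm_continuous[OF e]])
    show "negligible (Z \<union> Y)" using Z G by (simp add: negligible_Un)
    show "z t \<in> H1 \<Omega>" if "t \<in> {0..T} - (Z \<union> Y)" for t using G(4)[of t] that by auto
    show "(\<lambda>r. D r (z t)) integrable_on {s..t} \<and>
        (Lp_norm 2 \<Omega> (z t))\<^sup>2 - (Lp_norm 2 \<Omega> (z s))\<^sup>2 \<le> 2 * integral {s..t} (\<lambda>r. D r (z t))"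
      if t: "t \<in> {0..T} - (Z \<union> Y)" and s: "0 \<le> s" "s < t" for s t
    proof -
      have tT: "t \<in> {0..T}" "s \<in> {0..T}" "t \<le> T" using t s by auto
      have zt: "z t \<in> H1 \<Omega>" using G(4)[of t] t by auto
      have D: "(\<lambda>r. D r (z t)) integrable_on {s..t}"
        "L2_inner \<Omega> (z t) (z t) - L2_inner \<Omega> (z s) (z t) = integral {s..t} (\<lambda>r. D r (z t))"
        using e zt s tT(3) unfolding evolution_def by blast+
      have "0 \<le> (Lp_norm 2 \<Omega> (\<lambda>x. z s x + (-1) *\<^sub>R z t x))\<^sup>2" by simp
      also have "\<dots> = (Lp_norm 2 \<Omega> (z s))\<^sup>2 + 2 * L2_inner \<Omega> (z s) (\<lambda>x. (-1) *\<^sub>R z t x) + (Lp_norm 2 \<Omega> (\<lambda>x. (-1) *\<^sub>R z t x))\<^sup>2"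
        by (rule Lp2_norm_sq_add[OF L[OF tT(2)] Lp2_scaleR[OF L[OF tT(1)]]])
      also have "L2_inner \<Omega> (z s) (\<lambda>x. (-1) *\<^sub>R z t x) = - L2_inner \<Omega> (z s) (z t)" by (simp add: L2_inner_def)
      also have "Lp_norm 2 \<Omega> (\<lambda>x. (-1) *\<^sub>R z t x) = Lp_norm 2 \<Omega> (z t)" unfolding Lp2_norm_scaleR by simp
      finally show ?thesis using D L2_inner_self[of \<Omega> "z t"] by simp
    qed
    show "D r \<phi> - D r (z r) \<le> G r * H1_norm \<Omega> (\<lambda>x. \<phi> x - z r x)" if "r \<in> {0..T} - (Z \<union> Y)" "\<phi> \<in> H1 \<Omega>" for r \<phi>
    proof -
      have G4: "z r \<in> H1 \<Omega>" "D r \<in> H1_dual \<Omega>" "\<forall>\<psi>\<in>H1 \<Omega>. \<bar>D r \<psi>\<bar> \<le> G r * H1_norm \<Omega> \<psi>" using G(4)[of r] that by auto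
      have "\<bar>D r (\<lambda>x. \<phi> x - z r x)\<bar> \<le> G r * H1_norm \<Omega> (\<lambda>x. \<phi> x - z r x)"
        using G4 H.diff_in[OF that(2) G4(1)] by blast
      then show ?thesis using H1_dual_apply_diff[OF \<Omega> G4(2) that(2) G4(1)] by simp
    qed
    show "D r (z r) \<le> P r" if "r \<in> {0..T} - (Z \<union> Y)" for r using le[of r] G(4)[of r] that by auto
    show "\<exists>s e d Z'. (\<forall>t\<in>{0..T}. s t \<in> H1 \<Omega>) \<and> 0 < d \<and>
        (\<forall>t\<in>{0..T}. \<forall>r\<in>{0..T}. \<bar>t - r\<bar> \<le> d \<longrightarrow> H1_norm \<Omega> (\<lambda>x. s t x - s r x) \<le> \<epsilon>) \<and>
        (\<lambda>t. (e t)\<^sup>2) integrable_on {0..T} \<and> integral {0..T} (\<lambda>t. (e t)\<^sup>2) \<le> \<epsilon>\<^sup>2 \<and> negligible Z' \<and>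
        (\<forall>t\<in>{0..T} - Z'. H1_norm \<Omega> (\<lambda>x. z t x - s t x) \<le> e t)" if eps: "\<epsilon> > 0" for \<epsilon>
    proof -
      obtain s f d Z' where "\<forall>t. s t \<in> H1 \<Omega>" "0 < d"
        "\<forall>t\<in>{0..T}. \<forall>r\<in>{0..T}. \<bar>t - r\<bar> \<le> d \<longrightarrow> H1_norm \<Omega> (\<lambda>x. s t x - s r x) \<le> \<epsilon>"
        "(\<lambda>t. (f t)\<^sup>2) integrable_on {0..T}" "integral {0..T} (\<lambda>t. (f t)\<^sup>2) \<le> \<epsilon>\<^sup>2" "negligible Z'"
        "\<forall>t\<in>{0..T} - Z'. z t \<in> H1 \<Omega> \<and> 0 \<le> f t \<and> H1_norm \<Omega> (\<lambda>x. z t x - s t x) \<le> f t"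
        using e eps unfolding evolution_def by blast
      then show ?thesis by (intro exI[of _ s] exI[of _ f] exI[of _ d] exI[of _ Z']) auto
    qed
  qed (use G P H.N_triangle H.N_sym in auto)
qed

text \<open>As \<open>q\<close> is merely continuous, monotonicity is shown for the right side: q 0
  + C times the integral of q, multiplied by exp(-C t), is nonincreasing.\<close>

lemma gronwall:
  fixes q :: "real \<Rightarrow> real"
  assumes q: "continuous_on {0..T} q" and C: "0 \<le> C" and T: "0 \<le> T"
    and le: "\<And>t. t \<in> {0..T} \<Longrightarrow> q t \<le> q 0 + C * integral {0..t} q"
  shows "q T \<le> q 0 * exp (C * T)"
proof -
  define y where "y t = exp (- C * t) * (q 0 + C * integral {0..t} q)" for t
  have "y T \<le> y 0"
  proof (rule DERIV_nonpos_imp_decreasing_open[OF T])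
    have "continuous_on {0..T} (\<lambda>t. integral {0..t} q)"
      by (rule indefinite_integral_continuous_1[OF integrable_continuous_interval[OF q]])
    then show "continuous_on {0..T} y" unfolding y_def by (intro continuous_intros)
    fix t assume t: "0 < t" "t < T"
    have "((\<lambda>t. integral {0..t} q) has_real_derivative q t) (at t within {0..T})"
      by (rule integral_has_real_derivative[OF q]) (use t in auto)
    then have "((\<lambda>t. integral {0..t} q) has_real_derivative q t) (at t)"
      using t at_within_interior[of t "{0..T}"] by simp
    then have "(y has_real_derivative (exp (- C * t) * (C * q t) - C * exp (- C * t) * (q 0 + C * integral {0..t} q))) (at t)"
      unfolding y_def by (auto intro!: derivative_eq_intros)
    moreover have "exp (- C * t) * (C * q t) - C * exp (- C * t) * (q 0 + C * integral {0..t} q) \<le> 0"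
    proof -
      have "exp (- C * t) * (C * q t) - C * exp (- C * t) * (q 0 + C * integral {0..t} q) =
          (C * exp (- C * t)) * (q t - (q 0 + C * integral {0..t} q))" by (simp add: algebra_simps)
      also have "\<dots> \<le> 0" using le[of t] t C by (intro mult_nonneg_nonpos) auto
      finally show ?thesis .
    qed
    ultimately show "\<exists>y'. (y has_real_derivative y') (at t) \<and> y' \<le> 0" by blast
  qed
  then have "q 0 + C * integral {0..T} q \<le> q 0 * exp (C * T)"
    by (simp add: y_def exp_minus field_simps)
  then show ?thesis using le[of T] T by auto
qed

section \<open>Estimates for the coefficients of the equation\<close>

lemma Lp_infinity_norm_le:
  assumes "f \<in> borel_measurable (lebesgue_on \<Omega>)" "AE x in lebesgue_on \<Omega>. norm (f x) \<le> B" "0 \<le> B"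
  shows "f \<in> Lp \<infinity> \<Omega>" "Lp_norm \<infinity> \<Omega> f \<le> B"
proof -
  let ?e = "esssup (lebesgue_on \<Omega>) (\<lambda>x. ereal (norm (f x)))"
  have le: "?e \<le> ereal B" by (rule esssup_I) (use assms in auto)
  then have "?e < \<infinity>" by (cases ?e) auto
  then show "f \<in> Lp \<infinity> \<Omega>" using assms(1) by (simp add: Lp_def)
  show "Lp_norm \<infinity> \<Omega> f \<le> B" using le assms(3) by (cases ?e) (auto simp: Lp_norm_def)
qed

lemma AE_le_Lp_infinity_norm:
  assumes "f \<in> Lp \<infinity> \<Omega>"
  shows "AE x in lebesgue_on \<Omega>. norm (f x) \<le> Lp_norm \<infinity> \<Omega> f"
proof -
  let ?e = "esssup (lebesgue_on \<Omega>) (\<lambda>x. ereal (norm (f x)))"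
  have lt: "?e < \<infinity>" using assms by (simp add: Lp_def)
  have "AE x in lebesgue_on \<Omega>. ereal (norm (f x)) \<le> ?e" by (rule esssup_AE)
  then show ?thesis
  proof eventually_elim
    case (elim x)
    then show ?case using lt by (cases ?e) (auto simp: Lp_norm_def)
  qed
qed

lemma Lp_infinity_norm_nonneg:
  assumes "open \<Omega>" "\<Omega> \<noteq> {}" "f \<in> Lp \<infinity> \<Omega>"
  shows "0 \<le> Lp_norm \<infinity> \<Omega> f"
proof (rule ccontr)
  assume "\<not> ?thesis"
  then have neg: "Lp_norm \<infinity> \<Omega> f < 0" by simp
  have "AE x in lebesgue_on \<Omega>. False"
    using AE_le_Lp_infinity_norm[OF assms(3)]
  proof eventually_elim
    case (elim x)
    then show False using neg norm_ge_zero[of "f x"] by linarith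
  qed
  then have "negligible \<Omega>" using AE_lebesgue_on_iff_negligible[OF sets_lebesgue_open[OF assms(1)], of "\<lambda>_. False"] by simp
  then show False using open_not_negligible assms by blast
qed

lemma Lp_infinity_norm_cong_AE:
  fixes f h :: "'a::euclidean_space \<Rightarrow> 'b::euclidean_space"
  assumes \<Omega>: "\<Omega> \<in> sets lebesgue" and f: "f \<in> Lp \<infinity> \<Omega>" and eq: "AE x in lebesgue_on \<Omega>. f x = h x"
  shows "Lp_norm \<infinity> \<Omega> h = Lp_norm \<infinity> \<Omega> f" "h \<in> Lp \<infinity> \<Omega>"
proof -
  have m: "f \<in> borel_measurable (lebesgue_on \<Omega>)" using f by (simp add: Lp_def)
  have m': "h \<in> borel_measurable (lebesgue_on \<Omega>)" by (rule borel_measurable_lebesgue_on_cong_AE[OF \<Omega> m eq])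
  have "esssup (lebesgue_on \<Omega>) (\<lambda>x. ereal (norm (f x))) = esssup (lebesgue_on \<Omega>) (\<lambda>x. ereal (norm (h x)))"
    by (rule esssup_AE_cong) (use m m' eq in \<open>auto elim: eventually_mono\<close>)
  then show "Lp_norm \<infinity> \<Omega> h = Lp_norm \<infinity> \<Omega> f" "h \<in> Lp \<infinity> \<Omega>"
    using f m' by (auto simp: Lp_norm_def Lp_def)
qed

section \<open>Bounds for the nonlocal drift\<close>

lemma phase_space_affine_Lp:
  assumes "\<Omega> \<in> lmeasurable" "u \<in> phase_space \<Omega>"
  shows "(\<lambda>y. 1 - 2 * u y) \<in> Lp 2 \<Omega>" "(\<lambda>y. 1 - 2 * u y) \<in> Lp \<infinity> \<Omega>" "Lp_norm \<infinity> \<Omega> (\<lambda>y. 1 - 2 * u y) \<le> 1"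
proof -
  have u: "u \<in> Lp 2 \<Omega>" using assms phase_space_Lp2 by auto
  show "(\<lambda>y. 1 - 2 * u y) \<in> Lp 2 \<Omega>" by (rule Lp2_diff[OF Lp2_const[OF assms(1)] Lp2_cmult[OF u]])
  have m: "(\<lambda>y. 1 - 2 * u y) \<in> borel_measurable (lebesgue_on \<Omega>)" using Lp2_measurable[OF u] by measurable
  have ae: "AE y in lebesgue_on \<Omega>. norm (1 - 2 * u y) \<le> 1"
    using phase_space_bounds[OF assms(2)] by eventually_elim auto
  show "(\<lambda>y. 1 - 2 * u y) \<in> Lp \<infinity> \<Omega>" "Lp_norm \<infinity> \<Omega> (\<lambda>y. 1 - 2 * u y) \<le> 1"
    by (rule Lp_infinity_norm_le[OF m ae], simp)+
qed

text \<open>(K) is applied with p = infinity, where 1 - 2u has norm at most 1 for every u in the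
  phase space. This uniform bound is what lets differences of the mobility be estimated in
  L2.\<close>

lemma wgrad_conv_bounded:
  assumes \<Omega>: "open \<Omega>" "bounded \<Omega>" "\<Omega> \<noteq> {}" and K: "assumption_K \<Omega> K"
  shows "\<exists>B\<ge>0. \<forall>u\<in>phase_space \<Omega>. AE x in lebesgue_on \<Omega>. norm (wgrad \<Omega> (conv \<Omega> K (\<lambda>y. 1 - 2 * u y)) x) \<le> B"
proof -
  have \<Omega>s: "\<Omega> \<in> sets lebesgue" by (rule sets_lebesgue_open[OF \<Omega>(1)])
  have \<Omega>l: "\<Omega> \<in> lmeasurable" by (rule bounded_set_imp_lmeasurable[OF \<Omega>(2) \<Omega>s])
  have "\<forall>p\<ge>1. \<exists>r>0. \<forall>\<rho>\<in>Lp p \<Omega>. conv \<Omega> K \<rho> \<in> W1 p \<Omega> \<and> W1_norm p \<Omega> (conv \<Omega> K \<rho>) \<le> r * Lp_norm p \<Omega> \<rho>"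
    using K unfolding assumption_K_def by blast
  then obtain r where r: "r > 0" "\<And>\<rho>. \<rho> \<in> Lp \<infinity> \<Omega> \<Longrightarrow> conv \<Omega> K \<rho> \<in> W1 \<infinity> \<Omega> \<and> W1_norm \<infinity> \<Omega> (conv \<Omega> K \<rho>) \<le> r * Lp_norm \<infinity> \<Omega> \<rho>"
    by (metis top_greatest infinity_ennreal_def)
  have "AE x in lebesgue_on \<Omega>. norm (wgrad \<Omega> (conv \<Omega> K (\<lambda>y. 1 - 2 * u y)) x) \<le> r" if u: "u \<in> phase_space \<Omega>" for u
  proof -
    define w where "w = conv \<Omega> K (\<lambda>y. 1 - 2 * u y)"
    have w: "w \<in> W1 \<infinity> \<Omega>" "W1_norm \<infinity> \<Omega> w \<le> r * Lp_norm \<infinity> \<Omega> (\<lambda>y. 1 - 2 * u y)"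
      using r(2)[OF phase_space_affine_Lp(2)[OF \<Omega>l u]] by (auto simp: w_def)
    have "r * Lp_norm \<infinity> \<Omega> (\<lambda>y. 1 - 2 * u y) \<le> r * 1"
      using phase_space_affine_Lp(3)[OF \<Omega>l u] r(1) by (intro mult_left_mono) auto
    then have W: "W1_norm \<infinity> \<Omega> w \<le> r" using w(2) by simp
    obtain G where G: "G \<in> Lp \<infinity> \<Omega>" "weak_gradient \<Omega> w G" using w(1) by (auto simp: W1_def)
    have ae: "AE x in lebesgue_on \<Omega>. G x = wgrad \<Omega> w x"
      using wgrad_eq_AE[OF \<Omega>(1) G(2)] by eventually_elim simp
    have wg: "wgrad \<Omega> w \<in> Lp \<infinity> \<Omega>" by (rule Lp_infinity_norm_cong_AE(2)[OF \<Omega>s G(1) ae])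
    have "w \<in> Lp \<infinity> \<Omega>" using w(1) by (simp add: W1_def)
    then have "Lp_norm \<infinity> \<Omega> (wgrad \<Omega> w) \<le> r"
      using W Lp_infinity_norm_nonneg[OF \<Omega>(1,3), of w] by (simp add: W1_norm_def)
    then show ?thesis using AE_le_Lp_infinity_norm[OF wg] unfolding w_def[symmetric]
      by (auto elim!: eventually_mono)
  qed
  then show ?thesis using r(1) by (intro exI[of _ r]) auto
qed

text \<open>Additivity of \<open>conv\<close> at a point x requires the integrals there to exist;
  the supremum condition in (K) provides this for every x in \<Omega>. As \<open>K\<close> is only
  Lebesgue measurable, the reflection y -> x - y is treated as an affine map that preserves Lebesgue
  measurability.\<close>

lemma conv_integrable:
  fixes K :: "'a::euclidean_space \<Rightarrow> real"
  assumes \<Omega>: "\<Omega> \<in> sets lebesgue" and K: "assumption_K \<Omega> K" and x: "x \<in> \<Omega>"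
    and \<rho>: "\<rho> \<in> borel_measurable (lebesgue_on \<Omega>)" "AE y in lebesgue_on \<Omega>. \<bar>\<rho> y\<bar> \<le> 1"
  shows "integrable (lebesgue_on \<Omega>) (\<lambda>y. K (x - y) * \<rho> y)"
proof -
  have Km: "K \<in> borel_measurable lebesgue" and fin: "(SUP x\<in>\<Omega>. \<integral>\<^sup>+ y. ennreal \<bar>K (x - y)\<bar> \<partial>lebesgue_on \<Omega>) < \<infinity>"
    using K by (auto simp: assumption_K_def)
  have "(\<lambda>y. x + (\<Sum>j\<in>Basis. (- 1 * (y \<bullet> j)) *\<^sub>R j)) \<in> lebesgue \<rightarrow>\<^sub>M lebesgue"
    by (rule lebesgue_affine_measurable) auto
  also have "(\<lambda>y. x + (\<Sum>j\<in>Basis. (- 1 * (y \<bullet> j)) *\<^sub>R j)) = (\<lambda>y. x - y)"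
    by (simp add: sum_negf euclidean_representation)
  finally have "(\<lambda>y. x - y) \<in> lebesgue \<rightarrow>\<^sub>M lebesgue" .
  then have Kx: "(\<lambda>y. K (x - y)) \<in> borel_measurable (lebesgue_on \<Omega>)"
    using measurable_compose[OF _ Km] by (intro measurable_restrict_space1) auto
  have "integrable (lebesgue_on \<Omega>) (\<lambda>y. K (x - y))"
  proof (rule integrableI_bounded[OF Kx])
    have "(\<integral>\<^sup>+ y. ennreal (norm (K (x - y))) \<partial>lebesgue_on \<Omega>) \<le> (SUP x\<in>\<Omega>. \<integral>\<^sup>+ y. ennreal \<bar>K (x - y)\<bar> \<partial>lebesgue_on \<Omega>)"
      using SUP_upper[OF x, of "\<lambda>x. \<integral>\<^sup>+ y. ennreal \<bar>K (x - y)\<bar> \<partial>lebesgue_on \<Omega>"] by simp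
    then show "(\<integral>\<^sup>+ y. ennreal (norm (K (x - y))) \<partial>lebesgue_on \<Omega>) < \<infinity>" using fin by (rule le_less_trans)
  qed
  from integrable_norm[OF this] show ?thesis
  proof (rule Bochner_Integration.integrable_bound)
    show "(\<lambda>y. K (x - y) * \<rho> y) \<in> borel_measurable (lebesgue_on \<Omega>)" using Kx \<rho>(1) by measurable
    show "AE y in lebesgue_on \<Omega>. norm (K (x - y) * \<rho> y) \<le> norm (norm (K (x - y)))"
      using \<rho>(2) by eventually_elim (simp add: abs_mult mult_left_le)
  qed
qed

text \<open>On \<Omega> the difference of the two potentials is the convolution with -2 (u - v), to
  which (K) with p = 2 applies; hence the constant 2r. Uniqueness of weak gradients transfers this
  to the chosen gradients.\<close>

lemma wgrad_conv_lipschitz: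
  fixes K :: "'a::euclidean_space \<Rightarrow> real"
  assumes \<Omega>: "open \<Omega>" "bounded \<Omega>" and K: "assumption_K \<Omega> K"
  shows "\<exists>R\<ge>0. \<forall>u\<in>phase_space \<Omega>. \<forall>v\<in>phase_space \<Omega>.
    wgrad \<Omega> (conv \<Omega> K (\<lambda>y. 1 - 2 * u y)) \<in> Lp 2 \<Omega> \<and>
    Lp_norm 2 \<Omega> (\<lambda>x. wgrad \<Omega> (conv \<Omega> K (\<lambda>y. 1 - 2 * u y)) x - wgrad \<Omega> (conv \<Omega> K (\<lambda>y. 1 - 2 * v y)) x)
      \<le> R * L2_dist \<Omega> u v"
proof -
  have \<Omega>s: "\<Omega> \<in> sets lebesgue" by (rule sets_lebesgue_open[OF \<Omega>(1)])
  have \<Omega>l: "\<Omega> \<in> lmeasurable" by (rule bounded_set_imp_lmeasurable[OF \<Omega>(2) \<Omega>s])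
  have "\<forall>p\<ge>1. \<exists>r>0. \<forall>\<rho>\<in>Lp p \<Omega>. conv \<Omega> K \<rho> \<in> W1 p \<Omega> \<and> W1_norm p \<Omega> (conv \<Omega> K \<rho>) \<le> r * Lp_norm p \<Omega> \<rho>"
    using K unfolding assumption_K_def by blast
  then obtain r where r: "r > 0" "\<And>\<rho>. \<rho> \<in> Lp 2 \<Omega> \<Longrightarrow> conv \<Omega> K \<rho> \<in> H1 \<Omega> \<and> H1_norm \<Omega> (conv \<Omega> K \<rho>) \<le> r * Lp_norm 2 \<Omega> \<rho>"
    by (metis one_le_numeral)
  show ?thesis
  proof (intro exI[of _ "2 * r"] conjI ballI)
    show "0 \<le> 2 * r" using r by simp
    fix u v assume u: "u \<in> phase_space \<Omega>" and v: "v \<in> phase_space \<Omega>"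
    define \<rho> where "\<rho> = (\<lambda>(w :: 'a \<Rightarrow> real) y. 1 - 2 * w y)"
    have \<rho>uv: "(\<lambda>y. 1 - 2 * w y) = \<rho> w" for w by (simp add: \<rho>_def)
    have L: "\<rho> u \<in> Lp 2 \<Omega>" "\<rho> v \<in> Lp 2 \<Omega>"
      using phase_space_affine_Lp(1)[OF \<Omega>l] u v by (auto simp: \<rho>_def)
    have H: "conv \<Omega> K (\<rho> u) \<in> H1 \<Omega>" "conv \<Omega> K (\<rho> v) \<in> H1 \<Omega>" using r(2) L by auto
    show "wgrad \<Omega> (conv \<Omega> K (\<lambda>y. 1 - 2 * u y)) \<in> Lp 2 \<Omega>" unfolding \<rho>uv by (rule wgrad_Lp2[OF \<Omega>(1) H(1)])
    define \<rho>' where "\<rho>' = (\<lambda>y. \<rho> u y - \<rho> v y)"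
    have L': "\<rho>' \<in> Lp 2 \<Omega>" unfolding \<rho>'_def by (rule Lp2_diff[OF L])
    have H': "conv \<Omega> K \<rho>' \<in> H1 \<Omega>" using r(2)[OF L'] by auto
    have eq: "conv \<Omega> K \<rho>' x = conv \<Omega> K (\<rho> u) x - conv \<Omega> K (\<rho> v) x" if x: "x \<in> \<Omega>" for x
    proof -
      have "integrable (lebesgue_on \<Omega>) (\<lambda>y. K (x - y) * \<rho> w y)" if w: "w \<in> phase_space \<Omega>" for w
      proof (rule conv_integrable[OF \<Omega>s K x])
        show "\<rho> w \<in> borel_measurable (lebesgue_on \<Omega>)"
          using Lp2_measurable[OF phase_space_affine_Lp(1)[OF \<Omega>l w]] by (simp add: \<rho>_def)
        show "AE y in lebesgue_on \<Omega>. \<bar>\<rho> w y\<bar> \<le> 1"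
          using phase_space_bounds[OF w] by eventually_elim (auto simp: \<rho>_def)
      qed
      from this[OF u] this[OF v] show ?thesis by (simp add: conv_def \<rho>'_def right_diff_distrib)
    qed
    have ae: "AE x in lebesgue_on \<Omega>. wgrad \<Omega> (conv \<Omega> K \<rho>') x =
        1 *\<^sub>R wgrad \<Omega> (conv \<Omega> K (\<rho> u)) x + (-1) *\<^sub>R wgrad \<Omega> (conv \<Omega> K (\<rho> v)) x"
      by (rule weak_gradient_unique[OF W1_weak_gradient[OF H'] weak_gradient_scale_add[OF H[THEN W1_weak_gradient] \<Omega>s]])
         (use eq \<Omega> in auto)
    have "Lp_norm 2 \<Omega> (\<lambda>x. wgrad \<Omega> (conv \<Omega> K (\<rho> u)) x - wgrad \<Omega> (conv \<Omega> K (\<rho> v)) x) = Lp_norm 2 \<Omega> (wgrad \<Omega> (conv \<Omega> K \<rho>'))"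
      by (rule Lp2_norm_cong_AE[OF \<Omega>s _, symmetric]) (use Lp2_measurable[OF wgrad_Lp2[OF \<Omega>(1) H']] ae in auto)
    also have "\<dots> \<le> H1_norm \<Omega> (conv \<Omega> K \<rho>')" by (rule Lp_norm_le_H1_norm)
    also have "\<dots> \<le> r * Lp_norm 2 \<Omega> \<rho>'" using r(2)[OF L'] by auto
    also have "Lp_norm 2 \<Omega> \<rho>' = 2 * L2_dist \<Omega> u v"
    proof -
      have "\<rho>' = (\<lambda>y. (-2) *\<^sub>R (u y - v y))" by (auto simp: \<rho>'_def \<rho>_def)
      then show ?thesis using Lp2_norm_scaleR[of \<Omega> "-2" "\<lambda>y. u y - v y"] by (simp add: L2_dist_def)
    qed
    finally show "Lp_norm 2 \<Omega> (\<lambda>x. wgrad \<Omega> (conv \<Omega> K (\<lambda>y. 1 - 2 * u y)) x - wgrad \<Omega> (conv \<Omega> K (\<lambda>y. 1 - 2 * v y)) x)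
      \<le> 2 * r * L2_dist \<Omega> u v" unfolding \<rho>uv by simp
  qed
qed

text \<open>The bounds are the C^{1,1} bounds of (G); the real issue is measurability of
  \<open>g x (u x)\<close>, as \<open>g\<close> is measurable in x only for fixed s. The values of
  \<open>u\<close> are clipped to [0,1] and rounded down to multiples of 1/(n+1), which leaves
  countably many values of s, and the Lipschitz bound in s carries measurability to the
  limit.\<close>

lemma reaction_estimates:
  assumes \<Omega>: "\<Omega> \<in> lmeasurable" and g: "assumption_G \<Omega> g"
  shows "\<exists>M\<ge>0. (\<forall>u\<in>phase_space \<Omega>. (\<lambda>x. g x (u x)) \<in> borel_measurable (lebesgue_on \<Omega>) \<and>
      (AE x in lebesgue_on \<Omega>. \<bar>g x (u x)\<bar> \<le> M)) \<and>
    (\<forall>u\<in>phase_space \<Omega>. \<forall>v\<in>phase_space \<Omega>. AE x in lebesgue_on \<Omega>. \<bar>g x (u x) - g x (v x)\<bar> \<le> M * \<bar>u x - v x\<bar>)"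
proof -
  have \<Omega>s: "\<Omega> \<in> sets lebesgue" using \<Omega> by auto
  have gm: "\<And>s. s \<in> {0..1} \<Longrightarrow> (\<lambda>x. g x s) \<in> borel_measurable (lebesgue_on \<Omega>)"
    using g by (auto simp: assumption_G_def)
  obtain M0 where M0: "\<forall>x\<in>\<Omega>. \<exists>g'. (\<forall>s\<in>{0..1}. (g x has_real_derivative g' s) (at s within {0..1}) \<and>
           \<bar>g x s\<bar> \<le> M0 \<and> \<bar>g' s\<bar> \<le> M0) \<and> M0-lipschitz_on {0..1} g'"
    using g unfolding assumption_G_def by blast
  define M where "M = \<bar>M0\<bar>"
  have bd: "\<bar>g x s\<bar> \<le> M" if "x \<in> \<Omega>" "s \<in> {0..1}" for x s
  proof -
    have "\<bar>g x s\<bar> \<le> M0" using M0 that by blast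
    then show ?thesis by (simp add: M_def)
  qed
  have lip: "\<bar>g x s - g x t\<bar> \<le> M * \<bar>s - t\<bar>" if x: "x \<in> \<Omega>" and "s \<in> {0..1}" "t \<in> {0..1}" for x s t
  proof -
    obtain g' where g': "\<forall>s\<in>{0..1}. (g x has_real_derivative g' s) (at s within {0..1}) \<and> \<bar>g x s\<bar> \<le> M0 \<and> \<bar>g' s\<bar> \<le> M0"
      using M0 x by blast
    have "norm (g x s - g x t) \<le> M * norm (s - t)"
      by (rule field_differentiable_bound[of "{0..1::real}" "g x" g'])
         (use g' that in \<open>auto simp: M_def intro: order_trans[OF _ abs_ge_self]\<close>)
    then show ?thesis by simp
  qed
  have meas: "(\<lambda>x. g x (u x)) \<in> borel_measurable (lebesgue_on \<Omega>)" if u: "u \<in> phase_space \<Omega>" for u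
  proof -
    let ?M = "lebesgue_on \<Omega>"
    have um: "u \<in> borel_measurable ?M" using Lp2_measurable[OF phase_space_Lp2[OF u]] .
    define cl where "cl x = max 0 (min 1 (u x))" for x
    have clm[measurable]: "cl \<in> borel_measurable ?M" unfolding cl_def using um by measurable
    have cl01: "cl x \<in> {0..1}" for x by (auto simp: cl_def)
    define q where "q n x = real_of_int \<lfloor>real (Suc n) * cl x\<rfloor> / real (Suc n)" for n x
    have q01: "q n x \<in> {0..1}" for n x
    proof -
      have "real (Suc n) * cl x \<le> real (Suc n) * 1" using cl01[of x] by (intro mult_left_mono) auto
      with of_int_floor_le[of "real (Suc n) * cl x"]
      have "real_of_int \<lfloor>real (Suc n) * cl x\<rfloor> \<le> real (Suc n)" by (metis mult.right_neutral order_trans)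
      moreover have "0 \<le> real_of_int \<lfloor>real (Suc n) * cl x\<rfloor>" using cl01[of x] by simp
      ultimately show ?thesis unfolding q_def by (simp add: divide_le_eq)
    qed
    have qm: "(\<lambda>x. g x (q n x)) \<in> borel_measurable ?M" for n
    proof -
      define k where "k i x = g x (max 0 (min 1 (real_of_int i / real (Suc n))))" for i x
      have "(\<lambda>x. k \<lfloor>real (Suc n) * cl x\<rfloor> x) \<in> borel_measurable ?M"
      proof (rule measurable_compose_countable)
        show "(\<lambda>x. k i x) \<in> borel_measurable ?M" for i :: int unfolding k_def by (rule gm) auto
        show "(\<lambda>x. \<lfloor>real (Suc n) * cl x\<rfloor>) \<in> ?M \<rightarrow>\<^sub>M count_space UNIV" by measurable
      qed
      moreover have "k \<lfloor>real (Suc n) * cl x\<rfloor> x = g x (q n x)" for x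
        using q01[of n x] by (simp add: k_def q_def)
      ultimately show ?thesis by simp
    qed
    have cm: "(\<lambda>x. g x (cl x)) \<in> borel_measurable ?M"
    proof (rule borel_measurable_LIMSEQ_real[OF _ qm])
      fix x assume "x \<in> space ?M"
      then have x: "x \<in> \<Omega>" by simp
      have "(\<lambda>n. g x (q n x) - g x (cl x)) \<longlonglongrightarrow> 0"
      proof (rule Lim_null_comparison)
        show "(\<lambda>n. M * inverse (real (Suc n))) \<longlonglongrightarrow> 0"
          using tendsto_mult_right_zero[OF LIMSEQ_inverse_real_of_nat] .
        have "norm (g x (q n x) - g x (cl x)) \<le> M * inverse (real (Suc n))" for n
        proof -
          have "norm (g x (q n x) - g x (cl x)) \<le> M * \<bar>q n x - cl x\<bar>" using lip[OF x q01 cl01] by simp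
          also have "\<bar>q n x - cl x\<bar> = \<bar>real_of_int \<lfloor>real (Suc n) * cl x\<rfloor> - real (Suc n) * cl x\<bar> / real (Suc n)"
          proof -
            have "q n x - cl x = (real_of_int \<lfloor>real (Suc n) * cl x\<rfloor> - real (Suc n) * cl x) / real (Suc n)"
              by (simp add: q_def diff_divide_distrib del: of_nat_Suc)
            then show ?thesis by (simp only: abs_divide abs_of_nat)
          qed
          also have "M * \<dots> \<le> M * (1 / real (Suc n))"
            by (intro mult_left_mono divide_right_mono) (auto simp: M_def, linarith)
          finally show ?thesis by (simp add: divide_inverse)
        qed
        then show "\<forall>\<^sub>F n in sequentially. norm (g x (q n x) - g x (cl x)) \<le> M * inverse (real (Suc n))" by simp
      qed
      then show "(\<lambda>n. g x (q n x)) \<longlonglongrightarrow> g x (cl x)" by (simp add: LIM_zero_iff)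
    qed
    show ?thesis
    proof (rule borel_measurable_lebesgue_on_cong_AE[OF \<Omega>s cm])
      show "AE x in ?M. g x (cl x) = g x (u x)"
        using phase_space_bounds[OF u] by eventually_elim (simp add: cl_def)
    qed
  qed
  have "AE x in lebesgue_on \<Omega>. \<bar>g x (u x)\<bar> \<le> M" if "u \<in> phase_space \<Omega>" for u
    using phase_space_bounds[OF that] AE_space by eventually_elim (auto intro: bd)
  moreover have "AE x in lebesgue_on \<Omega>. \<bar>g x (u x) - g x (v x)\<bar> \<le> M * \<bar>u x - v x\<bar>"
    if "u \<in> phase_space \<Omega>" "v \<in> phase_space \<Omega>" for u v
    using phase_space_bounds[OF that(1)] phase_space_bounds[OF that(2)] AE_space
    by eventually_elim (auto intro: lip)
  ultimately show ?thesis using meas by (intro exI[of _ M]) (auto simp: M_def)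
qed

definition flux :: "'a::euclidean_space set \<Rightarrow> ('a \<Rightarrow> real) \<Rightarrow> ('a \<Rightarrow> real) \<Rightarrow> 'a \<Rightarrow> 'a" where
  "flux \<Omega> K u x = mobility (u x) *\<^sub>R wgrad \<Omega> (conv \<Omega> K (\<lambda>y. 1 - 2 * u y)) x"

text \<open>With W the gradient of the potential, the difference of two fluxes is split into
  (\<mu>(u) - \<mu>(v)) W(u) + \<mu>(v) (W(u) - W(v)). The first part uses the pointwise bound on W,
  the second the L2 Lipschitz bound. On [0,1] the mobility \<mu> is bounded by 1 and has Lipschitz
  constant 1.\<close>

lemma flux_estimates:
  fixes K :: "'a::euclidean_space \<Rightarrow> real"
  assumes \<Omega>: "open \<Omega>" "bounded \<Omega>" "\<Omega> \<noteq> {}" and K: "assumption_K \<Omega> K"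
  shows "\<exists>L\<ge>0. \<forall>u\<in>phase_space \<Omega>. flux \<Omega> K u \<in> Lp 2 \<Omega> \<and> Lp_norm 2 \<Omega> (flux \<Omega> K u) \<le> L \<and>
    (\<forall>v\<in>phase_space \<Omega>. Lp_norm 2 \<Omega> (\<lambda>x. flux \<Omega> K u x - flux \<Omega> K v x) \<le> L * L2_dist \<Omega> u v)"
proof -
  have \<Omega>s: "\<Omega> \<in> sets lebesgue" by (rule sets_lebesgue_open[OF \<Omega>(1)])
  have \<Omega>l: "\<Omega> \<in> lmeasurable" by (rule bounded_set_imp_lmeasurable[OF \<Omega>(2) \<Omega>s])
  define W where "W u = wgrad \<Omega> (conv \<Omega> K (\<lambda>y. 1 - 2 * u y))" for u
  obtain B where B: "B \<ge> 0" "\<And>u. u \<in> phase_space \<Omega> \<Longrightarrow> AE x in lebesgue_on \<Omega>. norm (W u x) \<le> B"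
    using wgrad_conv_bounded[OF \<Omega> K] unfolding W_def by blast
  obtain R where R: "R \<ge> 0" "\<And>u. u \<in> phase_space \<Omega> \<Longrightarrow> W u \<in> Lp 2 \<Omega>"
      "\<And>u v. u \<in> phase_space \<Omega> \<Longrightarrow> v \<in> phase_space \<Omega> \<Longrightarrow> Lp_norm 2 \<Omega> (\<lambda>x. W u x - W v x) \<le> R * L2_dist \<Omega> u v"
    using wgrad_conv_lipschitz[OF \<Omega>(1,2) K] unfolding W_def by blast
  define n1 where "n1 = Lp_norm 2 \<Omega> (\<lambda>x. 1::real)"
  have um: "u \<in> borel_measurable (lebesgue_on \<Omega>)" if "u \<in> phase_space \<Omega>" for u
    using Lp2_measurable[OF phase_space_Lp2[OF that]] .
  have mob: "\<bar>mobility a\<bar> \<le> 1" if "0 \<le> a" "a \<le> 1" for a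
    using that mult_le_one[of a "1 - a"] by (simp add: mobility_def)
  have mobd: "\<bar>mobility a - mobility b\<bar> \<le> \<bar>a - b\<bar>" if "0 \<le> a" "a \<le> 1" "0 \<le> b" "b \<le> 1" for a b
  proof -
    have "mobility a - mobility b = (a - b) * (1 - a - b)" by (simp add: mobility_def algebra_simps)
    moreover have "\<bar>1 - a - b\<bar> \<le> 1" using that by auto
    ultimately show ?thesis by (simp add: abs_mult mult_left_le)
  qed
  have fl: "flux \<Omega> K u = (\<lambda>x. mobility (u x) *\<^sub>R W u x)" for u by (simp add: flux_def W_def fun_eq_iff)
  have 1: "flux \<Omega> K u \<in> Lp 2 \<Omega>" "Lp_norm 2 \<Omega> (flux \<Omega> K u) \<le> B * n1" if u: "u \<in> phase_space \<Omega>" for u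
  proof -
    have m: "(\<lambda>x. mobility (u x) *\<^sub>R W u x) \<in> borel_measurable (lebesgue_on \<Omega>)"
      using um[OF u] Lp2_measurable[OF R(2)[OF u]] unfolding mobility_def by measurable
    have ae: "AE x in lebesgue_on \<Omega>. norm (mobility (u x) *\<^sub>R W u x) \<le> B * norm (1::real)"
      using phase_space_bounds[OF u] B(2)[OF u]
    proof eventually_elim
      case (elim x)
      have "\<bar>mobility (u x)\<bar> * norm (W u x) \<le> 1 * B" using elim mob by (intro mult_mono) auto
      then show ?case by simp
    qed
    show "flux \<Omega> K u \<in> Lp 2 \<Omega>" "Lp_norm 2 \<Omega> (flux \<Omega> K u) \<le> B * n1"
      unfolding fl n1_def using Lp2_norm_le_of_AE[OF m Lp2_const[OF \<Omega>l] ae B(1)] by auto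
  qed
  have 2: "Lp_norm 2 \<Omega> (\<lambda>x. flux \<Omega> K u x - flux \<Omega> K v x) \<le> (B + R) * L2_dist \<Omega> u v"
    if u: "u \<in> phase_space \<Omega>" and v: "v \<in> phase_space \<Omega>" for u v
  proof -
    have d: "(\<lambda>x. u x - v x) \<in> Lp 2 \<Omega>" by (rule Lp2_diff[OF phase_space_Lp2[OF u] phase_space_Lp2[OF v]])
    have Wd: "(\<lambda>x. W u x - W v x) \<in> Lp 2 \<Omega>" by (rule Lp2_diff[OF R(2)[OF u] R(2)[OF v]])
    define p where "p x = (mobility (u x) - mobility (v x)) *\<^sub>R W u x" for x
    define q where "q x = mobility (v x) *\<^sub>R (W u x - W v x)" for x
    have pm: "p \<in> borel_measurable (lebesgue_on \<Omega>)" and qm: "q \<in> borel_measurable (lebesgue_on \<Omega>)"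
      using um[OF u] um[OF v] Lp2_measurable[OF R(2)[OF u]] Lp2_measurable[OF R(2)[OF v]]
      unfolding mobility_def p_def q_def by measurable
    have "AE x in lebesgue_on \<Omega>. norm (p x) \<le> B * norm (u x - v x)"
      using phase_space_bounds[OF u] phase_space_bounds[OF v] B(2)[OF u]
    proof eventually_elim
      case (elim x)
      have "\<bar>mobility (u x) - mobility (v x)\<bar> * norm (W u x) \<le> \<bar>u x - v x\<bar> * B"
        using elim mobd B(1) by (intro mult_mono) auto
      then show ?case by (simp add: p_def mult.commute)
    qed
    note P = Lp2_norm_le_of_AE[OF pm d this B(1)]
    have "AE x in lebesgue_on \<Omega>. norm (q x) \<le> 1 * norm (W u x - W v x)"
      using phase_space_bounds[OF v]
    proof eventually_elim
      case (elim x)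
      have "\<bar>mobility (v x)\<bar> * norm (W u x - W v x) \<le> 1 * norm (W u x - W v x)"
        using elim mob by (intro mult_right_mono) auto
      then show ?case by (simp add: q_def)
    qed
    note Q = Lp2_norm_le_of_AE[OF qm Wd this]
    have "(\<lambda>x. flux \<Omega> K u x - flux \<Omega> K v x) = (\<lambda>x. p x + q x)"
      by (auto simp: fl p_def q_def algebra_simps)
    then have "Lp_norm 2 \<Omega> (\<lambda>x. flux \<Omega> K u x - flux \<Omega> K v x) \<le> Lp_norm 2 \<Omega> p + Lp_norm 2 \<Omega> q"
      using Lp2_norm_triangle[OF P(1) Q(1)] by simp
    then show ?thesis using P(2) Q(2) R(3)[OF u v] by (simp add: L2_dist_def distrib_right)
  qed
  have n0: "n1 \<ge> 0" by (simp add: n1_def)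
  define L where "L = B * n1 + (B + R)"
  have L: "B * n1 \<le> L" "B + R \<le> L" "0 \<le> L" using B R n0 by (auto simp: L_def)
  have "Lp_norm 2 \<Omega> (\<lambda>x. flux \<Omega> K u x - flux \<Omega> K v x) \<le> L * L2_dist \<Omega> u v"
    if "u \<in> phase_space \<Omega>" "v \<in> phase_space \<Omega>" for u v
    by (rule order_trans[OF 2[OF that] mult_right_mono[OF L(2)]]) simp
  then show ?thesis
    using 1(1) order_trans[OF 1(2) L(1)] L(3) by (intro exI[of _ L]) blast
qed

lemma reaction_L2_estimates:
  assumes \<Omega>: "\<Omega> \<in> lmeasurable" and g: "assumption_G \<Omega> g"
  shows "\<exists>M\<ge>0. \<forall>u\<in>phase_space \<Omega>. (\<lambda>x. g x (u x)) \<in> Lp 2 \<Omega> \<and> Lp_norm 2 \<Omega> (\<lambda>x. g x (u x)) \<le> M \<and>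
    (\<forall>v\<in>phase_space \<Omega>. Lp_norm 2 \<Omega> (\<lambda>x. g x (u x) - g x (v x)) \<le> M * L2_dist \<Omega> u v)"
proof -
  obtain M where M: "M \<ge> 0" "\<forall>u\<in>phase_space \<Omega>. (\<lambda>x. g x (u x)) \<in> borel_measurable (lebesgue_on \<Omega>) \<and>
      (AE x in lebesgue_on \<Omega>. \<bar>g x (u x)\<bar> \<le> M)"
    "\<forall>u\<in>phase_space \<Omega>. \<forall>v\<in>phase_space \<Omega>. AE x in lebesgue_on \<Omega>. \<bar>g x (u x) - g x (v x)\<bar> \<le> M * \<bar>u x - v x\<bar>"
    using reaction_estimates[OF \<Omega> g] by blast
  define n1 where "n1 = Lp_norm 2 \<Omega> (\<lambda>x. 1::real)"
  have n0: "n1 \<ge> 0" by (simp add: n1_def)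
  have 1: "(\<lambda>x. g x (u x)) \<in> Lp 2 \<Omega>" "Lp_norm 2 \<Omega> (\<lambda>x. g x (u x)) \<le> M * n1" if u: "u \<in> phase_space \<Omega>" for u
  proof -
    have m: "(\<lambda>x. g x (u x)) \<in> borel_measurable (lebesgue_on \<Omega>)"
      and ae: "AE x in lebesgue_on \<Omega>. norm (g x (u x)) \<le> M * norm (1::real)" using M(2) u by auto
    show "(\<lambda>x. g x (u x)) \<in> Lp 2 \<Omega>" "Lp_norm 2 \<Omega> (\<lambda>x. g x (u x)) \<le> M * n1"
      unfolding n1_def using Lp2_norm_le_of_AE[OF m Lp2_const[OF \<Omega>] ae M(1)] by auto
  qed
  have 2: "Lp_norm 2 \<Omega> (\<lambda>x. g x (u x) - g x (v x)) \<le> M * L2_dist \<Omega> u v"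
    if u: "u \<in> phase_space \<Omega>" and v: "v \<in> phase_space \<Omega>" for u v
  proof -
    have m: "(\<lambda>x. g x (u x) - g x (v x)) \<in> borel_measurable (lebesgue_on \<Omega>)"
      using M(2) u v by (intro borel_measurable_diff) auto
    have ae: "AE x in lebesgue_on \<Omega>. norm (g x (u x) - g x (v x)) \<le> M * norm (u x - v x)" using M(3) u v by auto
    show ?thesis unfolding L2_dist_def
      by (rule Lp2_norm_le_of_AE(2)[OF m Lp2_diff[OF phase_space_Lp2[OF u] phase_space_Lp2[OF v]] ae M(1)])
  qed
  define L where "L = M * n1 + M"
  have L: "M * n1 \<le> L" "M \<le> L" "0 \<le> L" using M n0 by (auto simp: L_def)
  have "Lp_norm 2 \<Omega> (\<lambda>x. g x (u x) - g x (v x)) \<le> L * L2_dist \<Omega> u v"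
    if "u \<in> phase_space \<Omega>" "v \<in> phase_space \<Omega>" for u v
    by (rule order_trans[OF 2[OF that] mult_right_mono[OF L(2)]]) simp
  then show ?thesis
    using 1(1) order_trans[OF 1(2) L(1)] L(3) by (intro exI[of _ L]) blast
qed

text \<open>The value that the weak formulation prescribes for the time derivative at
  \<psi>.\<close>

definition rhs ::
  "'a::euclidean_space set \<Rightarrow> ('a \<Rightarrow> real) \<Rightarrow> ('a \<Rightarrow> real \<Rightarrow> real) \<Rightarrow> ('a \<Rightarrow> real) \<Rightarrow> ('a \<Rightarrow> real) \<Rightarrow> real" where
  "rhs \<Omega> K g u \<psi> = L2_inner \<Omega> (\<lambda>x. g x (u x)) \<psi> - L2_inner \<Omega> (flux \<Omega> K u) (wgrad \<Omega> \<psi>)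
     - L2_inner \<Omega> (wgrad \<Omega> u) (wgrad \<Omega> \<psi>)"

lemma phase_space_norm_le:
  assumes \<Omega>: "\<Omega> \<in> lmeasurable" and u: "u \<in> phase_space \<Omega>"
  shows "Lp_norm 2 \<Omega> u \<le> sqrt (measure lebesgue \<Omega>)"
proof -
  have ae: "AE x in lebesgue_on \<Omega>. norm (u x) \<le> 1 * norm (1::real)"
    using phase_space_bounds[OF u] by eventually_elim auto
  have "Lp_norm 2 \<Omega> u \<le> 1 * Lp_norm 2 \<Omega> (\<lambda>x. 1::real)"
    by (rule Lp2_norm_le_of_AE(2)[OF Lp2_measurable[OF phase_space_Lp2[OF u]] Lp2_const[OF \<Omega>] ae]) simp
  also have "Lp_norm 2 \<Omega> (\<lambda>x. 1::real) = sqrt (measure lebesgue \<Omega>)"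
    using \<Omega> by (simp add: Lp2_norm_eq measure_restrict_space)
  finally show ?thesis by simp
qed

text \<open>With X the norm of the gradient, Young's inequality sets half of the diffusion term -X^2
  against the flux. The other half dominates a quarter of the squared H1 norm up to a constant,
  since that norm is a sum m + X with m bounded and (m + X)^2 <= 2 m^2 + 2 X^2. For two states the
  same absorption leaves only multiples of their squared L2 distance.\<close>

lemma rhs_dissipation:
  fixes K :: "'a::euclidean_space \<Rightarrow> real"
  assumes \<Omega>: "open \<Omega>" "bounded \<Omega>" "\<Omega> \<noteq> {}" and K: "assumption_K \<Omega> K" and g: "assumption_G \<Omega> g"
  shows "\<exists>C\<ge>0. (\<forall>u\<in>phase_space \<Omega> \<inter> H1 \<Omega>. rhs \<Omega> K g u u \<le> C - (H1_norm \<Omega> u)\<^sup>2 / 4) \<and>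
    (\<forall>u\<in>phase_space \<Omega> \<inter> H1 \<Omega>. \<forall>v\<in>phase_space \<Omega> \<inter> H1 \<Omega>.
      rhs \<Omega> K g u (\<lambda>x. u x - v x) - rhs \<Omega> K g v (\<lambda>x. u x - v x) \<le> C * (L2_dist \<Omega> u v)\<^sup>2)"
proof -
  have \<Omega>s: "\<Omega> \<in> sets lebesgue" by (rule sets_lebesgue_open[OF \<Omega>(1)])
  have \<Omega>l: "\<Omega> \<in> lmeasurable" by (rule bounded_set_imp_lmeasurable[OF \<Omega>(2) \<Omega>s])
  obtain L where L: "L \<ge> 0" "\<forall>u\<in>phase_space \<Omega>. flux \<Omega> K u \<in> Lp 2 \<Omega> \<and> Lp_norm 2 \<Omega> (flux \<Omega> K u) \<le> L \<and>
    (\<forall>v\<in>phase_space \<Omega>. Lp_norm 2 \<Omega> (\<lambda>x. flux \<Omega> K u x - flux \<Omega> K v x) \<le> L * L2_dist \<Omega> u v)"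
    using flux_estimates[OF \<Omega> K] by blast
  obtain M where M: "M \<ge> 0" "\<forall>u\<in>phase_space \<Omega>. (\<lambda>x. g x (u x)) \<in> Lp 2 \<Omega> \<and> Lp_norm 2 \<Omega> (\<lambda>x. g x (u x)) \<le> M \<and>
    (\<forall>v\<in>phase_space \<Omega>. Lp_norm 2 \<Omega> (\<lambda>x. g x (u x) - g x (v x)) \<le> M * L2_dist \<Omega> u v)"
    using reaction_L2_estimates[OF \<Omega>l g] by blast
  define S where "S = sqrt (measure lebesgue \<Omega>)"
  have S0: "S \<ge> 0" by (simp add: S_def)
  \<comment> \<open>The first estimate needs L^2/2 + M S + S^2/2, the second M + L^2/2;
    \<open>C\<close> exceeds both.\<close>
  define C where "C = L\<^sup>2 + M * S + S\<^sup>2 + M"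
  have young: "L * a * X \<le> (L * a)\<^sup>2 / 2 + X\<^sup>2 / 2" for a X
    using sum_squares_bound[of "L * a" X] by simp
  have 1: "rhs \<Omega> K g u u \<le> C - (H1_norm \<Omega> u)\<^sup>2 / 4" if u: "u \<in> phase_space \<Omega>" "u \<in> H1 \<Omega>" for u
  proof -
    define X where "X = Lp_norm 2 \<Omega> (wgrad \<Omega> u)"
    define m where "m = Lp_norm 2 \<Omega> u"
    have X0: "X \<ge> 0" "m \<ge> 0" "m \<le> S" using phase_space_norm_le[OF \<Omega>l u(1)] by (auto simp: X_def m_def S_def)
    have Lu: "flux \<Omega> K u \<in> Lp 2 \<Omega>" "Lp_norm 2 \<Omega> (flux \<Omega> K u) \<le> L"
      and Mu: "(\<lambda>x. g x (u x)) \<in> Lp 2 \<Omega>" "Lp_norm 2 \<Omega> (\<lambda>x. g x (u x)) \<le> M" using L(2) M(2) u(1) by auto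
    have "- L2_inner \<Omega> (flux \<Omega> K u) (wgrad \<Omega> u) \<le> Lp_norm 2 \<Omega> (flux \<Omega> K u) * X"
      using L2_Cauchy_Schwarz[OF Lu(1) wgrad_Lp2[OF \<Omega>(1) u(2)]] by (simp add: X_def abs_le_iff)
    also have "\<dots> \<le> L * X" using Lu(2) X0 by (intro mult_right_mono)
    finally have i: "- L2_inner \<Omega> (flux \<Omega> K u) (wgrad \<Omega> u) \<le> L\<^sup>2 / 2 + X\<^sup>2 / 2" using young[of 1 X] by simp
    have "L2_inner \<Omega> (\<lambda>x. g x (u x)) u \<le> Lp_norm 2 \<Omega> (\<lambda>x. g x (u x)) * m"
      using L2_Cauchy_Schwarz[OF Mu(1) phase_space_Lp2[OF u(1)]] by (simp add: m_def abs_le_iff)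
    also have "\<dots> \<le> M * S" using Mu(2) X0 M(1) by (intro mult_mono) auto
    finally have ii: "L2_inner \<Omega> (\<lambda>x. g x (u x)) u \<le> M * S" .
    have h: "(H1_norm \<Omega> u)\<^sup>2 \<le> 2 * m\<^sup>2 + 2 * X\<^sup>2"
      using sum_squares_bound[of m X] by (simp add: W1_norm_def m_def X_def power2_sum)
    have "m\<^sup>2 \<le> S\<^sup>2" using X0 by (intro power_mono) auto
    moreover have "0 \<le> L\<^sup>2" by simp
    moreover have "rhs \<Omega> K g u u = L2_inner \<Omega> (\<lambda>x. g x (u x)) u - L2_inner \<Omega> (flux \<Omega> K u) (wgrad \<Omega> u) - X\<^sup>2"
      by (simp add: rhs_def L2_inner_self X_def)
    ultimately show ?thesis using i ii h M(1) zero_le_power2[of S] unfolding C_def by linarith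
  qed
  have 2: "rhs \<Omega> K g u (\<lambda>x. u x - v x) - rhs \<Omega> K g v (\<lambda>x. u x - v x) \<le> C * (L2_dist \<Omega> u v)\<^sup>2"
    if u: "u \<in> phase_space \<Omega>" "u \<in> H1 \<Omega>" and v: "v \<in> phase_space \<Omega>" "v \<in> H1 \<Omega>" for u v
  proof -
    define z where "z = (\<lambda>x. u x - v x)"
    have z: "z \<in> H1 \<Omega>" unfolding z_def by (rule H1_diff(1)[OF \<Omega>(1) u(2) v(2)])
    have zL: "z \<in> Lp 2 \<Omega>" by (rule H1_Lp2[OF z])
    have gz: "wgrad \<Omega> z \<in> Lp 2 \<Omega>" by (rule wgrad_Lp2[OF \<Omega>(1) z])
    define X where "X = Lp_norm 2 \<Omega> (wgrad \<Omega> z)"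
    define d where "d = L2_dist \<Omega> u v"
    have d: "d = Lp_norm 2 \<Omega> z" "d \<ge> 0" by (auto simp: d_def L2_dist_def z_def)
    have X0: "X \<ge> 0" by (simp add: X_def)
    have F: "flux \<Omega> K u \<in> Lp 2 \<Omega>" "flux \<Omega> K v \<in> Lp 2 \<Omega>" "Lp_norm 2 \<Omega> (\<lambda>x. flux \<Omega> K u x - flux \<Omega> K v x) \<le> L * d"
      using L(2) u(1) v(1) by (auto simp: d_def)
    have Gg: "(\<lambda>x. g x (u x)) \<in> Lp 2 \<Omega>" "(\<lambda>x. g x (v x)) \<in> Lp 2 \<Omega>" "Lp_norm 2 \<Omega> (\<lambda>x. g x (u x) - g x (v x)) \<le> M * d"
      using M(2) u(1) v(1) by (auto simp: d_def)
    have W: "wgrad \<Omega> u \<in> Lp 2 \<Omega>" "wgrad \<Omega> v \<in> Lp 2 \<Omega>" using wgrad_Lp2[OF \<Omega>(1)] u(2) v(2) by auto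
    have "- L2_inner \<Omega> (\<lambda>x. flux \<Omega> K u x - flux \<Omega> K v x) (wgrad \<Omega> z) \<le> Lp_norm 2 \<Omega> (\<lambda>x. flux \<Omega> K u x - flux \<Omega> K v x) * X"
      using L2_Cauchy_Schwarz[OF Lp2_diff[OF F(1,2)] gz] by (simp add: X_def abs_le_iff)
    also have "\<dots> \<le> L * d * X" using F(3) X0 by (intro mult_right_mono)
    finally have i: "- L2_inner \<Omega> (\<lambda>x. flux \<Omega> K u x - flux \<Omega> K v x) (wgrad \<Omega> z) \<le> (L * d)\<^sup>2 / 2 + X\<^sup>2 / 2"
      using young[of d X] by simp
    have "L2_inner \<Omega> (\<lambda>x. g x (u x) - g x (v x)) z \<le> Lp_norm 2 \<Omega> (\<lambda>x. g x (u x) - g x (v x)) * d"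
      using L2_Cauchy_Schwarz[OF Lp2_diff[OF Gg(1,2)] zL] by (simp add: d abs_le_iff)
    also have "\<dots> \<le> M * d * d" using Gg(3) d(2) by (intro mult_right_mono)
    finally have ii: "L2_inner \<Omega> (\<lambda>x. g x (u x) - g x (v x)) z \<le> M * d\<^sup>2" by (simp add: power2_eq_square mult.assoc)
    have "L2_inner \<Omega> (\<lambda>x. wgrad \<Omega> u x - wgrad \<Omega> v x) (wgrad \<Omega> z) = L2_inner \<Omega> (wgrad \<Omega> z) (wgrad \<Omega> z)"
      by (rule L2_inner_cong_AE[OF \<Omega>s Lp2_measurable[OF Lp2_diff[OF W]] Lp2_measurable[OF gz]])
         (use H1_diff(2)[OF \<Omega>(1) u(2) v(2)] in \<open>auto simp: z_def elim: eventually_mono\<close>)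
    then have iii: "L2_inner \<Omega> (wgrad \<Omega> u) (wgrad \<Omega> z) - L2_inner \<Omega> (wgrad \<Omega> v) (wgrad \<Omega> z) = X\<^sup>2"
      using L2_inner_diff_left[OF W gz] by (simp add: L2_inner_self X_def)
    have "rhs \<Omega> K g u z - rhs \<Omega> K g v z = L2_inner \<Omega> (\<lambda>x. g x (u x) - g x (v x)) z
        - L2_inner \<Omega> (\<lambda>x. flux \<Omega> K u x - flux \<Omega> K v x) (wgrad \<Omega> z) - X\<^sup>2"
      using iii L2_inner_diff_left[OF Gg(1,2) zL] L2_inner_diff_left[OF F(1,2) gz] by (simp add: rhs_def)
    also have "\<dots> \<le> M * d\<^sup>2 + L\<^sup>2 * d\<^sup>2 / 2" using i ii zero_le_power2[of X] unfolding power_mult_distrib by linarith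
    also have "\<dots> \<le> C * d\<^sup>2"
    proof -
      have "M + L\<^sup>2 / 2 \<le> C" using M(1) S0 zero_le_power2[of L] zero_le_power2[of S] mult_nonneg_nonneg[OF M(1) S0]
        unfolding C_def by linarith
      then have "(M + L\<^sup>2 / 2) * d\<^sup>2 \<le> C * d\<^sup>2" by (intro mult_right_mono) auto
      then show ?thesis by (simp add: algebra_simps)
    qed
    finally show ?thesis by (simp add: z_def d_def)
  qed
  have "C \<ge> 0" using M(1) S0 by (auto simp: C_def)
  then show ?thesis using 1 2 by (intro exI[of _ C]) auto
qed

section \<open>Weak solutions as evolutions\<close>

lemma integral_shift:
  fixes f :: "real \<Rightarrow> real"
  assumes "f integrable_on {s + a..s + b}"
  shows "(\<lambda>r. f (s + r)) integrable_on {a..b}" "integral {a..b} (\<lambda>r. f (s + r)) = integral {s + a..s + b} f"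
proof -
  have "((\<lambda>r. f (r + s)) has_integral integral {s + a..s + b} f) {s + a - s..s + b - s}"
    by (rule has_integral_shift_real_ivl[OF integrable_integral[OF assms]])
  then have "((\<lambda>r. f (s + r)) has_integral integral {s + a..s + b} f) {a..b}" by (simp add: add.commute)
  then show "(\<lambda>r. f (s + r)) integrable_on {a..b}" "integral {a..b} (\<lambda>r. f (s + r)) = integral {s + a..s + b} f"
    by (auto simp: has_integral_iff)
qed

text \<open>A weak solution is square integrable in time only on compact subintervals of the open
  half line, so it is restarted at s > 0 and shifted to [0,T]. One \<open>du\<close> is fixed before
  s and T, so that all pieces of a trajectory share their derivative.\<close>

lemma solution_evolution:
  fixes K :: "'a::euclidean_space \<Rightarrow> real"
  assumes \<Omega>: "open \<Omega>" and sol: "weak_solution \<Omega> K g u0 u"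
  shows "\<exists>du. \<forall>s>0. \<forall>T>0. evolution \<Omega> T (\<lambda>r. u (s + r)) (\<lambda>r. du (s + r)) \<and>
    (\<lambda>r. (H1_norm \<Omega> (u (s + r)))\<^sup>2) integrable_on {0..T} \<and>
    (\<exists>Z. negligible Z \<and> (\<forall>r\<in>{0..T} - Z. \<forall>\<psi>\<in>H1 \<Omega>. du (s + r) \<psi> = rhs \<Omega> K g (u (s + r)) \<psi>))"
proof -
  have cont: "cont_in (Lp 2 \<Omega>) (Lp_norm 2 \<Omega>) u" and uV: "L2_loc (H1 \<Omega>) (H1_norm \<Omega>) u"
    using sol by (auto simp: weak_solution_def)
  obtain du where du: "L2_loc (H1_dual \<Omega>) (H1_dual_norm \<Omega>) du" "weak_time_derivative \<Omega> u du"
    and eq: "AE t in lebesgue_on {0<..}. \<forall>\<psi>\<in>H1 \<Omega>.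
           du t \<psi>
           + L2_inner \<Omega> (\<lambda>x. mobility (u t x) *\<^sub>R wgrad \<Omega> (potential \<Omega> K u t) x) (wgrad \<Omega> \<psi>)
           + L2_inner \<Omega> (wgrad \<Omega> (u t)) (wgrad \<Omega> \<psi>)
           = L2_inner \<Omega> (\<lambda>x. g x (u t x)) \<psi>"
    using sol unfolding weak_solution_def by blast
  interpret H: seminormed_space "H1 \<Omega>" "H1_norm \<Omega>" by (rule seminormed_space_H1[OF \<Omega>])
  have uL: "u t \<in> Lp 2 \<Omega>" and ut: "((\<lambda>s. L2_dist \<Omega> (u s) (u t)) \<longlongrightarrow> 0) (at t within {0..})" if "t \<ge> 0" for t
    using cont that by (auto simp: cont_in_def L2_dist_def)
  have neg_shift: "negligible ((+) (- s) ` Z)" if "negligible Z" for s :: real and Z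
    by (rule negligible_translation[OF that])
  have shift_mem: "s + r \<notin> Z" if "r \<notin> (+) (- s) ` Z" for s r :: real and Z
  proof
    assume "s + r \<in> Z"
    then have "- s + (s + r) \<in> (+) (- s) ` Z" by (rule imageI)
    then show False using that by simp
  qed
  have "evolution \<Omega> T (\<lambda>r. u (s + r)) (\<lambda>r. du (s + r)) \<and>
    (\<lambda>r. (H1_norm \<Omega> (u (s + r)))\<^sup>2) integrable_on {0..T} \<and>
    (\<exists>Z. negligible Z \<and> (\<forall>r\<in>{0..T} - Z. \<forall>\<psi>\<in>H1 \<Omega>. du (s + r) \<psi> = rhs \<Omega> K g (u (s + r)) \<psi>))"
    if s: "s > 0" and T: "T > 0" for s T
  proof (intro conjI)
    have sT: "0 < s" "s < s + T" using s T by auto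
    have um: "strongly_measurable (H1 \<Omega>) (H1_norm \<Omega>) {s..s + T} u"
      and ui: "integrable (lebesgue_on {s..s + T}) (\<lambda>t. (H1_norm \<Omega> (u t))\<^sup>2)"
      using uV sT by (auto simp: L2_loc_def)
    have dm: "strongly_measurable (H1_dual \<Omega>) (H1_dual_norm \<Omega>) {s..s + T} du"
      and di: "integrable (lebesgue_on {s..s + T}) (\<lambda>t. (H1_dual_norm \<Omega> (du t))\<^sup>2)"
      using du(1) sT by (auto simp: L2_loc_def)
    have ui': "(\<lambda>t. (H1_norm \<Omega> (u t))\<^sup>2) integrable_on {s..s + T}"
      and di': "(\<lambda>t. (H1_dual_norm \<Omega> (du t))\<^sup>2) integrable_on {s..s + T}"
      using ui di by (auto intro: integrable_on_lebesgue_on)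
    show "(\<lambda>r. (H1_norm \<Omega> (u (s + r)))\<^sup>2) integrable_on {0..T}"
      using integral_shift(1)[of "\<lambda>t. (H1_norm \<Omega> (u t))\<^sup>2" s 0 T] ui' by simp
    have "AE t in lebesgue_on {0<..}. \<forall>\<psi>\<in>H1 \<Omega>. du t \<psi> = rhs \<Omega> K g (u t) \<psi>"
      using eq by eventually_elim (auto simp: rhs_def flux_def[abs_def] potential_def algebra_simps)
    then have N: "negligible {t \<in> {0<..}. \<not> (\<forall>\<psi>\<in>H1 \<Omega>. du t \<psi> = rhs \<Omega> K g (u t) \<psi>)}" (is "negligible ?N")
      by (subst (asm) AE_lebesgue_on_iff_negligible) auto
    show "\<exists>Z. negligible Z \<and> (\<forall>r\<in>{0..T} - Z. \<forall>\<psi>\<in>H1 \<Omega>. du (s + r) \<psi> = rhs \<Omega> K g (u (s + r)) \<psi>)"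
    proof (intro exI conjI ballI)
      show "negligible ((+) (- s) ` ?N)" by (rule neg_shift[OF N])
      fix r \<psi> assume r: "r \<in> {0..T} - (+) (- s) ` ?N" and \<psi>: "\<psi> \<in> H1 \<Omega>"
      have "s + r \<notin> ?N" using r by (intro shift_mem) auto
      then show "du (s + r) \<psi> = rhs \<Omega> K g (u (s + r)) \<psi>" using r s \<psi> by auto
    qed
    show "evolution \<Omega> T (\<lambda>r. u (s + r)) (\<lambda>r. du (s + r))"
      unfolding evolution_def
    proof (intro conjI ballI allI impI)
      fix t assume t: "t \<in> {0..T}"
      show "u (s + t) \<in> Lp 2 \<Omega>" using uL t s by auto
      have "filterlim (\<lambda>r. s + r) (at (s + t) within {0..}) (at t within {0..T})"
        unfolding filterlim_at
      proof
        show "((\<lambda>r. s + r) \<longlongrightarrow> s + t) (at t within {0..T})" by (intro tendsto_intros)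
        show "\<forall>\<^sub>F r in at t within {0..T}. s + r \<in> {0..} \<and> s + r \<noteq> s + t"
          using s by (auto simp: eventually_at_filter intro!: always_eventually)
      qed
      from filterlim_compose[OF ut this] t s
      show "((\<lambda>r. L2_dist \<Omega> (u (s + r)) (u (s + t))) \<longlongrightarrow> 0) (at t within {0..T})" by simp
    next
      have "AE t in lebesgue_on {s..s + T}. u t \<in> H1 \<Omega> \<and> du t \<in> H1_dual \<Omega>"
      proof -
        have "AE t in lebesgue_on {s..s + T}. u t \<in> H1 \<Omega>"
          using um unfolding strongly_measurable_def by (auto elim!: eventually_mono)
        moreover have "AE t in lebesgue_on {s..s + T}. du t \<in> H1_dual \<Omega>"
          using dm unfolding strongly_measurable_def by (auto elim!: eventually_mono)
        ultimately show ?thesis by eventually_elim simp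
      qed
      then have N: "negligible {t \<in> {s..s + T}. \<not> (u t \<in> H1 \<Omega> \<and> du t \<in> H1_dual \<Omega>)}" (is "negligible ?N")
        by (subst (asm) AE_lebesgue_on_iff_negligible) auto
      show "\<exists>G Z. negligible Z \<and> (\<forall>t. 0 \<le> G t) \<and> (\<lambda>t. (G t)\<^sup>2) integrable_on {0..T} \<and>
        (\<forall>t\<in>{0..T} - Z. u (s + t) \<in> H1 \<Omega> \<and> du (s + t) \<in> H1_dual \<Omega> \<and>
           (\<forall>\<psi>\<in>H1 \<Omega>. \<bar>du (s + t) \<psi>\<bar> \<le> G t * H1_norm \<Omega> \<psi>))"
      proof (intro exI[of _ "\<lambda>t. \<bar>H1_dual_norm \<Omega> (du (s + t))\<bar>"] exI[of _ "(+) (- s) ` ?N"] conjI ballI allI)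
        show "negligible ((+) (- s) ` ?N)" by (rule neg_shift[OF N])
        show "(\<lambda>t. \<bar>H1_dual_norm \<Omega> (du (s + t))\<bar>\<^sup>2) integrable_on {0..T}"
          using integral_shift(1)[of "\<lambda>t. (H1_dual_norm \<Omega> (du t))\<^sup>2" s 0 T] di' by simp
        fix t assume t: "t \<in> {0..T} - (+) (- s) ` ?N"
        have "s + t \<notin> ?N" using t by (intro shift_mem) auto
        then show m: "u (s + t) \<in> H1 \<Omega>" "du (s + t) \<in> H1_dual \<Omega>" using t by auto
        fix \<psi> assume \<psi>: "\<psi> \<in> H1 \<Omega>"
        have "\<bar>du (s + t) \<psi>\<bar> \<le> H1_dual_norm \<Omega> (du (s + t)) * H1_norm \<Omega> \<psi>" by (rule H1_dual_bound[OF \<Omega> m(2) \<psi>])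
        also have "\<dots> \<le> \<bar>H1_dual_norm \<Omega> (du (s + t))\<bar> * H1_norm \<Omega> \<psi>" by (intro mult_right_mono) auto
        finally show "\<bar>du (s + t) \<psi>\<bar> \<le> \<bar>H1_dual_norm \<Omega> (du (s + t))\<bar> * H1_norm \<Omega> \<psi>" .
      qed auto
    next
      fix \<psi> and a b :: real assume \<psi>: "\<psi> \<in> H1 \<Omega>" and ab: "0 \<le> a \<and> a < b \<and> b \<le> T"
      have yc: "continuous_on {0<..} (\<lambda>t. L2_inner \<Omega> (u t) \<psi>)"
        unfolding continuous_on_def
      proof
        fix t :: real assume t: "t \<in> {0<..}"
        have "((\<lambda>r. L2_inner \<Omega> (u r) \<psi> - L2_inner \<Omega> (u t) \<psi>) \<longlongrightarrow> 0) (at t within {0<..})"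
        proof (rule Lim_null_comparison)
          have "((\<lambda>r. L2_dist \<Omega> (u r) (u t)) \<longlongrightarrow> 0) (at t within {0<..})"
            by (rule tendsto_within_subset[OF ut]) (use t in auto)
          then show "((\<lambda>r. L2_dist \<Omega> (u r) (u t) * Lp_norm 2 \<Omega> \<psi>) \<longlongrightarrow> 0) (at t within {0<..})"
            by (rule tendsto_mult_left_zero)
          have "\<bar>L2_inner \<Omega> (u r) \<psi> - L2_inner \<Omega> (u t) \<psi>\<bar> \<le> L2_dist \<Omega> (u r) (u t) * Lp_norm 2 \<Omega> \<psi>" if "r > 0" for r
          proof -
            have l: "u r \<in> Lp 2 \<Omega>" "u t \<in> Lp 2 \<Omega>" "\<psi> \<in> Lp 2 \<Omega>" using uL that t H1_Lp2[OF \<psi>] by auto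
            show ?thesis using L2_Cauchy_Schwarz[OF Lp2_diff[OF l(1,2)] l(3)] L2_inner_diff_left[OF l] by (simp add: L2_dist_def)
          qed
          then show "\<forall>\<^sub>F r in at t within {0<..}. norm (L2_inner \<Omega> (u r) \<psi> - L2_inner \<Omega> (u t) \<psi>) \<le> L2_dist \<Omega> (u r) (u t) * Lp_norm 2 \<Omega> \<psi>"
            by (auto simp: eventually_at_filter intro!: always_eventually)
        qed
        then show "((\<lambda>t. L2_inner \<Omega> (u t) \<psi>) \<longlongrightarrow> L2_inner \<Omega> (u t) \<psi>) (at t within {0<..})" by (simp add: LIM_zero_iff)
      qed
      have fi: "integrable (lebesgue_on {p..q}) (\<lambda>t. du t \<psi>)" if "0 < p" "p < q" for p q
        by (rule integrable_dual_pairing[OF \<Omega> _ _ \<psi>]) (use du(1) that in \<open>auto simp: L2_loc_def\<close>)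
      have w: "(LINT t|lebesgue_on {0<..}. L2_inner \<Omega> (u t) \<psi> * deriv \<eta> t) = - (LINT t|lebesgue_on {0<..}. du t \<psi> * \<eta> t)"
        if "test_function {0<..} \<eta>" for \<eta>
        using du(2) that \<psi> by (auto simp: weak_time_derivative_def)
      have sab: "0 < s + a" "s + a < s + b" using s ab by auto
      note I = weak_derivative_integral[OF yc fi w sab]
      show "(\<lambda>r. du (s + r) \<psi>) integrable_on {a..b}" by (rule integral_shift(1)[OF I(1)])
      show "L2_inner \<Omega> (u (s + b)) \<psi> - L2_inner \<Omega> (u (s + a)) \<psi> = integral {a..b} (\<lambda>r. du (s + r) \<psi>)"
        using I(2) integral_shift(2)[OF I(1)] by simp
    next
      fix \<epsilon> :: real assume \<epsilon>: "0 < \<epsilon>"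
      obtain v e d Z where v: "\<forall>t. v t \<in> H1 \<Omega>" "0 < d"
        "\<forall>t\<in>{s..s + T}. \<forall>r\<in>{s..s + T}. \<bar>t - r\<bar> \<le> d \<longrightarrow> H1_norm \<Omega> (\<lambda>x. v t x - v r x) \<le> \<epsilon>"
        "(\<lambda>t. (e t)\<^sup>2) integrable_on {s..s + T}" "integral {s..s + T} (\<lambda>t. (e t)\<^sup>2) \<le> \<epsilon>\<^sup>2" "negligible Z"
        "\<forall>t\<in>{s..s + T} - Z. u t \<in> H1 \<Omega> \<and> 0 \<le> e t \<and> H1_norm \<Omega> (\<lambda>x. u t x - v t x) \<le> e t"
        using H.strongly_measurable_approx[OF um ui \<epsilon>] by blast
      show "\<exists>v e d Z. (\<forall>t. v t \<in> H1 \<Omega>) \<and> 0 < d \<and>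
        (\<forall>t\<in>{0..T}. \<forall>r\<in>{0..T}. \<bar>t - r\<bar> \<le> d \<longrightarrow> H1_norm \<Omega> (\<lambda>x. v t x - v r x) \<le> \<epsilon>) \<and>
        (\<lambda>t. (e t)\<^sup>2) integrable_on {0..T} \<and> integral {0..T} (\<lambda>t. (e t)\<^sup>2) \<le> \<epsilon>\<^sup>2 \<and> negligible Z \<and>
        (\<forall>t\<in>{0..T} - Z. u (s + t) \<in> H1 \<Omega> \<and> 0 \<le> e t \<and> H1_norm \<Omega> (\<lambda>x. u (s + t) x - v t x) \<le> e t)"
      proof (intro exI[of _ "\<lambda>t. v (s + t)"] exI[of _ "\<lambda>t. e (s + t)"] exI[of _ d] exI[of _ "(+) (- s) ` Z"] conjI ballI allI impI)
        show "v (s + t) \<in> H1 \<Omega>" for t using v(1) by blast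
        show "0 < d" by (rule v(2))
        show "H1_norm \<Omega> (\<lambda>x. v (s + t) x - v (s + r) x) \<le> \<epsilon>" if "t \<in> {0..T}" "r \<in> {0..T}" "\<bar>t - r\<bar> \<le> d" for t r
          using v(3) that by auto
        show "(\<lambda>t. (e (s + t))\<^sup>2) integrable_on {0..T}" "integral {0..T} (\<lambda>t. (e (s + t))\<^sup>2) \<le> \<epsilon>\<^sup>2"
          using integral_shift[of "\<lambda>t. (e t)\<^sup>2" s 0 T] v(4,5) by auto
        show "negligible ((+) (- s) ` Z)" by (rule neg_shift[OF v(6)])
        fix t assume t: "t \<in> {0..T} - (+) (- s) ` Z"
        have "s + t \<in> {s..s + T} - Z" using t shift_mem[of t s Z] by auto
        from bspec[OF v(7) this] show "u (s + t) \<in> H1 \<Omega>" "0 \<le> e (s + t)" "H1_norm \<Omega> (\<lambda>x. u (s + t) x - v (s + t) x) \<le> e (s + t)" by auto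
      qed
    qed
  qed
  then show ?thesis by blast
qed

section \<open>Smoothing and continuous dependence\<close>

lemma evolution_in_H1:
  assumes "evolution \<Omega> T z D"
  shows "\<exists>Y. negligible Y \<and> (\<forall>t\<in>{0..T} - Y. z t \<in> H1 \<Omega>)"
proof -
  obtain G Y where "negligible Y" "\<forall>t. 0 \<le> G t" "(\<lambda>t. (G t)\<^sup>2) integrable_on {0..T}"
    "\<forall>t\<in>{0..T} - Y. z t \<in> H1 \<Omega> \<and> D t \<in> H1_dual \<Omega> \<and> (\<forall>\<psi>\<in>H1 \<Omega>. \<bar>D t \<psi>\<bar> \<le> G t * H1_norm \<Omega> \<psi>)"
    using assms unfolding evolution_def by blast
  then show ?thesis by blast
qed

text \<open>By the energy inequality over a unit interval, the squared H1 norm integrates to at most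
  4C + 2|\<Omega>|, with |\<Omega>| bounding the initial squared L2 norm. It cannot exceed this mean
  almost everywhere by more than 1; the summand 1 makes the contradiction strict.\<close>

lemma evolution_visits_H1_ball:
  fixes K :: "'a::euclidean_space \<Rightarrow> real"
  assumes \<Omega>: "open \<Omega>" and \<Omega>l: "\<Omega> \<in> lmeasurable"
    and C: "\<And>v. v \<in> phase_space \<Omega> \<inter> H1 \<Omega> \<Longrightarrow> rhs \<Omega> K g v v \<le> C - (H1_norm \<Omega> v)\<^sup>2 / 4"
    and e: "evolution \<Omega> 1 z D" and i: "(\<lambda>r. (H1_norm \<Omega> (z r))\<^sup>2) integrable_on {0..1}"
    and Z: "negligible Z" "\<And>r \<psi>. r \<in> {0..1} - Z \<Longrightarrow> \<psi> \<in> H1 \<Omega> \<Longrightarrow> D r \<psi> = rhs \<Omega> K g (z r) \<psi>"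
    and z: "\<And>r. r \<in> {0..1} \<Longrightarrow> z r \<in> phase_space \<Omega>"
  shows "\<exists>t\<in>{0..1}. z t \<in> H1 \<Omega> \<and> (H1_norm \<Omega> (z t))\<^sup>2 \<le> 4 * C + 2 * measure lebesgue \<Omega> + 1"
proof (rule ccontr)
  assume no: "\<not> ?thesis"
  let ?P = "\<lambda>t. C - (H1_norm \<Omega> (z t))\<^sup>2 / 4"
  have P: "?P integrable_on {0..1}" by (intro integrable_diff integrable_const_ivl integrable_on_divide i)
  have en: "(Lp_norm 2 \<Omega> (z 1))\<^sup>2 - (Lp_norm 2 \<Omega> (z 0))\<^sup>2 \<le> 2 * integral {0..1} ?P"
    by (rule evolution_energy[OF \<Omega> _ e P Z(1)]) (use Z(2) C z in auto)
  have "integral {0..1} ?P = C - integral {0..1} (\<lambda>t. (H1_norm \<Omega> (z t))\<^sup>2) / 4"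
    using integral_diff[OF integrable_const_ivl[of C 0 "1::real"] integrable_on_divide[OF i, of 4]] by simp
  moreover have "(Lp_norm 2 \<Omega> (z 0))\<^sup>2 \<le> measure lebesgue \<Omega>"
    using power_mono[OF phase_space_norm_le[OF \<Omega>l z[of 0]], of 2] by simp
  moreover have "0 \<le> (Lp_norm 2 \<Omega> (z 1))\<^sup>2" by simp
  ultimately have up: "integral {0..1} (\<lambda>t. (H1_norm \<Omega> (z t))\<^sup>2) \<le> 4 * C + 2 * measure lebesgue \<Omega>"
    using en by linarith
  obtain Y where Y: "negligible Y" "\<forall>t\<in>{0..1} - Y. z t \<in> H1 \<Omega>"
    using evolution_in_H1[OF e] by blast
  have "integral {0..1::real} (\<lambda>t. 4 * C + 2 * measure lebesgue \<Omega> + 1) \<le> integral {0..1} (\<lambda>t. (H1_norm \<Omega> (z t))\<^sup>2)"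
    by (rule integral_le_off_negligible[OF _ i Y(1)]) (use no Y(2) in force)+
  then show False using up by simp
qed

text \<open>The energy inequality for the difference, followed by Gronwall. The latter wants the
  inequality at every intermediate time, hence evolutions on all intervals [0,T]; the factor 2 in
  the exponent comes from working with the squared distance.\<close>

lemma evolution_continuous_dependence:
  fixes K :: "'a::euclidean_space \<Rightarrow> real"
  assumes \<Omega>: "open \<Omega>"
    and C: "C \<ge> 0" "\<And>u v. u \<in> phase_space \<Omega> \<inter> H1 \<Omega> \<Longrightarrow> v \<in> phase_space \<Omega> \<inter> H1 \<Omega> \<Longrightarrow>
      rhs \<Omega> K g u (\<lambda>x. u x - v x) - rhs \<Omega> K g v (\<lambda>x. u x - v x) \<le> C * (L2_dist \<Omega> u v)\<^sup>2"
    and eu: "\<And>T. T > 0 \<Longrightarrow> evolution \<Omega> T u Du" and ev: "\<And>T. T > 0 \<Longrightarrow> evolution \<Omega> T v Dv"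
    and Zu: "negligible Zu" "\<And>r \<psi>. r \<in> {0..T} - Zu \<Longrightarrow> \<psi> \<in> H1 \<Omega> \<Longrightarrow> Du r \<psi> = rhs \<Omega> K g (u r) \<psi>"
    and Zv: "negligible Zv" "\<And>r \<psi>. r \<in> {0..T} - Zv \<Longrightarrow> \<psi> \<in> H1 \<Omega> \<Longrightarrow> Dv r \<psi> = rhs \<Omega> K g (v r) \<psi>"
    and u: "\<And>r. r \<ge> 0 \<Longrightarrow> u r \<in> phase_space \<Omega>" and v: "\<And>r. r \<ge> 0 \<Longrightarrow> v r \<in> phase_space \<Omega>"
    and T: "T \<ge> 0"
  shows "(L2_dist \<Omega> (u T) (v T))\<^sup>2 \<le> (L2_dist \<Omega> (u 0) (v 0))\<^sup>2 * exp (2 * C * T)"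
proof (cases "T = 0")
  case False
  define q where "q t = (L2_dist \<Omega> (u t) (v t))\<^sup>2" for t
  have ed: "evolution \<Omega> S (\<lambda>t x. u t x - v t x) (\<lambda>t \<psi>. Du t \<psi> - Dv t \<psi>)" if "S > 0" for S
    by (rule evolution_diff[OF \<Omega> eu[OF that] ev[OF that]])
  have qc: "continuous_on {0..S} q" if "S > 0" for S
    using evolution_norm_continuous[OF ed[OF that]] by (simp add: q_def[abs_def] L2_dist_def)
  have "q S \<le> q 0 + 2 * C * integral {0..S} q" if S: "S \<in> {0..T}" for S
  proof (cases "S = 0")
    case False
    then have S0: "S > 0" using S by auto
    obtain Y where Y: "negligible Y" "\<forall>t\<in>{0..S} - Y. u t \<in> H1 \<Omega>"
      using evolution_in_H1[OF eu[OF S0]] by blast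
    obtain Y' where Y': "negligible Y'" "\<forall>t\<in>{0..S} - Y'. v t \<in> H1 \<Omega>"
      using evolution_in_H1[OF ev[OF S0]] by blast
    have qi: "q integrable_on {0..S}" by (rule integrable_continuous_interval[OF qc[OF S0]])
    have "(Lp_norm 2 \<Omega> (\<lambda>x. u S x - v S x))\<^sup>2 - (Lp_norm 2 \<Omega> (\<lambda>x. u 0 x - v 0 x))\<^sup>2 \<le> 2 * integral {0..S} (\<lambda>t. C * q t)"
    proof (rule evolution_energy[OF \<Omega> S0 ed[OF S0], where Z = "Zu \<union> Zv \<union> Y \<union> Y'"])
      show "(\<lambda>t. C * q t) integrable_on {0..S}" by (rule integrable_on_mult_right[OF qi])
      show "negligible (Zu \<union> Zv \<union> Y \<union> Y')" using Zu Zv Y Y' by (simp add: negligible_Un)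
      fix t assume t: "t \<in> {0..S} - (Zu \<union> Zv \<union> Y \<union> Y')" and w: "(\<lambda>x. u t x - v t x) \<in> H1 \<Omega>"
      have tu: "t \<in> {0..T} - Zu" and tv: "t \<in> {0..T} - Zv" using t S by auto
      have H: "u t \<in> phase_space \<Omega> \<inter> H1 \<Omega>" "v t \<in> phase_space \<Omega> \<inter> H1 \<Omega>" using t Y(2) Y'(2) u v by auto
      show "Du t (\<lambda>x. u t x - v t x) - Dv t (\<lambda>x. u t x - v t x) \<le> C * q t"
        using C(2)[OF H] Zu(2)[OF tu w] Zv(2)[OF tv w] by (simp add: q_def)
    qed
    then show ?thesis by (simp add: q_def[symmetric] L2_dist_def[symmetric])
  qed simp
  from gronwall[OF qc _ T this] False T C(1) show ?thesis by (simp add: q_def)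
qed simp

section \<open>Construction of the attractor\<close>

theorem theorem6:
  fixes \<Omega> :: "'a::euclidean_space set"
    and K :: "'a \<Rightarrow> real"
    and g :: "'a \<Rightarrow> real \<Rightarrow> real"
    and S :: "real \<Rightarrow> ('a \<Rightarrow> real) \<Rightarrow> 'a \<Rightarrow> real"
  assumes "DIM('a) \<le> 3"
    and "bounded_lipschitz_domain \<Omega>"
    and "assumption_K \<Omega> K"
    and "assumption_G \<Omega> g"
    and "generated_system \<Omega> K g S"
  shows "\<exists>A. exponential_attractor \<Omega> S A"
proof -
  let ?X = "phase_space \<Omega>"
  have \<Omega>: "open \<Omega>" "bounded \<Omega>" "\<Omega> \<noteq> {}" using assms(2) by (auto simp: bounded_lipschitz_domain_def)
  have \<Omega>s: "\<Omega> \<in> sets lebesgue" by (rule sets_lebesgue_open[OF \<Omega>(1)])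
  have \<Omega>l: "\<Omega> \<in> lmeasurable" by (rule bounded_set_imp_lmeasurable[OF \<Omega>(2) \<Omega>s])
  have SX: "S t u0 \<in> ?X" if "u0 \<in> ?X" "t \<ge> 0" for t u0 using assms(5) that by (auto simp: generated_system_def)
  have Ssol: "weak_solution \<Omega> K g u0 (\<lambda>t. S t u0)" if "u0 \<in> ?X" for u0
    using assms(5) that by (auto simp: generated_system_def)
  have SXL: "S t u0 \<in> Lp 2 \<Omega>" if "u0 \<in> ?X" "t \<ge> 0" for t u0 using SX[OF that] by (rule phase_space_Lp2)
  obtain C where C: "C \<ge> 0" "\<forall>u\<in>?X \<inter> H1 \<Omega>. rhs \<Omega> K g u u \<le> C - (H1_norm \<Omega> u)\<^sup>2 / 4"
    "\<forall>u\<in>?X \<inter> H1 \<Omega>. \<forall>v\<in>?X \<inter> H1 \<Omega>.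
      rhs \<Omega> K g u (\<lambda>x. u x - v x) - rhs \<Omega> K g v (\<lambda>x. u x - v x) \<le> C * (L2_dist \<Omega> u v)\<^sup>2"
    using rhs_dissipation[OF \<Omega> assms(3,4)] by blast
  have "\<forall>u0\<in>?X. \<exists>du. \<forall>s>0. \<forall>T>0. evolution \<Omega> T (\<lambda>r. S (s + r) u0) (\<lambda>r. du (s + r)) \<and>
    (\<lambda>r. (H1_norm \<Omega> (S (s + r) u0))\<^sup>2) integrable_on {0..T} \<and>
    (\<exists>Z. negligible Z \<and> (\<forall>r\<in>{0..T} - Z. \<forall>\<psi>\<in>H1 \<Omega>. du (s + r) \<psi> = rhs \<Omega> K g (S (s + r) u0) \<psi>))"
    using solution_evolution[OF \<Omega>(1) Ssol] by blast
  from bchoice[OF this] obtain du where du: "\<forall>u0\<in>?X. \<forall>s>0. \<forall>T>0. evolution \<Omega> T (\<lambda>r. S (s + r) u0) (\<lambda>r. du u0 (s + r)) \<and>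
    (\<lambda>r. (H1_norm \<Omega> (S (s + r) u0))\<^sup>2) integrable_on {0..T} \<and>
    (\<exists>Z. negligible Z \<and> (\<forall>r\<in>{0..T} - Z. \<forall>\<psi>\<in>H1 \<Omega>. du u0 (s + r) \<psi> = rhs \<Omega> K g (S (s + r) u0) \<psi>))" ..
  define R where "R = sqrt (4 * C + 2 * measure lebesgue \<Omega> + 1)"
  \<comment> \<open>Each element of the ball remembers that it is a state of a trajectory at a
    positive time. The net of \<open>B\<close> will consist of such states, and they have to be
    followed further.\<close>
  define B where "B = {v \<in> ?X \<inter> H1 \<Omega>. H1_norm \<Omega> v \<le> R \<and> (\<exists>s>0. \<exists>u0\<in>?X. v = S s u0)}"
  have visit: "\<exists>\<tau>\<in>{0..1}. S (s + \<tau>) u0 \<in> B" if s: "s > 0" and u0: "u0 \<in> ?X" for s u0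
  proof -
    have 1: "evolution \<Omega> 1 (\<lambda>r. S (s + r) u0) (\<lambda>r. du u0 (s + r))"
      "(\<lambda>r. (H1_norm \<Omega> (S (s + r) u0))\<^sup>2) integrable_on {0..1}"
      using du s u0 zero_less_one by blast+
    obtain Z where Z: "negligible Z" "\<forall>r\<in>{0..1} - Z. \<forall>\<psi>\<in>H1 \<Omega>. du u0 (s + r) \<psi> = rhs \<Omega> K g (S (s + r) u0) \<psi>"
      using du s u0 zero_less_one by blast
    have "\<exists>t\<in>{0..1}. S (s + t) u0 \<in> H1 \<Omega> \<and> (H1_norm \<Omega> (S (s + t) u0))\<^sup>2 \<le> 4 * C + 2 * measure lebesgue \<Omega> + 1"
      by (rule evolution_visits_H1_ball[OF \<Omega>(1) \<Omega>l _ 1 Z(1)]) (use C(2) Z(2) SX u0 s in auto)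
    then obtain t where t: "t \<in> {0..1}" "S (s + t) u0 \<in> H1 \<Omega>" "(H1_norm \<Omega> (S (s + t) u0))\<^sup>2 \<le> 4 * C + 2 * measure lebesgue \<Omega> + 1"
      by blast
    have "H1_norm \<Omega> (S (s + t) u0) \<le> R" unfolding R_def by (rule real_le_rsqrt[OF t(3)])
    then have "S (s + t) u0 \<in> B" using t(1,2) SX[OF u0, of "s + t"] s u0 by (auto simp: B_def intro!: exI[of _ "s + t"])
    then show ?thesis using t(1) by blast
  qed
  \<comment> \<open>Growth factor of the L2 distance over times up to 1; the root appears because
    Gronwall bounds the squared distance.\<close>
  define E where "E = sqrt (exp (2 * C))"
  have E: "E > 0" by (simp add: E_def)
  have dep: "L2_dist \<Omega> (S (s1 + \<tau>) u1) (S (s2 + \<tau>) u2) \<le> E * L2_dist \<Omega> (S s1 u1) (S s2 u2)"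
    if u: "u1 \<in> ?X" "u2 \<in> ?X" and s: "s1 > 0" "s2 > 0" and \<tau>: "\<tau> \<in> {0..1}" for s1 s2 u1 u2 \<tau>
  proof -
    have T: "(1::real) > 0" by simp
    obtain Z1 where Z1: "negligible Z1" "\<forall>r\<in>{0..1} - Z1. \<forall>\<psi>\<in>H1 \<Omega>. du u1 (s1 + r) \<psi> = rhs \<Omega> K g (S (s1 + r) u1) \<psi>"
      using du s u T by blast
    obtain Z2 where Z2: "negligible Z2" "\<forall>r\<in>{0..1} - Z2. \<forall>\<psi>\<in>H1 \<Omega>. du u2 (s2 + r) \<psi> = rhs \<Omega> K g (S (s2 + r) u2) \<psi>"
      using du s u T by blast
    have "(L2_dist \<Omega> (S (s1 + \<tau>) u1) (S (s2 + \<tau>) u2))\<^sup>2 \<le> (L2_dist \<Omega> (S (s1 + 0) u1) (S (s2 + 0) u2))\<^sup>2 * exp (2 * C * \<tau>)"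
    proof (rule evolution_continuous_dependence[OF \<Omega>(1) C(1), where u = "\<lambda>r. S (s1 + r) u1" and v = "\<lambda>r. S (s2 + r) u2"
          and Du = "\<lambda>r. du u1 (s1 + r)" and Dv = "\<lambda>r. du u2 (s2 + r)" and Zu = Z1 and Zv = Z2 and K = K and g = g])
      show "evolution \<Omega> T (\<lambda>r. S (s1 + r) u1) (\<lambda>r. du u1 (s1 + r))" if "T > 0" for T using du s(1) u(1) that by blast
      show "evolution \<Omega> T (\<lambda>r. S (s2 + r) u2) (\<lambda>r. du u2 (s2 + r))" if "T > 0" for T using du s(2) u(2) that by blast
    qed (use C(3) Z1 Z2 \<tau> u s SX in auto)
    also have "\<dots> \<le> (L2_dist \<Omega> (S s1 u1) (S s2 u2))\<^sup>2 * exp (2 * C)"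
      using C(1) \<tau> mult_left_mono[of \<tau> 1 C] by (intro mult_mono) auto
    also have "\<dots> = (E * L2_dist \<Omega> (S s1 u1) (S s2 u2))\<^sup>2" by (simp add: E_def power_mult_distrib mult.commute)
    finally show ?thesis using E by (simp add: power2_le_iff_abs_le mult_nonneg_nonneg)
  qed
  \<comment> \<open>From time 2 on, the state at t can be traced back to a visit of \<open>B\<close>
    in [t - 1, t], and t - 1 is positive as the restarted estimates require.\<close>
  define A0 where "A0 = {S t u0 | t u0. t \<ge> 2 \<and> u0 \<in> ?X}"
  have A0X: "A0 \<subseteq> ?X" using SX by (auto simp: A0_def)
  have tb: "\<exists>N. finite N \<and> N \<subseteq> ?X \<and> (\<forall>u\<in>A0. \<exists>v\<in>N. L2_dist \<Omega> u v \<le> e)" if e: "e > 0" for e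
  proof -
    \<comment> \<open>The error of the net of \<open>B\<close> grows by at most the factor
      \<open>E\<close>, to e/2; the other e/2 is left for discretising the arcs.\<close>
    define e1 where "e1 = e / (2 * E)"
    have e1: "e1 > 0" using e E by (simp add: e1_def)
    have "\<exists>N. finite N \<and> N \<subseteq> B \<and> (\<forall>u\<in>B. \<exists>v\<in>N. L2_dist \<Omega> u v \<le> e1)"
      by (rule H1_totally_bounded[OF \<Omega>(1,2) _ _ e1, of B R])
         (auto simp: B_def intro: order_trans[OF Lp_norm_le_H1_norm(2)])
    then obtain N0 where N0: "finite N0" "N0 \<subseteq> B" "\<forall>u\<in>B. \<exists>v\<in>N0. L2_dist \<Omega> u v \<le> e1"
      by blast
    \<comment> \<open>The time left after a visit can be any number in [0,1], so each centre
      contributes its whole arc of unit length. The arc is the continuous image of a compact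
      interval and hence has a finite net.\<close>
    have path: "\<exists>F. finite F \<and> F \<subseteq> ?X \<and> (\<forall>\<tau>\<in>{0..1}. \<exists>p\<in>F. L2_dist \<Omega> (S (s + \<tau>) u0) p \<le> e / 2)"
      if s: "s > 0" and u0: "u0 \<in> ?X" for s u0
    proof -
      have ev: "evolution \<Omega> 1 (\<lambda>r. S (s + r) u0) (\<lambda>r. du u0 (s + r))" using du s u0 zero_less_one by blast
      have "\<forall>t\<in>{0..1}. \<exists>d>0. \<forall>r\<in>{0..1}. dist r t < d \<longrightarrow> L2_dist \<Omega> (S (s + r) u0) (S (s + t) u0) \<le> e / 2"
      proof
        fix t :: real assume t: "t \<in> {0..1}"
        have "((\<lambda>r. L2_dist \<Omega> (S (s + r) u0) (S (s + t) u0)) \<longlongrightarrow> 0) (at t within {0..1})"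
          using ev t by (auto simp: evolution_def)
        then have "\<forall>\<^sub>F r in at t within {0..1}. L2_dist \<Omega> (S (s + r) u0) (S (s + t) u0) < e / 2"
          by (rule order_tendstoD) (use e in simp)
        then obtain d where d: "d > 0" "\<forall>r\<in>{0..1}. r \<noteq> t \<and> dist r t < d \<longrightarrow> L2_dist \<Omega> (S (s + r) u0) (S (s + t) u0) < e / 2"
          unfolding eventually_at by blast
        then show "\<exists>d>0. \<forall>r\<in>{0..1}. dist r t < d \<longrightarrow> L2_dist \<Omega> (S (s + r) u0) (S (s + t) u0) \<le> e / 2"
          using e by (intro exI[of _ d]) (metis L2_dist_self less_eq_real_def half_gt_zero)
      qed
      from bchoice[OF this] obtain d where d: "\<forall>t\<in>{0..1}. d t > 0 \<and> (\<forall>r\<in>{0..1}. dist r t < d t \<longrightarrow> L2_dist \<Omega> (S (s + r) u0) (S (s + t) u0) \<le> e / 2)" ..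
      have "{0..1} \<subseteq> (\<Union>t\<in>{0..1}. ball t (d t))" using d by auto
      then obtain D where D: "D \<subseteq> {0..1}" "finite D" "{0..1} \<subseteq> (\<Union>t\<in>D. ball t (d t))"
        using compactE_image[of "{0..1::real}" "{0..1}" "\<lambda>t. ball t (d t)"] by auto
      show ?thesis
      proof (intro exI[of _ "(\<lambda>t. S (s + t) u0) ` D"] conjI ballI)
        show "finite ((\<lambda>t. S (s + t) u0) ` D)" using D by simp
        show "(\<lambda>t. S (s + t) u0) ` D \<subseteq> ?X" using D(1) s SX[OF u0] by force
        fix \<tau> :: real assume \<tau>: "\<tau> \<in> {0..1}"
        then obtain t where t: "t \<in> D" "\<tau> \<in> ball t (d t)" using D(3) by blast
        then have "L2_dist \<Omega> (S (s + \<tau>) u0) (S (s + t) u0) \<le> e / 2" using d D(1) \<tau> by (auto simp: dist_commute)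
        then show "\<exists>p\<in>(\<lambda>t. S (s + t) u0) ` D. L2_dist \<Omega> (S (s + \<tau>) u0) p \<le> e / 2" using t(1) by blast
      qed
    qed
    have "\<forall>v\<in>N0. \<exists>s u0 F. s > 0 \<and> u0 \<in> ?X \<and> v = S s u0 \<and> finite F \<and> F \<subseteq> ?X \<and>
        (\<forall>\<tau>\<in>{0..1}. \<exists>p\<in>F. L2_dist \<Omega> (S (s + \<tau>) u0) p \<le> e / 2)"
    proof
      fix v assume "v \<in> N0"
      then obtain s u0 where su: "s > 0" "u0 \<in> ?X" "v = S s u0" using N0(2) unfolding B_def by blast
      show "\<exists>s u0 F. s > 0 \<and> u0 \<in> ?X \<and> v = S s u0 \<and> finite F \<and> F \<subseteq> ?X \<and>
        (\<forall>\<tau>\<in>{0..1}. \<exists>p\<in>F. L2_dist \<Omega> (S (s + \<tau>) u0) p \<le> e / 2)"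
        using path[OF su(1,2)] su by blast
    qed
    then obtain sv uv F where F: "\<forall>v\<in>N0. sv v > 0 \<and> uv v \<in> ?X \<and> v = S (sv v) (uv v) \<and> finite (F v) \<and> F v \<subseteq> ?X \<and>
        (\<forall>\<tau>\<in>{0..1}. \<exists>p\<in>F v. L2_dist \<Omega> (S (sv v + \<tau>) (uv v)) p \<le> e / 2)" by metis
    show ?thesis
    proof (intro exI[of _ "\<Union>v\<in>N0. F v"] conjI ballI)
      show "finite (\<Union>v\<in>N0. F v)" "(\<Union>v\<in>N0. F v) \<subseteq> ?X" using F N0(1) by auto
      fix u assume "u \<in> A0"
      then obtain t u0 where t: "u = S t u0" "t \<ge> 2" "u0 \<in> ?X" unfolding A0_def by blast
      obtain \<sigma> where \<sigma>: "\<sigma> \<in> {0..1}" "S (t - 1 + \<sigma>) u0 \<in> B" using visit[of "t - 1" u0] t by auto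
      \<comment> \<open>The time from the visit at t - 1 + \<sigma> to t. The centre near the
        visited state is advanced by the same \<tau> on its own clock.\<close>
      define \<tau> where "\<tau> = 1 - \<sigma>"
      have \<tau>: "\<tau> \<in> {0..1}" "t = (t - 1 + \<sigma>) + \<tau>" using \<sigma> by (auto simp: \<tau>_def)
      obtain v where v: "v \<in> N0" "L2_dist \<Omega> (S (t - 1 + \<sigma>) u0) v \<le> e1" using N0(3) \<sigma>(2) by blast
      note Fv = bspec[OF F v(1)]
      obtain p where p: "p \<in> F v" "L2_dist \<Omega> (S (sv v + \<tau>) (uv v)) p \<le> e / 2" using Fv \<tau>(1) by blast
      have "L2_dist \<Omega> (S ((t - 1 + \<sigma>) + \<tau>) u0) (S (sv v + \<tau>) (uv v)) \<le> E * L2_dist \<Omega> (S (t - 1 + \<sigma>) u0) (S (sv v) (uv v))"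
        by (rule dep) (use t \<sigma>(1) Fv \<tau>(1) in auto)
      also have "S (sv v) (uv v) = v" using Fv by simp
      also have "E * L2_dist \<Omega> (S (t - 1 + \<sigma>) u0) v \<le> E * e1" using v(2) E by (intro mult_left_mono) auto
      also have "E * e1 = e / 2" using E by (simp add: e1_def)
      finally have d1: "L2_dist \<Omega> u (S (sv v + \<tau>) (uv v)) \<le> e / 2" using t(1) \<tau>(2) by simp
      have "L2_dist \<Omega> u p \<le> L2_dist \<Omega> u (S (sv v + \<tau>) (uv v)) + L2_dist \<Omega> (S (sv v + \<tau>) (uv v)) p"
      proof (rule L2_dist_triangle)
        have "p \<in> ?X" using Fv p(1) by blast
        then show "p \<in> Lp 2 \<Omega>" by (rule phase_space_Lp2)
      qed (use t SXL Fv \<tau>(1) in auto)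
      then have "L2_dist \<Omega> u p \<le> e" using d1 p(2) by linarith
      then show "\<exists>p\<in>\<Union>v\<in>N0. F v. L2_dist \<Omega> u p \<le> e" using p(1) v(1) by blast
    qed
  qed
  define A where "A = {u \<in> ?X. \<forall>e>0. \<exists>v\<in>A0. L2_dist \<Omega> u v < e}"
  have comp: "compactin (L2_topology \<Omega>) A" unfolding A_def by (rule compactin_L2_closure[OF \<Omega>l A0X tb])
  have A0A: "A0 \<subseteq> A" using A0X by (auto simp: A_def intro!: bexI)
  have AX: "A \<subseteq> ?X" by (auto simp: A_def)
  have "(\<lambda>x. 0) \<in> ?X" by (auto simp: phase_space_def Lp2_iff)
  then have "S 2 (\<lambda>x. 0) \<in> A0" unfolding A0_def by blast
  then have a0: "S 2 (\<lambda>x. 0) \<in> A" using A0A by blast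
  define m where "m = sqrt (measure lebesgue \<Omega>)"
  have m0: "m \<ge> 0" by (simp add: m_def)
  have diam: "L2_dist \<Omega> u v \<le> 2 * m" if "u \<in> ?X" "v \<in> ?X" for u v
  proof -
    have "L2_dist \<Omega> u v \<le> L2_dist \<Omega> u (\<lambda>x. 0) + L2_dist \<Omega> (\<lambda>x. 0) v"
      by (rule L2_dist_triangle) (use that phase_space_Lp2 in \<open>auto simp: Lp2_iff\<close>)
    then show ?thesis using phase_space_norm_le[OF \<Omega>l that(1)] phase_space_norm_le[OF \<Omega>l that(2)]
        L2_dist_commute[of \<Omega> "\<lambda>x. 0" v] by (simp add: L2_dist_def m_def)
  qed
  have bdd: "bdd_below ((\<lambda>a. L2_dist \<Omega> u a) ` A)" for u by (rule bdd_belowI2[of _ 0]) simp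
  \<comment> \<open>From time 2 on the distance is 0. Before that the diameter bound 2m is used, and
    the factor exp 2 compensates the decay of exp(-t) up to time 2; the summand 1 makes the constant
    positive.\<close>
  have attr: "(INF a\<in>A. L2_dist \<Omega> (S t u0) a) \<le> (2 * m + 1) * exp 2 * exp (- 1 * t)"
    if u0: "u0 \<in> ?X" and t: "t \<ge> 0" for u0 t
  proof (cases "t \<ge> 2")
    case True
    then have "S t u0 \<in> A" using A0A u0 unfolding A0_def by blast
    then have "(INF a\<in>A. L2_dist \<Omega> (S t u0) a) \<le> L2_dist \<Omega> (S t u0) (S t u0)" by (rule cINF_lower[OF bdd])
    also have "\<dots> \<le> (2 * m + 1) * exp 2 * exp (- 1 * t)" using m0 by simp
    finally show ?thesis .
  next
    case False
    have "(INF a\<in>A. L2_dist \<Omega> (S t u0) a) \<le> L2_dist \<Omega> (S t u0) (S 2 (\<lambda>x. 0))" by (rule cINF_lower[OF bdd a0])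
    also have "\<dots> \<le> 2 * m" by (rule diam[OF SX[OF u0 t] subsetD[OF AX a0]])
    also have "\<dots> \<le> (2 * m + 1) * exp (2 - t)"
    proof -
      have "1 \<le> exp (2 - t)" using False by simp
      then have "(2 * m + 1) * 1 \<le> (2 * m + 1) * exp (2 - t)" using m0 by (intro mult_left_mono) auto
      then show ?thesis by simp
    qed
    also have "\<dots> = (2 * m + 1) * exp 2 * exp (- 1 * t)" by (simp add: exp_diff exp_minus field_simps)
    finally show ?thesis .
  qed
  have "exponential_attractor \<Omega> S A"
    unfolding exponential_attractor_def
  proof (intro conjI)
    show "A \<noteq> {}" using a0 by blast
    have "(2 * m + 1) * exp 2 > 0" using m0 by (intro mult_pos_pos) auto
    then show "\<exists>c>0. \<exists>C>0. \<forall>u0\<in>?X. \<forall>t\<ge>0. (INF a\<in>A. L2_dist \<Omega> (S t u0) a) \<le> C * exp (- c * t)"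
      using attr by (intro exI[of _ 1] exI[of _ "(2 * m + 1) * exp 2"] conjI) auto
  qed (rule AX comp)+
  then show ?thesis by blast
qed

end
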